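(* Let $x=(x_A)_{A\in\Omega(n,r)}$ be a family of elements of $K$. Then $$c(x)=\sum_{A\in\Omega(n,r)}x_A[A]$$ lies in the center $Z(\boldsymbol{\mathcal S}_q(n,r))$ of the $q$-Schur algebra if and only if the following equations hold for all $1\le h<n$: ($e_h$-center equations) for every $B=(b_{ij})\in\Theta^+_{n,r}(h)$, $$\sum_{\substack{1\le u\le n\\ b_{h,u}>0}} x_{B-E_{h,u}+E_{h+1,u}}\,L^+_{h,u}(B-E_{h,u}+E_{h+1,u})=\sum_{\substack{1\le u\le n\\ b_{u,h+1}>0}} x_{B+E_{u,h}-E_{u,h+1}}\,R^+_{h,u}(B+E_{u,h}-E_{u,h+1});$$ ($f_h$-center equations) for every $B=(b_{ij})\in\Theta^-_{n,r}(h)$, $$\sum_{\substack{1\le u\le n\\ b_{h+1,u}>0}} x_{B+E_{h,u}-E_{h+1,u}}\,L^-_{h,u}(B+E_{h,u}-E_{h+1,u})=\sum_{\substack{1\le u\le n\\ b_{u,h}>0}} x_{B-E_{u,h}+E_{u,h+1}}\,R^-_{h,u}(B-E_{u,h}+E_{u,h+1}).$$ A term whose subscript matrix is not in $\Omega(n,r)$ is interpreted as zero.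
   Context: Let $\upsilon$ be an indeterminate, $q=\upsilon^2$, $\mathcal A=\mathbb Z[\upsilon,\upsilon^{-1}]$, $K=\mathbb Q(\upsilon)$, $\mathbb N=\{0,1,2,\dots\}$. Hecke algebra: $\mathcal H_{\mathcal A}(r)$ is the Hecke algebra over $\mathcal A$ of the symmetric group $\mathfrak S_r=\langle s_1,\dots,s_{r-1}\rangle$, generated by $T_i=T_{s_i}$ ($1\le i<r$) with $T_i^2=(q-1)T_i+q$, $T_iT_{i+1}T_i=T_{i+1}T_iT_{i+1}$, and $T_iT_j=T_jT_i$ for $|i-j|>1$. $q$-Schur algebra of type $A$: let $\Lambda(n,r)=\{\lambda\in\mathbb N^n\mid \sum_i\lambda_i=r\}$; for $\lambda\in\Lambda(n,r)$ let $\mathfrak S_\lambda$ be the Young subgroup and $x_\lambda=\sum_{w\in\mathfrak S_\lambda}T_w$. Put $\mathcal S_q(n,r)=\operatorname{End}_{\mathcal H_{\mathcal A}(r)}\big(\bigoplus_{\lambda\in\Lambda(n,r)}x_\lambda\mathcal H_{\mathcal A}(r)\big)$ and $\boldsymbol{\mathcal S}_q(n,r)=K\otimes_{\mathcal A}\mathcal S_q(n,r)$. Normalized BLM basis: $\Theta(n,r)$ is the set of $n\times n$ matrices $A=(a_{ij})$ over $\mathbb N$ with $\sum_{i,j}a_{ij}=r$; $\operatorname{ro}(A)$ and $\operatorname{co}(A)$ are the vectors of row sums and column sums. If $\operatorname{ro}(A)=\lambda$, $\operatorname{co}(A)=\mu$, then $A$ corresponds to the double coset $D_A=\mathfrak S_\lambda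 w\mathfrak S_\mu$ with $a_{ij}=|R^\lambda_i\cap wR^\mu_j|$, where $R^\lambda_1,\dots,R^\lambda_n$ are the consecutive blocks of $\{1,\dots,r\}$ of sizes $\lambda_1,\dots,\lambda_n$. Let $e_A\in\mathcal S_q(n,r)$ be given by $e_A(x_\nu h)=\delta_{\nu,\mu}\sum_{w\in D_A}T_wh$, and put $[A]=\upsilon^{-d_A}e_A$ with $d_A=\sum_{i\ge k,\ j<l}a_{ij}a_{kl}$. The set $\{[A]\mid A\in\Theta(n,r)\}$ is a $K$-basis of $\boldsymbol{\mathcal S}_q(n,r)$. Balanced matrices: $\Omega(n,r)=\{A\in\Theta(n,r)\mid \operatorname{ro}(A)=\operatorname{co}(A)\}$. Further notation: $E_{ij}$ is the $n\times n$ matrix unit, $\varepsilon_i$ the $i$-th standard basis vector of $\mathbb Z^n$, $\alpha_h=\varepsilon_h-\varepsilon_{h+1}$, and $\Theta^{\pm}_{n,r}(h)=\{B\in\Theta(n,r)\mid \operatorname{ro}(B)-\operatorname{co}(B)=\pm\alpha_h\}$ for $1\le h<n$. For $a\in\mathbb Z$ put $[\![a]\!]=\frac{\upsilon^{2a}-1}{\upsilon^2-1}$, and let the bar denote the ring automorphism of $\mathcal A$ with $\overline{\upsilon}=\upsilon^{-1}$. For $A=(a_{ij})\in\Theta(n,r)$, $1\le h<n$, $1\le p\le n$, put $$\beta_p(A,h)=\sum_{j\ge p}a_{h,j}-\sum_{j>p}a_{h+1,j},\qquad \beta'_p(A,h)=\sum_{j\le p}a_{h+1,j}-\sum_{j<p}a_{h,j},$$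 and, with $A^t$ the transpose of $A$, $$L^+_{h,u}(A)=\upsilon^{\beta_u(A,h)}\overline{[\![a_{h,u}+1]\!]},\quad L^-_{h,u}(A)=\upsilon^{\beta'_u(A,h)}\overline{[\![a_{h+1,u}+1]\!]},$$ $$R^+_{h,u}(A)=\upsilon^{\beta'_u(A^t,h)}\overline{[\![a_{u,h+1}+1]\!]},\quad R^-_{h,u}(A)=\upsilon^{\beta_u(A^t,h)}\overline{[\![a_{u,h}+1]\!]}.$$ *)

theory Defs
  imports
    "HOL-Algebra.QuotRing"
    "HOL-Computational_Algebra.Polynomial_Factorial"
    "HOL-Combinatorics.Permutations"
    "HOL-Library.Function_Algebras"
begin

section \<open>Ring-theoretic constructions\<close>

text \<open>The monoid algebra of the monoid \<open>G\<close> with coefficients in the subring \<open>C\<close> of an ambient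
  commutative ring.\<close>

definition monoid_algebra :: "'c::comm_ring_1 set \<Rightarrow> ('g, 'x) monoid_scheme \<Rightarrow> ('g \<Rightarrow> 'c) ring"
  where "monoid_algebra C G =
    \<lparr>carrier = {f. finite {g. f g \<noteq> 0} \<and> {g. f g \<noteq> 0} \<subseteq> carrier G \<and> range f \<subseteq> C},
     monoid.mult = (\<lambda>f f' g. \<Sum>(a, b) \<in> {(a, b). f a \<noteq> 0 \<and> f' b \<noteq> 0 \<and> a \<otimes>\<^bsub>G\<^esub> b = g}. f a * f' b),
     one = (\<lambda>g. if g = \<one>\<^bsub>G\<^esub> then 1 else 0),
     zero = (\<lambda>g. 0),
     add = (\<lambda>f f' g. f g + f' g)\<rparr>"

definition single :: "'g \<Rightarrow> 'c::zero \<Rightarrow> 'g \<Rightarrow> 'c"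
  where "single a c = (\<lambda>g. if g = a then c else 0)"

definition ring_center :: "('a, 'x) ring_scheme \<Rightarrow> 'a set"
  where "ring_center R = {z \<in> carrier R. \<forall>y \<in> carrier R. z \<otimes>\<^bsub>R\<^esub> y = y \<otimes>\<^bsub>R\<^esub> z}"

text \<open>Base change \<open>K \<otimes>\<^sub>A S\<close> of an \<open>A\<close>-algebra \<open>S\<close>, where \<open>A\<close> is a subring of the commutative ring
  \<open>K\<close> (a whole type) and \<open>act\<close> is the scalar action of \<open>A\<close> on \<open>S\<close>.  It is the free abelian group on
  \<open>K \<times> S\<close> modulo the usual bilinearity relations.  The free group is taken as the integral monoid
  ring of the multiplicative monoid \<open>K \<times> S\<close>: multiplying a bilinearity relation by a basis element
  gives a bilinearity relation, so the ideal they generate is the subgroup they generate, and the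
  quotient carries the product \<open>(k \<otimes> s) (l \<otimes> t) = k l \<otimes> s t\<close>.\<close>

definition tensor_free :: "('s, 'x) ring_scheme \<Rightarrow> ('k::comm_ring_1 \<times> 's \<Rightarrow> int) ring"
  where "tensor_free S =
    monoid_algebra UNIV (\<lparr>carrier = UNIV, monoid.mult = (*), one = 1\<rparr> \<times>\<times> S)"

definition tensor_relations ::
    "'k::comm_ring_1 set \<Rightarrow> ('k \<Rightarrow> 's \<Rightarrow> 's) \<Rightarrow> ('s, 'x) ring_scheme \<Rightarrow> ('k \<times> 's \<Rightarrow> int) set"
  where "tensor_relations A act S =
    (let F = tensor_free S in
      {single (k + l, s) 1 \<ominus>\<^bsub>F\<^esub> (single (k, s) 1 \<oplus>\<^bsub>F\<^esub> single (l, s) 1) | k l s. s \<in> carrier S}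
      \<union> {single (k, s \<oplus>\<^bsub>S\<^esub> t) 1 \<ominus>\<^bsub>F\<^esub> (single (k, s) 1 \<oplus>\<^bsub>F\<^esub> single (k, t) 1) | k s t.
            s \<in> carrier S \<and> t \<in> carrier S}
      \<union> {single (k * a, s) 1 \<ominus>\<^bsub>F\<^esub> single (k, act a s) 1 | k a s. a \<in> A \<and> s \<in> carrier S})"

definition tensor_ideal ::
    "'k::comm_ring_1 set \<Rightarrow> ('k \<Rightarrow> 's \<Rightarrow> 's) \<Rightarrow> ('s, 'x) ring_scheme \<Rightarrow> ('k \<times> 's \<Rightarrow> int) set"
  where "tensor_ideal A act S = Idl\<^bsub>tensor_free S\<^esub> (tensor_relations A act S)"

definition base_change ::
    "'k::comm_ring_1 set \<Rightarrow> ('k \<Rightarrow> 's \<Rightarrow> 's) \<Rightarrow> ('s, 'x) ring_scheme \<Rightarrow> ('k \<times> 's \<Rightarrow> int) set ring"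
  where "base_change A act S = tensor_free S Quot tensor_ideal A act S"

definition pure_tensor ::
    "'k::comm_ring_1 set \<Rightarrow> ('k \<Rightarrow> 's \<Rightarrow> 's) \<Rightarrow> ('s, 'x) ring_scheme \<Rightarrow> 'k \<Rightarrow> 's \<Rightarrow> ('k \<times> 's \<Rightarrow> int) set"
  where "pure_tensor A act S k s = tensor_ideal A act S +>\<^bsub>tensor_free S\<^esub> single (k, s) 1"


section \<open>The coefficients\<close>

type_synonym K = "rat poly fract"

definition \<upsilon> :: K
  where "\<upsilon> = to_fract [:0, 1:]"

definition q :: K
  where "q = \<upsilon>\<^sup>2"

text \<open>\<open>\<int>[\<upsilon>, \<upsilon>\<^sup>-\<^sup>1]\<close> as a subring of \<open>K\<close>\<close>

definition laurent :: "K set"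
  where "laurent = {\<Sum>i\<in>I. of_int (c i) * \<upsilon> powi i | (c :: int \<Rightarrow> int) I. finite I}"

definition laurent_ring :: "K ring"
  where "laurent_ring = \<lparr>carrier = laurent, monoid.mult = (*), one = 1, zero = 0, add = (+)\<rparr>"

definition bar :: "K \<Rightarrow> K"
  where "bar = (THE \<phi>. \<phi> \<in> ring_iso laurent_ring laurent_ring \<and> \<phi> \<in> extensional laurent
                       \<and> \<phi> \<upsilon> = inverse \<upsilon>)"

definition qint :: "int \<Rightarrow> K"
  where "qint a = (\<upsilon> powi (2 * a) - 1) / (\<upsilon>\<^sup>2 - 1)"


section \<open>The Hecke algebra of the symmetric group\<close>

text \<open>The free associative algebra over \<open>laurent\<close> on the letters \<open>1, \<dots>, r - 1\<close>; the letter \<open>i\<close>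
  stands for \<open>T\<^sub>i\<close>.\<close>

definition word_monoid :: "nat \<Rightarrow> nat list monoid"
  where "word_monoid r = \<lparr>carrier = lists {1..<r}, monoid.mult = (@), one = []\<rparr>"

definition hecke_free :: "nat \<Rightarrow> (nat list \<Rightarrow> K) ring"
  where "hecke_free r = monoid_algebra laurent (word_monoid r)"

definition hecke_relations :: "nat \<Rightarrow> (nat list \<Rightarrow> K) set"
  where "hecke_relations r =
    (let F = hecke_free r in
      {single [i, i] 1 \<ominus>\<^bsub>F\<^esub> (single [i] (q - 1) \<oplus>\<^bsub>F\<^esub> single [] q) | i. 1 \<le> i \<and> i < r}
      \<union> {single [i, i + 1, i] 1 \<ominus>\<^bsub>F\<^esub> single [i + 1, i, i + 1] 1 | i. 1 \<le> i \<and> i + 1 < r}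
      \<union> {single [i, j] 1 \<ominus>\<^bsub>F\<^esub> single [j, i] 1 | i j.
            1 \<le> i \<and> i < r \<and> 1 \<le> j \<and> j < r \<and> \<bar>int i - int j\<bar> > 1})"

type_synonym hecke_elem = "(nat list \<Rightarrow> K) set"

definition hecke_ideal :: "nat \<Rightarrow> (nat list \<Rightarrow> K) set"
  where "hecke_ideal r = Idl\<^bsub>hecke_free r\<^esub> (hecke_relations r)"

definition hecke :: "nat \<Rightarrow> hecke_elem ring"
  where "hecke r = hecke_free r Quot hecke_ideal r"

definition hecke_gen :: "nat \<Rightarrow> nat \<Rightarrow> hecke_elem"
  where "hecke_gen r i = hecke_ideal r +>\<^bsub>hecke_free r\<^esub> single [i] 1"

text \<open>The image of a scalar \<open>a \<in> laurent\<close>\<close>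

definition hecke_scalar :: "nat \<Rightarrow> K \<Rightarrow> hecke_elem"
  where "hecke_scalar r a = hecke_ideal r +>\<^bsub>hecke_free r\<^esub> single [] a"

text \<open>Permutations are functions on \<open>{1..r}\<close>, acting and composed on the left.  A reduced expression
  of \<open>w\<close> is a word of minimal length representing it; by the braid relations the choice of
  the reduced expression does not affect \<open>T\<^sub>w\<close>.\<close>

definition word_perm :: "nat list \<Rightarrow> nat \<Rightarrow> nat"
  where "word_perm ws = foldr (\<lambda>i w. transpose i (i + 1) \<circ> w) ws id"

definition reduced_word :: "nat \<Rightarrow> (nat \<Rightarrow> nat) \<Rightarrow> nat list"
  where "reduced_word r w = (ARG_MIN length ws. ws \<in> lists {1..<r} \<and> word_perm ws = w)"

definition T :: "nat \<Rightarrow> (nat \<Rightarrow> nat) \<Rightarrow> hecke_elem"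
  where "T r w = foldr (\<lambda>i t. hecke_gen r i \<otimes>\<^bsub>hecke r\<^esub> t) (reduced_word r w) \<one>\<^bsub>hecke r\<^esub>"

definition T_sum :: "nat \<Rightarrow> (nat \<Rightarrow> nat) set \<Rightarrow> hecke_elem"
  where "T_sum r D = (\<Oplus>\<^bsub>hecke r\<^esub> w \<in> D. T r w)"


section \<open>Compositions, matrices and double cosets\<close>

text \<open>Compositions and matrices are indexed from 1 and vanish outside the index range.\<close>

type_synonym comp = "nat \<Rightarrow> nat"
type_synonym mat = "nat \<Rightarrow> nat \<Rightarrow> nat"

definition Lam :: "nat \<Rightarrow> nat \<Rightarrow> comp set"
  where "Lam n r = {\<mu>. (\<forall>i. i \<notin> {1..n} \<longrightarrow> \<mu> i = 0) \<and> (\<Sum>i=1..n. \<mu> i) = r}"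

definition block :: "comp \<Rightarrow> nat \<Rightarrow> nat set"
  where "block \<mu> i = {(\<Sum>k\<in>{1..<i}. \<mu> k) <.. (\<Sum>k\<in>{1..i}. \<mu> k)}"

definition young :: "nat \<Rightarrow> nat \<Rightarrow> comp \<Rightarrow> (nat \<Rightarrow> nat) set"
  where "young n r \<mu> = {w. w permutes {1..r} \<and> (\<forall>i\<in>{1..n}. w ` block \<mu> i = block \<mu> i)}"

definition double_coset :: "nat \<Rightarrow> nat \<Rightarrow> comp \<Rightarrow> (nat \<Rightarrow> nat) \<Rightarrow> comp \<Rightarrow> (nat \<Rightarrow> nat) set"
  where "double_coset n r \<mu> w \<nu> = {a \<circ> w \<circ> b | a b. a \<in> young n r \<mu> \<and> b \<in> young n r \<nu>}"

definition Theta :: "nat \<Rightarrow> nat \<Rightarrow> mat set"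
  where "Theta n r = {A. (\<forall>i j. i \<notin> {1..n} \<or> j \<notin> {1..n} \<longrightarrow> A i j = 0)
                          \<and> (\<Sum>i=1..n. \<Sum>j=1..n. A i j) = r}"

definition ro :: "nat \<Rightarrow> mat \<Rightarrow> comp"
  where "ro n A = (\<lambda>i. \<Sum>j=1..n. A i j)"

definition co :: "nat \<Rightarrow> mat \<Rightarrow> comp"
  where "co n A = (\<lambda>j. \<Sum>i=1..n. A i j)"

definition Omega :: "nat \<Rightarrow> nat \<Rightarrow> mat set"
  where "Omega n r = {A \<in> Theta n r. ro n A = co n A}"

definition mat_transpose :: "mat \<Rightarrow> mat"
  where "mat_transpose A = (\<lambda>i j. A j i)"

definition coset_of_mat :: "nat \<Rightarrow> nat \<Rightarrow> mat \<Rightarrow> (nat \<Rightarrow> nat) set"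
  where "coset_of_mat n r A =
    (THE D. \<exists>w. w permutes {1..r} \<and> D = double_coset n r (ro n A) w (co n A)
              \<and> (\<forall>i\<in>{1..n}. \<forall>j\<in>{1..n}. A i j = card (block (ro n A) i \<inter> w ` block (co n A) j)))"

text \<open>Sums and differences of matrices are entrywise.  The entries are natural numbers, so a
  difference must only be formed where the entry subtracted from is positive.\<close>

definition E :: "nat \<Rightarrow> nat \<Rightarrow> mat"
  where "E i j = (\<lambda>k l. if k = i \<and> l = j then 1 else 0)"

definition \<epsilon> :: "nat \<Rightarrow> nat \<Rightarrow> int"
  where "\<epsilon> i = (\<lambda>k. if k = i then 1 else 0)"

definition \<alpha> :: "nat \<Rightarrow> nat \<Rightarrow> int"
  where "\<alpha> h = (\<lambda>k. \<epsilon> h k - \<epsilon> (h + 1) k)"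

definition Theta_plus :: "nat \<Rightarrow> nat \<Rightarrow> nat \<Rightarrow> mat set"
  where "Theta_plus n r h =
    {B \<in> Theta n r. \<forall>i\<in>{1..n}. int (ro n B i) - int (co n B i) = \<alpha> h i}"

definition Theta_minus :: "nat \<Rightarrow> nat \<Rightarrow> nat \<Rightarrow> mat set"
  where "Theta_minus n r h =
    {B \<in> Theta n r. \<forall>i\<in>{1..n}. int (ro n B i) - int (co n B i) = - \<alpha> h i}"


section \<open>The \<open>q\<close>-Schur algebra\<close>

definition x_elem :: "nat \<Rightarrow> nat \<Rightarrow> comp \<Rightarrow> hecke_elem"
  where "x_elem n r \<mu> = T_sum r (young n r \<mu>)"

text \<open>The right module \<open>\<Oplus>\<^sub>\<mu> x\<^sub>\<mu> \<H>\<close>.  As \<open>Lam n r\<close> is finite, the direct sum consists of all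
  families.\<close>

type_synonym mod_elem = "comp \<Rightarrow> hecke_elem"

definition qmod :: "nat \<Rightarrow> nat \<Rightarrow> mod_elem set"
  where "qmod n r =
    (\<Pi>\<^sub>E \<mu> \<in> Lam n r. {x_elem n r \<mu> \<otimes>\<^bsub>hecke r\<^esub> h | h. h \<in> carrier (hecke r)})"

definition qmod_zero :: "nat \<Rightarrow> nat \<Rightarrow> mod_elem"
  where "qmod_zero n r = (\<lambda>\<mu>\<in>Lam n r. \<zero>\<^bsub>hecke r\<^esub>)"

definition qmod_add :: "nat \<Rightarrow> nat \<Rightarrow> mod_elem \<Rightarrow> mod_elem \<Rightarrow> mod_elem"
  where "qmod_add n r m m' = (\<lambda>\<mu>\<in>Lam n r. m \<mu> \<oplus>\<^bsub>hecke r\<^esub> m' \<mu>)"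

definition qmod_act :: "nat \<Rightarrow> nat \<Rightarrow> mod_elem \<Rightarrow> hecke_elem \<Rightarrow> mod_elem"
  where "qmod_act n r m h = (\<lambda>\<mu>\<in>Lam n r. m \<mu> \<otimes>\<^bsub>hecke r\<^esub> h)"

definition qmod_incl :: "nat \<Rightarrow> nat \<Rightarrow> comp \<Rightarrow> hecke_elem \<Rightarrow> mod_elem"
  where "qmod_incl n r \<mu> t = (\<lambda>\<nu>\<in>Lam n r. if \<nu> = \<mu> then t else \<zero>\<^bsub>hecke r\<^esub>)"

definition qschur_int :: "nat \<Rightarrow> nat \<Rightarrow> (mod_elem \<Rightarrow> mod_elem) ring"
  where "qschur_int n r =
    \<lparr>carrier = {\<phi> \<in> qmod n r \<rightarrow>\<^sub>E qmod n r.
        (\<forall>m\<in>qmod n r. \<forall>m'\<in>qmod n r. \<phi> (qmod_add n r m m') = qmod_add n r (\<phi> m) (\<phi> m'))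
        \<and> (\<forall>m\<in>qmod n r. \<forall>h\<in>carrier (hecke r). \<phi> (qmod_act n r m h) = qmod_act n r (\<phi> m) h)},
     monoid.mult = (\<lambda>\<phi> \<psi>. compose (qmod n r) \<phi> \<psi>),
     one = (\<lambda>m\<in>qmod n r. m),
     zero = (\<lambda>m\<in>qmod n r. qmod_zero n r),
     add = (\<lambda>\<phi> \<psi>. \<lambda>m\<in>qmod n r. qmod_add n r (\<phi> m) (\<psi> m))\<rparr>"

definition qschur_smult :: "nat \<Rightarrow> nat \<Rightarrow> K \<Rightarrow> (mod_elem \<Rightarrow> mod_elem) \<Rightarrow> mod_elem \<Rightarrow> mod_elem"
  where "qschur_smult n r a \<phi> = (\<lambda>m\<in>qmod n r. qmod_act n r (\<phi> m) (hecke_scalar r a))"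

definition qschur :: "nat \<Rightarrow> nat \<Rightarrow> (K \<times> (mod_elem \<Rightarrow> mod_elem) \<Rightarrow> int) set ring"
  where "qschur n r = base_change laurent (qschur_smult n r) (qschur_int n r)"

definition e_basis :: "nat \<Rightarrow> nat \<Rightarrow> mat \<Rightarrow> mod_elem \<Rightarrow> mod_elem"
  where "e_basis n r A =
    (THE \<phi>. \<phi> \<in> carrier (qschur_int n r)
      \<and> (\<forall>\<nu>\<in>Lam n r. \<forall>h\<in>carrier (hecke r).
            \<phi> (qmod_incl n r \<nu> (x_elem n r \<nu> \<otimes>\<^bsub>hecke r\<^esub> h)) =
              (if \<nu> = co n A
               then qmod_incl n r (ro n A) (T_sum r (coset_of_mat n r A) \<otimes>\<^bsub>hecke r\<^esub> h)
               else qmod_zero n r)))"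

definition d_stat :: "nat \<Rightarrow> mat \<Rightarrow> nat"
  where "d_stat n A =
    (\<Sum>(i, j, k, l) \<in> {(i, j, k, l). i \<in> {1..n} \<and> j \<in> {1..n} \<and> k \<in> {1..n} \<and> l \<in> {1..n}
                                     \<and> i \<ge> k \<and> j < l}. A i j * A k l)"

definition BLM :: "nat \<Rightarrow> nat \<Rightarrow> mat \<Rightarrow> mod_elem \<Rightarrow> mod_elem"
  where "BLM n r A = qschur_smult n r (\<upsilon> powi (- int (d_stat n A))) (e_basis n r A)"

text \<open>The term \<open>x\<^sub>A [A]\<close> is the pure tensor of \<open>x\<^sub>A\<close> and \<open>[A]\<close>.\<close>

definition c_elem :: "nat \<Rightarrow> nat \<Rightarrow> (mat \<Rightarrow> K) \<Rightarrow> (K \<times> (mod_elem \<Rightarrow> mod_elem) \<Rightarrow> int) set"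
  where "c_elem n r x =
    (\<Oplus>\<^bsub>qschur n r\<^esub> A \<in> Omega n r.
       pure_tensor laurent (qschur_smult n r) (qschur_int n r) (x A) (BLM n r A))"


section \<open>The coefficients of the center equations\<close>

definition \<beta> :: "nat \<Rightarrow> nat \<Rightarrow> mat \<Rightarrow> nat \<Rightarrow> int"
  where "\<beta> n p A h = (\<Sum>j\<in>{p..n}. int (A h j)) - (\<Sum>j\<in>{p<..n}. int (A (h + 1) j))"

definition \<beta>' :: "nat \<Rightarrow> mat \<Rightarrow> nat \<Rightarrow> int"
  where "\<beta>' p A h = (\<Sum>j\<in>{1..p}. int (A (h + 1) j)) - (\<Sum>j\<in>{1..<p}. int (A h j))"

definition L_plus :: "nat \<Rightarrow> nat \<Rightarrow> nat \<Rightarrow> mat \<Rightarrow> K"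
  where "L_plus n h u A = \<upsilon> powi (\<beta> n u A h) * bar (qint (int (A h u) + 1))"

definition L_minus :: "nat \<Rightarrow> nat \<Rightarrow> nat \<Rightarrow> mat \<Rightarrow> K"
  where "L_minus n h u A = \<upsilon> powi (\<beta>' u A h) * bar (qint (int (A (h + 1) u) + 1))"

definition R_plus :: "nat \<Rightarrow> nat \<Rightarrow> nat \<Rightarrow> mat \<Rightarrow> K"
  where "R_plus n h u A = \<upsilon> powi (\<beta>' u (mat_transpose A) h) * bar (qint (int (A u (h + 1)) + 1))"

definition R_minus :: "nat \<Rightarrow> nat \<Rightarrow> nat \<Rightarrow> mat \<Rightarrow> K"
  where "R_minus n h u A = \<upsilon> powi (\<beta> n u (mat_transpose A) h) * bar (qint (int (A u h) + 1))"

text \<open>The family \<open>x\<close> is only meaningful on \<open>Omega n r\<close>; elsewhere it is read as zero.\<close>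

definition on_Omega :: "nat \<Rightarrow> nat \<Rightarrow> (mat \<Rightarrow> K) \<Rightarrow> mat \<Rightarrow> K"
  where "on_Omega n r x A = (if A \<in> Omega n r then x A else 0)"

end

theory Submission
  imports Defs
begin

text \<open>
  Let \<open>\<H>(r)\<close> act from the right on functions on the words \<open>{1..n}\<^sup>r\<close> (tensor space).  The permutations of
  \<open>{1..r}\<close>, read as words, carry the regular representation, and pulling back along
  \<open>w \<mapsto> j\<^sub>\<mu> \<circ> w\<close>, where \<open>j\<^sub>\<mu> = 1\<^sup>\<mu>\<^sup>1 2\<^sup>\<mu>\<^sup>2 \<dots>\<close>, identifies the functions of weight \<open>\<mu>\<close> with \<open>x\<^sub>\<mu> \<H>(r)\<close>; faithfulness of
  the regular representation comes from Matsumoto's theorem.  Hence the \<open>q\<close>-Schur algebra is the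
  commutant of the Hecke action, an element \<open>X\<close> of it is determined by its columns at the words
  \<open>j\<^sub>\<mu>\<close>, and the entry at \<open>(i, j\<^sub>\<mu>)\<close> is the coefficient of \<open>e\<^sub>A\<close> where \<open>A\<close> counts the letter pairs of \<open>(i, j\<^sub>\<mu>)\<close>.
  Dually, the entry at \<open>(j\<^sub>\<lambda>, i)\<close> is the coefficient of \<open>e\<^sub>A\<close> times \<open>q\<close> to the number of inversions of \<open>i\<close>.

  On tensor space \<open>e\<^sub>h\<close> and \<open>f\<^sub>h\<close> change one letter of a word, so left products with them are read off from
  columns and right products from rows by counting.  Over the field of fractions they generate the
  commutant together with the weight projections: if \<open>B\<close> is \<open>A\<close> with a suitable unit moved one
  step towards the diagonal, then the product of \<open>e\<^sub>h\<close> or \<open>f\<^sub>h\<close> with \<open>e\<^sub>B\<close> is a nonzero multiple of \<open>e\<^sub>A\<close>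
  plus terms closer to the diagonal.  This also produces the \<open>e\<^sub>A\<close>, whose integrality is automatic.  So \<open>c(x)\<close> is central
  if and only if it commutes with all \<open>e\<^sub>h\<close> and \<open>f\<^sub>h\<close>, and comparing coefficients of \<open>e\<^sub>B\<close> gives the center
  equations up to the common factor \<open>\<upsilon>\<close> to the power \<open>co(B)\<^sub>a - d\<^sub>B\<close> with \<open>a = h\<close> or \<open>a = h + 1\<close>.\<close>

section \<open>Monoid algebras\<close>

text \<open>The objects of the statement are reached through choices and quotients: \<open>T\<close>
  picks a reduced word, \<open>bar\<close>, \<open>coset_of_mat\<close> and \<open>e_basis\<close>
  are definite descriptions, and the Hecke algebra and the base change are quotients of free
  objects. Each is pinned down by a faithful passage to functions or operators, where equality is
  tested entry by entry. One operator \<open>Rop\<close> treats words with and without repeated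
  letters, so the regular representation and the modules x_mu H share one action and one induction,
  bubble sort. Generation takes place over K because the leading coefficients involve quantum
  integers, nonzero but in general not units of the Laurent ring. The integral algebra is recovered
  because columns at unsorted words arise from sorted ones by \<open>Rop\<close>, which keeps
  coefficients Laurent. In the base change, bilinearity reduces every element to a K-combination of
  the e_A, and these are independent as operators. The common factor arises because rows and columns
  lead to the exponents ro(B)_a - 1 - d_B and co(B)_a - d_B; they agree for the B of the equations,
  and for every other B both sides vanish.\<close>

definition lin :: "('c::comm_ring_1 \<Rightarrow> 'd::comm_ring_1) \<Rightarrow> ('g \<Rightarrow> 'd) \<Rightarrow> ('g \<Rightarrow> 'c) \<Rightarrow> 'd"
  where "lin \<iota> \<theta> f = (\<Sum>g | f g \<noteq> 0. \<iota> (f g) * \<theta> g)"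

locale coeff_subring =
  fixes C :: "'c::comm_ring_1 set"
  assumes C_one [simp]: "1 \<in> C"
    and C_add: "x \<in> C \<Longrightarrow> y \<in> C \<Longrightarrow> x + y \<in> C"
    and C_mult: "x \<in> C \<Longrightarrow> y \<in> C \<Longrightarrow> x * y \<in> C"
    and C_uminus: "x \<in> C \<Longrightarrow> - x \<in> C"
begin

lemma C_zero [simp]: "0 \<in> C"
  using C_add [OF C_one C_uminus [OF C_one]] by simp

lemma C_sum: "(\<And>x. x \<in> A \<Longrightarrow> f x \<in> C) \<Longrightarrow> sum f A \<in> C"
  by (induction A rule: infinite_finite_induct) (auto intro: C_add)

end

locale coeff_hom =
  fixes \<iota> :: "'c::comm_ring_1 \<Rightarrow> 'd::comm_ring_1"
  assumes hom_one [simp]: "\<iota> 1 = 1"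
    and hom_add: "\<iota> (x + y) = \<iota> x + \<iota> y"
    and hom_mult: "\<iota> (x * y) = \<iota> x * \<iota> y"
begin

lemma hom_zero [simp]: "\<iota> 0 = 0"
  using hom_add [of 0 0] by simp

lemma hom_sum: "\<iota> (sum f A) = (\<Sum>x\<in>A. \<iota> (f x))"
  by (induction A rule: infinite_finite_induct) (auto simp: hom_add)

lemma lin_superset:
  assumes "finite A" "{g. f g \<noteq> 0} \<subseteq> A"
  shows "lin \<iota> \<theta> f = (\<Sum>g\<in>A. \<iota> (f g) * \<theta> g)"
  unfolding lin_def by (rule sum.mono_neutral_left) (use assms in auto)

lemma lin_plus:
  assumes "finite {g. f g \<noteq> 0}" "finite {g. f' g \<noteq> 0}"
  shows "lin \<iota> \<theta> (\<lambda>g. f g + f' g) = lin \<iota> \<theta> f + lin \<iota> \<theta> f'"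
proof -
  let ?A = "{g. f g \<noteq> 0} \<union> {g. f' g \<noteq> 0}"
  have "finite ?A" using assms by simp
  then have *: "lin \<iota> \<theta> h = (\<Sum>g\<in>?A. \<iota> (h g) * \<theta> g)" if "{g. h g \<noteq> 0} \<subseteq> ?A" for h
    using that by (rule lin_superset)
  have "lin \<iota> \<theta> (\<lambda>g. f g + f' g) = (\<Sum>g\<in>?A. \<iota> (f g + f' g) * \<theta> g)"
    by (rule *) auto
  also have "\<dots> = lin \<iota> \<theta> f + lin \<iota> \<theta> f'"
    by (subst (1 2) *) (auto simp: hom_add distrib_right sum.distrib)
  finally show ?thesis .
qed

lemma lin_single [simp]: "lin \<iota> \<theta> (single a c) = \<iota> c * \<theta> a"
  by (subst lin_superset [of "{a}"]) (auto simp: single_def)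

end

lemma coeff_hom_id: "coeff_hom (\<lambda>x. x)"
  by (simp add: coeff_hom_def)

lemmas lin_id_superset = coeff_hom.lin_superset [OF coeff_hom_id]
  and lin_id_plus = coeff_hom.lin_plus [OF coeff_hom_id]
  and lin_id_single = coeff_hom.lin_single [OF coeff_hom_id]

lemma lin_cong: "(\<And>g. f g \<noteq> 0 \<Longrightarrow> \<theta> g = \<theta>' g) \<Longrightarrow> lin \<iota> \<theta> f = lin \<iota> \<theta>' f"
  unfolding lin_def by (rule sum.cong) auto

lemma lin_add_right: "lin \<iota> (\<lambda>g. \<theta> g + \<theta>' g) f = lin \<iota> \<theta> f + lin \<iota> \<theta>' f"
  unfolding lin_def by (simp add: algebra_simps sum.distrib)

lemma lin_scale_right: "lin \<iota> (\<lambda>g. c * \<theta> g) f = c * lin \<iota> \<theta> f"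
  unfolding lin_def by (simp add: algebra_simps sum_distrib_left)

lemma lin_scale_left: "lin \<iota> (\<lambda>g. \<theta> g * c) f = lin \<iota> \<theta> f * c"
  using lin_scale_right [of \<iota> c \<theta> f] by (simp add: mult.commute)

context coeff_hom
begin

text \<open>\<open>lin\<close> extends \<open>\<theta>\<close> linearly from the monoid to its
  algebra. A product is summed over pairs (a, b) grouped by their product, so pairing it with
  \<open>\<theta>\<close> becomes an iterated pairing over the two factors.\<close>

lemma lin_mult:
  assumes "f \<in> carrier (monoid_algebra C G)" "f' \<in> carrier (monoid_algebra C G)"
  shows "lin \<iota> \<theta> (f \<otimes>\<^bsub>monoid_algebra C G\<^esub> f') =
    lin \<iota> (\<lambda>a. lin \<iota> (\<lambda>b. \<theta> (a \<otimes>\<^bsub>G\<^esub> b)) f') f"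
proof -
  let ?A = "{a. f a \<noteq> 0}" and ?B = "{b. f' b \<noteq> 0}"
  let ?m = "\<lambda>x. fst x \<otimes>\<^bsub>G\<^esub> snd x"
  let ?h = "\<lambda>x. f (fst x) * f' (snd x)"
  have fin: "finite ?A" "finite ?B" using assms by (auto simp: monoid_algebra_def)
  have mult: "(f \<otimes>\<^bsub>monoid_algebra C G\<^esub> f') g = (\<Sum>x\<in>{x\<in>?A \<times> ?B. ?m x = g}. ?h x)" for g
    unfolding monoid_algebra_def by (auto simp: case_prod_beta intro!: sum.cong)
  have supp: "{g. (f \<otimes>\<^bsub>monoid_algebra C G\<^esub> f') g \<noteq> 0} \<subseteq> ?m ` (?A \<times> ?B)"
    unfolding mult by (force elim: sum.not_neutral_contains_not_neutral)
  have "lin \<iota> \<theta> (f \<otimes>\<^bsub>monoid_algebra C G\<^esub> f') =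
      (\<Sum>g\<in>?m ` (?A \<times> ?B). \<Sum>x\<in>{x\<in>?A \<times> ?B. ?m x = g}. \<iota> (?h x) * \<theta> (?m x))"
    using fin supp
    by (subst lin_superset [OF _ supp]) (auto simp: mult hom_sum sum_distrib_right intro!: sum.cong)
  also have "\<dots> = (\<Sum>x\<in>?A \<times> ?B. \<iota> (?h x) * \<theta> (?m x))"
    by (rule sum.group) (use fin in auto)
  also have "\<dots> = lin \<iota> (\<lambda>a. lin \<iota> (\<lambda>b. \<theta> (a \<otimes>\<^bsub>G\<^esub> b)) f') f"
    unfolding lin_def using fin
    by (subst sum.cartesian_product') (simp add: hom_mult sum_distrib_left mult.assoc)
  finally show ?thesis .
qed

end

lemmas lin_id_mult = coeff_hom.lin_mult [OF coeff_hom_id]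

lemma lin_delta: "finite {g. f g \<noteq> 0} \<Longrightarrow> lin (\<lambda>x. x) (\<lambda>a. if a = g then 1 else 0) f = f g"
  by (subst lin_id_superset [of "insert g {g. f g \<noteq> 0}"]) (simp_all add: mult.commute if_distrib subset_insertI cong: if_cong)

text \<open>Delta functions recover the single coefficients. Equality in the algebra can therefore
  be proved by pairing with an arbitrary \<open>\<theta>\<close>, which turns ring axioms into
  rearrangements of finite sums.\<close>

lemma lin_ext:
  assumes "finite {g. f g \<noteq> 0}" "finite {g. f' g \<noteq> 0}"
    and "\<And>\<theta>. lin (\<lambda>x. x) \<theta> f = lin (\<lambda>x. x) \<theta> f'"
  shows "f = f'"
  using assms by (metis (no_types, lifting) ext lin_delta)

locale monoid_ring = coeff_subring C + Group.monoid G for C :: "'c::comm_ring_1 set" and G (structure)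
begin

abbreviation MA where "MA \<equiv> monoid_algebra C G"

lemma carrierI:
  "finite {g. f g \<noteq> 0} \<Longrightarrow> {g. f g \<noteq> 0} \<subseteq> carrier G \<Longrightarrow> range f \<subseteq> C \<Longrightarrow> f \<in> carrier MA"
  by (simp add: monoid_algebra_def)

lemma carrier_finite: "f \<in> carrier MA \<Longrightarrow> finite {g. f g \<noteq> 0}"
  by (simp add: monoid_algebra_def)

lemma carrier_supp: "f \<in> carrier MA \<Longrightarrow> f g \<noteq> 0 \<Longrightarrow> g \<in> carrier G"
  by (auto simp: monoid_algebra_def)

lemma carrier_coeff: "f \<in> carrier MA \<Longrightarrow> f g \<in> C"
  by (auto simp: monoid_algebra_def)

lemma add_eq: "f \<oplus>\<^bsub>MA\<^esub> f' = (\<lambda>g. f g + f' g)"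
  by (simp add: monoid_algebra_def)

lemma zero_eq: "\<zero>\<^bsub>MA\<^esub> = (\<lambda>g. 0)"
  by (simp add: monoid_algebra_def)

lemma one_eq: "\<one>\<^bsub>MA\<^esub> = single \<one> 1"
  by (simp add: monoid_algebra_def single_def)

lemma single_carrier: "a \<in> carrier G \<Longrightarrow> c \<in> C \<Longrightarrow> single a c \<in> carrier MA"
  by (rule carrierI) (auto simp: single_def)

lemma plus_carrier: "f \<in> carrier MA \<Longrightarrow> f' \<in> carrier MA \<Longrightarrow> (\<lambda>g. f g + f' g) \<in> carrier MA"
proof (rule carrierI)
  assume *: "f \<in> carrier MA" "f' \<in> carrier MA"
  have sub: "{g. f g + f' g \<noteq> 0} \<subseteq> {g. f g \<noteq> 0} \<union> {g. f' g \<noteq> 0}" by auto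
  then show "finite {g. f g + f' g \<noteq> 0}"
    by (rule finite_subset) (use * in \<open>auto intro: carrier_finite\<close>)
  show "{g. f g + f' g \<noteq> 0} \<subseteq> carrier G"
    using sub * carrier_supp by blast
  show "range (\<lambda>g. f g + f' g) \<subseteq> C"
    using * by (simp add: image_subset_iff C_add carrier_coeff)
qed

lemma uminus_carrier: "f \<in> carrier MA \<Longrightarrow> (\<lambda>g. - f g) \<in> carrier MA"
  by (rule carrierI) (auto intro: C_uminus carrier_coeff carrier_finite dest: carrier_supp)

lemma mult_carrier:
  assumes "f \<in> carrier MA" "f' \<in> carrier MA"
  shows "f \<otimes>\<^bsub>MA\<^esub> f' \<in> carrier MA"
proof -
  let ?m = "f \<otimes>\<^bsub>MA\<^esub> f'"
  let ?S = "\<lambda>g. {(a, b). f a \<noteq> 0 \<and> f' b \<noteq> 0 \<and> a \<otimes> b = g}"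
  have mult: "?m g = (\<Sum>(a, b)\<in>?S g. f a * f' b)" for g
    by (simp add: monoid_algebra_def)
  have supp: "{g. ?m g \<noteq> 0} \<subseteq> (\<lambda>(a, b). a \<otimes> b) ` ({a. f a \<noteq> 0} \<times> {b. f' b \<noteq> 0})"
    unfolding mult by (force elim: sum.not_neutral_contains_not_neutral)
  show ?thesis
  proof (rule carrierI)
    show "finite {g. ?m g \<noteq> 0}"
      by (rule finite_subset [OF supp]) (use assms in \<open>auto intro: carrier_finite\<close>)
    show "{g. ?m g \<noteq> 0} \<subseteq> carrier G"
      using supp carrier_supp [OF assms(1)] carrier_supp [OF assms(2)] by auto
    show "range ?m \<subseteq> C"
      unfolding mult using carrier_coeff [OF assms(1)] carrier_coeff [OF assms(2)]
      by (auto intro!: C_sum C_mult)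
  qed
qed

lemma monoid_algebra_ring: "ring MA"
proof (rule ringI)
  show "abelian_group MA"
  proof (rule abelian_groupI)
    fix f assume f: "f \<in> carrier MA"
    show "\<exists>f'\<in>carrier MA. f' \<oplus>\<^bsub>MA\<^esub> f = \<zero>\<^bsub>MA\<^esub>"
      by (rule bexI [of _ "\<lambda>g. - f g"]) (use f uminus_carrier in \<open>auto simp: add_eq zero_eq\<close>)
  qed (auto simp: add_eq zero_eq plus_carrier algebra_simps intro!: carrierI)
  show "Group.monoid MA"
  proof (rule monoidI)
    fix f f' f'' assume *: "f \<in> carrier MA" "f' \<in> carrier MA" "f'' \<in> carrier MA"
    show "f \<otimes>\<^bsub>MA\<^esub> f' \<otimes>\<^bsub>MA\<^esub> f'' = f \<otimes>\<^bsub>MA\<^esub> (f' \<otimes>\<^bsub>MA\<^esub> f'')"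
    proof (rule lin_ext)
      fix \<theta> :: "'a \<Rightarrow> 'c"
      have "lin (\<lambda>x. x) \<theta> (f \<otimes>\<^bsub>MA\<^esub> f' \<otimes>\<^bsub>MA\<^esub> f'') =
          lin (\<lambda>x. x) (\<lambda>a. lin (\<lambda>x. x) (\<lambda>b. lin (\<lambda>x. x) (\<lambda>c. \<theta> ((a \<otimes> b) \<otimes> c)) f'') f') f"
        using * by (simp add: lin_id_mult mult_carrier)
      \<comment> \<open>The monoid laws hold on the carrier only; \<open>lin_cong\<close> restricts
        the three arguments to the supports, which lie in it.\<close>
      also have "\<dots> = lin (\<lambda>x. x) (\<lambda>a. lin (\<lambda>x. x) (\<lambda>b. lin (\<lambda>x. x) (\<lambda>c. \<theta> (a \<otimes> (b \<otimes> c))) f'') f') f"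
        by (intro lin_cong)
        (simp add: m_assoc carrier_supp [OF *(1)] carrier_supp [OF *(2)] carrier_supp [OF *(3)])
      also have "\<dots> = lin (\<lambda>x. x) \<theta> (f \<otimes>\<^bsub>MA\<^esub> (f' \<otimes>\<^bsub>MA\<^esub> f''))"
        using * by (simp add: lin_id_mult mult_carrier)
      finally show "lin (\<lambda>x. x) \<theta> (f \<otimes>\<^bsub>MA\<^esub> f' \<otimes>\<^bsub>MA\<^esub> f'') = lin (\<lambda>x. x) \<theta> (f \<otimes>\<^bsub>MA\<^esub> (f' \<otimes>\<^bsub>MA\<^esub> f''))" .
    qed (simp_all add: * carrier_finite mult_carrier)
  next
    fix f assume f: "f \<in> carrier MA"
    have one: "single \<one> 1 \<in> carrier MA" by (simp add: single_carrier)
    note fin = carrier_finite [OF mult_carrier] carrier_finite [OF f]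
    have *: "lin (\<lambda>x. x) (\<lambda>b. \<theta> (\<one> \<otimes> b)) f = lin (\<lambda>x. x) \<theta> f"
      "lin (\<lambda>x. x) (\<lambda>b. \<theta> (b \<otimes> \<one>)) f = lin (\<lambda>x. x) \<theta> f" for \<theta> :: "'a \<Rightarrow> 'c"
      by (rule lin_cong, simp add: carrier_supp [OF f])+
    show "\<one>\<^bsub>MA\<^esub> \<otimes>\<^bsub>MA\<^esub> f = f" unfolding one_eq
      by (rule lin_ext) (simp_all add: fin one f lin_id_mult lin_id_single *)
    show "f \<otimes>\<^bsub>MA\<^esub> \<one>\<^bsub>MA\<^esub> = f" unfolding one_eq
      by (rule lin_ext) (simp_all add: fin one f lin_id_mult lin_id_single *)
  qed (auto simp: mult_carrier one_eq single_carrier)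
  fix f f' f'' assume *: "f \<in> carrier MA" "f' \<in> carrier MA" "f'' \<in> carrier MA"
  show "(f \<oplus>\<^bsub>MA\<^esub> f') \<otimes>\<^bsub>MA\<^esub> f'' = f \<otimes>\<^bsub>MA\<^esub> f'' \<oplus>\<^bsub>MA\<^esub> f' \<otimes>\<^bsub>MA\<^esub> f''"
    unfolding add_eq
    by (rule lin_ext) (simp_all add: * lin_id_mult lin_id_plus plus_carrier carrier_finite mult_carrier)
  show "f'' \<otimes>\<^bsub>MA\<^esub> (f \<oplus>\<^bsub>MA\<^esub> f') = f'' \<otimes>\<^bsub>MA\<^esub> f \<oplus>\<^bsub>MA\<^esub> f'' \<otimes>\<^bsub>MA\<^esub> f'"
    unfolding add_eq
    by (rule lin_ext) (simp_all add: * lin_id_mult lin_id_plus lin_add_right plus_carrier carrier_finite mult_carrier)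
qed

lemma single_mult:
  assumes "a \<in> carrier G" "b \<in> carrier G" "c \<in> C" "d \<in> C"
  shows "single a c \<otimes>\<^bsub>MA\<^esub> single b d = single (a \<otimes> b) (c * d)"
  by (rule lin_ext) (simp_all add: assms lin_id_mult lin_id_single single_carrier C_mult mult.assoc
    carrier_finite mult_carrier)

lemma minus_eq:
  assumes "f \<in> carrier MA" "f' \<in> carrier MA"
  shows "f \<ominus>\<^bsub>MA\<^esub> f' = (\<lambda>g. f g - f' g)"
proof -
  interpret R: ring MA by (rule monoid_algebra_ring)
  have "\<ominus>\<^bsub>MA\<^esub> f' = (\<lambda>g. - f' g)"
    by (rule R.minus_equality) (use assms uminus_carrier in \<open>auto simp: add_eq zero_eq\<close>)
  then show ?thesis
    by (simp add: a_minus_def add_eq)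
qed

lemma carrier_induct [consumes 1, case_names zero add]:
  assumes f: "f \<in> carrier MA"
    and zero: "P (\<lambda>g. 0)"
    and add: "\<And>a c f. a \<in> carrier G \<Longrightarrow> c \<in> C \<Longrightarrow> f \<in> carrier MA \<Longrightarrow> P f \<Longrightarrow> P (\<lambda>g. single a c g + f g)"
  shows "P f"
proof -
  have "finite A \<Longrightarrow> A \<subseteq> carrier G \<Longrightarrow> P (\<lambda>g. if g \<in> A then f g else 0)" for A
  proof (induction A rule: finite_induct)
    case empty
    then show ?case using zero by simp
  next
    case (insert a A)
    have "(\<lambda>g. if g \<in> A then f g else 0) \<in> carrier MA"
      using insert f by (intro carrierI) (auto intro: carrier_coeff)
    with insert add [of a "f a" "\<lambda>g. if g \<in> A then f g else 0"] carrier_coeff [OF f]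
    have "P (\<lambda>g. single a (f a) g + (if g \<in> A then f g else 0))" by auto
    also have "(\<lambda>g. single a (f a) g + (if g \<in> A then f g else 0)) = (\<lambda>g. if g \<in> insert a A then f g else 0)"
      using insert by (auto simp: single_def)
    finally show ?case .
  qed
  from this [of "{g. f g \<noteq> 0}"] have "P (\<lambda>g. if g \<in> {g. f g \<noteq> 0} then f g else 0)"
    using f by (simp add: monoid_algebra_def)
  moreover have "(\<lambda>g. if g \<in> {g. f g \<noteq> 0} then f g else 0) = f" by auto
  ultimately show ?thesis by simp
qed

end

text \<open>The zero set of \<open>\<psi>\<close> is an ideal containing \<open>S\<close>. The
  target is merely an abelian group because later it consists of operators, whose composition is not
  a multiplication of their function type; stability of the zero set stands in for
  multiplicativity.\<close>

lemma (in ring) quotient_lift: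
  fixes \<psi> :: "'a \<Rightarrow> 'v::ab_group_add"
  assumes S: "S \<subseteq> carrier R"
    and add: "\<And>a b. a \<in> carrier R \<Longrightarrow> b \<in> carrier R \<Longrightarrow> \<psi> (a \<oplus> b) = \<psi> a + \<psi> b"
    and mult: "\<And>a b. a \<in> carrier R \<Longrightarrow> b \<in> carrier R \<Longrightarrow> \<psi> a = 0 \<Longrightarrow> \<psi> (a \<otimes> b) = 0 \<and> \<psi> (b \<otimes> a) = 0"
    and gen: "\<And>s. s \<in> S \<Longrightarrow> \<psi> s = 0"
    and ab: "a \<in> carrier R" "b \<in> carrier R" "Idl S +> a = Idl S +> b"
  shows "\<psi> a = \<psi> b"
proof -
  have zero: "\<psi> \<zero> = 0" using add [of \<zero> \<zero>] by simp
  have minus: "\<psi> (\<ominus> a) = - \<psi> a" if "a \<in> carrier R" for a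
    using add [of a "\<ominus> a"] that zero by (simp add: r_neg add_eq_0_iff)
  let ?I = "{a \<in> carrier R. \<psi> a = 0}"
  have "ideal ?I R"
  proof (rule idealI)
    show "subgroup ?I (add_monoid R)"
      by (rule group.subgroupI) (use minus zero add in \<open>auto simp: add.group_axioms simp flip: a_inv_def\<close>)
  qed (use mult ring_axioms in auto)
  then have "Idl S \<subseteq> ?I" using gen S by (intro genideal_minimal) auto
  moreover have "a \<ominus> b \<in> Idl S"
    using quotient_eq_iff_same_a_r_cos [OF genideal_ideal [OF S] ab(1,2)] ab(3) by simp
  ultimately have "\<psi> (a \<ominus> b) = 0" by auto
  then show ?thesis using ab add [of a "\<ominus> b"] by (simp add: a_minus_def minus)
qed

section \<open>Laurent polynomials\<close>

lemma upsilon_nonzero [simp]: "\<upsilon> \<noteq> 0"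
  by (simp add: \<upsilon>_def)

lemma q_nonzero [simp]: "q \<noteq> 0"
  by (simp add: q_def)

text \<open>Formal Laurent polynomials are the integral monoid ring of the additive group of
  exponents. The elements of \<open>laurent\<close> are their values at \<upsilon>, and the bar
  involution becomes evaluation at the inverse.\<close>

definition int_exponents :: "int monoid"
  where "int_exponents = \<lparr>carrier = UNIV, monoid.mult = (+), one = 0\<rparr>"

lemma coeff_subring_UNIV: "coeff_subring UNIV"
  by unfold_locales auto

interpretation exps: monoid_ring "UNIV :: int set" int_exponents
  by (intro monoid_ring.intro coeff_subring_UNIV monoidI) (auto simp: int_exponents_def)

interpretation int_K: coeff_hom "of_int :: int \<Rightarrow> K"
  by unfold_locales auto

definition laurent_at :: "K \<Rightarrow> (int \<Rightarrow> int) \<Rightarrow> K"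
  where "laurent_at x = lin of_int (\<lambda>i. x powi i)"

lemma exps_carrier_iff: "c \<in> carrier exps.MA \<longleftrightarrow> finite {i. c i \<noteq> 0}"
  by (simp add: monoid_algebra_def int_exponents_def)

lemma exps_mult: "a \<otimes>\<^bsub>int_exponents\<^esub> b = a + b"
  by (simp add: int_exponents_def)

lemma laurent_at_mult:
  assumes "x \<noteq> 0" "c \<in> carrier exps.MA" "c' \<in> carrier exps.MA"
  shows "laurent_at x (c \<otimes>\<^bsub>exps.MA\<^esub> c') = laurent_at x c * laurent_at x c'"
  unfolding laurent_at_def int_K.lin_mult [OF assms(2,3)] exps_mult
  using assms by (simp add: power_int_add lin_scale_right lin_scale_left)

lemma laurent_at_plus:
  assumes "c \<in> carrier exps.MA" "c' \<in> carrier exps.MA"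
  shows "laurent_at x (\<lambda>i. c i + c' i) = laurent_at x c + laurent_at x c'"
  unfolding laurent_at_def by (rule int_K.lin_plus) (use assms in \<open>auto simp: exps_carrier_iff\<close>)

lemma laurent_at_single: "laurent_at x (single i k) = of_int k * x powi i"
  unfolding laurent_at_def by (rule int_K.lin_single)

lemma laurent_at_uminus: "laurent_at x (\<lambda>i. - c i) = - laurent_at x c"
  unfolding laurent_at_def lin_def by (simp add: sum_negf)

lemma laurent_eq: "laurent = laurent_at \<upsilon> ` carrier exps.MA"
proof (intro equalityI subsetI)
  fix x assume "x \<in> laurent"
  then obtain c I where I: "finite I" and x: "x = (\<Sum>i\<in>I. of_int (c i) * \<upsilon> powi i)"
    by (auto simp: laurent_def)
  let ?c = "\<lambda>i. if i \<in> I then c i else 0"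
  have sub: "{i. ?c i \<noteq> 0} \<subseteq> I" by auto
  have "x = laurent_at \<upsilon> ?c"
    unfolding laurent_at_def int_K.lin_superset [OF I sub] x by simp
  moreover have "?c \<in> carrier exps.MA"
    unfolding exps_carrier_iff using finite_subset [OF sub I] .
  ultimately show "x \<in> laurent_at \<upsilon> ` carrier exps.MA" by blast
next
  fix x assume "x \<in> laurent_at \<upsilon> ` carrier exps.MA"
  then show "x \<in> laurent"
    by (force simp: laurent_def laurent_at_def lin_def exps_carrier_iff)
qed

interpretation laurent: coeff_subring laurent
proof
  have "laurent_at \<upsilon> (single 0 1) = 1" by (simp add: laurent_at_single)
  moreover have "single 0 1 \<in> carrier exps.MA" by (simp add: exps_carrier_iff single_def)
  ultimately show "1 \<in> laurent" unfolding laurent_eq by (metis image_eqI)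
next
  fix x y assume "x \<in> laurent" "y \<in> laurent"
  then obtain c c' where "c \<in> carrier exps.MA" "c' \<in> carrier exps.MA"
    "x = laurent_at \<upsilon> c" "y = laurent_at \<upsilon> c'"
    by (auto simp: laurent_eq)
  then show "x + y \<in> laurent" "x * y \<in> laurent"
    unfolding laurent_eq
    by (auto simp: laurent_at_mult simp flip: laurent_at_plus intro!: imageI exps.plus_carrier)
      (metis exps.mult_carrier image_eqI laurent_at_mult upsilon_nonzero)
next
  fix x assume "x \<in> laurent"
  then show "- x \<in> laurent"
    unfolding laurent_eq by (auto simp flip: laurent_at_uminus intro!: imageI exps.uminus_carrier)
qed

lemma powi_laurent: "\<upsilon> powi i \<in> laurent"
proof -
  have "laurent_at \<upsilon> (single i 1) = \<upsilon> powi i" by (simp add: laurent_at_single)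
  moreover have "single i 1 \<in> carrier exps.MA" by (simp add: exps_carrier_iff single_def)
  ultimately show ?thesis unfolding laurent_eq by (metis image_eqI)
qed

lemma upsilon_laurent: "\<upsilon> \<in> laurent" "inverse \<upsilon> \<in> laurent"
  using powi_laurent [of 1] powi_laurent [of "-1"] by (auto simp: power_int_minus)

lemma q_laurent [simp]: "q \<in> laurent" "q - 1 \<in> laurent"
proof -
  show q: "q \<in> laurent" using powi_laurent [of 2] by (simp add: q_def)
  show "q - 1 \<in> laurent"
    using laurent.C_add [OF q laurent.C_uminus [OF laurent.C_one]] by simp
qed

text \<open>Transcendence of \<upsilon>: a relation is multiplied by a power of \<upsilon> that
  clears negative exponents and becomes a polynomial over the rationals that vanishes in the
  fraction field.\<close>

lemma laurent_at_inj:
  assumes "c \<in> carrier exps.MA" "laurent_at \<upsilon> c = 0"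
  shows "c = (\<lambda>i. 0)"
proof -
  let ?S = "{i. c i \<noteq> 0}"
  have S: "finite ?S" using assms by (simp add: exps_carrier_iff)
  \<comment> \<open>The sum of the absolute values of all occurring exponents is a crude bound for
    each of them.\<close>
  obtain N where N: "\<And>i. i \<in> ?S \<Longrightarrow> 0 \<le> i + int N"
  proof
    fix i assume "i \<in> ?S"
    then have "nat \<bar>i\<bar> \<le> (\<Sum>i\<in>?S. nat \<bar>i\<bar>)" using S by (intro member_le_sum) auto
    then show "0 \<le> i + int (\<Sum>i\<in>?S. nat \<bar>i\<bar>)" by linarith
  qed
  let ?p = "\<Sum>i\<in>?S. monom (of_int (c i) :: rat) (nat (i + int N))"
  have monom: "to_fract (monom (of_int k) m) = of_int k * \<upsilon> ^ m" for k m
  proof -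
    have pow: "\<upsilon> ^ m = to_fract ([:0, 1:] ^ m)"
      unfolding \<upsilon>_def by (induction m) (simp_all only: power_0 power_Suc to_fract_1 to_fract_mult)
    have oi: "to_fract (of_int k) = (of_int k :: K)"
      by (cases k) (auto simp: to_fract_def of_nat_fract One_fract_def)
    have "(monom (of_int k) m :: rat poly) = of_int k * [:0, 1:] ^ m"
      by (simp add: monom_altdef of_int_poly)
    then show ?thesis by (simp only: pow to_fract_mult oi)
  qed
  have "to_fract ?p = (\<Sum>i\<in>?S. of_int (c i) * \<upsilon> ^ nat (i + int N))"
    by (simp add: monom)
  also have "\<dots> = (\<Sum>i\<in>?S. of_int (c i) * (\<upsilon> powi i * \<upsilon> powi int N))"
  proof (rule sum.cong)
    fix i assume "i \<in> ?S"
    then have "\<upsilon> ^ nat (i + int N) = \<upsilon> powi (i + int N)"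
      using N by (simp add: power_int_def)
    then show "of_int (c i) * \<upsilon> ^ nat (i + int N) = of_int (c i) * (\<upsilon> powi i * \<upsilon> powi int N)"
      by (simp add: power_int_add)
  qed simp
  also have "\<dots> = laurent_at \<upsilon> c * \<upsilon> powi int N"
    by (simp add: laurent_at_def lin_def sum_distrib_right mult.assoc)
  finally have p: "?p = 0" by (simp only: assms(2) mult_zero_left to_fract_eq_0_iff)
  have "c j = 0" for j
  proof (rule ccontr)
    assume j: "c j \<noteq> 0"
    have "coeff ?p (nat (j + int N)) = (\<Sum>i\<in>?S. if i = j then of_int (c i) else 0)"
      unfolding coeff_sum
    proof (rule sum.cong)
      fix i assume "i \<in> ?S"
      then have "nat (j + int N) = nat (i + int N) \<longleftrightarrow> i = j"
        using N [of i] N [of j] j by auto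
      then show "coeff (monom (of_int (c i) :: rat) (nat (i + int N))) (nat (j + int N)) =
          (if i = j then of_int (c i) else 0)"
        by auto
    qed simp
    also have "\<dots> = of_int (c j)" using S j by simp
    finally show False using p j by simp
  qed
  then show ?thesis by auto
qed

lemma laurent_at_inj_on: "inj_on (laurent_at \<upsilon>) (carrier exps.MA)"
proof (rule inj_onI)
  fix c c' assume *: "c \<in> carrier exps.MA" "c' \<in> carrier exps.MA" "laurent_at \<upsilon> c = laurent_at \<upsilon> c'"
  let ?d = "\<lambda>i. c i + (- c' i)"
  have "?d \<in> carrier exps.MA"
    by (rule exps.plus_carrier [OF *(1) exps.uminus_carrier [OF *(2)]])
  moreover have "laurent_at \<upsilon> ?d = 0"
    by (subst laurent_at_plus) (use * in \<open>auto simp: laurent_at_uminus exps.uminus_carrier\<close>)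
  ultimately have "?d = (\<lambda>i. 0)" by (rule laurent_at_inj)
  then have "c i - c' i = 0" for i by (simp add: fun_eq_iff)
  then show "c = c'" by (simp add: fun_eq_iff)
qed

lemma laurent_at_inverse:
  "laurent_at (inverse x) c = laurent_at x (\<lambda>i. c (- i))"
  unfolding laurent_at_def lin_def
  by (rule sum.reindex_bij_witness [where i = uminus and j = uminus])
    (auto simp: power_int_minus power_int_inverse)

lemma exps_flip: "c \<in> carrier exps.MA \<Longrightarrow> (\<lambda>i. c (- i)) \<in> carrier exps.MA"
proof -
  assume "c \<in> carrier exps.MA"
  moreover have "{i. c (- i) \<noteq> 0} = uminus ` {i. c i \<noteq> 0}" by (auto simp: image_iff) (metis minus_minus)
  ultimately show ?thesis by (simp add: exps_carrier_iff)
qed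

section \<open>The bar involution\<close>

lemma laurent_ring_simps [simp]:
  "carrier laurent_ring = laurent" "x \<otimes>\<^bsub>laurent_ring\<^esub> y = x * y" "x \<oplus>\<^bsub>laurent_ring\<^esub> y = x + y"
  "\<one>\<^bsub>laurent_ring\<^esub> = 1"
  by (simp_all add: laurent_ring_def)

text \<open>Injectivity of the evaluation makes the substitution of the inverse for \<upsilon> well
  defined. Evaluating at the inverse amounts to negating the exponents, so the map is its own
  inverse and hence bijective.\<close>

lemma bar_exists:
  "\<exists>\<phi>. \<phi> \<in> ring_iso laurent_ring laurent_ring \<and> \<phi> \<in> extensional laurent \<and> \<phi> \<upsilon> = inverse \<upsilon>"
proof -
  define \<phi> where "\<phi> = (\<lambda>x\<in>laurent. laurent_at (inverse \<upsilon>) (inv_into (carrier exps.MA) (laurent_at \<upsilon>) x))"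
  have eq: "\<phi> (laurent_at \<upsilon> c) = laurent_at (inverse \<upsilon>) c" if "c \<in> carrier exps.MA" for c
    using that by (simp add: \<phi>_def laurent_eq laurent_at_inj_on)
  have closed: "\<phi> x \<in> laurent" and invol: "\<phi> (\<phi> x) = x" if "x \<in> laurent" for x
  proof -
    from that obtain c where c: "c \<in> carrier exps.MA" "x = laurent_at \<upsilon> c"
      by (auto simp: laurent_eq)
    then have *: "\<phi> x = laurent_at \<upsilon> (\<lambda>i. c (- i))" by (simp add: eq laurent_at_inverse)
    then show "\<phi> x \<in> laurent" using exps_flip [OF c(1)] by (auto simp: laurent_eq)
    show "\<phi> (\<phi> x) = x" unfolding * using c by (simp add: eq exps_flip laurent_at_inverse)
  qed
  have sing: "\<phi> (of_int k * \<upsilon> powi i) = of_int k * inverse \<upsilon> powi i" for k i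
    using eq [of "single i k"] by (simp add: exps_carrier_iff single_def laurent_at_single [unfolded single_def])
  have hom: "\<phi> (x + y) = \<phi> x + \<phi> y" "\<phi> (x * y) = \<phi> x * \<phi> y" if "x \<in> laurent" "y \<in> laurent" for x y
  proof -
    from that obtain c c' where c: "c \<in> carrier exps.MA" "x = laurent_at \<upsilon> c"
      "c' \<in> carrier exps.MA" "y = laurent_at \<upsilon> c'"
      by (auto simp: laurent_eq)
    show "\<phi> (x + y) = \<phi> x + \<phi> y"
      unfolding c using c by (simp add: eq exps.plus_carrier flip: laurent_at_plus)
    show "\<phi> (x * y) = \<phi> x * \<phi> y"
      unfolding c using c by (simp add: eq exps.mult_carrier flip: laurent_at_mult)
  qed
  have "\<phi> \<in> ring_iso laurent_ring laurent_ring"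
  proof (rule ring_iso_memI)
    show "\<phi> \<one>\<^bsub>laurent_ring\<^esub> = \<one>\<^bsub>laurent_ring\<^esub>" using sing [of 1 0] by simp
    show "bij_betw \<phi> (carrier laurent_ring) (carrier laurent_ring)"
      by (rule bij_betw_byWitness [where f' = \<phi>]) (use closed invol in auto)
  qed (use closed hom in auto)
  moreover have "\<phi> \<upsilon> = inverse \<upsilon>" using sing [of 1 1] by simp
  ultimately show ?thesis by (auto simp: \<phi>_def)
qed

text \<open>A unital ring homomorphism fixes the integers, and its value at \<upsilon> determines it
  on all powers, the negative ones included.\<close>

lemma bar_unique:
  assumes \<phi>: "\<phi> \<in> ring_iso laurent_ring laurent_ring" "\<phi> \<upsilon> = inverse \<upsilon>"
    and c: "c \<in> carrier exps.MA"
  shows "\<phi> (laurent_at \<upsilon> c) = laurent_at (inverse \<upsilon>) c"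
proof -
  have add: "\<phi> (x + y) = \<phi> x + \<phi> y" and mult: "\<phi> (x * y) = \<phi> x * \<phi> y"
    if "x \<in> laurent" "y \<in> laurent" for x y
    using ring_iso_memE(2,3) [OF \<phi>(1)] that by auto
  have one: "\<phi> 1 = 1" using ring_iso_memE(4) [OF \<phi>(1)] by simp
  have zero: "\<phi> 0 = 0" using add [of 0 0] by simp
  have uminus: "\<phi> (- x) = - \<phi> x" if "x \<in> laurent" for x
    using add [OF that laurent.C_uminus [OF that]] zero by (simp add: eq_neg_iff_add_eq_0 add.commute)
  have nat: "of_nat k \<in> laurent \<and> \<phi> (of_nat k) = of_nat k" for k
    by (induction k) (auto simp: zero one add laurent.C_add)
  have int: "of_int k \<in> laurent" "\<phi> (of_int k) = of_int k" for k
    by (cases k rule: int_cases2; use nat uminus laurent.C_uminus in auto)+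
  have inv: "\<phi> (inverse \<upsilon>) = \<upsilon>"
    using mult [OF upsilon_laurent] \<phi>(2) one by (simp add: field_simps)
  have pow: "\<upsilon> ^ k \<in> laurent \<and> \<phi> (\<upsilon> ^ k) = inverse \<upsilon> ^ k"
      "inverse \<upsilon> ^ k \<in> laurent \<and> \<phi> (inverse \<upsilon> ^ k) = \<upsilon> ^ k" for k
    by (induction k) (auto simp: one mult \<phi>(2) inv upsilon_laurent laurent.C_mult)
  have powi: "\<phi> (\<upsilon> powi i) = inverse \<upsilon> powi i" for i
    using pow by (simp add: power_int_def)
  show ?thesis using c
  proof (induction rule: exps.carrier_induct)
    case zero
    then show ?case by (simp add: laurent_at_def lin_def \<open>\<phi> 0 = 0\<close>)
  next
    case (add a k f)
    have s: "single a k \<in> carrier exps.MA" by (simp add: exps_carrier_iff single_def)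
    have "laurent_at \<upsilon> f \<in> laurent" using add by (auto simp: laurent_eq)
    moreover have "of_int k * \<upsilon> powi a \<in> laurent"
      using int powi_laurent laurent.C_mult by blast
    ultimately show ?case
      using add s \<open>\<And>x y. x \<in> laurent \<Longrightarrow> y \<in> laurent \<Longrightarrow> \<phi> (x + y) = \<phi> x + \<phi> y\<close>
      by (simp add: laurent_at_plus laurent_at_single mult int powi powi_laurent)
  qed
qed

text \<open>The homomorphism conditions concern \<open>laurent\<close> only; extensionality fixes
  the remaining values, so the description of \<open>bar\<close> has exactly one solution.\<close>

lemma bar_props: "bar \<in> ring_iso laurent_ring laurent_ring \<and> bar \<in> extensional laurent \<and> bar \<upsilon> = inverse \<upsilon>"
proof -
  have "\<exists>!\<phi>. \<phi> \<in> ring_iso laurent_ring laurent_ring \<and> \<phi> \<in> extensional laurent \<and> \<phi> \<upsilon> = inverse \<upsilon>"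
  proof (rule ex_ex1I [OF bar_exists])
    fix \<phi> \<psi> assume *: "\<phi> \<in> ring_iso laurent_ring laurent_ring \<and> \<phi> \<in> extensional laurent \<and> \<phi> \<upsilon> = inverse \<upsilon>"
      "\<psi> \<in> ring_iso laurent_ring laurent_ring \<and> \<psi> \<in> extensional laurent \<and> \<psi> \<upsilon> = inverse \<upsilon>"
    show "\<phi> = \<psi>"
    proof (rule extensionalityI)
      fix x assume "x \<in> laurent"
      then show "\<phi> x = \<psi> x" using * by (auto simp: laurent_eq bar_unique)
    qed (use * in auto)
  qed
  from theI' [OF this] show ?thesis by (simp only: bar_def)
qed

lemma bar_powi: "bar (\<upsilon> powi i) = \<upsilon> powi (- i)"
  using bar_unique [of bar "single i 1"] bar_props
  by (simp add: exps_carrier_iff single_def laurent_at_single [unfolded single_def] power_int_inverse power_int_minus)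

lemma bar_add: "x \<in> laurent \<Longrightarrow> y \<in> laurent \<Longrightarrow> bar (x + y) = bar x + bar y"
  using ring_iso_memE(3) [of bar laurent_ring laurent_ring] bar_props by simp

lemma bar_sum: "(\<And>x. x \<in> A \<Longrightarrow> f x \<in> laurent) \<Longrightarrow> bar (sum f A) = (\<Sum>x\<in>A. bar (f x))"
proof (induction A rule: infinite_finite_induct)
  case (insert a A)
  then show ?case by (simp add: bar_add laurent.C_sum)
qed (use bar_add [of 0 0] in auto)

section \<open>Quantum integers\<close>

definition qsum :: "nat \<Rightarrow> K"
  where "qsum m = (\<Sum>k<m. q ^ k)"

lemma upsilon_even: "\<upsilon> powi (2 * int k) = q ^ k"
  by (simp add: q_def power_int_def nat_mult_distrib flip: power_mult)

text \<open>The bar turns the powers of q into inverse powers; multiplication by q^m makes them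
  nonnegative again and reverses the order of summation.\<close>

lemma bar_qint: "bar (qint (int m + 1)) * q ^ m = qsum (Suc m)"
proof -
  \<comment> \<open>The denominator of \<open>qint\<close> is nonzero, since the polynomial behind
    it takes the value 3 at 2.\<close>
  have "q - 1 = to_fract ([:0, 1:]\<^sup>2 - 1)" by (simp only: q_def \<upsilon>_def power2_eq_square to_fract_diff to_fract_mult to_fract_1)
  also have "\<dots> \<noteq> 0"
  proof
    assume "to_fract ([:0, 1:]\<^sup>2 - 1 :: rat poly) = 0"
    then have "poly ([:0, 1:]\<^sup>2 - 1 :: rat poly) 2 = poly 0 2" by (simp only: to_fract_eq_0_iff)
    then show False by simp
  qed
  finally have q1: "q \<noteq> 1" by simp
  have "qint (int m + 1) = (q ^ Suc m - 1) / (q - 1)"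
    unfolding qint_def using upsilon_even [of "Suc m"] by (simp add: q_def algebra_simps)
  also have "\<dots> = (\<Sum>k<Suc m. q ^ k)"
    using q1 by (subst sum_gp_strict) (simp add: divide_simps algebra_simps)
  finally have "qint (int m + 1) = (\<Sum>k<Suc m. \<upsilon> powi (2 * int k))"
    by (simp only: upsilon_even)
  then have "bar (qint (int m + 1)) = (\<Sum>k<Suc m. \<upsilon> powi (- (2 * int k)))"
    by (simp only: bar_sum powi_laurent bar_powi)
  also have "\<dots> * q ^ m = (\<Sum>k<Suc m. q ^ (m - k))"
    unfolding sum_distrib_right power_int_minus upsilon_even
    by (rule sum.cong) (simp_all add: power_diff divide_inverse)
  also have "\<dots> = qsum (Suc m)"
    unfolding qsum_def using sum.nat_diff_reindex [of "\<lambda>k. q ^ k" "Suc m"] by simp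
  finally show ?thesis .
qed

text \<open>At \<upsilon> = 1 the polynomial takes the value m, nonzero in characteristic zero.
  These are the coefficients that the generation argument inverts.\<close>

lemma qsum_nonzero:
  assumes "m > 0"
  shows "qsum m \<noteq> 0"
proof
  have pow: "q ^ k = to_fract (([:0, 1:] ^ 2) ^ k)" for k
    unfolding q_def \<upsilon>_def
    by (induction k) (simp_all only: power2_eq_square power_0 power_Suc to_fract_1 to_fract_mult)
  assume "qsum m = 0"
  then have "to_fract (\<Sum>k<m. (([:0, 1:] :: rat poly) ^ 2) ^ k) = 0" by (simp add: qsum_def pow)
  then have "poly (\<Sum>k<m. (([:0, 1:] :: rat poly) ^ 2) ^ k) 1 = poly 0 1"
    by (simp only: to_fract_eq_0_iff)
  then show False using assms by (simp add: poly_sum)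
qed

section \<open>Words and the right action of the Hecke generators\<close>

text \<open>Right multiplication by a simple transposition. The codomain is left arbitrary, so that
  permutations and words with repeated letters are treated alike.\<close>

definition sw :: "nat \<Rightarrow> (nat \<Rightarrow> 'a) \<Rightarrow> nat \<Rightarrow> 'a"
  where "sw p w = w \<circ> transpose p (Suc p)"

lemma sw_simps [simp]:
  "sw p w p = w (Suc p)" "sw p w (Suc p) = w p" "a \<noteq> p \<Longrightarrow> a \<noteq> Suc p \<Longrightarrow> sw p w a = w a"
  "sw p (sw p w) = w"
  by (auto simp: sw_def fun_eq_iff transpose_def)

lemma sw_upd: "sw p w = w(p := w (Suc p), Suc p := w p)"
  by (auto simp: sw_def fun_eq_iff transpose_def)

lemma sw_comp: "sw p (u \<circ> w) = u \<circ> sw p w"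
  by (simp add: sw_def comp_assoc)

lemma sw_id: "w p = w (Suc p) \<Longrightarrow> sw p w = w"
  by (auto simp: sw_upd)

lemma transpose_permutes: "p \<in> {1..<r} \<Longrightarrow> transpose p (Suc p) permutes {1..r}"
  by (rule permutes_swap_id) auto

lemma sw_permutes: "p \<in> {1..<r} \<Longrightarrow> w permutes {1..r} \<Longrightarrow> sw p w permutes {1..r}"
  unfolding sw_def by (rule permutes_compose [OF transpose_permutes])

lemma sw_permutes_iff: "p \<in> {1..<r} \<Longrightarrow> sw p w permutes {1..r} \<longleftrightarrow> w permutes {1..r}"
  using sw_permutes [of p r w] sw_permutes [of p r "sw p w"] by auto

section \<open>Inversions and bubble sort\<close>

definition ninv :: "nat \<Rightarrow> (nat \<Rightarrow> nat) \<Rightarrow> nat"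
  where "ninv r w = card {(a, b). 1 \<le> a \<and> a < b \<and> b \<le> r \<and> w b < w a}"

lemma finite_inversions: "finite {(a, b). 1 \<le> a \<and> a < b \<and> b \<le> r \<and> P a b}" for r :: nat
  by (rule finite_subset [of _ "{1..r} \<times> {1..r}"]) auto

text \<open>Applying the transposition to both positions of an inversion matches the inversions
  before and after the exchange, except that the pair (p, p + 1) is new.\<close>

lemma ninv_sw:
  assumes p: "p \<in> {1..<r}" and asc: "w p < w (Suc p)"
  shows "ninv r (sw p w) = Suc (ninv r w)"
proof -
  let ?I = "\<lambda>w :: nat \<Rightarrow> nat. {(a, b). 1 \<le> a \<and> a < b \<and> b \<le> r \<and> w b < w a}"
  let ?t = "transpose p (Suc p)"
  have fwd: "map_prod ?t ?t x \<in> ?I (sw p w)" "map_prod ?t ?t x \<noteq> (p, Suc p)" if "x \<in> ?I w" for x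
    using that p asc by (cases x; auto simp: sw_def transpose_def split: if_splits)+
  have bwd: "map_prod ?t ?t x \<in> ?I w" if "x \<in> ?I (sw p w)" "x \<noteq> (p, Suc p)" for x
    using that p asc by (cases x; auto simp: sw_def transpose_def split: if_splits)
  have "?I (sw p w) = insert (p, Suc p) (map_prod ?t ?t ` ?I w)"
  proof (intro equalityI subsetI)
    fix x assume x: "x \<in> ?I (sw p w)"
    show "x \<in> insert (p, Suc p) (map_prod ?t ?t ` ?I w)"
    proof (cases "x = (p, Suc p)")
      case False
      have "map_prod ?t ?t (map_prod ?t ?t x) \<in> map_prod ?t ?t ` ?I w"
        by (intro imageI bwd x False)
      moreover have "map_prod ?t ?t (map_prod ?t ?t x) = x" by (cases x) simp
      ultimately show ?thesis by simp
    qed simp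
  next
    fix x assume "x \<in> insert (p, Suc p) (map_prod ?t ?t ` ?I w)"
    then show "x \<in> ?I (sw p w)"
    proof (elim insertE imageE)
      assume "x = (p, Suc p)"
      then show ?thesis using p asc by simp
    next
      fix y assume "x = map_prod ?t ?t y" "y \<in> ?I w"
      then show ?thesis using fwd(1) by (simp only:)
    qed
  qed
  moreover have "inj_on (map_prod ?t ?t) (?I w)"
    by (intro inj_on_subset [OF map_prod_inj_on [of ?t UNIV ?t UNIV]]) auto
  moreover have "(p, Suc p) \<notin> map_prod ?t ?t ` ?I w"
  proof
    assume "(p, Suc p) \<in> map_prod ?t ?t ` ?I w"
    then show False by (elim imageE) (drule fwd(2), simp)
  qed
  moreover have "finite (?I w)" by (rule finite_inversions)
  ultimately show ?thesis
    unfolding ninv_def by (simp only: card_image card_insert_disjoint finite_imageI not_False_eq_True)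
qed

lemma ninv_sw_desc:
  assumes "p \<in> {1..<r}" "w (Suc p) < w p"
  shows "ninv r w = Suc (ninv r (sw p w))"
  using ninv_sw [of p r "sw p w"] assms by simp

lemma mono_of_adjacent:
  fixes w :: "nat \<Rightarrow> nat"
  assumes "\<And>p. p \<in> {1..<r} \<Longrightarrow> w p \<le> w (Suc p)" "1 \<le> a" "a \<le> b" "b \<le> r"
  shows "w a \<le> w b"
  using assms(3,4)
proof (induction rule: dec_induct)
  case (step m)
  then have "m \<in> {1..<r}" using assms(2) by auto
  from assms(1) [OF this] step show ?case by simp
qed simp

text \<open>Bubble sort as an induction principle.\<close>

lemma word_induct:
  fixes w :: "nat \<Rightarrow> nat"
  assumes "Q w"
    and closed: "\<And>w p. Q w \<Longrightarrow> p \<in> {1..<r} \<Longrightarrow> w (Suc p) < w p \<Longrightarrow> Q (sw p w)"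
    and sorted: "\<And>w. Q w \<Longrightarrow> (\<And>a b. 1 \<le> a \<Longrightarrow> a \<le> b \<Longrightarrow> b \<le> r \<Longrightarrow> w a \<le> w b) \<Longrightarrow> P w"
    and step: "\<And>w p. Q w \<Longrightarrow> p \<in> {1..<r} \<Longrightarrow> w (Suc p) < w p \<Longrightarrow> P (sw p w) \<Longrightarrow> P w"
  shows "P w"
  using assms(1)
proof (induction "ninv r w" arbitrary: w rule: less_induct)
  case less
  show ?case
  proof (cases "\<exists>p\<in>{1..<r}. w (Suc p) < w p")
    case True
    then obtain p where p: "p \<in> {1..<r}" "w (Suc p) < w p" by blast
    have "P (sw p w)"
      by (rule less.hyps) (use p ninv_sw_desc [OF p] closed less.prems in auto)
    then show ?thesis using step less.prems p by blast
  next
    case False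
    then have "w p \<le> w (Suc p)" if "p \<in> {1..<r}" for p using that by (meson not_le)
    then show ?thesis using sorted [OF less.prems] mono_of_adjacent [of r w] by blast
  qed
qed

text \<open>Injectivity makes the order strict; then a \<le> w a follows by induction upwards from
  1, and w a \<le> a by induction downwards from r.\<close>

lemma sorted_permutation:
  fixes w :: "nat \<Rightarrow> nat"
  assumes w: "w permutes {1..r}" and mono: "\<And>a b. 1 \<le> a \<Longrightarrow> a \<le> b \<Longrightarrow> b \<le> r \<Longrightarrow> w a \<le> w b"
  shows "w = id"
proof
  fix p
  have inj: "inj w" using w by (rule permutes_inj)
  have smono: "w a < w b" if "1 \<le> a" "a < b" "b \<le> r" for a b
    using mono [of a b] that inj_eq [OF inj, of a b] by (metis less_imp_le_nat nat_less_le)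
  have ge: "a \<le> w a" if "1 \<le> a" "a \<le> r" for a
    using that
  proof (induction a)
    case (Suc a)
    show ?case
    proof (cases "a = 0")
      case True
      have "w (Suc 0) \<in> {1..r}" using permutes_in_image [OF w, of "Suc 0"] Suc.prems True by simp
      then show ?thesis using True by simp
    next
      case False
      then show ?thesis using Suc smono [of a "Suc a"] by simp
    qed
  qed simp
  have le: "w a \<le> a" if "1 \<le> a" "a \<le> r" for a
    using that(2,1)
  proof (induction rule: inc_induct)
    case base
    have "w r \<in> {1..r}" using permutes_in_image [OF w, of r] base by simp
    then show ?case by simp
  next
    case (step m)
    then show ?case using smono [of m "Suc m"] by simp
  qed
  show "w p = id p"
    using le [of p] ge [of p] permutes_not_in [OF w, of p] by (cases "p \<in> {1..r}") auto
qed

lemma permutation_induct [consumes 1, case_names id step]: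
  fixes w :: "nat \<Rightarrow> nat"
  assumes "w permutes {1..r}"
    and id: "P id"
    and step: "\<And>w p. w permutes {1..r} \<Longrightarrow> p \<in> {1..<r} \<Longrightarrow> w (Suc p) < w p \<Longrightarrow> P (sw p w) \<Longrightarrow> P w"
  shows "P w"
proof (rule word_induct [where Q = "\<lambda>w. w permutes {1..r}" and w = w and r = r and P = P])
  fix w :: "nat \<Rightarrow> nat" assume "w permutes {1..r}" "\<And>a b. 1 \<le> a \<Longrightarrow> a \<le> b \<Longrightarrow> b \<le> r \<Longrightarrow> w a \<le> w b"
  then have "w = id" by (rule sorted_permutation)
  then show "P w" using id by simp
next
  show "sw p w permutes {1..r}" if "w permutes {1..r}" "p \<in> {1..<r}" for w p
    by (rule sw_permutes [OF that(2,1)])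
  show "P w" if "w permutes {1..r}" "p \<in> {1..<r}" "w (Suc p) < w p" "P (sw p w)" for w p
    by (rule step [OF that])
qed (rule assms(1))

lemma ninv_id: "ninv r id = 0"
proof -
  have "{(a, b). 1 \<le> a \<and> a < b \<and> b \<le> r \<and> id b < (id a :: nat)} = {}" by auto
  then show ?thesis by (simp only: ninv_def card.empty)
qed

text \<open>Right multiplication of \<open>\<Sum> f(w) T\<^sub>w\<close> by \<open>T\<^sub>p\<close>, extended to words with repeated letters.\<close>

definition Rop :: "nat \<Rightarrow> ((nat \<Rightarrow> nat) \<Rightarrow> K) \<Rightarrow> (nat \<Rightarrow> nat) \<Rightarrow> K"
  where "Rop p f w =
    (if w p = w (Suc p) then q * f w
     else if w p < w (Suc p) then q * f (sw p w)
     else f (sw p w) + (q - 1) * f w)"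

section \<open>Linearity and the Hecke relations for the right action\<close>

lemma Rop_plus: "Rop p (\<lambda>w. f w + g w) = (\<lambda>w. Rop p f w + Rop p g w)"
  by (auto simp: Rop_def fun_eq_iff algebra_simps)

lemma Rop_scale: "Rop p (\<lambda>w. c * f w) = (\<lambda>w. c * Rop p f w)"
  by (auto simp: Rop_def fun_eq_iff algebra_simps)

lemma Rop_sum: "Rop p (\<lambda>w. \<Sum>x\<in>A. f x w) = (\<lambda>w. \<Sum>x\<in>A. Rop p (f x) w)"
  by (auto simp: Rop_def fun_eq_iff algebra_simps sum.distrib sum_distrib_left sum_subtractf)

lemma Rop_quadratic: "Rop p (Rop p f) = (\<lambda>w. (q - 1) * Rop p f w + q * f w)"
  by (auto simp: Rop_def fun_eq_iff algebra_simps)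

lemma Rop_commute:
  assumes "Suc p < s"
  shows "Rop p (Rop s f) = Rop s (Rop p f)"
proof -
  have *: "sw p (sw s w) = sw s (sw p w)" for w :: "nat \<Rightarrow> nat"
    using assms by (auto simp: fun_eq_iff sw_def transpose_def)
  show ?thesis
    using assms by (auto simp: Rop_def fun_eq_iff algebra_simps *)
qed

text \<open>Only the letters at p, p + 1 and p + 2 are touched. With the rest of the word frozen in
  \<open>W\<close>, the identity is a finite check over the relative orders of three letters,
  equalities included.\<close>

lemma Rop_braid: "Rop p (Rop (Suc p) (Rop p f)) = Rop (Suc p) (Rop p (Rop (Suc p) f))"
proof
  fix w :: "nat \<Rightarrow> nat"
  define W where "W a b c = w(p := a, Suc p := b, Suc (Suc p) := c)" for a b c
  have W: "w = W (w p) (w (Suc p)) (w (Suc (Suc p)))" by (simp add: W_def)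
  have R1: "Rop p h (W a b c) = (if a = b then q * h (W a b c) else if a < b then q * h (W b a c)
      else h (W b a c) + (q - 1) * h (W a b c))" for h a b c
    by (simp add: Rop_def W_def sw_upd fun_upd_twist)
  have R2: "Rop (Suc p) h (W a b c) = (if b = c then q * h (W a b c) else if b < c then q * h (W a c b)
      else h (W a c b) + (q - 1) * h (W a b c))" for h a b c
    by (simp add: Rop_def W_def sw_upd fun_upd_twist)
  have "Rop p (Rop (Suc p) (Rop p f)) (W a b c) = Rop (Suc p) (Rop p (Rop (Suc p) f)) (W a b c)" for a b c
    by (cases a b rule: linorder_cases; cases b c rule: linorder_cases; cases a c rule: linorder_cases)
      (simp_all add: R1 R2 algebra_simps)
  then show "Rop p (Rop (Suc p) (Rop p f)) w = Rop (Suc p) (Rop p (Rop (Suc p) f)) w"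
    by (subst (1 2) W)
qed

text \<open>The delta function at the less sorted word is reached without a correction term.
  Inductions along bubble sort use this to pass from a sorted word to all its
  rearrangements.\<close>

lemma Rop_single:
  assumes "w (Suc p) < w p"
  shows "Rop p (single (sw p w) 1) = single w 1"
proof
  fix v
  have "sw p v = sw p w \<longleftrightarrow> v = w" by (metis sw_simps(4))
  moreover have "sw p w \<noteq> w" using assms by (metis less_irrefl sw_simps(1))
  ultimately show "Rop p (single (sw p w) 1) v = single w 1 v"
    using assms by (auto simp: Rop_def single_def)
qed

lemma Rop_laurent: "(\<And>w. f w \<in> laurent) \<Longrightarrow> Rop p f w \<in> laurent"
  by (auto simp: Rop_def intro!: laurent.C_mult laurent.C_add q_laurent)

subsection \<open>Tensor words\<close>

text \<open>The value 0 outside 1..r makes two words equal as functions once their letters agree,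
  and it is preserved by composition with permutations of the positions.\<close>

definition words :: "nat \<Rightarrow> nat \<Rightarrow> (nat \<Rightarrow> nat) set"
  where "words n r = {i. (\<forall>p\<in>{1..r}. i p \<in> {1..n}) \<and> (\<forall>p. p \<notin> {1..r} \<longrightarrow> i p = 0)}"

definition ct :: "nat \<Rightarrow> (nat \<Rightarrow> nat) \<Rightarrow> comp"
  where "ct r i = (\<lambda>a. card {p \<in> {1..r}. i p = a})"

definition mt :: "nat \<Rightarrow> (nat \<Rightarrow> nat) \<Rightarrow> (nat \<Rightarrow> nat) \<Rightarrow> mat"
  where "mt r i j = (\<lambda>a b. card {p \<in> {1..r}. i p = a \<and> j p = b})"

text \<open>The weakly increasing word of content \<open>\<mu>\<close>.\<close>

definition jw :: "nat \<Rightarrow> comp \<Rightarrow> nat \<Rightarrow> nat"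
  where "jw r \<mu> p = (if p \<in> {1..r} then LEAST a. p \<le> (\<Sum>k=1..a. \<mu> k) else 0)"

lemma words_in: "i \<in> words n r \<Longrightarrow> p \<in> {1..r} \<Longrightarrow> i p \<in> {1..n}"
  by (simp add: words_def)

lemma words_out: "i \<in> words n r \<Longrightarrow> p \<notin> {1..r} \<Longrightarrow> i p = 0"
  by (simp add: words_def)

lemma finite_words: "finite (words n r)"
  by (rule finite_subset [OF _ finite_set_of_finite_funs [of "{1..r}" "{1..n}" 0]])
    (auto simp: words_def)

lemma comp_words: "i \<in> words n r \<Longrightarrow> w permutes {1..r} \<Longrightarrow> i \<circ> w \<in> words n r"
  using permutes_in_image [of w "{1..r}"] by (auto simp: words_def)

lemma sw_words: "p \<in> {1..<r} \<Longrightarrow> sw p i \<in> words n r \<longleftrightarrow> i \<in> words n r"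
  using comp_words [OF _ transpose_permutes, of i n r p] comp_words [OF _ transpose_permutes, of "sw p i" n r p]
  by (metis sw_def sw_simps(4))

section \<open>Contents and types of words\<close>

lemma card_comp_permutes:
  assumes "w permutes S"
  shows "card {p \<in> S. P (w p)} = card {p \<in> S. P p}"
proof (rule bij_betw_same_card)
  show "bij_betw w {p \<in> S. P (w p)} {p \<in> S. P p}"
    unfolding bij_betw_def using permutes_inj [OF assms] permutes_in_image [OF assms]
      permutes_surj [OF assms]
    by (auto simp: inj_on_def image_iff inj_def) (metis surjD)
qed

lemma ct_comp: "w permutes {1..r} \<Longrightarrow> ct r (i \<circ> w) = ct r i"
  unfolding ct_def using card_comp_permutes [of w "{1..r}" "\<lambda>p. i p = _"] by (auto simp: fun_eq_iff)

lemma mt_comp: "w permutes {1..r} \<Longrightarrow> mt r (i \<circ> w) (j \<circ> w) = mt r i j"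
  unfolding mt_def using card_comp_permutes [of w "{1..r}" "\<lambda>p. i p = _ \<and> j p = _"] by (auto simp: fun_eq_iff)

lemma ct_sw: "p \<in> {1..<r} \<Longrightarrow> ct r (sw p i) = ct r i"
  unfolding sw_def by (rule ct_comp [OF transpose_permutes])

lemma mt_sw: "p \<in> {1..<r} \<Longrightarrow> mt r (sw p i) (sw p j) = mt r i j"
  unfolding sw_def by (rule mt_comp [OF transpose_permutes])

lemma sum_card_fibres:
  assumes "\<And>p. p \<in> {1..r} \<Longrightarrow> P p \<Longrightarrow> i p \<in> I" "finite I"
  shows "(\<Sum>a\<in>I. card {p \<in> {1..r::nat}. P p \<and> i p = a}) = card {p \<in> {1..r}. P p}"
proof -
  have "card {p \<in> {1..r}. P p} = card (\<Union>a\<in>I. {p \<in> {1..r}. P p \<and> i p = a})"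
    using assms by (intro arg_cong [of _ _ card]) auto
  also have "\<dots> = (\<Sum>a\<in>I. card {p \<in> {1..r}. P p \<and> i p = a})"
    by (rule card_UN_disjoint) (use assms in auto)
  finally show ?thesis by simp
qed

lemma ct_Lam: "i \<in> words n r \<Longrightarrow> ct r i \<in> Lam n r"
proof -
  assume i: "i \<in> words n r"
  have "(\<Sum>a=1..n. card {p \<in> {1..r}. True \<and> i p = a}) = card {p \<in> {1..r}. True}"
    by (rule sum_card_fibres) (use i words_in in auto)
  moreover have "{p \<in> {1..r}. True} = {1..r}" by auto
  moreover have "card {p \<in> {1..r}. i p = a} = 0" if "a \<notin> {1..n}" for a
    using words_in [OF i] that by (subst card_eq_0_iff) auto
  ultimately show ?thesis by (auto simp: Lam_def ct_def)
qed

lemma ro_mt: "j \<in> words n r \<Longrightarrow> ro n (mt r i j) = ct r i"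
  unfolding ro_def ct_def mt_def
  using sum_card_fibres [of r "\<lambda>p. i p = _" j "{1..n}"] words_in by (auto simp: fun_eq_iff)

lemma co_mt: "i \<in> words n r \<Longrightarrow> co n (mt r i j) = ct r j"
  unfolding co_def ct_def mt_def
  using sum_card_fibres [of r "\<lambda>p. j p = _" i "{1..n}"] words_in by (auto simp: fun_eq_iff conj_commute)

lemma mt_Theta: "i \<in> words n r \<Longrightarrow> j \<in> words n r \<Longrightarrow> mt r i j \<in> Theta n r"
proof -
  assume i: "i \<in> words n r" and j: "j \<in> words n r"
  have "card {p \<in> {1..r}. i p = a \<and> j p = b} = 0" if "a \<notin> {1..n} \<or> b \<notin> {1..n}" for a b
    using words_in [OF i] words_in [OF j] that by (subst card_eq_0_iff) auto
  moreover have "(\<Sum>a=1..n. \<Sum>b=1..n. mt r i j a b) = r"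
    using ro_mt [OF j, of i] ct_Lam [OF i] by (simp add: Lam_def ro_def fun_eq_iff)
  ultimately show ?thesis by (auto simp: Theta_def mt_def)
qed

lemma ro_Lam: "A \<in> Theta n r \<Longrightarrow> ro n A \<in> Lam n r"
  by (auto simp: Theta_def Lam_def ro_def)

lemma co_Lam: "A \<in> Theta n r \<Longrightarrow> co n A \<in> Lam n r"
  unfolding Theta_def Lam_def co_def by (simp, subst sum.swap) simp

lemma comp_sum_mono: "(a :: nat) \<le> b \<Longrightarrow> (\<Sum>k=1..a. \<mu> k) \<le> (\<Sum>k=1..b. \<mu> k :: nat)"
  by (rule sum_mono2) auto

text \<open>Letters of the sorted word and partial sums of \<mu> form a Galois connection.
  Monotonicity and the description by blocks both come from it.\<close>

lemma jw_le_iff: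
  assumes "\<mu> \<in> Lam n r" "p \<in> {1..r}"
  shows "jw r \<mu> p \<le> a \<longleftrightarrow> p \<le> (\<Sum>k=1..a. \<mu> k)"
proof
  have ex: "p \<le> (\<Sum>k=1..n. \<mu> k)" using assms by (auto simp: Lam_def)
  have "p \<le> (\<Sum>k=1..jw r \<mu> p. \<mu> k)"
    using LeastI [of "\<lambda>a. p \<le> (\<Sum>k=1..a. \<mu> k)", OF ex] assms by (simp add: jw_def)
  then show "p \<le> (\<Sum>k=1..a. \<mu> k)" if "jw r \<mu> p \<le> a"
    using comp_sum_mono [OF that, of \<mu>] by simp
  show "jw r \<mu> p \<le> a" if "p \<le> (\<Sum>k=1..a. \<mu> k)"
    using that assms by (simp add: jw_def Least_le)
qed

lemma jw_mono:
  assumes "\<mu> \<in> Lam n r" "1 \<le> a" "a \<le> b" "b \<le> r"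
  shows "jw r \<mu> a \<le> jw r \<mu> b"
  using assms jw_le_iff [OF assms(1), of a "jw r \<mu> b"] jw_le_iff [OF assms(1), of b "jw r \<mu> b"] by simp

lemma jw_words: "\<mu> \<in> Lam n r \<Longrightarrow> jw r \<mu> \<in> words n r"
proof -
  assume \<mu>: "\<mu> \<in> Lam n r"
  have "jw r \<mu> p \<in> {1..n}" if "p \<in> {1..r}" for p
    using jw_le_iff [OF \<mu> that, of n] jw_le_iff [OF \<mu> that, of 0] that \<mu> by (auto simp: Lam_def)
  then show ?thesis by (auto simp: words_def jw_def)
qed

lemma jw_block:
  assumes "\<mu> \<in> Lam n r" "p \<in> {1..r}" "1 \<le> a"
  shows "jw r \<mu> p = a \<longleftrightarrow> p \<in> block \<mu> a"
proof -
  have "{1..<a} = {1..a - 1}" using assms(3) by auto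
  then show ?thesis
    using jw_le_iff [OF assms(1,2), of a] jw_le_iff [OF assms(1,2), of "a - 1"] assms(3)
    by (auto simp: block_def)
qed

lemma block_subset:
  assumes "\<mu> \<in> Lam n r" "a \<in> {1..n}"
  shows "block \<mu> a \<subseteq> {1..r}"
  using comp_sum_mono [of a n \<mu>] assms by (auto simp: block_def Lam_def)

lemma card_block: "1 \<le> a \<Longrightarrow> card (block \<mu> a) = \<mu> a"
proof -
  assume "1 \<le> a"
  then have "{1..a} = insert a {1..<a}" by auto
  then show ?thesis by (simp add: block_def)
qed

lemma ct_jw: "\<mu> \<in> Lam n r \<Longrightarrow> ct r (jw r \<mu>) = \<mu>"
proof
  fix a assume \<mu>: "\<mu> \<in> Lam n r"
  show "ct r (jw r \<mu>) a = \<mu> a"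
  proof (cases "a \<in> {1..n}")
    case True
    then have "{p \<in> {1..r}. jw r \<mu> p = a} = block \<mu> a"
      using jw_block [OF \<mu>] block_subset [OF \<mu> True] by auto
    then show ?thesis using True by (simp add: ct_def card_block)
  next
    case False
    then show ?thesis using ct_Lam [OF jw_words [OF \<mu>]] \<mu> by (simp add: Lam_def)
  qed
qed

text \<open>In a weakly increasing word the letters \<le> a occupy an initial segment, whose length
  is a partial sum of the content; by \<open>jw_le_iff\<close> this property determines the
  letters.\<close>

lemma sorted_word_eq_jw:
  assumes i: "i \<in> words n r" and mono: "\<And>a b. 1 \<le> a \<Longrightarrow> a \<le> b \<Longrightarrow> b \<le> r \<Longrightarrow> i a \<le> i b"
  shows "i = jw r (ct r i)"
proof
  fix p
  show "i p = jw r (ct r i) p"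
  proof (cases "p \<in> {1..r}")
    case True
    have "i p \<le> a \<longleftrightarrow> p \<le> (\<Sum>k=1..a. ct r i k)" for a
    proof -
      let ?D = "{p \<in> {1..r}. i p \<le> a}"
      have "(\<Sum>k=1..a. card {p \<in> {1..r}. i p \<le> a \<and> i p = k}) = card ?D"
        by (rule sum_card_fibres) (use words_in [OF i] in auto)
      moreover have "(\<Sum>k=1..a. card {p \<in> {1..r}. i p \<le> a \<and> i p = k}) = (\<Sum>k=1..a. ct r i k)"
        unfolding ct_def by (intro sum.cong arg_cong [of _ _ card]) auto
      ultimately have D: "card ?D = (\<Sum>k=1..a. ct r i k)" by simp
      show ?thesis
      proof
        assume "i p \<le> a"
        then have "{1..p} \<subseteq> ?D" using mono True by (fastforce intro: order_trans)
        then have "card {1..p} \<le> card ?D" by (intro card_mono) auto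
        also note D
        finally show "p \<le> (\<Sum>k=1..a. ct r i k)" by simp
      next
        assume p: "p \<le> (\<Sum>k=1..a. ct r i k)"
        show "i p \<le> a"
        proof (rule ccontr)
          assume "\<not> i p \<le> a"
          then have "?D \<subseteq> {1..<p}"
            using mono [of p] True by (auto simp: not_le) (meson le_trans not_le)
          then have "card ?D \<le> card {1..<p}" by (intro card_mono) auto
          then show False using p True D by auto
        qed
      qed
    qed
    then show ?thesis
      using jw_le_iff [OF ct_Lam [OF i] True] by (metis order_antisym order_refl)
  next
    case False
    then show ?thesis using words_out [OF i False] unfolding jw_def by auto
  qed
qed

lemma words_induct [consumes 1, case_names sorted step]:
  assumes "i \<in> words n r"
    and sorted: "\<And>\<mu>. \<mu> \<in> Lam n r \<Longrightarrow> P (jw r \<mu>)"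
    and step: "\<And>i p. i \<in> words n r \<Longrightarrow> sw p i \<in> words n r \<Longrightarrow> p \<in> {1..<r} \<Longrightarrow> i (Suc p) < i p \<Longrightarrow>
      P (sw p i) \<Longrightarrow> P i"
  shows "P i"
proof (rule word_induct [where Q = "\<lambda>i. i \<in> words n r" and w = i and r = r and P = P])
  fix i assume i: "i \<in> words n r" and mono: "\<And>a b. 1 \<le> a \<Longrightarrow> a \<le> b \<Longrightarrow> b \<le> r \<Longrightarrow> i a \<le> i b"
  have "i = jw r (ct r i)" by (rule sorted_word_eq_jw [OF i mono])
  then show "P i" by (rule ssubst) (rule sorted [OF ct_Lam [OF i]])
next
  show closed: "sw p i \<in> words n r" if "i \<in> words n r" "p \<in> {1..<r}" for i p
    using that sw_words by blast
  show "P i" if "i \<in> words n r" "p \<in> {1..<r}" "i (Suc p) < i p" "P (sw p i)" for i p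
    by (rule step [OF that(1) closed [OF that(1,2)] that(2-4)])
qed (rule assms(1))

lemma word_permutation:
  assumes "i \<in> words n r"
  shows "\<exists>w. w permutes {1..r} \<and> i = jw r (ct r i) \<circ> w"
  using assms
proof (induction rule: words_induct)
  case (sorted \<mu>)
  then show ?case using permutes_id by (metis comp_id ct_jw)
next
  case (step i p)
  obtain w where "w permutes {1..r}" "sw p i = jw r (ct r i) \<circ> w"
    using step(5) unfolding ct_sw [OF step(3)] by blast
  then have "sw p w permutes {1..r} \<and> i = jw r (ct r i) \<circ> sw p w"
    using step(3) by (metis sw_comp sw_permutes sw_simps(4))
  then show ?case by blast
qed

text \<open>Each pair (a, b) is listed with multiplicity A a b, the third component of
  \<open>S\<close> keeping the copies apart. An enumeration of \<open>S\<close> by 1..r is then a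
  pair of words.\<close>

lemma exists_words_of_type:
  assumes A: "A \<in> Theta n r"
  obtains i j where "i \<in> words n r" "j \<in> words n r" "mt r i j = A"
proof -
  define S where "S = (SIGMA a:{1..n}. SIGMA b:{1..n}. {..<A a b})"
  have S: "finite S" "card S = r"
    using A by (simp_all add: S_def card_SigmaI Theta_def)
  from ex_bij_betw_nat_finite_1 [OF S(1)] S(2) obtain h where h: "bij_betw h {1..r} S" by auto
  define i j where "i = (\<lambda>p. if p \<in> {1..r} then fst (h p) else 0)"
    and "j = (\<lambda>p. if p \<in> {1..r} then fst (snd (h p)) else 0)"
  have hS: "h p \<in> S" if "p \<in> {1..r}" for p using bij_betwE [OF h] that by blast
  have "fst (h p) \<in> {1..n}" "fst (snd (h p)) \<in> {1..n}" if "p \<in> {1..r}" for p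
    using hS [OF that] by (auto simp: S_def)
  then have words: "i \<in> words n r" "j \<in> words n r"
    by (simp_all add: words_def i_def j_def)
  moreover have "mt r i j = A"
  proof (intro ext)
    fix a b
    have "bij_betw h {p \<in> {1..r}. i p = a \<and> j p = b} {x \<in> S. fst x = a \<and> fst (snd x) = b}"
      by (rule bij_betw_Collect [OF h]) (simp add: i_def j_def)
    then have "mt r i j a b = card {x \<in> S. fst x = a \<and> fst (snd x) = b}"
      by (simp add: mt_def bij_betw_same_card)
    also have "{x \<in> S. fst x = a \<and> fst (snd x) = b} =
        (if a \<in> {1..n} \<and> b \<in> {1..n} then (\<lambda>k. (a, b, k)) ` {..<A a b} else {})"
      by (auto simp: S_def)
    also have "card \<dots> = A a b"
      using A by (auto simp: card_image inj_on_def Theta_def)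
    finally show "mt r i j a b = A a b" .
  qed
  ultimately show ?thesis using that by blast
qed

text \<open>A pair of words of type A is rearranged by one permutation until the second word is
  sorted; simultaneous rearrangement keeps the type.\<close>

lemma column_word:
  assumes A: "A \<in> Theta n r"
  shows "\<exists>i\<in>words n r. mt r i (jw r (co n A)) = A"
proof -
  obtain i j where ij: "i \<in> words n r" "j \<in> words n r" "mt r i j = A"
    using exists_words_of_type [OF A] .
  have "ct r j = co n A" using co_mt [OF ij(1), of j] ij(3) by simp
  with word_permutation [OF ij(2)] obtain w where w: "w permutes {1..r}" "j = jw r (co n A) \<circ> w" by auto
  have "mt r (i \<circ> inv_into UNIV w) (j \<circ> inv_into UNIV w) = A"
    using mt_comp [OF permutes_inv [OF w(1)]] ij(3) by simp
  moreover have "j \<circ> inv_into UNIV w = jw r (co n A)"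
    using w by (simp add: comp_assoc permutes_inv_o)
  ultimately show ?thesis using comp_words [OF ij(1) permutes_inv [OF w(1)]] by auto
qed

lemma mt_swap: "mt r j i a b = mt r i j b a"
  by (simp add: mt_def conj_commute)

lemma row_word:
  assumes A: "A \<in> Theta n r"
  shows "\<exists>i\<in>words n r. mt r (jw r (ro n A)) i = A"
proof -
  have "mat_transpose A \<in> Theta n r"
    using A sum.swap [of "\<lambda>i j. A i j" "{1..n}" "{1..n}"] by (auto simp: Theta_def mat_transpose_def)
  from column_word [OF this] obtain i where "i \<in> words n r"
    "mt r i (jw r (co n (mat_transpose A))) = mat_transpose A" by blast
  moreover have "co n (mat_transpose A) = ro n A" by (simp add: co_def ro_def mat_transpose_def)
  moreover have "mt r j i = A" if "mt r i j = mat_transpose A" for i j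
    by (intro ext) (simp add: mt_swap [of r j] that, simp add: mat_transpose_def)
  ultimately show ?thesis by auto
qed

text \<open>The two lists of letter pairs agree as multisets, so a permutation of the positions
  carries one to the other; the common second component forces it to stabilise j. For sorted j it
  thus lies in a Young subgroup.\<close>

lemma same_type_permutation:
  assumes "mt r i j = mt r i' j" "i \<in> words n r" "i' \<in> words n r" "j \<in> words n r"
  shows "\<exists>w. w permutes {1..r} \<and> i = i' \<circ> w \<and> j = j \<circ> w"
proof -
  have count: "count (image_mset f (mset_set B)) x = card {p \<in> B. f p = x}" if "finite B"
    for B :: "nat set" and f :: "nat \<Rightarrow> nat \<times> nat" and x
    using that
  proof (induction B rule: finite_induct)
    case (insert a B)
    have "{p \<in> insert a B. f p = x} =
        (if f a = x then insert a {p \<in> B. f p = x} else {p \<in> B. f p = x})" by auto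
    then show ?case using insert by simp
  qed simp
  have "image_mset (\<lambda>p. (i p, j p)) (mset_set {1..r}) = image_mset (\<lambda>p. (i' p, j p)) (mset_set {1..r})"
  proof (rule multiset_eqI)
    fix x
    show "count (image_mset (\<lambda>p. (i p, j p)) (mset_set {1..r})) x =
        count (image_mset (\<lambda>p. (i' p, j p)) (mset_set {1..r})) x"
      using assms(1) by (cases x) (simp add: count mt_def fun_eq_iff)
  qed
  from image_mset_eq_implies_permutes [OF _ this] obtain w where
    w: "w permutes {1..r}" "\<forall>p\<in>{1..r}. (i p, j p) = (i' (w p), j (w p))" by auto
  have "i p = i' (w p) \<and> j p = j (w p)" for p
    using w permutes_not_in [OF w(1), of p] words_out [OF assms(2), of p] words_out [OF assms(3), of p]
    by (cases "p \<in> {1..r}") auto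
  then show ?thesis using w(1) by (auto simp: fun_eq_iff)
qed

text \<open>Preserving the blocks means preserving the letter that each position carries. As the
  stabiliser of a word, the Young subgroup can be handled by identities between words.\<close>

lemma young_iff:
  assumes \<mu>: "\<mu> \<in> Lam n r"
  shows "w \<in> young n r \<mu> \<longleftrightarrow> w permutes {1..r} \<and> jw r \<mu> \<circ> w = jw r \<mu>"
proof -
  have "(\<forall>i\<in>{1..n}. w ` block \<mu> i = block \<mu> i) \<longleftrightarrow> jw r \<mu> \<circ> w = jw r \<mu>" if w: "w permutes {1..r}"
  proof
    assume *: "\<forall>i\<in>{1..n}. w ` block \<mu> i = block \<mu> i"
    show "jw r \<mu> \<circ> w = jw r \<mu>"
    proof
      fix p
      show "(jw r \<mu> \<circ> w) p = jw r \<mu> p"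
      proof (cases "p \<in> {1..r}")
        case True
        have a: "jw r \<mu> p \<in> {1..n}" using words_in [OF jw_words [OF \<mu>] True] .
        then have "p \<in> block \<mu> (jw r \<mu> p)" using jw_block [OF \<mu> True, of "jw r \<mu> p"] by simp
        then have "w p \<in> block \<mu> (jw r \<mu> p)" using * a by blast
        then show ?thesis using jw_block [OF \<mu>] block_subset [OF \<mu> a] a by auto
      qed (use permutes_not_in [OF w] in auto)
    qed
  next
    assume *: "jw r \<mu> \<circ> w = jw r \<mu>"
    show "\<forall>i\<in>{1..n}. w ` block \<mu> i = block \<mu> i"
    proof
      fix a assume a: "a \<in> {1..n}"
      have "w p \<in> block \<mu> a" if "p \<in> block \<mu> a" for p
      proof -
        have p: "p \<in> {1..r}" "w p \<in> {1..r}"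
          using that block_subset [OF \<mu> a] permutes_in_image [OF w] by auto
        then show ?thesis
          using that * jw_block [OF \<mu> p(1)] jw_block [OF \<mu> p(2)] a by (metis atLeastAtMost_iff comp_apply)
      qed
      then have "w ` block \<mu> a \<subseteq> block \<mu> a" by auto
      moreover have "card (w ` block \<mu> a) = card (block \<mu> a)"
        by (rule card_image) (use permutes_inj [OF w] in \<open>auto simp: inj_on_def inj_def\<close>)
      ultimately show "w ` block \<mu> a = block \<mu> a"
        by (intro card_subset_eq) (auto simp: block_def)
    qed
  qed
  then show ?thesis by (auto simp: young_def)
qed

section \<open>The Hecke algebra\<close>

subsection \<open>Reduced words\<close>

lemma word_perm_append: "word_perm (u @ v) = word_perm u \<circ> word_perm v"
proof -
  have "foldr (\<lambda>i w. transpose i (i + 1) \<circ> w) u w = word_perm u \<circ> w" for w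
    by (induction u) (auto simp: word_perm_def comp_assoc)
  then show ?thesis by (simp add: word_perm_def)
qed

lemma word_perm_snoc: "word_perm (u @ [p]) = sw p (word_perm u)"
  unfolding word_perm_append by (simp add: word_perm_def sw_def)

lemma word_perm_Nil [simp]: "word_perm [] = id"
  by (simp add: word_perm_def)

lemma word_perm_permutes: "u \<in> lists {1..<r} \<Longrightarrow> word_perm u permutes {1..r}"
  by (induction u rule: rev_induct) (simp_all add: permutes_id word_perm_snoc sw_permutes del: One_nat_def)

text \<open>Minimality is expressed through the number of inversions, which makes induction on
  inversions available; \<open>reduced_word_is_reduced\<close> shows that the chosen shortest words
  qualify.\<close>

definition is_reduced :: "nat \<Rightarrow> nat list \<Rightarrow> (nat \<Rightarrow> nat) \<Rightarrow> bool"
  where "is_reduced r u w \<longleftrightarrow> u \<in> lists {1..<r} \<and> word_perm u = w \<and> length u = ninv r w"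

lemma permutes_adjacent_neq:
  fixes w :: "nat \<Rightarrow> nat"
  assumes "w permutes S"
  shows "w p \<noteq> w (Suc p)"
  using permutes_inj [OF assms] by (metis inj_eq n_not_Suc_n)

text \<open>Appending a letter changes the number of inversions by one, up or down.\<close>

lemma ninv_word_perm_le: "u \<in> lists {1..<r} \<Longrightarrow> ninv r (word_perm u) \<le> length u"
proof (induction u rule: rev_induct)
  case (snoc p u)
  let ?w = "word_perm u"
  have p: "p \<in> {1..<r}" and u: "u \<in> lists {1..<r}" using snoc.prems by auto
  have "ninv r (sw p ?w) \<le> Suc (ninv r ?w)"
    using ninv_sw [OF p, of ?w] ninv_sw_desc [OF p, of ?w]
      permutes_adjacent_neq [OF word_perm_permutes [OF u], of p]
    by (cases "?w p < ?w (Suc p)") auto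
  then show ?case using snoc.IH [OF u] by (simp add: word_perm_snoc)
qed (simp add: ninv_id [unfolded id_def] ninv_id)

lemma exists_reduced:
  assumes "w permutes {1..r}"
  shows "\<exists>u. is_reduced r u w"
  using assms
proof (induction rule: permutation_induct)
  case id
  have "is_reduced r [] id" by (simp add: is_reduced_def ninv_id)
  then show ?case ..
next
  case (step w p)
  then obtain u where "is_reduced r u (sw p w)" by blast
  then have "is_reduced r (u @ [p]) w"
    using step ninv_sw_desc [OF step(2,3)] by (simp add: is_reduced_def word_perm_snoc)
  then show ?case ..
qed

text \<open>Some word attains the lower bound given by the inversions, so every word of minimal
  length attains it.\<close>

lemma reduced_word_is_reduced:
  assumes "w permutes {1..r}"
  shows "is_reduced r (reduced_word r w) w"
proof -
  let ?P = "\<lambda>u. u \<in> lists {1..<r} \<and> word_perm u = w"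
  obtain u where u: "is_reduced r u w" using exists_reduced [OF assms] ..
  then have "?P u" by (simp add: is_reduced_def)
  have main: "?P (reduced_word r w) \<and> (\<forall>v. ?P v \<longrightarrow> length (reduced_word r w) \<le> length v)"
    unfolding reduced_word_def
    by (rule arg_min_nat_lemma [where P = ?P and k = u and m = length]) (rule \<open>?P u\<close>)
  have *: "?P (reduced_word r w)" by (rule conjunct1 [OF main])
  have len: "length (reduced_word r w) \<le> length u"
    by (rule mp [OF spec [OF conjunct2 [OF main]]]) (rule \<open>?P u\<close>)
  have "ninv r (word_perm (reduced_word r w)) \<le> length (reduced_word r w)"
    by (rule ninv_word_perm_le [OF conjunct1 [OF *]])
  then show ?thesis using conjunct1 [OF *] conjunct2 [OF *] len u
    unfolding is_reduced_def by (metis order_antisym)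
qed

text \<open>Were the last letter not a descent, the remaining word would be shorter than the number
  of inversions of the permutation it represents.\<close>

lemma is_reduced_snoc:
  assumes "is_reduced r (u @ [p]) w"
  shows "p \<in> {1..<r} \<and> w (Suc p) < w p \<and> is_reduced r u (sw p w)"
proof -
  have u: "u \<in> lists {1..<r}" and p: "p \<in> {1..<r}" and w: "w = sw p (word_perm u)"
    and len: "Suc (length u) = ninv r w"
    using assms by (auto simp: is_reduced_def word_perm_snoc)
  have le: "ninv r (sw p w) \<le> length u" using ninv_word_perm_le [OF u] by (simp add: w)
  have "w (Suc p) \<noteq> w p"
    using permutes_adjacent_neq [OF word_perm_permutes [OF u], of p] by (simp add: w)
  moreover have "\<not> w p < w (Suc p)" using ninv_sw [OF p, of w] le len by auto
  ultimately have "w (Suc p) < w p" by simp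
  then show ?thesis using ninv_sw_desc [OF p, of w] u p len by (simp add: is_reduced_def w)
qed

lemma is_reduced_append:
  assumes "is_reduced r u (sw p w)" "p \<in> {1..<r}" "w (Suc p) < w p"
  shows "is_reduced r (u @ [p]) w"
  using assms ninv_sw_desc [OF assms(2,3)] by (simp add: is_reduced_def word_perm_snoc)

subsection \<open>The presentation and the right action\<close>

lemma word_monoid_simps [simp]:
  "carrier (word_monoid r) = lists {1..<r}" "u \<otimes>\<^bsub>word_monoid r\<^esub> v = u @ v" "\<one>\<^bsub>word_monoid r\<^esub> = []"
  by (simp_all add: word_monoid_def)

interpretation hf: monoid_ring laurent "word_monoid r" for r
  by (intro monoid_ring.intro laurent.coeff_subring_axioms monoidI) auto

lemma hecke_free_ring: "ring (hecke_free r)"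
  unfolding hecke_free_def by (rule hf.monoid_algebra_ring)

lemma single_hecke_free: "u \<in> lists {1..<r} \<Longrightarrow> x \<in> laurent \<Longrightarrow> single u x \<in> carrier (hecke_free r)"
  unfolding hecke_free_def by (rule hf.single_carrier) auto

lemma hecke_free_plus: "a \<oplus>\<^bsub>hecke_free r\<^esub> b = (\<lambda>u. a u + b u)"
  unfolding hecke_free_def by (rule hf.add_eq)

lemma hecke_free_minus:
  "a \<in> carrier (hecke_free r) \<Longrightarrow> b \<in> carrier (hecke_free r) \<Longrightarrow> a \<ominus>\<^bsub>hecke_free r\<^esub> b = (\<lambda>u. a u - b u)"
  unfolding hecke_free_def by (rule hf.minus_eq)

lemma hecke_free_single_mult:
  "u \<in> lists {1..<r} \<Longrightarrow> v \<in> lists {1..<r} \<Longrightarrow> x \<in> laurent \<Longrightarrow> y \<in> laurent \<Longrightarrow>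
    single u x \<otimes>\<^bsub>hecke_free r\<^esub> single v y = single (u @ v) (x * y)"
  unfolding hecke_free_def using hf.single_mult [of u r v x y] by simp

lemma hecke_relations_carrier: "hecke_relations r \<subseteq> carrier (hecke_free r)"
proof -
  interpret F: ring "hecke_free r" by (rule hecke_free_ring)
  have s: "single u x \<in> carrier (hecke_free r)" if "set u \<subseteq> {1..<r}" "x \<in> laurent" for u x
    using that by (intro single_hecke_free) auto
  show ?thesis
    unfolding hecke_relations_def Let_def
    by (intro Un_least subsetI; elim CollectE exE conjE; clarify; intro F.minus_closed F.add.m_closed s) auto
qed

lemma hecke_ideal_ideal: "ideal (hecke_ideal r) (hecke_free r)"
  unfolding hecke_ideal_def by (rule ring.genideal_ideal [OF hecke_free_ring hecke_relations_carrier])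

lemma hecke_ring: "ring (hecke r)"
  unfolding hecke_def by (rule ideal.quotient_is_ring [OF hecke_ideal_ideal])

definition hecke_class :: "nat \<Rightarrow> (nat list \<Rightarrow> K) \<Rightarrow> hecke_elem"
  where "hecke_class r a = hecke_ideal r +>\<^bsub>hecke_free r\<^esub> a"

lemma hecke_class_hom: "hecke_class r \<in> ring_hom (hecke_free r) (hecke r)"
  unfolding hecke_class_def [abs_def] hecke_def by (rule ideal.rcos_ring_hom [OF hecke_ideal_ideal])

lemma hecke_class_closed: "a \<in> carrier (hecke_free r) \<Longrightarrow> hecke_class r a \<in> carrier (hecke r)"
  using hecke_class_hom by (rule ring_hom_closed)

lemma hecke_class_mult: "a \<in> carrier (hecke_free r) \<Longrightarrow> b \<in> carrier (hecke_free r) \<Longrightarrow>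
    hecke_class r (a \<otimes>\<^bsub>hecke_free r\<^esub> b) = hecke_class r a \<otimes>\<^bsub>hecke r\<^esub> hecke_class r b"
  using hecke_class_hom by (rule ring_hom_mult)

lemma hecke_class_add: "a \<in> carrier (hecke_free r) \<Longrightarrow> b \<in> carrier (hecke_free r) \<Longrightarrow>
    hecke_class r (\<lambda>u. a u + b u) = hecke_class r a \<oplus>\<^bsub>hecke r\<^esub> hecke_class r b"
  using ring_hom_add [OF hecke_class_hom, of a r b] by (simp add: hecke_free_plus)

lemma hecke_class_one: "hecke_class r (single [] 1) = \<one>\<^bsub>hecke r\<^esub>"
  using ring_hom_one [OF hecke_class_hom, of r] by (simp add: hecke_free_def hf.one_eq)

lemma hecke_class_zero: "hecke_class r (\<lambda>u. 0) = \<zero>\<^bsub>hecke r\<^esub>"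
  using ring_hom_zero [OF hecke_class_hom hecke_free_ring hecke_ring, of r] by (simp add: hecke_free_def hf.zero_eq)

lemma hecke_carrier: "carrier (hecke r) = hecke_class r ` carrier (hecke_free r)"
  unfolding hecke_class_def [abs_def] hecke_def by (auto simp: FactRing_def A_RCOSETS_def' a_r_coset_def)

lemma hecke_class_relation:
  assumes "a \<ominus>\<^bsub>hecke_free r\<^esub> b \<in> hecke_relations r" "a \<in> carrier (hecke_free r)" "b \<in> carrier (hecke_free r)"
  shows "hecke_class r a = hecke_class r b"
proof -
  interpret F: ring "hecke_free r" by (rule hecke_free_ring)
  have "a \<ominus>\<^bsub>hecke_free r\<^esub> b \<in> hecke_ideal r"
    using assms(1) F.genideal_self [OF hecke_relations_carrier] unfolding hecke_ideal_def by blast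
  then show ?thesis
    using F.quotient_eq_iff_same_a_r_cos [OF hecke_ideal_ideal assms(2,3)] by (simp add: hecke_class_def)
qed

text \<open>The letters are applied from left to right, so the first factor of a product acts first:
  this is a right action written with operators on the left.\<close>

definition ract :: "(nat list \<Rightarrow> K) \<Rightarrow> ((nat \<Rightarrow> nat) \<Rightarrow> K) \<Rightarrow> (nat \<Rightarrow> nat) \<Rightarrow> K"
  where "ract a f = (\<lambda>w. lin (\<lambda>x. x) (\<lambda>u. fold Rop u f w) a)"

lemma fold_Rop_lin: "fold Rop v (\<lambda>w. lin (\<lambda>x. x) (\<lambda>u. g u w) a) = (\<lambda>w. lin (\<lambda>x. x) (\<lambda>u. fold Rop v (g u) w) a)"
  by (induction v arbitrary: g) (simp_all add: lin_def Rop_sum Rop_scale)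

lemma fold_Rop_zero: "fold Rop v (\<lambda>w. 0) = (\<lambda>w. 0)"
  using fold_Rop_lin [of v "\<lambda>u w. 0" "\<lambda>u :: nat. 0"] by (simp add: lin_def)

lemma ract_mult:
  assumes "a \<in> carrier (hecke_free r)" "b \<in> carrier (hecke_free r)"
  shows "ract (a \<otimes>\<^bsub>hecke_free r\<^esub> b) f = ract b (ract a f)"
proof
  fix w
  have "ract (a \<otimes>\<^bsub>hecke_free r\<^esub> b) f w =
      lin (\<lambda>x. x) (\<lambda>u. lin (\<lambda>x. x) (\<lambda>v. fold Rop v (fold Rop u f) w) b) a"
    using assms unfolding ract_def hecke_free_def by (simp add: lin_id_mult)
  also have "\<dots> = lin (\<lambda>x. x) (\<lambda>v. lin (\<lambda>x. x) (\<lambda>u. fold Rop v (fold Rop u f) w) a) b"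
    unfolding lin_def sum_distrib_left by (subst sum.swap) (simp add: mult.left_commute)
  also have "\<dots> = ract b (ract a f) w" by (simp add: ract_def fold_Rop_lin)
  finally show "ract (a \<otimes>\<^bsub>hecke_free r\<^esub> b) f w = ract b (ract a f) w" .
qed

lemma ract_add:
  assumes "a \<in> carrier (hecke_free r)" "b \<in> carrier (hecke_free r)"
  shows "ract (\<lambda>u. a u + b u) f = (\<lambda>w. ract a f w + ract b f w)"
  using assms unfolding ract_def hecke_free_def by (simp add: lin_id_plus hf.carrier_finite)

lemma ract_single: "ract (single u x) f = (\<lambda>w. x * fold Rop u f w)"
  by (simp add: ract_def lin_id_single)

lemma ract_zero: "ract a (\<lambda>w. 0) = (\<lambda>w. 0)" "ract (\<lambda>u. 0) f = (\<lambda>w. 0)"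
  by (simp_all add: ract_def fold_Rop_zero lin_def)

lemma ract_uminus: "ract (\<lambda>u. - a u) f = (\<lambda>w. - ract a f w)"
  by (simp add: ract_def lin_def sum_negf)

lemma ract_relation:
  assumes "s \<in> hecke_relations r"
  shows "ract s f = (\<lambda>w. 0)"
proof -
  have s: "single u x \<in> carrier (hecke_free r)" if "set u \<subseteq> {1..<r}" "x \<in> laurent" for u x
    using that by (intro single_hecke_free) auto
  interpret F: ring "hecke_free r" by (rule hecke_free_ring)
  have minus: "ract (a \<ominus>\<^bsub>hecke_free r\<^esub> b) f = (\<lambda>w. ract a f w - ract b f w)"
    if "a \<in> carrier (hecke_free r)" "b \<in> carrier (hecke_free r)" for a b
    using ract_add [of a r "\<lambda>u. - b u" f] that hf.uminus_carrier [of b r]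
    by (simp add: hecke_free_minus ract_uminus) (simp add: hecke_free_def)
  from assms consider
    (quad) i where "s = single [i, i] 1 \<ominus>\<^bsub>hecke_free r\<^esub> (single [i] (q - 1) \<oplus>\<^bsub>hecke_free r\<^esub> single [] q)"
      "1 \<le> i" "i < r"
    | (braid) i where "s = single [i, i + 1, i] 1 \<ominus>\<^bsub>hecke_free r\<^esub> single [i + 1, i, i + 1] 1" "1 \<le> i" "i + 1 < r"
    | (comm) i j where "s = single [i, j] 1 \<ominus>\<^bsub>hecke_free r\<^esub> single [j, i] 1" "1 \<le> i" "i < r" "1 \<le> j" "j < r"
      "\<bar>int i - int j\<bar> > 1"
    unfolding hecke_relations_def Let_def by auto
  then show ?thesis
  proof cases
    case quad
    then have c: "single [i, i] 1 \<in> carrier (hecke_free r)" "single [i] (q - 1) \<in> carrier (hecke_free r)"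
      "single [] q \<in> carrier (hecke_free r)"
      by (auto intro!: s)
    show ?thesis
      unfolding quad(1) minus [OF c(1) F.add.m_closed [OF c(2,3)]]
      unfolding hecke_free_plus ract_add [OF c(2,3)]
      by (simp add: ract_single Rop_quadratic)
  next
    case braid
    then have c: "single [i, i + 1, i] 1 \<in> carrier (hecke_free r)" "single [i + 1, i, i + 1] 1 \<in> carrier (hecke_free r)"
      by (auto intro!: s)
    show ?thesis
      unfolding braid(1) minus [OF c] by (simp add: ract_single Rop_braid)
  next
    case comm
    then have c: "single [i, j] 1 \<in> carrier (hecke_free r)" "single [j, i] 1 \<in> carrier (hecke_free r)"
      by (auto intro!: s)
    have "Rop j (Rop i f) = Rop i (Rop j f)"
    proof (cases "i < j")
      case True
      then show ?thesis using comm(6) Rop_commute [of i j f] by simp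
    next
      case False
      then show ?thesis using comm(6) Rop_commute [of j i f] by simp
    qed
    then show ?thesis
      unfolding comm(1) minus [OF c] by (simp add: ract_single)
  qed
qed

text \<open>A representative is chosen arbitrarily; \<open>hact_hecke_class\<close> shows that the
  operator depends on the class only.\<close>

definition hact :: "nat \<Rightarrow> hecke_elem \<Rightarrow> ((nat \<Rightarrow> nat) \<Rightarrow> K) \<Rightarrow> (nat \<Rightarrow> nat) \<Rightarrow> K"
  where "hact r h = ract (SOME a. a \<in> carrier (hecke_free r) \<and> hecke_class r a = h)"

lemma hact_hecke_class:
  assumes a: "a \<in> carrier (hecke_free r)"
  shows "hact r (hecke_class r a) = ract a"
proof -
  interpret F: ring "hecke_free r" by (rule hecke_free_ring)
  let ?b = "SOME b. b \<in> carrier (hecke_free r) \<and> hecke_class r b = hecke_class r a"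
  have b: "?b \<in> carrier (hecke_free r)" "hecke_class r ?b = hecke_class r a"
    using someI [of "\<lambda>b. b \<in> carrier (hecke_free r) \<and> hecke_class r b = hecke_class r a" a] a by auto
  \<comment> \<open>Operators form an abelian group under pointwise addition, and products act by
    composition; hence an element acting as zero still does so after multiplication on either
    side.\<close>
  have "ract ?b = ract a"
  proof (rule F.quotient_lift [OF hecke_relations_carrier, of ract])
    fix a b assume ab: "a \<in> carrier (hecke_free r)" "b \<in> carrier (hecke_free r)"
    then show "ract (a \<oplus>\<^bsub>hecke_free r\<^esub> b) = ract a + ract b"
      by (intro ext) (simp add: hecke_free_plus ract_add)
    assume "ract a = 0"
    then have "ract a f = (\<lambda>w. 0)" for f by (simp add: zero_fun_def)
    then show "ract (a \<otimes>\<^bsub>hecke_free r\<^esub> b) = 0 \<and> ract (b \<otimes>\<^bsub>hecke_free r\<^esub> a) = 0"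
      using ab by (intro conjI ext) (simp_all add: ract_mult ract_zero)
  next
    fix s assume "s \<in> hecke_relations r"
    then show "ract s = 0" using ract_relation by (auto simp: fun_eq_iff)
  qed (use a b in \<open>auto simp: hecke_class_def hecke_ideal_def\<close>)
  then show ?thesis by (simp add: hact_def)
qed

lemma hact_add:
  assumes "h \<in> carrier (hecke r)" "h' \<in> carrier (hecke r)"
  shows "hact r (h \<oplus>\<^bsub>hecke r\<^esub> h') f = (\<lambda>w. hact r h f w + hact r h' f w)"
proof -
  from assms obtain a b where ab: "a \<in> carrier (hecke_free r)" "b \<in> carrier (hecke_free r)" "h = hecke_class r a" "h' = hecke_class r b"
    by (auto simp: hecke_carrier)
  then have "(\<lambda>u. a u + b u) \<in> carrier (hecke_free r)" unfolding hecke_free_def by (simp add: hf.plus_carrier)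
  then show ?thesis using ab by (simp add: hact_hecke_class ract_add flip: hecke_class_add)
qed

lemma hact_mult:
  assumes "h \<in> carrier (hecke r)" "h' \<in> carrier (hecke r)"
  shows "hact r (h \<otimes>\<^bsub>hecke r\<^esub> h') f = hact r h' (hact r h f)"
proof -
  interpret F: ring "hecke_free r" by (rule hecke_free_ring)
  from assms obtain a b where ab: "a \<in> carrier (hecke_free r)" "b \<in> carrier (hecke_free r)" "h = hecke_class r a" "h' = hecke_class r b"
    by (auto simp: hecke_carrier)
  then show ?thesis by (simp add: hact_hecke_class ract_mult flip: hecke_class_mult)
qed

lemma hact_word: "u \<in> lists {1..<r} \<Longrightarrow> x \<in> laurent \<Longrightarrow> hact r (hecke_class r (single u x)) f = (\<lambda>w. x * fold Rop u f w)"
  by (simp add: hact_hecke_class single_hecke_free ract_single)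

lemma hact_zero: "hact r \<zero>\<^bsub>hecke r\<^esub> f = (\<lambda>w. 0)"
proof -
  have "(\<lambda>u. 0) \<in> carrier (hecke_free r)" unfolding hecke_free_def by (rule hf.carrierI) auto
  then show ?thesis by (simp add: hact_hecke_class ract_zero flip: hecke_class_zero)
qed

lemma hecke_scalar_hecke_class: "hecke_scalar r x = hecke_class r (single [] x)"
  by (simp add: hecke_scalar_def hecke_class_def)

lemma hecke_scalar_closed: "x \<in> laurent \<Longrightarrow> hecke_scalar r x \<in> carrier (hecke r)"
  unfolding hecke_scalar_hecke_class by (intro hecke_class_closed single_hecke_free) auto

lemma hact_scalar: "x \<in> laurent \<Longrightarrow> hact r (hecke_scalar r x) f = (\<lambda>w. x * f w)"
  unfolding hecke_scalar_hecke_class by (subst hact_word) auto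

lemma hecke_gen_closed: "p \<in> {1..<r} \<Longrightarrow> hecke_gen r p \<in> carrier (hecke r)"
  unfolding hecke_gen_def hecke_class_def [symmetric] by (intro hecke_class_closed single_hecke_free) auto

lemma hact_gen: "p \<in> {1..<r} \<Longrightarrow> hact r (hecke_gen r p) f = Rop p f"
  unfolding hecke_gen_def hecke_class_def [symmetric] by (subst hact_word) auto

lemma hecke_induct [consumes 1, case_names zero add]:
  assumes h: "h \<in> carrier (hecke r)"
    and zero: "P \<zero>\<^bsub>hecke r\<^esub>"
    and add: "\<And>u x h. u \<in> lists {1..<r} \<Longrightarrow> x \<in> laurent \<Longrightarrow> h \<in> carrier (hecke r) \<Longrightarrow> P h \<Longrightarrow>
      P (hecke_class r (single u x) \<oplus>\<^bsub>hecke r\<^esub> h)"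
  shows "P h"
proof -
  obtain a where a: "a \<in> carrier (hf.MA r)" "h = hecke_class r a"
    using h by (auto simp: hecke_carrier hecke_free_def)
  from a(1) have "P (hecke_class r a)"
  proof (induction rule: hf.carrier_induct)
    case (add u x f)
    have "single u x \<in> carrier (hecke_free r)" by (rule single_hecke_free) (use add in auto)
    moreover have "f \<in> carrier (hecke_free r)" using add by (simp add: hecke_free_def)
    ultimately show ?case using add assms(3) [of u x "hecke_class r f"] by (simp add: hecke_class_add hecke_class_closed)
  qed (simp add: hecke_class_zero zero)
  then show ?thesis by (simp add: a)
qed

subsection \<open>Matsumoto's theorem and the standard basis\<close>

definition T_word :: "nat \<Rightarrow> nat list \<Rightarrow> hecke_elem"
  where "T_word r u = hecke_class r (single u 1)"

lemma T_word_closed: "u \<in> lists {1..<r} \<Longrightarrow> T_word r u \<in> carrier (hecke r)"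
  unfolding T_word_def by (intro hecke_class_closed single_hecke_free) auto

lemma T_word_append: "u \<in> lists {1..<r} \<Longrightarrow> v \<in> lists {1..<r} \<Longrightarrow> T_word r (u @ v) = T_word r u \<otimes>\<^bsub>hecke r\<^esub> T_word r v"
  unfolding T_word_def by (subst hecke_class_mult [symmetric]) (auto intro: single_hecke_free simp: hecke_free_single_mult)

lemma T_word_braid:
  assumes "1 \<le> p" "Suc p < r"
  shows "T_word r [p, Suc p, p] = T_word r [Suc p, p, Suc p]"
  unfolding T_word_def
proof (rule hecke_class_relation)
  show "single [p, Suc p, p] 1 \<ominus>\<^bsub>hecke_free r\<^esub> single [Suc p, p, Suc p] 1 \<in> hecke_relations r"
    unfolding hecke_relations_def Let_def
      by (rule UnI1, rule UnI2, intro CollectI exI [of _ p]) (use assms in auto)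
qed (use assms in \<open>auto intro!: single_hecke_free\<close>)

lemma T_word_commute:
  assumes "p \<in> {1..<r}" "s \<in> {1..<r}" "Suc p < s \<or> Suc s < p"
  shows "T_word r [p, s] = T_word r [s, p]"
  unfolding T_word_def
proof (rule hecke_class_relation)
  show "single [p, s] 1 \<ominus>\<^bsub>hecke_free r\<^esub> single [s, p] 1 \<in> hecke_relations r"
    unfolding hecke_relations_def Let_def
      by (intro UnI2 CollectI exI [of _ p] exI [of _ s]) (use assms in auto)
qed (use assms in \<open>auto intro!: single_hecke_free\<close>)

lemma T_word_quadratic:
  assumes "p \<in> {1..<r}"
  shows "T_word r [p, p] = hecke_class r (single [p] (q - 1)) \<oplus>\<^bsub>hecke r\<^esub> hecke_class r (single [] q)"
proof -
  interpret F: ring "hecke_free r" by (rule hecke_free_ring)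
  have c: "single [p] (q - 1) \<in> carrier (hecke_free r)" "single [] q \<in> carrier (hecke_free r)"
    using assms by (auto intro!: single_hecke_free)
  have "T_word r [p, p] = hecke_class r (single [p] (q - 1) \<oplus>\<^bsub>hecke_free r\<^esub> single [] q)"
    unfolding T_word_def
  proof (rule hecke_class_relation)
    show "single [p, p] 1 \<ominus>\<^bsub>hecke_free r\<^esub> (single [p] (q - 1) \<oplus>\<^bsub>hecke_free r\<^esub> single [] q) \<in> hecke_relations r"
      unfolding hecke_relations_def Let_def
      by (rule UnI1, rule UnI1, intro CollectI exI [of _ p]) (use assms in auto)
  qed (use assms c in \<open>auto intro!: single_hecke_free\<close>)
  then show ?thesis using c by (simp add: hecke_free_plus hecke_class_add)
qed

lemma sw_commute: "Suc p < s \<Longrightarrow> sw p (sw s w) = sw s (sw p w)"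
  by (auto simp: fun_eq_iff sw_def transpose_def)

lemma sw_braid: "sw p (sw (Suc p) (sw p w)) = sw (Suc p) (sw p (sw (Suc p) w))"
  by (auto simp: fun_eq_iff sw_def transpose_def)

text \<open>Induction on inversions. Two reduced words of w are compared through their last letters,
  both descents of w. Equal letters are cancelled, distant ones commute; for neighbouring ones the
  three entries concerned are decreasing, and the two words can be replaced by words ending in the
  two sides of the braid relation.\<close>

theorem matsumoto:
  assumes "is_reduced r u w" "is_reduced r v w"
  shows "T_word r u = T_word r v"
  using assms
proof (induction "ninv r w" arbitrary: u v w rule: less_induct)
  case less
  interpret H: ring "hecke r" by (rule hecke_ring)
  have perm: "w permutes {1..r}"
    using less.prems(1) word_perm_permutes by (auto simp: is_reduced_def)
  show ?case
  proof (cases "ninv r w = 0")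
    case True
    then show ?thesis using less.prems by (simp add: is_reduced_def)
  next
    case False
    then have "u \<noteq> []" "v \<noteq> []" using less.prems by (auto simp: is_reduced_def)
    then obtain u' p v' s where uv: "u = u' @ [p]" "v = v' @ [s]" by (metis rev_exhaust)
    have p: "p \<in> {1..<r}" "w (Suc p) < w p" "is_reduced r u' (sw p w)"
      and s: "s \<in> {1..<r}" "w (Suc s) < w s" "is_reduced r v' (sw s w)"
      using is_reduced_snoc [of r u' p w] is_reduced_snoc [of r v' s w] less.prems uv by auto
    have lists: "u' \<in> lists {1..<r}" "v' \<in> lists {1..<r}" using p(3) s(3) by (auto simp: is_reduced_def)
    have IHp: "T_word r u' = T_word r z" if "is_reduced r z (sw p w)" for z
      by (rule less.hyps [OF _ p(3) that]) (use ninv_sw_desc [OF p(1,2)] in simp)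
    have IHs: "T_word r v' = T_word r z" if "is_reduced r z (sw s w)" for z
      by (rule less.hyps [OF _ s(3) that]) (use ninv_sw_desc [OF s(1,2)] in simp)
    have snoc: "T_word r u = T_word r u' \<otimes>\<^bsub>hecke r\<^esub> T_word r [p]" "T_word r v = T_word r v' \<otimes>\<^bsub>hecke r\<^esub> T_word r [s]"
      unfolding uv using lists p(1) s(1) by (simp_all add: T_word_append)
    have braid_case: "T_word r z1 \<otimes>\<^bsub>hecke r\<^esub> T_word r [a] = T_word r z2 \<otimes>\<^bsub>hecke r\<^esub> T_word r [Suc a]"
      if a: "a \<in> {1..<r}" "Suc a \<in> {1..<r}" "w (Suc a) < w a" "w (Suc (Suc a)) < w (Suc a)"
        and z1: "\<And>z. is_reduced r z (sw a w) \<Longrightarrow> T_word r z1 = T_word r z"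
        and z2: "\<And>z. is_reduced r z (sw (Suc a) w) \<Longrightarrow> T_word r z2 = T_word r z" for a z1 z2
    proof -
      have "sw a (sw (Suc a) (sw a w)) permutes {1..r}"
        by (intro sw_permutes perm a(1,2))
      \<comment> \<open>The three decreasing entries at a, a + 1, a + 2 are now increasing, so z can
        be prolonged by either side of the braid relation and stays reduced.\<close>
      then obtain z where z: "is_reduced r z (sw a (sw (Suc a) (sw a w)))" using exists_reduced by blast
      have "is_reduced r (z @ [a]) (sw (Suc a) (sw a w))"
        by (rule is_reduced_append [OF z]) (use a in auto)
      then have r1: "is_reduced r ((z @ [a]) @ [Suc a]) (sw a w)"
        by (rule is_reduced_append) (use a in auto)
      have "is_reduced r (z @ [Suc a]) (sw a (sw (Suc a) w))"
        by (rule is_reduced_append [of r z "Suc a"]) (use z a in \<open>auto simp: sw_braid\<close>)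
      then have r2: "is_reduced r ((z @ [Suc a]) @ [a]) (sw (Suc a) w)"
        by (rule is_reduced_append) (use a in auto)
      have zl: "z \<in> lists {1..<r}" using z by (simp add: is_reduced_def)
      have t: "T_word r (z @ [x]) = T_word r z \<otimes>\<^bsub>hecke r\<^esub> T_word r [x]" if "x \<in> {1..<r}" for x
        using zl that by (simp add: T_word_append)
      have "T_word r z1 \<otimes>\<^bsub>hecke r\<^esub> T_word r [a] = T_word r (z @ [a, Suc a, a])"
        using z1 [OF r1] T_word_append [of "z @ [a, Suc a]" r "[a]"] zl a by simp
      also have "\<dots> = T_word r z \<otimes>\<^bsub>hecke r\<^esub> T_word r [a, Suc a, a]"
        by (rule T_word_append) (use zl a in auto)
      also have "\<dots> = T_word r z \<otimes>\<^bsub>hecke r\<^esub> T_word r [Suc a, a, Suc a]"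
        using T_word_braid [of a r] a by simp
      also have "\<dots> = T_word r (z @ [Suc a, a, Suc a])"
        by (rule T_word_append [symmetric]) (use zl a in auto)
      also have "\<dots> = T_word r z2 \<otimes>\<^bsub>hecke r\<^esub> T_word r [Suc a]"
        using z2 [OF r2] T_word_append [of "z @ [Suc a, a]" r "[Suc a]"] zl a by simp
      finally show ?thesis .
    qed
    consider "p = s" | "s = Suc p" | "p = Suc s" | "Suc p < s \<or> Suc s < p" by linarith
    then show ?thesis
    proof cases
      case 1
      then show ?thesis using IHp [of v'] s(3) by (simp add: snoc)
    next
      case 2
      note s' = s(1,2) [unfolded 2] and IHs' = IHs [unfolded 2]
      show ?thesis
        unfolding snoc 2 by (rule braid_case [OF p(1) s'(1) p(2) s'(2) IHp IHs'])
    next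
      case 3
      note p' = p(1,2) [unfolded 3] and IHp' = IHp [unfolded 3]
      show ?thesis
        unfolding snoc 3 by (rule braid_case [OF s(1) p'(1) s(2) p'(2) IHs IHp', symmetric])
    next
      case 4
      have comm: "sw s (sw p w) = sw p (sw s w)" using 4 sw_commute by metis
      have "sw s (sw p w) permutes {1..r}" by (intro sw_permutes perm p(1) s(1))
      then obtain z where z: "is_reduced r z (sw s (sw p w))" using exists_reduced by blast
      have r1: "is_reduced r (z @ [s]) (sw p w)"
        by (rule is_reduced_append [OF z s(1)]) (use s p 4 in auto)
      have r2: "is_reduced r (z @ [p]) (sw s w)"
        by (rule is_reduced_append [OF _ p(1)]) (use z comm s p 4 in auto)
      have zl: "z \<in> lists {1..<r}" using z by (simp add: is_reduced_def)
      have "T_word r u = T_word r (z @ [s, p])"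
        unfolding snoc IHp [OF r1] using T_word_append [of "z @ [s]" r "[p]"] zl s p by simp
      also have "\<dots> = T_word r z \<otimes>\<^bsub>hecke r\<^esub> T_word r [s, p]"
        by (rule T_word_append) (use zl s p in auto)
      also have "\<dots> = T_word r z \<otimes>\<^bsub>hecke r\<^esub> T_word r [p, s]"
        using T_word_commute [OF p(1) s(1) 4] by simp
      also have "\<dots> = T_word r (z @ [p, s])"
        by (rule T_word_append [symmetric]) (use zl s p in auto)
      also have "\<dots> = T_word r v"
        unfolding snoc IHs [OF r2] using T_word_append [of "z @ [p]" r "[s]"] zl s p by simp
      finally show ?thesis .
    qed
  qed
qed

lemma T_eq_T_word:
  assumes "w permutes {1..r}"
  shows "T r w = T_word r (reduced_word r w)"
proof -
  have "foldr (\<lambda>i t. hecke_gen r i \<otimes>\<^bsub>hecke r\<^esub> t) u \<one>\<^bsub>hecke r\<^esub> = T_word r u" if "u \<in> lists {1..<r}" for u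
    using that
  proof (induction u)
    case Nil
    then show ?case by (simp add: T_word_def hecke_class_one)
  next
    case (Cons p u)
    then have "T_word r ([p] @ u) = T_word r [p] \<otimes>\<^bsub>hecke r\<^esub> T_word r u" by (intro T_word_append) auto
    then show ?case using Cons by (simp add: T_word_def hecke_class_def hecke_gen_def)
  qed
  then show ?thesis
    using reduced_word_is_reduced [OF assms] by (simp add: T_def is_reduced_def)
qed

lemma T_closed: "w permutes {1..r} \<Longrightarrow> T r w \<in> carrier (hecke r)"
  using reduced_word_is_reduced by (simp add: T_eq_T_word T_word_closed is_reduced_def)

lemma T_reduced: "is_reduced r u w \<Longrightarrow> w permutes {1..r} \<Longrightarrow> T r w = T_word r u"
  unfolding T_eq_T_word by (rule matsumoto [OF reduced_word_is_reduced])

lemma T_mult_asc: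
  assumes w: "w permutes {1..r}" and p: "p \<in> {1..<r}" "w p < w (Suc p)"
  shows "T r w \<otimes>\<^bsub>hecke r\<^esub> T_word r [p] = T r (sw p w)"
proof -
  have red: "is_reduced r (reduced_word r w) w" by (rule reduced_word_is_reduced [OF w])
  then have "is_reduced r (reduced_word r w @ [p]) (sw p w)"
    by (intro is_reduced_append) (use p in auto)
  moreover have "T_word r (reduced_word r w @ [p]) = T r w \<otimes>\<^bsub>hecke r\<^esub> T_word r [p]"
    using red p by (subst T_word_append) (auto simp: is_reduced_def T_eq_T_word [OF w])
  ultimately show ?thesis using T_reduced [OF _ sw_permutes [OF p(1) w]] by simp
qed

lemma hecke_class_single_mult:
  assumes "u \<in> lists {1..<r}" "v \<in> lists {1..<r}" "x \<in> laurent" "y \<in> laurent"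
  shows "hecke_class r (single u x) \<otimes>\<^bsub>hecke r\<^esub> hecke_class r (single v y) = hecke_class r (single (u @ v) (x * y))"
  using assms by (subst hecke_class_mult [symmetric]) (simp_all add: single_hecke_free hecke_free_single_mult)

lemma hecke_class_single_T:
  assumes "w permutes {1..r}" "x \<in> laurent"
  shows "hecke_class r (single (reduced_word r w) x) = hecke_scalar r x \<otimes>\<^bsub>hecke r\<^esub> T r w"
  using reduced_word_is_reduced [OF assms(1)] assms(2) unfolding hecke_scalar_hecke_class T_eq_T_word [OF assms(1)] T_word_def
  by (subst hecke_class_single_mult) (auto simp: is_reduced_def)

lemma scalar_mult: "x \<in> laurent \<Longrightarrow> y \<in> laurent \<Longrightarrow>
    hecke_scalar r x \<otimes>\<^bsub>hecke r\<^esub> hecke_scalar r y = hecke_scalar r (x * y)"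
  unfolding hecke_scalar_hecke_class by (subst hecke_class_single_mult) auto

section \<open>The standard basis elements span\<close>

inductive_set T_span :: "nat \<Rightarrow> hecke_elem set" for r
  where zero: "\<zero>\<^bsub>hecke r\<^esub> \<in> T_span r"
  | add: "w permutes {1..r} \<Longrightarrow> x \<in> laurent \<Longrightarrow> h \<in> T_span r \<Longrightarrow>
      hecke_scalar r x \<otimes>\<^bsub>hecke r\<^esub> T r w \<oplus>\<^bsub>hecke r\<^esub> h \<in> T_span r"

lemma scalar_T_closed: "w permutes {1..r} \<Longrightarrow> x \<in> laurent \<Longrightarrow>
    hecke_scalar r x \<otimes>\<^bsub>hecke r\<^esub> T r w \<in> carrier (hecke r)"
  by (intro monoid.m_closed ring.is_monoid hecke_ring hecke_scalar_closed T_closed)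

lemma T_span_carrier: "h \<in> T_span r \<Longrightarrow> h \<in> carrier (hecke r)"
proof (induction rule: T_span.induct)
  interpret H: ring "hecke r" by (rule hecke_ring)
  case zero
  show ?case by simp
next
  interpret H: ring "hecke r" by (rule hecke_ring)
  case (add w x h)
  then show ?case by (intro H.add.m_closed scalar_T_closed)
qed

lemma T_span_plus: "h \<in> T_span r \<Longrightarrow> h' \<in> T_span r \<Longrightarrow> h \<oplus>\<^bsub>hecke r\<^esub> h' \<in> T_span r"
proof (induction rule: T_span.induct)
  interpret H: ring "hecke r" by (rule hecke_ring)
  case zero
  then show ?case by (simp add: T_span_carrier)
next
  interpret H: ring "hecke r" by (rule hecke_ring)
  case (add w x h)
  then have "hecke_scalar r x \<otimes>\<^bsub>hecke r\<^esub> T r w \<oplus>\<^bsub>hecke r\<^esub> (h \<oplus>\<^bsub>hecke r\<^esub> h') \<in> T_span r"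
    by (intro T_span.add) auto
  then show ?case
    using add by (subst H.a_assoc) (auto intro: scalar_T_closed T_span_carrier)
qed

lemma T_span_scalar_T: "w permutes {1..r} \<Longrightarrow> x \<in> laurent \<Longrightarrow> hecke_scalar r x \<otimes>\<^bsub>hecke r\<^esub> T r w \<in> T_span r"
proof -
  interpret H: ring "hecke r" by (rule hecke_ring)
  assume wx: "w permutes {1..r}" "x \<in> laurent"
  show ?thesis
    using T_span.add [OF wx T_span.zero] H.r_zero [OF scalar_T_closed [OF wx]] by simp
qed

text \<open>At an ascent of w the product is again a standard basis element. At a descent, T_w
  itself ends in T_p, and the quadratic relation rewrites the square of T_p.\<close>

lemma T_span_mult_gen:
  assumes "h \<in> T_span r" and p: "p \<in> {1..<r}"
  shows "h \<otimes>\<^bsub>hecke r\<^esub> T_word r [p] \<in> T_span r"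
  using assms(1)
proof (induction rule: T_span.induct)
  interpret H: ring "hecke r" by (rule hecke_ring)
  have tp: "T_word r [p] \<in> carrier (hecke r)" using p by (simp add: T_word_closed)
  case zero
  show ?case using tp by (simp add: T_span.zero)
next
  interpret H: ring "hecke r" by (rule hecke_ring)
  have tp: "T_word r [p] \<in> carrier (hecke r)" using p by (intro T_word_closed) auto
  case (add w x h)
  note c = hecke_scalar_closed [OF add(2), of r] T_closed [OF add(1)]
  have "hecke_scalar r x \<otimes>\<^bsub>hecke r\<^esub> (T r w \<otimes>\<^bsub>hecke r\<^esub> T_word r [p]) \<in> T_span r"
  proof (cases "w p < w (Suc p)")
    case True
    then show ?thesis using T_mult_asc [OF add(1) p] add p by (simp add: T_span_scalar_T sw_permutes del: One_nat_def)
  next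
    case False
    then have desc: "w (Suc p) < w p"
      using permutes_adjacent_neq [OF add(1), of p] by simp
    let ?v = "sw p w"
    have v: "?v permutes {1..r}" by (rule sw_permutes [OF p add(1)])
    note cv = T_closed [OF v]
    have Tw: "T r w = T r ?v \<otimes>\<^bsub>hecke r\<^esub> T_word r [p]"
      using T_mult_asc [OF v p] desc by simp
    have sq: "T_word r [p] \<otimes>\<^bsub>hecke r\<^esub> T_word r [p] =
        hecke_scalar r (q - 1) \<otimes>\<^bsub>hecke r\<^esub> T_word r [p] \<oplus>\<^bsub>hecke r\<^esub> hecke_scalar r q"
    proof -
      have "T_word r [p] \<otimes>\<^bsub>hecke r\<^esub> T_word r [p] = T_word r [p, p]"
        using p T_word_append [of "[p]" r "[p]"] by simp
      moreover have "hecke_class r (single [p] (q - 1)) = hecke_scalar r (q - 1) \<otimes>\<^bsub>hecke r\<^esub> T_word r [p]"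
        unfolding hecke_scalar_hecke_class T_word_def using p by (subst hecke_class_single_mult) auto
      ultimately show ?thesis using T_word_quadratic [OF p] by (simp add: hecke_scalar_hecke_class)
    qed
    have central: "T r ?v \<otimes>\<^bsub>hecke r\<^esub> hecke_scalar r y = hecke_scalar r y \<otimes>\<^bsub>hecke r\<^esub> T r ?v" if "y \<in> laurent" for y
      unfolding hecke_scalar_hecke_class T_eq_T_word [OF v] T_word_def
      using reduced_word_is_reduced [OF v] that by (simp add: hecke_class_single_mult is_reduced_def)
    note cq = hecke_scalar_closed [OF q_laurent(1), of r] hecke_scalar_closed [OF q_laurent(2), of r]
    have "T r w \<otimes>\<^bsub>hecke r\<^esub> T_word r [p] = T r ?v \<otimes>\<^bsub>hecke r\<^esub> (T_word r [p] \<otimes>\<^bsub>hecke r\<^esub> T_word r [p])"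
      unfolding Tw using cv tp by (simp add: H.m_assoc)
    also have "\<dots> = T r ?v \<otimes>\<^bsub>hecke r\<^esub> hecke_scalar r (q - 1) \<otimes>\<^bsub>hecke r\<^esub> T_word r [p]
        \<oplus>\<^bsub>hecke r\<^esub> T r ?v \<otimes>\<^bsub>hecke r\<^esub> hecke_scalar r q"
      unfolding sq using cv tp cq by (simp add: H.r_distr H.m_assoc)
    also have "\<dots> = hecke_scalar r (q - 1) \<otimes>\<^bsub>hecke r\<^esub> T r w \<oplus>\<^bsub>hecke r\<^esub> hecke_scalar r q \<otimes>\<^bsub>hecke r\<^esub> T r ?v"
      unfolding central [OF q_laurent(1)] central [OF q_laurent(2)] Tw using cv tp cq by (simp add: H.m_assoc)
    finally have "hecke_scalar r x \<otimes>\<^bsub>hecke r\<^esub> (T r w \<otimes>\<^bsub>hecke r\<^esub> T_word r [p]) =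
        hecke_scalar r (x * (q - 1)) \<otimes>\<^bsub>hecke r\<^esub> T r w \<oplus>\<^bsub>hecke r\<^esub> hecke_scalar r (x * q) \<otimes>\<^bsub>hecke r\<^esub> T r ?v"
      using c cv cq add(2)
      by (simp add: H.r_distr H.m_assoc [symmetric] scalar_mult)
    also have "\<dots> \<in> T_span r"
      using add v laurent.C_mult [OF add(2)] by (intro T_span_plus T_span_scalar_T) auto
    finally show ?thesis .
  qed
  moreover have "(hecke_scalar r x \<otimes>\<^bsub>hecke r\<^esub> T r w \<oplus>\<^bsub>hecke r\<^esub> h) \<otimes>\<^bsub>hecke r\<^esub> T_word r [p] =
      hecke_scalar r x \<otimes>\<^bsub>hecke r\<^esub> (T r w \<otimes>\<^bsub>hecke r\<^esub> T_word r [p]) \<oplus>\<^bsub>hecke r\<^esub> h \<otimes>\<^bsub>hecke r\<^esub> T_word r [p]"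
    using c tp T_span_carrier [OF add(3)] by (simp add: H.l_distr H.m_assoc)
  ultimately show ?case using T_span_plus add.IH by simp
qed

lemma reduced_word_id: "reduced_word r id = []"
  using reduced_word_is_reduced [OF permutes_id, of r] by (simp add: is_reduced_def ninv_id)

lemma T_span_all: "h \<in> carrier (hecke r) \<Longrightarrow> h \<in> T_span r"
proof (induction rule: hecke_induct)
  case (add u x h)
  have "hecke_class r (single u x) \<in> T_span r" using add(1)
  proof (induction u rule: rev_induct)
    case Nil
    have "hecke_class r (single [] x) = hecke_scalar r x \<otimes>\<^bsub>hecke r\<^esub> T r id"
      using hecke_class_single_T [OF permutes_id add(2)] by (simp add: reduced_word_id)
    then show ?case using T_span_scalar_T [OF permutes_id add(2)] by simp
  next
    case (snoc p u)
    then have "hecke_class r (single (u @ [p]) x) = hecke_class r (single u x) \<otimes>\<^bsub>hecke r\<^esub> T_word r [p]"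
      unfolding T_word_def using add(2) by (subst hecke_class_single_mult) auto
    then show ?case using snoc T_span_mult_gen by simp
  qed
  then show ?case using add by (simp add: T_span_plus)
qed (rule T_span.zero)

subsection \<open>Coordinates\<close>

text \<open>The coordinates of h in the standard basis, obtained by letting h act on the delta
  function at the identity permutation.\<close>

definition ev :: "nat \<Rightarrow> hecke_elem \<Rightarrow> (nat \<Rightarrow> nat) \<Rightarrow> K"
  where "ev r h = hact r h (single id 1)"

text \<open>Every letter of a reduced word creates a descent when it is applied, so the correction
  term of \<open>Rop\<close> never contributes.\<close>

lemma fold_Rop_reduced: "is_reduced r u w \<Longrightarrow> fold Rop u (single id 1) = single w 1"
proof (induction u arbitrary: w rule: rev_induct)
  case Nil
  then show ?case by (simp add: is_reduced_def)
next
  case (snoc p u)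
  then have "w (Suc p) < w p" "is_reduced r u (sw p w)" using is_reduced_snoc by blast+
  then show ?case using snoc.IH by (simp add: Rop_single)
qed

lemma ev_scalar_T:
  assumes "w permutes {1..r}" "x \<in> laurent"
  shows "ev r (hecke_scalar r x \<otimes>\<^bsub>hecke r\<^esub> T r w) = single w x"
proof -
  have red: "is_reduced r (reduced_word r w) w" by (rule reduced_word_is_reduced [OF assms(1)])
  have "ev r (hecke_scalar r x \<otimes>\<^bsub>hecke r\<^esub> T r w) = (\<lambda>v. x * fold Rop (reduced_word r w) (single id 1) v)"
    unfolding ev_def hecke_class_single_T [OF assms, symmetric]
    by (rule hact_word) (use red assms in \<open>auto simp: is_reduced_def\<close>)
  then show ?thesis by (simp add: fold_Rop_reduced [OF red]) (auto simp: single_def)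
qed

lemma scalar_one: "hecke_scalar r 1 = \<one>\<^bsub>hecke r\<^esub>"
  by (simp add: hecke_scalar_hecke_class hecke_class_one)

lemma ev_T: "w permutes {1..r} \<Longrightarrow> ev r (T r w) = single w 1"
  using ev_scalar_T [of w r 1] ring.is_monoid [OF hecke_ring, of r]
  by (simp add: scalar_one monoid.l_one T_closed)

lemma ev_add: "h \<in> carrier (hecke r) \<Longrightarrow> h' \<in> carrier (hecke r) \<Longrightarrow>
    ev r (h \<oplus>\<^bsub>hecke r\<^esub> h') = (\<lambda>w. ev r h w + ev r h' w)"
  by (simp add: ev_def hact_add)

lemma ev_zero: "ev r \<zero>\<^bsub>hecke r\<^esub> = (\<lambda>w. 0)"
  by (simp add: ev_def hact_zero)

lemma ev_mult: "h \<in> carrier (hecke r) \<Longrightarrow> h' \<in> carrier (hecke r) \<Longrightarrow>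
    ev r (h \<otimes>\<^bsub>hecke r\<^esub> h') = hact r h' (ev r h)"
  by (simp add: ev_def hact_mult)

lemma ev_laurent: "h \<in> carrier (hecke r) \<Longrightarrow> ev r h w \<in> laurent"
proof (drule T_span_all, induction rule: T_span.induct)
  case (add v x h)
  then show ?case
    by (subst ev_add) (auto simp: ev_scalar_T single_def scalar_T_closed T_span_carrier intro: laurent.C_add)
qed (simp add: ev_zero)

lemma ev_support:
  assumes "h \<in> carrier (hecke r)" "\<not> w permutes {1..r}"
  shows "ev r h w = 0"
  using T_span_all [OF assms(1)] assms(2)
proof (induction rule: T_span.induct)
  case (add v x h)
  then show ?case
    by (subst ev_add) (auto simp: ev_scalar_T single_def scalar_T_closed T_span_carrier)
qed (simp add: ev_zero)

definition laurent_family :: "nat \<Rightarrow> ((nat \<Rightarrow> nat) \<Rightarrow> K) set"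
  where "laurent_family r = {c. range c \<subseteq> laurent \<and> (\<forall>w. \<not> w permutes {1..r} \<longrightarrow> c w = 0)}"

text \<open>Stands for the sum of all c(w) T_w, but is the class of a single element of the free
  algebra, supported on the chosen reduced words. Additivity in c is then a pointwise
  matter.\<close>

definition T_comb :: "nat \<Rightarrow> ((nat \<Rightarrow> nat) \<Rightarrow> K) \<Rightarrow> hecke_elem"
  where "T_comb r c = hecke_class r (\<lambda>u. if u \<in> reduced_word r ` {w. w permutes {1..r}} then c (word_perm u) else 0)"

lemma word_perm_reduced_word: "w permutes {1..r} \<Longrightarrow> word_perm (reduced_word r w) = w"
  using reduced_word_is_reduced by (simp add: is_reduced_def)

lemma T_comb_free:
  assumes "c \<in> laurent_family r"
  shows "(\<lambda>u. if u \<in> reduced_word r ` {w. w permutes {1..r}} then c (word_perm u) else 0) \<in> carrier (hecke_free r)"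
  unfolding hecke_free_def
proof (rule hf.carrierI)
  let ?f = "\<lambda>u. if u \<in> reduced_word r ` {w. w permutes {1..r}} then c (word_perm u) else 0"
  have sub: "{u. ?f u \<noteq> 0} \<subseteq> reduced_word r ` {w. w permutes {1..r}}" by auto
  then show "finite {u. ?f u \<noteq> 0}" by (rule finite_subset) (simp add: finite_permutations)
  have "reduced_word r w \<in> lists {1..<r}" if "w permutes {1..r}" for w
    using reduced_word_is_reduced [OF that] by (simp add: is_reduced_def)
  then show "{u. ?f u \<noteq> 0} \<subseteq> carrier (word_monoid r)" using sub by auto
  show "range ?f \<subseteq> laurent" using assms by (auto simp: laurent_family_def)
qed

lemma T_comb_add:
  assumes "c \<in> laurent_family r" "d \<in> laurent_family r"
  shows "T_comb r (\<lambda>w. c w + d w) = T_comb r c \<oplus>\<^bsub>hecke r\<^esub> T_comb r d"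
  unfolding T_comb_def hecke_class_add [OF T_comb_free [OF assms(1)] T_comb_free [OF assms(2)], symmetric]
  by (intro arg_cong [of _ _ "hecke_class r"]) auto

lemma T_comb_single:
  assumes "w permutes {1..r}" "x \<in> laurent"
  shows "T_comb r (single w x) = hecke_scalar r x \<otimes>\<^bsub>hecke r\<^esub> T r w"
  unfolding T_comb_def hecke_class_single_T [OF assms, symmetric]
  by (intro arg_cong [of _ _ "hecke_class r"] ext) (use assms in \<open>auto simp: single_def word_perm_reduced_word image_iff\<close>)

text \<open>Verified on spanning elements, where both sides are explicit. It gives a left inverse of
  \<open>ev\<close>, so the regular representation is faithful.\<close>

lemma T_comb_ev: "h \<in> carrier (hecke r) \<Longrightarrow> T_comb r (ev r h) = h"
proof (drule T_span_all, induction rule: T_span.induct)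
  case zero
  then show ?case by (simp add: ev_zero T_comb_def hecke_class_zero cong: if_cong)
next
  case (add w x h)
  have "ev r h \<in> laurent_family r"
    using T_span_carrier [OF add(3)] ev_laurent ev_support by (auto simp: laurent_family_def)
  moreover have "single w x \<in> laurent_family r"
    using add by (auto simp: laurent_family_def single_def)
  ultimately have "T_comb r (\<lambda>v. single w x v + ev r h v) = hecke_scalar r x \<otimes>\<^bsub>hecke r\<^esub> T r w \<oplus>\<^bsub>hecke r\<^esub> h"
    using add by (simp add: T_comb_add T_comb_single)
  then show ?case
    using add by (simp add: ev_add ev_scalar_T scalar_T_closed T_span_carrier)
qed

lemma ev_inj: "h \<in> carrier (hecke r) \<Longrightarrow> h' \<in> carrier (hecke r) \<Longrightarrow> ev r h = ev r h' \<Longrightarrow> h = h'"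
  using T_comb_ev by metis

lemma ev_T_sum:
  assumes "finite D" "\<And>w. w \<in> D \<Longrightarrow> w permutes {1..r}"
  shows "T_sum r D \<in> carrier (hecke r) \<and> ev r (T_sum r D) = (\<lambda>w. if w \<in> D then 1 else 0)"
  using assms
proof (induction D rule: finite_induct)
  interpret H: ring "hecke r" by (rule hecke_ring)
  case empty
  then show ?case by (simp add: T_sum_def ev_zero)
next
  interpret H: ring "hecke r" by (rule hecke_ring)
  case (insert w D)
  have T: "T r \<in> D \<rightarrow> carrier (hecke r)" "T r w \<in> carrier (hecke r)"
    using insert.prems by (auto intro: T_closed)
  have "T_sum r (insert w D) = T r w \<oplus>\<^bsub>hecke r\<^esub> T_sum r D"
    unfolding T_sum_def by (rule H.finsum_insert) (use insert T in auto)
  moreover have "(\<lambda>v. single w 1 v + (if v \<in> D then 1 else 0)) = (\<lambda>v. if v \<in> insert w D then 1 else 0 :: K)"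
    by (intro ext) (use insert.hyps in \<open>simp add: single_def\<close>)
  ultimately show ?case
    using insert T by (simp add: ev_add ev_T)
qed

section \<open>The commutant of the Hecke action on tensor space\<close>

definition TS :: "nat \<Rightarrow> nat \<Rightarrow> ((nat \<Rightarrow> nat) \<Rightarrow> K) set"
  where "TS n r = {f. \<forall>i. i \<notin> words n r \<longrightarrow> f i = 0}"

type_synonym tensor_op = "((nat \<Rightarrow> nat) \<Rightarrow> K) \<Rightarrow> (nat \<Rightarrow> nat) \<Rightarrow> K"

text \<open>All conditions are imposed on \<open>TS n r\<close> only. The values of an operator
  elsewhere are arbitrary, and operators are compared on \<open>TS n r\<close>.\<close>

definition commutant :: "nat \<Rightarrow> nat \<Rightarrow> tensor_op set"
  where "commutant n r =
    {X. (\<forall>f\<in>TS n r. X f \<in> TS n r)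
      \<and> (\<forall>f\<in>TS n r. \<forall>g\<in>TS n r. X (\<lambda>i. f i + g i) = (\<lambda>i. X f i + X g i))
      \<and> (\<forall>c. \<forall>f\<in>TS n r. X (\<lambda>i. c * f i) = (\<lambda>i. c * X f i))
      \<and> (\<forall>f\<in>TS n r. \<forall>p\<in>{1..<r}. X (Rop p f) = Rop p (X f))}"

lemma TS_zero: "(\<lambda>i. 0) \<in> TS n r"
  by (simp add: TS_def)

lemma TS_plus: "f \<in> TS n r \<Longrightarrow> g \<in> TS n r \<Longrightarrow> (\<lambda>i. f i + g i) \<in> TS n r"
  by (simp add: TS_def)

lemma TS_scale: "f \<in> TS n r \<Longrightarrow> (\<lambda>i. c * f i) \<in> TS n r"
  by (simp add: TS_def)

lemma TS_sum: "(\<And>x. x \<in> A \<Longrightarrow> f x \<in> TS n r) \<Longrightarrow> (\<lambda>i. \<Sum>x\<in>A. f x i) \<in> TS n r"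
  by (simp add: TS_def)

lemma TS_single: "i \<in> words n r \<Longrightarrow> single i c \<in> TS n r"
  by (auto simp: TS_def single_def)

lemma TS_Rop: "f \<in> TS n r \<Longrightarrow> p \<in> {1..<r} \<Longrightarrow> Rop p f \<in> TS n r"
  using sw_words [of p r] by (auto simp: TS_def Rop_def)

lemma comm_TS: "X \<in> commutant n r \<Longrightarrow> f \<in> TS n r \<Longrightarrow> X f \<in> TS n r"
  and comm_plus: "X \<in> commutant n r \<Longrightarrow> f \<in> TS n r \<Longrightarrow> g \<in> TS n r \<Longrightarrow> X (\<lambda>i. f i + g i) = (\<lambda>i. X f i + X g i)"
  and comm_scale: "X \<in> commutant n r \<Longrightarrow> f \<in> TS n r \<Longrightarrow> X (\<lambda>i. c * f i) = (\<lambda>i. c * X f i)"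
  and comm_Rop: "X \<in> commutant n r \<Longrightarrow> f \<in> TS n r \<Longrightarrow> p \<in> {1..<r} \<Longrightarrow> X (Rop p f) = Rop p (X f)"
  by (simp_all add: commutant_def)

lemma comm_zero: "X \<in> commutant n r \<Longrightarrow> X (\<lambda>i. 0) = (\<lambda>i. 0)"
  using comm_scale [of X n r "\<lambda>i. 0" 0] by (simp add: TS_zero)

lemma comm_sum:
  assumes X: "X \<in> commutant n r" and "finite A" "\<And>x. x \<in> A \<Longrightarrow> f x \<in> TS n r"
  shows "X (\<lambda>i. \<Sum>x\<in>A. f x i) = (\<lambda>i. \<Sum>x\<in>A. X (f x) i)"
  using assms(2,3)
  by (induction A rule: finite_induct) (simp_all add: comm_zero [OF X] comm_plus [OF X] TS_sum)

lemma TS_expand: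
  assumes "f \<in> TS n r"
  shows "f = (\<lambda>i. \<Sum>j\<in>words n r. f j * single j 1 i)"
proof
  fix i
  have "(\<Sum>j\<in>words n r. f j * single j 1 i) = (\<Sum>j\<in>words n r. if j = i then f i else 0)"
    by (rule sum.cong) (auto simp: single_def)
  then show "f i = (\<Sum>j\<in>words n r. f j * single j 1 i)"
    using assms by (simp add: finite_words TS_def)
qed

lemma comm_expand:
  assumes X: "X \<in> commutant n r" and f: "f \<in> TS n r"
  shows "X f = (\<lambda>i. \<Sum>j\<in>words n r. f j * X (single j 1) i)"
proof -
  have "X f = X (\<lambda>i. \<Sum>j\<in>words n r. f j * single j 1 i)" using TS_expand [OF f] by simp
  also have "\<dots> = (\<lambda>i. \<Sum>j\<in>words n r. X (\<lambda>i. f j * single j 1 i) i)"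
    by (rule comm_sum [OF X finite_words]) (simp add: TS_scale TS_single)
  also have "\<dots> = (\<lambda>i. \<Sum>j\<in>words n r. f j * X (single j 1) i)"
    by (simp add: comm_scale [OF X] TS_single)
  finally show ?thesis .
qed

lemma commutant_plus: "X \<in> commutant n r \<Longrightarrow> Y \<in> commutant n r \<Longrightarrow> (\<lambda>f i. X f i + Y f i) \<in> commutant n r"
  unfolding commutant_def by (auto simp: TS_plus Rop_plus algebra_simps)

lemma commutant_scale: "X \<in> commutant n r \<Longrightarrow> (\<lambda>f i. c * X f i) \<in> commutant n r"
  unfolding commutant_def by (auto simp: TS_scale Rop_scale algebra_simps)

lemma commutant_comp: "X \<in> commutant n r \<Longrightarrow> Y \<in> commutant n r \<Longrightarrow> (\<lambda>f. X (Y f)) \<in> commutant n r"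
  unfolding commutant_def by auto

lemma commutant_zero: "(\<lambda>f i. 0) \<in> commutant n r"
  by (auto simp: commutant_def TS_zero Rop_def)

lemma commutant_sum: "(\<And>x. x \<in> A \<Longrightarrow> X x \<in> commutant n r) \<Longrightarrow> (\<lambda>f i. \<Sum>x\<in>A. X x f i) \<in> commutant n r"
  by (induction A rule: infinite_finite_induct) (auto simp: commutant_zero intro: commutant_plus)

subsection \<open>Matrix coefficients\<close>

text \<open>The choice of \<open>i\<close> is immaterial for \<open>X\<close> in the commutant (\<open>comm_column\<close>).\<close>

definition cf :: "nat \<Rightarrow> nat \<Rightarrow> tensor_op \<Rightarrow> mat \<Rightarrow> K"
  where "cf n r X A = X (single (jw r (co n A)) 1) (SOME i. i \<in> words n r \<and> mt r i (jw r (co n A)) = A)"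

lemma Rop_single_flat:
  assumes "j p = j (Suc p)"
  shows "Rop p (single j 1) = (\<lambda>i. q * single j 1 i)"
proof
  fix i
  have "sw p i = j \<longleftrightarrow> i = j" using sw_id [of j p] assms by (metis sw_simps(4))
  then show "Rop p (single j 1) i = q * single j 1 i"
    using assms by (auto simp: Rop_def single_def)
qed

text \<open>Bubble sort of an element of the stabiliser stays inside the stabiliser, so invariance
  under its simple transpositions gives invariance under all of it.\<close>

lemma young_induct:
  assumes \<mu>: "\<mu> \<in> Lam n r" and b: "b permutes {1..r}" "jw r \<mu> \<circ> b = jw r \<mu>"
    and g: "\<And>p i. p \<in> {1..<r} \<Longrightarrow> jw r \<mu> p = jw r \<mu> (Suc p) \<Longrightarrow> g (sw p i) = g i"
  shows "g (i \<circ> b) = g i"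
  using b
proof (induction rule: permutation_induct)
  case (step b p)
  have jwb: "jw r \<mu> (b x) = jw r \<mu> x" for x using fun_cong [OF step(5), of x] by simp
  have "b p \<in> {1..r}" "b (Suc p) \<in> {1..r}"
    using step(2) permutes_in_image [OF step(1)] by auto
  \<comment> \<open>Since b permutes within blocks, a descent of b at p gives one inequality between
    the letters at p and p + 1, and sortedness gives the other.\<close>
  then have "jw r \<mu> (b (Suc p)) \<le> jw r \<mu> (b p)" using step(3) by (intro jw_mono [OF \<mu>]) auto
  moreover have "jw r \<mu> p \<le> jw r \<mu> (Suc p)" using step(2) by (intro jw_mono [OF \<mu>]) auto
  ultimately have flat: "jw r \<mu> p = jw r \<mu> (Suc p)" by (simp add: jwb)
  have "jw r \<mu> \<circ> sw p b = jw r \<mu>"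
    unfolding sw_comp [symmetric] step(5) by (rule sw_id [OF flat])
  then have "g (i \<circ> sw p b) = g i" by (rule step(4))
  then show ?case using g [OF step(2) flat, of "i \<circ> b"] unfolding sw_comp by (simp only:)
qed simp

text \<open>Being a q-eigenvector of \<open>Rop p\<close> means invariance under the exchange at p.
  Two words of the same type differ by an element of the stabiliser, which such exchanges
  generate.\<close>

lemma constant_on_types:
  assumes \<mu>: "\<mu> \<in> Lam n r"
    and g: "\<And>p. p \<in> {1..<r} \<Longrightarrow> jw r \<mu> p = jw r \<mu> (Suc p) \<Longrightarrow> Rop p g = (\<lambda>i. q * g i)"
    and i: "i \<in> words n r" "i' \<in> words n r" "mt r i (jw r \<mu>) = mt r i' (jw r \<mu>)"
  shows "g i = g i'"
proof -
  obtain b where b: "b permutes {1..r}" "i = i' \<circ> b" "jw r \<mu> = jw r \<mu> \<circ> b"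
    using same_type_permutation [OF i(3,1,2) jw_words [OF \<mu>]] by auto
  have "g (sw p k) = g k" if "p \<in> {1..<r}" "jw r \<mu> p = jw r \<mu> (Suc p)" for p k
  proof -
    have *: "Rop p g k = q * g k" "Rop p g (sw p k) = q * g (sw p k)" using g [OF that] by simp_all
    consider "k p = k (Suc p)" | "k p < k (Suc p)" | "k (Suc p) < k p" by linarith
    then show ?thesis using * by cases (auto simp: Rop_def sw_id)
  qed
  then show ?thesis using young_induct [OF \<mu> b(1) b(3) [symmetric], of g i'] b(2) by simp
qed

text \<open>Where the sorted word is flat, its delta function is a q-eigenvector of
  \<open>Rop p\<close>. Its image under X inherits this and is therefore constant on types.\<close>

lemma comm_column:
  assumes X: "X \<in> commutant n r" and \<mu>: "\<mu> \<in> Lam n r" and i: "i \<in> words n r"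
  shows "X (single (jw r \<mu>) 1) i = cf n r X (mt r i (jw r \<mu>))"
proof -
  let ?A = "mt r i (jw r \<mu>)" and ?g = "X (single (jw r \<mu>) 1)"
  have co: "co n ?A = \<mu>" using co_mt [OF i] ct_jw [OF \<mu>] by simp
  let ?k = "SOME k. k \<in> words n r \<and> mt r k (jw r (co n ?A)) = ?A"
  have k: "?k \<in> words n r \<and> mt r ?k (jw r (co n ?A)) = ?A"
    by (rule someI [of _ i]) (use i co in simp)
  have flat: "Rop p ?g = (\<lambda>i. q * ?g i)" if p: "p \<in> {1..<r}" "jw r \<mu> p = jw r \<mu> (Suc p)" for p
  proof -
    have s: "single (jw r \<mu>) 1 \<in> TS n r" by (simp add: TS_single jw_words [OF \<mu>])
    show ?thesis
      using comm_Rop [OF X s p(1)] by (simp add: Rop_single_flat [OF p(2)] comm_scale [OF X s])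
  qed
  have "mt r i (jw r \<mu>) = mt r ?k (jw r \<mu>)" using conjunct2 [OF k] by (simp only: co)
  from constant_on_types [where g = ?g, OF \<mu> flat i conjunct1 [OF k] this]
  have "?g i = ?g ?k" .
  then show ?thesis by (simp add: cf_def co)
qed

lemma cf_eq:
  assumes X: "X \<in> commutant n r" and A: "A \<in> Theta n r" and i: "i \<in> words n r" "mt r i (jw r (co n A)) = A"
  shows "cf n r X A = X (single (jw r (co n A)) 1) i"
  using comm_column [OF X co_Lam [OF A] i(1)] i(2) by simp

lemma sorted_ninv:
  assumes "\<And>a b. 1 \<le> a \<Longrightarrow> a \<le> b \<Longrightarrow> b \<le> r \<Longrightarrow> w a \<le> w b"
  shows "ninv r w = 0"
proof -
  have *: "\<not> w b < w a" if "1 \<le> a" "a < b" "b \<le> r" for a b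
    using assms [of a b] that by simp
  have "{(a, b). 1 \<le> a \<and> a < b \<and> b \<le> r \<and> w b < w a} = {}" using * by blast
  then show ?thesis by (simp only: ninv_def card.empty)
qed

text \<open>Swapping the same neighbours in \<open>i\<close> and \<open>j\<close> preserves the hypothesis, and \<open>Rop\<close> then contributes
  the factor \<open>q\<close> both for \<open>j p = j (Suc p)\<close> and for \<open>j p < j (Suc p)\<close>.\<close>

lemma comm_row:
  assumes X: "X \<in> commutant n r"
    and i: "i \<in> words n r" and j: "j \<in> words n r"
    and ij: "\<And>a b. 1 \<le> a \<Longrightarrow> a < b \<Longrightarrow> b \<le> r \<Longrightarrow> i b < i a \<Longrightarrow> j a \<le> j b"
  shows "X (single i 1) j = q ^ ninv r i * cf n r X (mt r j i)"
proof -
  let ?C = "\<lambda>i j. \<forall>a b. 1 \<le> a \<longrightarrow> a < b \<longrightarrow> b \<le> r \<longrightarrow> (i b :: nat) < i a \<longrightarrow> (j a :: nat) \<le> j b"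
  have "\<forall>j\<in>words n r. ?C i j \<longrightarrow> X (single i 1) j = q ^ ninv r i * cf n r X (mt r j i)"
    using i
  proof (induction rule: words_induct)
    case (sorted \<mu>)
    then show ?case
      using comm_column [OF X sorted] sorted_ninv [of r "jw r \<mu>", OF jw_mono [OF sorted]] by simp
  next
    case (step i p)
    note si = step(2) and p = step(3) and desc = step(4) and IH = step(5)
    show ?case
    proof (intro ballI impI)
      fix j assume j: "j \<in> words n r" and C: "?C i j"
      have sj: "sw p j \<in> words n r" using j p sw_words by blast
      have C': "?C (sw p i) (sw p j)"
      proof (intro allI impI)
        fix a b assume ab: "1 \<le> a" "a < b" "b \<le> r" "sw p i b < sw p i a"
        let ?t = "transpose p (Suc p)"
        have "\<not> (a = p \<and> b = Suc p)" using ab desc by auto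
        then have "1 \<le> ?t a" "?t a < ?t b" "?t b \<le> r"
          using ab(1-3) p by (auto simp: transpose_def split: if_splits)
        then show "sw p j a \<le> sw p j b" using C ab(4) by (simp add: sw_def)
      qed
      have le: "j p \<le> j (Suc p)" using C p desc by auto
      let ?g = "X (single (sw p i) 1)"
      have "X (single i 1) j = Rop p ?g j"
        using comm_Rop [OF X TS_single [OF si, of 1] p] Rop_single [OF desc] by simp
      also have "\<dots> = q * ?g (sw p j)"
        using le by (cases "j p = j (Suc p)") (auto simp: Rop_def sw_id)
      also have "\<dots> = q * (q ^ ninv r (sw p i) * cf n r X (mt r (sw p j) (sw p i)))"
        by (simp only: mp [OF bspec [OF IH sj] C'])
      also have "\<dots> = q ^ ninv r i * cf n r X (mt r j i)"
        using ninv_sw_desc [OF p desc] mt_sw [OF p] by (simp add: mult.assoc)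
      finally show "X (single i 1) j = q ^ ninv r i * cf n r X (mt r j i)" .
    qed
  qed
  then show ?thesis using j ij by blast
qed

lemma comm_row_jw:
  assumes X: "X \<in> commutant n r" and "\<mu> \<in> Lam n r" and "i \<in> words n r"
  shows "X (single i 1) (jw r \<mu>) = q ^ ninv r i * cf n r X (mt r (jw r \<mu>) i)"
  by (rule comm_row [OF X assms(3) jw_words [OF assms(2)]]) (auto intro: jw_mono [OF assms(2)])

lemma comm_ext_single:
  assumes X: "X \<in> commutant n r" and Y: "Y \<in> commutant n r"
    and eq: "\<And>A. A \<in> Theta n r \<Longrightarrow> cf n r X A = cf n r Y A" and i: "i \<in> words n r"
  shows "X (single i 1) = Y (single i 1)"
  using i
proof (induction rule: words_induct)
  case (sorted \<mu>)
  have TS: "X (single (jw r \<mu>) 1) \<in> TS n r" "Y (single (jw r \<mu>) 1) \<in> TS n r"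
    using comm_TS [OF X] comm_TS [OF Y] TS_single [OF jw_words [OF sorted]] by auto
  show ?case
  proof
    fix k
    show "X (single (jw r \<mu>) 1) k = Y (single (jw r \<mu>) 1) k"
    proof (cases "k \<in> words n r")
      case True
      then show ?thesis
        by (simp add: comm_column [OF X sorted] comm_column [OF Y sorted] eq mt_Theta jw_words [OF sorted])
    qed (use TS in \<open>simp add: TS_def\<close>)
  qed
next
  case (step i p)
  have s: "single (sw p i) 1 \<in> TS n r" by (rule TS_single [OF step(2)])
  show ?case
    using comm_Rop [OF X s step(3)] comm_Rop [OF Y s step(3)] step(5)
    by (simp add: Rop_single [of i p, OF step(4)])
qed

lemma comm_ext:
  assumes X: "X \<in> commutant n r" and Y: "Y \<in> commutant n r"
    and eq: "\<And>A. A \<in> Theta n r \<Longrightarrow> cf n r X A = cf n r Y A" and f: "f \<in> TS n r"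
  shows "X f = Y f"
  using comm_expand [OF X f] comm_expand [OF Y f] comm_ext_single [OF X Y eq] by simp

lemma cf_plus: "cf n r (\<lambda>f i. X f i + Y f i) A = cf n r X A + cf n r Y A"
  by (simp add: cf_def)

lemma cf_scale: "cf n r (\<lambda>f i. c * X f i) A = c * cf n r X A"
  by (simp add: cf_def)

lemma cf_sum: "cf n r (\<lambda>f i. \<Sum>x\<in>S. X x f i) A = (\<Sum>x\<in>S. cf n r (X x) A)"
  by (simp add: cf_def)

lemma cf_cong:
  assumes "A \<in> Theta n r" "\<And>f. f \<in> TS n r \<Longrightarrow> X f = Y f"
  shows "cf n r X A = cf n r Y A"
  using assms(2) [OF TS_single [OF jw_words [OF co_Lam [OF assms(1)]]], of 1] by (simp add: cf_def)

subsection \<open>The raising and lowering operators\<close>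

text \<open>With \<open>R = (<)\<close>, \<open>a = h\<close>, \<open>b = h + 1\<close> this is the action of \<open>e\<^sub>h\<close>; with \<open>R = (>)\<close>,
  \<open>a = h + 1\<close>, \<open>b = h\<close> that of \<open>f\<^sub>h\<close>.\<close>

definition Gop :: "nat \<Rightarrow> (nat \<Rightarrow> nat \<Rightarrow> bool) \<Rightarrow> nat \<Rightarrow> nat \<Rightarrow> tensor_op"
  where "Gop r R a b f i =
    (\<Sum>s\<in>{s \<in> {1..r}. i s = a}. q ^ card {t \<in> {1..r}. R s t \<and> i t = a} * f (i(s := b)))"

definition root_op :: "(nat \<Rightarrow> nat \<Rightarrow> bool) \<Rightarrow> nat \<Rightarrow> nat \<Rightarrow> bool"
  where "root_op R a b \<longleftrightarrow> R = (<) \<and> b = Suc a \<or> R = (>) \<and> a = Suc b"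

lemma root_op_order: "root_op R a b \<Longrightarrow> R = (<) \<or> R = (>)"
  by (auto simp: root_op_def)

lemma Gop_plus: "Gop r R a b (\<lambda>i. f i + g i) = (\<lambda>i. Gop r R a b f i + Gop r R a b g i)"
  by (simp add: Gop_def fun_eq_iff algebra_simps sum.distrib)

lemma Gop_scale: "Gop r R a b (\<lambda>i. c * f i) = (\<lambda>i. c * Gop r R a b f i)"
  by (simp add: Gop_def fun_eq_iff algebra_simps sum_distrib_left)

lemma Gop_TS:
  assumes f: "f \<in> TS n r" and ab: "a \<in> {1..n}" "b \<in> {1..n}"
  shows "Gop r R a b f \<in> TS n r"
proof -
  have "f (i(s := b)) = 0" if "i \<notin> words n r" "s \<in> {1..r}" "i s = a" for i s
  proof -
    have "i(s := b) \<notin> words n r"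
    proof
      assume w: "i(s := b) \<in> words n r"
      have "i \<in> words n r"
        unfolding words_def
      proof (intro CollectI conjI ballI allI impI)
        fix p assume "p \<in> {1..r}"
        then show "i p \<in> {1..n}" using words_in [OF w, of p] that ab by (cases "p = s") auto
      next
        fix p assume "p \<notin> {1..r}"
        then show "i p = 0" using words_out [OF w, of p] that by (cases "p = s") auto
      qed
      then show False using that by simp
    qed
    then show ?thesis using f by (simp add: TS_def)
  qed
  then show ?thesis by (simp add: TS_def Gop_def)
qed

text \<open>The sum over positions is split. Positions other than p and p + 1 have weights untouched
  by the exchange and commute termwise (\<open>G1\<close>). The two remaining positions
  (\<open>G2\<close>) lead to a finite check on two letters; since a and b are adjacent, any third
  letter compares alike with both.\<close>

lemma Gop_Rop:
  assumes root: "root_op R a b" and p: "p \<in> {1..<r}"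
  shows "Gop r R a b (Rop p f) = Rop p (Gop r R a b f)"
proof
  fix i :: "nat \<Rightarrow> nat"
  let ?S = "{1..r} - {p, Suc p}"
  define c where "c i s = (if i s = a then q ^ card {t \<in> {1..r}. R s t \<and> i t = a} else 0)" for i s
  define G1 where "G1 f i = (\<Sum>s\<in>?S. c i s * f (i(s := b)))" for f i
  define G2 where "G2 f i = c i p * f (i(p := b)) + c i (Suc p) * f (i(Suc p := b))" for f i
  have "Gop r R a b f i = (\<Sum>s\<in>{1..r}. c i s * f (i(s := b)))" for f i
    unfolding Gop_def c_def by (rule sum.mono_neutral_cong_left) auto
  moreover have "{1..r} = insert p (insert (Suc p) ?S)" using p by auto
  ultimately have split: "Gop r R a b f = (\<lambda>i. G2 f i + G1 f i)" for f
    using sum.insert [of "insert (Suc p) ?S" p "\<lambda>s. c _ s * f (_(s := b))"]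
    by (simp add: G1_def G2_def fun_eq_iff add.assoc)
  have R_t: "R s (transpose p (Suc p) t) \<longleftrightarrow> R s t" if "s \<in> ?S" for s t
    using that root_op_order [OF root] by (auto simp: transpose_def)
  have c_sw: "c (sw p i) s = c i s" if "s \<in> ?S" for i s
  proof -
    have "card {t \<in> {1..r}. R s t \<and> sw p i t = a} = card {t \<in> {1..r}. R s t \<and> i t = a}"
      using card_comp_permutes [OF transpose_permutes [OF p], of "\<lambda>t. R s t \<and> i t = a"] R_t [OF that]
      by (simp add: sw_def)
    moreover have "sw p i s = i s" using that by simp
    ultimately show ?thesis by (simp add: c_def)
  qed
  have upd: "(sw p i)(s := b) = sw p (i(s := b))" if "s \<in> ?S" for i s
    using that by (auto simp: sw_upd fun_eq_iff)
  have 1: "G1 (Rop p f) i = Rop p (G1 f) i" for i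
  proof -
    consider "i p = i (Suc p)" | "i p < i (Suc p)" | "i (Suc p) < i p" by linarith
    then show ?thesis
      by cases (simp_all add: G1_def Rop_def c_sw upd sum_distrib_left sum.distrib [symmetric] algebra_simps
          del: sum_distrib_left [symmetric])
  qed
  define W where "W x y = i(p := x, Suc p := y)" for x y :: nat
  have W: "i = W (i p) (i (Suc p))" by (simp add: W_def)
  have RW: "Rop p h (W x y) = (if x = y then q * h (W x y) else if x < y then q * h (W y x)
      else h (W y x) + (q - 1) * h (W x y))" for h x y
    by (simp add: Rop_def W_def sw_upd fun_upd_twist)
  \<comment> \<open>The contribution of the other positions, common to p and p + 1. An extra q
    appears when the partner also carries a and lies on the R-side.\<close>
  define N where "N = q ^ card {t \<in> ?S. R p t \<and> i t = a}"
  have cW: "c (W x y) p = (if x = a then N * (if y = a \<and> R p (Suc p) then q else 1) else 0)"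
    "c (W x y) (Suc p) = (if y = a then N * (if x = a \<and> R (Suc p) p then q else 1) else 0)" for x y
  proof -
    have irr: "\<not> R s s" for s using root_op_order [OF root] by auto
    have e1: "{t \<in> {1..r}. R p t \<and> W x y t = a} =
        (if y = a \<and> R p (Suc p) then insert (Suc p) {t \<in> ?S. R p t \<and> i t = a} else {t \<in> ?S. R p t \<and> i t = a})"
      using p irr by (auto simp: W_def)
    have Rp: "R (Suc p) t \<longleftrightarrow> R p t" if "t \<in> ?S" for t
      using that root_op_order [OF root] by auto
    have e2: "{t \<in> {1..r}. R (Suc p) t \<and> W x y t = a} =
        (if x = a \<and> R (Suc p) p then insert p {t \<in> ?S. R p t \<and> i t = a} else {t \<in> ?S. R p t \<and> i t = a})"
      using p irr Rp by (auto simp: W_def)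
    have "W x y p = x" "W x y (Suc p) = y" by (simp_all add: W_def)
    then show "c (W x y) p = (if x = a then N * (if y = a \<and> R p (Suc p) then q else 1) else 0)"
      "c (W x y) (Suc p) = (if y = a then N * (if x = a \<and> R (Suc p) p then q else 1) else 0)"
      unfolding c_def e1 e2 N_def by simp_all
  qed
  have Wupd: "(W x y)(p := b) = W b y" "(W x y)(Suc p := b) = W x b" for x y
    by (auto simp: W_def fun_eq_iff)
  have G2W: "G2 h (W x y) = c (W x y) p * h (W b y) + c (W x y) (Suc p) * h (W x b)" for h x y
    by (simp add: G2_def Wupd)
  have 2: "G2 (Rop p f) (W x y) = Rop p (G2 f) (W x y)" for x y
    using root unfolding root_op_def
  proof (elim disjE conjE)
    assume "R = (<)" "b = Suc a"
    then show ?thesis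
      unfolding RW G2W cW by (auto simp: algebra_simps)
  next
    assume "R = (>)" "a = Suc b"
    then show ?thesis
      unfolding RW G2W cW by (auto simp: algebra_simps)
  qed
  show "Gop r R a b (Rop p f) i = Rop p (Gop r R a b f) i"
    unfolding split Rop_plus using 1 [of i] 2 [of "i p" "i (Suc p)"] W by simp
qed

lemma Gop_commutant:
  "root_op R a b \<Longrightarrow> a \<in> {1..n} \<Longrightarrow> b \<in> {1..n} \<Longrightarrow> Gop r R a b \<in> commutant n r"
  unfolding commutant_def
  by (simp add: Gop_TS Gop_plus Gop_scale Gop_Rop del: One_nat_def)

subsection \<open>Multiplication formulas\<close>

text \<open>For either order, the number of elements beyond s runs once through 0, ..., card S -
  1.\<close>

lemma rank_sum:
  fixes S :: "nat set"
  assumes "finite S" "R = (<) \<or> R = (>)"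
  shows "(\<Sum>s\<in>S. q ^ card {t \<in> S. R s t}) = qsum (card S)"
  using assms(2)
proof
  assume R: "R = (<)"
  show ?thesis using assms(1) unfolding R
  proof (induction S rule: finite_linorder_min_induct)
    case (insert b A)
    have "{t \<in> insert b A. b < t} = A" using insert by auto
    moreover have "{t \<in> insert b A. s < t} = {t \<in> A. s < t}" if "s \<in> A" for s using insert that by auto
    moreover have "b \<notin> A" using insert by auto
    ultimately show ?case using insert by (simp add: qsum_def)
  qed (simp add: qsum_def)
next
  assume R: "R = (>)"
  show ?thesis using assms(1) unfolding R
  proof (induction S rule: finite_linorder_max_induct)
    case (insert b A)
    have "{t \<in> insert b A. b > t} = A" using insert by auto
    moreover have "{t \<in> insert b A. s > t} = {t \<in> A. s > t}" if "s \<in> A" for s using insert that by auto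
    moreover have "b \<notin> A" using insert by auto
    ultimately show ?case using insert by (simp add: qsum_def)
  qed (simp add: qsum_def)
qed

text \<open>The sorted word is monotone, so the positions beyond s either lie in a block beyond u, a
  constant contribution, or in the block u itself, where they contribute the rank of s.\<close>

lemma block_rank_sum:
  assumes \<mu>: "\<mu> \<in> Lam n r" and R: "R = (<) \<or> R = (>)"
  shows "(\<Sum>s\<in>{s \<in> {1..r}. i s = a \<and> jw r \<mu> s = u}. q ^ card {t \<in> {1..r}. R s t \<and> i t = a})
    = q ^ (\<Sum>v | v \<in> {1..n} \<and> R u v. card {t \<in> {1..r}. i t = a \<and> jw r \<mu> t = v})
      * qsum (card {t \<in> {1..r}. i t = a \<and> jw r \<mu> t = u})"
proof -
  let ?S = "{s \<in> {1..r}. i s = a \<and> jw r \<mu> s = u}"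
  let ?U = "{t \<in> {1..r}. R u (jw r \<mu> t) \<and> i t = a}"
  have card_U: "card ?U = (\<Sum>v | v \<in> {1..n} \<and> R u v. card {t \<in> {1..r}. i t = a \<and> jw r \<mu> t = v})"
  proof -
    have "(\<Sum>v | v \<in> {1..n} \<and> R u v. card {t \<in> {1..r}. (R u (jw r \<mu> t) \<and> i t = a) \<and> jw r \<mu> t = v}) = card ?U"
      by (rule sum_card_fibres) (use words_in [OF jw_words [OF \<mu>]] in auto)
    moreover have "{t \<in> {1..r}. (R u (jw r \<mu> t) \<and> i t = a) \<and> jw r \<mu> t = v} =
        {t \<in> {1..r}. i t = a \<and> jw r \<mu> t = v}" if "R u v" for v
      using that by auto
    ultimately show ?thesis by simp
  qed
  have "card {t \<in> {1..r}. R s t \<and> i t = a} = card ?U + card {t \<in> ?S. R s t}" if s: "s \<in> ?S" for s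
  proof -
    have jw: "R s t \<longleftrightarrow> R u (jw r \<mu> t) \<or> (jw r \<mu> t = u \<and> R s t)" if t: "t \<in> {1..r}" for t
    proof -
      have "jw r \<mu> s \<le> jw r \<mu> t" if "s \<le> t" by (rule jw_mono [OF \<mu>]) (use that s t in auto)
      moreover have "jw r \<mu> t \<le> jw r \<mu> s" if "t \<le> s" by (rule jw_mono [OF \<mu>]) (use that s t in auto)
      ultimately show ?thesis using R s by (cases s t rule: linorder_cases) auto
    qed
    have irr: "\<not> R u u" using R by auto
    have "{t \<in> {1..r}. R s t \<and> i t = a} = ?U \<union> {t \<in> ?S. R s t}" using jw by blast
    moreover have "?U \<inter> {t \<in> ?S. R s t} = {}" using irr by auto
    ultimately show ?thesis by (simp add: card_Un_disjoint)
  qed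
  then have "(\<Sum>s\<in>?S. q ^ card {t \<in> {1..r}. R s t \<and> i t = a}) = (\<Sum>s\<in>?S. q ^ card ?U * q ^ card {t \<in> ?S. R s t})"
    by (intro sum.cong refl) (simp only: power_add)
  also have "\<dots> = q ^ card ?U * qsum (card ?S)"
    using rank_sum [OF _ R, of ?S] by (simp add: sum_distrib_left [symmetric])
  finally show ?thesis by (simp only: card_U)
qed

lemma mt_update:
  assumes "s \<in> {1..r}" "i s = a" "j s = u" "a \<noteq> b"
  shows "mt r (i(s := b)) j = mt r i j - E a u + E b u"
proof (intro ext)
  fix x y :: nat
  let ?M = "\<lambda>i. {p \<in> {1..r}. i p = x \<and> j p = y}"
  have fin: "finite (?M i)" for i :: "nat \<Rightarrow> nat" by simp
  have mem: "s \<in> ?M i \<longleftrightarrow> x = a \<and> y = u" "s \<in> ?M (i(s := b)) \<longleftrightarrow> x = b \<and> y = u" using assms by auto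
  have rest: "?M (i(s := b)) - {s} = ?M i - {s}" by auto
  have card: "card N = card (N - {s}) + (if s \<in> N then 1 else 0)" if "finite N" for N
    using card.remove [of N s] that by auto
  show "mt r (i(s := b)) j x y = (mt r i j - E a u + E b u) x y"
    using card [OF fin, of i] card [OF fin, of "i(s := b)"]
    unfolding rest mem mt_def E_def plus_fun_apply minus_apply by (simp split: if_splits)
qed

lemma mt_update_right:
  assumes "s \<in> {1..r}" "i s = b" "j s = u" "a \<noteq> b"
  shows "mt r j (i(s := a)) = mt r j i - E u b + E u a"
proof (intro ext)
  fix x y
  have "mt r j (i(s := a)) x y = (mt r i j - E b u + E a u) y x"
    using mt_update [of s r i b j u a] assms by (simp add: mt_swap [of r j])
  then show "mt r j (i(s := a)) x y = (mt r j i - E u b + E u a) x y"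
    by (simp add: mt_swap [of r j] E_def conj_commute)
qed

lemma words_update: "i \<in> words n r \<Longrightarrow> s \<in> {1..r} \<Longrightarrow> b \<in> {1..n} \<Longrightarrow> i(s := b) \<in> words n r"
  by (auto simp: words_def)

text \<open>Read at a word i whose type against the sorted word is B. Changing position s of i moves
  one unit of B within the column given by the sorted letter at s; grouping positions by this letter
  produces the powers of q and the quantum integers.\<close>

theorem cf_Gop_left:
  assumes root: "root_op R a b" and ab: "a \<in> {1..n}" "b \<in> {1..n}"
    and X: "X \<in> commutant n r" and B: "B \<in> Theta n r"
  shows "cf n r (\<lambda>f. Gop r R a b (X f)) B =
    (\<Sum>u | u \<in> {1..n} \<and> B a u > 0.
      q ^ (\<Sum>v | v \<in> {1..n} \<and> R u v. B a v) * qsum (B a u) * cf n r X (B - E a u + E b u))"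
proof -
  let ?\<mu> = "co n B"
  have \<mu>: "?\<mu> \<in> Lam n r" by (rule co_Lam [OF B])
  obtain i where i: "i \<in> words n r" "mt r i (jw r ?\<mu>) = B" using column_word [OF B] by blast
  have neq: "a \<noteq> b" using root by (auto simp: root_op_def)
  have Bc: "card {t \<in> {1..r}. i t = a \<and> jw r ?\<mu> t = v} = B a v" for v
    using fun_cong [OF fun_cong [OF i(2), of a], of v] by (simp add: mt_def)
  let ?w = "\<lambda>s. q ^ card {t \<in> {1..r}. R s t \<and> i t = a}"
  have "cf n r (\<lambda>f. Gop r R a b (X f)) B = Gop r R a b (X (single (jw r ?\<mu>) 1)) i"
    by (rule cf_eq [OF commutant_comp [OF Gop_commutant [OF root ab] X] B i])
  also have "\<dots> = (\<Sum>s\<in>{s \<in> {1..r}. i s = a}. ?w s * cf n r X (B - E a (jw r ?\<mu> s) + E b (jw r ?\<mu> s)))"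
    unfolding Gop_def
  proof (rule sum.cong)
    fix s assume s: "s \<in> {s \<in> {1..r}. i s = a}"
    then have "X (single (jw r ?\<mu>) 1) (i(s := b)) = cf n r X (mt r (i(s := b)) (jw r ?\<mu>))"
      using comm_column [OF X \<mu> words_update [OF i(1) _ ab(2)]] by simp
    also have "mt r (i(s := b)) (jw r ?\<mu>) = B - E a (jw r ?\<mu> s) + E b (jw r ?\<mu> s)"
      using mt_update [of s r i a "jw r ?\<mu>"] s neq i(2) by simp
    finally show "?w s * X (single (jw r ?\<mu>) 1) (i(s := b)) =
        ?w s * cf n r X (B - E a (jw r ?\<mu> s) + E b (jw r ?\<mu> s))" by (simp only:)
  qed simp
  also have "\<dots> = (\<Sum>u\<in>{1..n}. \<Sum>s\<in>{s \<in> {s \<in> {1..r}. i s = a}. jw r ?\<mu> s = u}.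
      ?w s * cf n r X (B - E a (jw r ?\<mu> s) + E b (jw r ?\<mu> s)))"
    by (rule sum.group [symmetric]) (use words_in [OF jw_words [OF \<mu>]] in auto)
  also have "\<dots> = (\<Sum>u\<in>{1..n}. (\<Sum>s\<in>{s \<in> {1..r}. i s = a \<and> jw r ?\<mu> s = u}. ?w s) * cf n r X (B - E a u + E b u))"
    unfolding sum_distrib_right by (intro sum.cong) auto
  also have "\<dots> = (\<Sum>u\<in>{1..n}. q ^ (\<Sum>v | v \<in> {1..n} \<and> R u v. B a v) * qsum (B a u) * cf n r X (B - E a u + E b u))"
    unfolding block_rank_sum [OF \<mu> root_op_order [OF root]] Bc ..
  also have "\<dots> = (\<Sum>u | u \<in> {1..n} \<and> B a u > 0.
      q ^ (\<Sum>v | v \<in> {1..n} \<and> R u v. B a v) * qsum (B a u) * cf n r X (B - E a u + E b u))"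
    by (rule sum.mono_neutral_right) (auto simp: qsum_def)
  finally show ?thesis .
qed

lemma ninv_update:
  assumes p: "p \<in> {1..r}"
  shows "ninv r (i(p := x)) = card {(c, d). 1 \<le> c \<and> c < d \<and> d \<le> r \<and> c \<noteq> p \<and> d \<noteq> p \<and> i d < i c}
    + card {s. 1 \<le> s \<and> s < p \<and> x < i s} + card {s. p < s \<and> s \<le> r \<and> i s < x}"
proof -
  let ?A = "{(c, d). 1 \<le> c \<and> c < d \<and> d \<le> r \<and> c \<noteq> p \<and> d \<noteq> p \<and> i d < i c}"
  let ?B = "{s. 1 \<le> s \<and> s < p \<and> x < i s}" and ?C = "{s. p < s \<and> s \<le> r \<and> i s < x}"
  let ?L = "{(c, d). 1 \<le> c \<and> c < d \<and> d \<le> r \<and> (i(p := x)) d < (i(p := x)) c}"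
  let ?B' = "(\<lambda>s. (s, p)) ` ?B" and ?C' = "(\<lambda>s. (p, s)) ` ?C"
  have "(c, d) \<in> ?L \<longleftrightarrow> (c, d) \<in> (?A \<union> ?B') \<union> ?C'" for c d
    using p by (cases "c = p"; cases "d = p") auto
  then have L: "?L = (?A \<union> ?B') \<union> ?C'"
    by (intro equalityI subrelI; simp only:)
  have fin: "finite ?A" "finite ?B'" "finite ?C'"
    by (rule finite_subset [of _ "{1..r} \<times> {1..r}"]; use p in auto)+
  have "?A \<inter> ?B' = {}" "(?A \<union> ?B') \<inter> ?C' = {}" by auto
  then have "card ?L = card ?A + card ?B' + card ?C'"
    unfolding L using fin by (simp only: card_Un_disjoint finite_Un simp_thms)
  moreover have "card ?B' = card ?B" "card ?C' = card ?C"
    by (auto intro!: card_image inj_onI)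
  ultimately show ?thesis unfolding ninv_def by (simp only:)
qed

text \<open>Replacing a letter by an adjacent one alters only comparisons with equal letters, either
  old or new. This converts the weights of \<open>Gop\<close>, which count the letter a, into
  weights that count the letter b in the original word.\<close>

lemma ninv_root:
  assumes root: "root_op R a b" and p: "p \<in> {1..r}" "i p = b"
  shows "ninv r (i(p := a)) + card {t \<in> {1..r}. R p t \<and> i t = a} =
    ninv r i + card {t \<in> {1..r}. R t p \<and> i t = b}"
proof -
  let ?l = "\<lambda>P. card {s. 1 \<le> s \<and> s < p \<and> P (i s)}" and ?g = "\<lambda>P. card {s. p < s \<and> s \<le> r \<and> P (i s)}"
  have l: "?l (\<lambda>y. m < y) = ?l (\<lambda>y. Suc m < y) + ?l (\<lambda>y. y = Suc m)" for m
  proof -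
    have eq: "{s. 1 \<le> s \<and> s < p \<and> m < i s} = {s. 1 \<le> s \<and> s < p \<and> Suc m < i s} \<union> {s. 1 \<le> s \<and> s < p \<and> i s = Suc m}"
      by auto
    show ?thesis unfolding eq by (rule card_Un_disjoint) auto
  qed
  have g: "?g (\<lambda>y. y < Suc m) = ?g (\<lambda>y. y < m) + ?g (\<lambda>y. y = m)" for m
  proof -
    have eq: "{s. p < s \<and> s \<le> r \<and> i s < Suc m} = {s. p < s \<and> s \<le> r \<and> i s < m} \<union> {s. p < s \<and> s \<le> r \<and> i s = m}"
      by auto
    show ?thesis unfolding eq by (rule card_Un_disjoint) auto
  qed
  have sets: "{t \<in> {1..r}. p < t \<and> i t = c} = {s. p < s \<and> s \<le> r \<and> i s = c}"
    "{t \<in> {1..r}. t < p \<and> i t = c} = {s. 1 \<le> s \<and> s < p \<and> i s = c}" for c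
    using p by auto
  have i: "ninv r i = ninv r (i(p := b))"
    unfolding p(2) [symmetric] fun_upd_triv ..
  show ?thesis
    using root unfolding root_op_def
  proof (elim disjE conjE)
    assume R: "R = (<)" "b = Suc a"
    show ?thesis
      unfolding i ninv_update [OF p(1)] R sets using l [of a] g [of a] by linarith
  next
    assume R: "R = (>)" "a = Suc b"
    show ?thesis
      unfolding i ninv_update [OF p(1)] R sets using l [of b] g [of b] by linarith
  qed
qed

text \<open>Read in the row of a sorted word, where \<open>comm_row_jw\<close> introduces a power of
  q for the inversions of i. \<open>ninv_root\<close> trades it for the same power at every summand;
  what is left is a block sum for the converse order.\<close>

theorem cf_Gop_right:
  assumes root: "root_op R a b" and ab: "a \<in> {1..n}" "b \<in> {1..n}"
    and X: "X \<in> commutant n r" and B: "B \<in> Theta n r"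
  shows "cf n r (\<lambda>f. X (Gop r R a b f)) B =
    (\<Sum>u | u \<in> {1..n} \<and> B u b > 0.
      q ^ (\<Sum>v | v \<in> {1..n} \<and> R v u. B v b) * qsum (B u b) * cf n r X (B - E u b + E u a))"
proof -
  let ?\<mu> = "ro n B" and ?T = "\<lambda>s t. R t s"
  have \<mu>: "?\<mu> \<in> Lam n r" by (rule ro_Lam [OF B])
  note jw = jw_words [OF \<mu>]
  obtain i where i: "i \<in> words n r" "mt r (jw r ?\<mu>) i = B" using row_word [OF B] by blast
  have neq: "a \<noteq> b" using root by (auto simp: root_op_def)
  have R: "R = (<) \<or> R = (>)" by (rule root_op_order [OF root])
  then have T: "?T = (<) \<or> ?T = (>)" by auto
  have irr: "\<not> R s s" for s using R by auto
  have Bc: "card {t \<in> {1..r}. i t = b \<and> jw r ?\<mu> t = v} = B v b" for v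
    using fun_cong [OF fun_cong [OF i(2), of v], of b] by (simp add: mt_def conj_commute)
  let ?c = "\<lambda>s. q ^ card {t \<in> {1..r}. R s t \<and> i t = a}"
  let ?w = "\<lambda>s. q ^ card {t \<in> {1..r}. R t s \<and> i t = b}"
  let ?P = "{s \<in> {1..r}. i s = b}"
  \<comment> \<open>Only words that become i after changing one letter a back to b contribute. The
    weight may be counted in i instead, because R is irreflexive and the words differ at s
    alone.\<close>
  have G: "Gop r R a b (single i 1) = (\<lambda>j. \<Sum>s\<in>?P. ?c s * single (i(s := a)) 1 j)"
  proof
    fix j
    have "Gop r R a b (single i 1) j =
        (\<Sum>s\<in>{1..r}. if j s = a then q ^ card {t \<in> {1..r}. R s t \<and> j t = a} * single i 1 (j(s := b)) else 0)"
      unfolding Gop_def by (rule sum.mono_neutral_cong_left) auto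
    also have "\<dots> = (\<Sum>s\<in>{1..r}. if i s = b then ?c s * single (i(s := a)) 1 j else 0)"
    proof (rule sum.cong)
      fix s
      show "(if j s = a then q ^ card {t \<in> {1..r}. R s t \<and> j t = a} * single i 1 (j(s := b)) else 0) =
          (if i s = b then ?c s * single (i(s := a)) 1 j else 0)"
      proof (cases "i s = b \<and> j = i(s := a)")
        case True
        then have "{t \<in> {1..r}. R s t \<and> j t = a} = {t \<in> {1..r}. R s t \<and> i t = a}"
          using irr by auto
        moreover have "j(s := b) = i" using True by auto
        ultimately show ?thesis using True by (simp add: single_def)
      next
        case False
        then have "\<not> (j s = a \<and> j(s := b) = i)" by auto
        then show ?thesis using False by (auto simp: single_def)
      qed
    qed simp
    also have "\<dots> = (\<Sum>s\<in>?P. ?c s * single (i(s := a)) 1 j)"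
      by (rule sum.mono_neutral_cong_right) auto
    finally show "Gop r R a b (single i 1) j = (\<Sum>s\<in>?P. ?c s * single (i(s := a)) 1 j)" .
  qed
  have upd: "i(s := a) \<in> words n r" if "s \<in> ?P" for s
    using that by (intro words_update [OF i(1) _ ab(1)]) auto
  have G_TS: "(\<lambda>j. ?c s * single (i(s := a)) 1 j) \<in> TS n r" if "s \<in> ?P" for s
    by (intro TS_scale TS_single upd that)
  \<comment> \<open>Row entries show a coefficient only together with this power of q; it is carried
    along on both sides and cancelled at the end.\<close>
  have "q ^ ninv r i * cf n r (\<lambda>f. X (Gop r R a b f)) B = X (Gop r R a b (single i 1)) (jw r ?\<mu>)"
    using comm_row_jw [OF commutant_comp [OF X Gop_commutant [OF root ab]] \<mu> i(1)] i(2) by simp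
  also have "\<dots> = (\<Sum>s\<in>?P. X (\<lambda>j. ?c s * single (i(s := a)) 1 j) (jw r ?\<mu>))"
    unfolding G by (subst comm_sum [OF X _ G_TS]) auto
  also have "\<dots> = (\<Sum>s\<in>?P. q ^ ninv r i * (?w s * cf n r X (B - E (jw r ?\<mu> s) b + E (jw r ?\<mu> s) a)))"
  proof (rule sum.cong)
    fix s assume s: "s \<in> ?P"
    have "X (\<lambda>j. ?c s * single (i(s := a)) 1 j) (jw r ?\<mu>) =
        ?c s * (q ^ ninv r (i(s := a)) * cf n r X (mt r (jw r ?\<mu>) (i(s := a))))"
      by (simp add: comm_scale [OF X] TS_single upd [OF s] comm_row_jw [OF X \<mu> upd [OF s]])
    also have "mt r (jw r ?\<mu>) (i(s := a)) = B - E (jw r ?\<mu> s) b + E (jw r ?\<mu> s) a"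
      using mt_update_right [of s r i b "jw r ?\<mu>"] s neq i(2) by simp
    also have "?c s * (q ^ ninv r (i(s := a)) * cf n r X (B - E (jw r ?\<mu> s) b + E (jw r ?\<mu> s) a)) =
        q ^ (ninv r (i(s := a)) + card {t \<in> {1..r}. R s t \<and> i t = a}) * cf n r X (B - E (jw r ?\<mu> s) b + E (jw r ?\<mu> s) a)"
      by (simp only: power_add mult_ac)
    also have "ninv r (i(s := a)) + card {t \<in> {1..r}. R s t \<and> i t = a} =
        ninv r i + card {t \<in> {1..r}. R t s \<and> i t = b}"
      by (rule ninv_root [OF root]) (use s in auto)
    finally show "X (\<lambda>j. ?c s * single (i(s := a)) 1 j) (jw r ?\<mu>) =
        q ^ ninv r i * (?w s * cf n r X (B - E (jw r ?\<mu> s) b + E (jw r ?\<mu> s) a))"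
      by (simp only: power_add mult_ac)
  qed simp
  also have "\<dots> = q ^ ninv r i * (\<Sum>s\<in>?P. ?w s * cf n r X (B - E (jw r ?\<mu> s) b + E (jw r ?\<mu> s) a))"
    by (simp only: sum_distrib_left)
  finally have "cf n r (\<lambda>f. X (Gop r R a b f)) B =
      (\<Sum>s\<in>?P. ?w s * cf n r X (B - E (jw r ?\<mu> s) b + E (jw r ?\<mu> s) a))"
    by simp
  also have "\<dots> = (\<Sum>u\<in>{1..n}. \<Sum>s\<in>{s \<in> ?P. jw r ?\<mu> s = u}.
      ?w s * cf n r X (B - E (jw r ?\<mu> s) b + E (jw r ?\<mu> s) a))"
    by (rule sum.group [symmetric]) (use words_in [OF jw] in auto)
  also have "\<dots> = (\<Sum>u\<in>{1..n}. (\<Sum>s\<in>{s \<in> {1..r}. i s = b \<and> jw r ?\<mu> s = u}. ?w s) * cf n r X (B - E u b + E u a))"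
    unfolding sum_distrib_right by (intro sum.cong) auto
  also have "\<dots> = (\<Sum>u\<in>{1..n}. q ^ (\<Sum>v | v \<in> {1..n} \<and> R v u. B v b) * qsum (B u b) * cf n r X (B - E u b + E u a))"
    unfolding block_rank_sum [OF \<mu> T] Bc ..
  also have "\<dots> = (\<Sum>u | u \<in> {1..n} \<and> B u b > 0.
      q ^ (\<Sum>v | v \<in> {1..n} \<and> R v u. B v b) * qsum (B u b) * cf n r X (B - E u b + E u a))"
    by (rule sum.mono_neutral_right) (auto simp: qsum_def)
  finally show ?thesis .
qed

subsection \<open>Generation\<close>

definition op_proj :: "nat \<Rightarrow> comp \<Rightarrow> tensor_op"
  where "op_proj r \<mu> = (\<lambda>f i. if ct r i = \<mu> then f i else 0)"

definition op_plus :: "tensor_op \<Rightarrow> tensor_op \<Rightarrow> tensor_op"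
  where "op_plus X Y = (\<lambda>f i. X f i + Y f i)"

definition op_scale :: "K \<Rightarrow> tensor_op \<Rightarrow> tensor_op"
  where "op_scale c X = (\<lambda>f i. c * X f i)"

text \<open>Each closure rule is one under which commuting with a fixed linear operator is
  inherited, so the criterion for centrality becomes an induction over this set.\<close>

inductive_set genalg :: "nat \<Rightarrow> nat \<Rightarrow> tensor_op set" for n r
  where gen: "root_op R a b \<Longrightarrow> a \<in> {1..n} \<Longrightarrow> b \<in> {1..n} \<Longrightarrow> Gop r R a b \<in> genalg n r"
  | proj: "op_proj r \<mu> \<in> genalg n r"
  | plus: "X \<in> genalg n r \<Longrightarrow> Y \<in> genalg n r \<Longrightarrow> op_plus X Y \<in> genalg n r"
  | scale: "X \<in> genalg n r \<Longrightarrow> op_scale c X \<in> genalg n r"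
  | comp: "X \<in> genalg n r \<Longrightarrow> Y \<in> genalg n r \<Longrightarrow> X \<circ> Y \<in> genalg n r"

lemma proj_commutant: "op_proj r \<mu> \<in> commutant n r"
  by (auto simp: op_proj_def commutant_def TS_def Rop_def fun_eq_iff ct_sw simp del: One_nat_def)

lemma genalg_commutant: "X \<in> genalg n r \<Longrightarrow> X \<in> commutant n r"
  by (induction rule: genalg.induct)
    (simp_all only: Gop_commutant proj_commutant op_plus_def op_scale_def comp_def
      commutant_plus commutant_scale commutant_comp)

lemma genalg_zero: "(\<lambda>f i. 0) \<in> genalg n r"
  using genalg.scale [OF genalg.proj, of 0] by (simp add: op_scale_def)

lemma genalg_sum: "(\<And>x. x \<in> S \<Longrightarrow> X x \<in> genalg n r) \<Longrightarrow> (\<lambda>f i. \<Sum>x\<in>S. X x f i) \<in> genalg n r"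
proof (induction S rule: infinite_finite_induct)
  case (insert x S)
  then have "op_plus (X x) (\<lambda>f i. \<Sum>x\<in>S. X x f i) \<in> genalg n r" by (intro genalg.plus) auto
  then show ?case using insert by (simp add: op_plus_def)
qed (simp_all add: genalg_zero)

lemma finite_Theta: "finite (Theta n r)"
proof -
  have "Theta n r \<subseteq> (\<lambda>(i, j). mt r i j) ` (words n r \<times> words n r)"
  proof
    fix A assume "A \<in> Theta n r"
    then obtain i j where "i \<in> words n r" "j \<in> words n r" "mt r i j = A" by (rule exists_words_of_type)
    then show "A \<in> (\<lambda>(i, j). mt r i j) ` (words n r \<times> words n r)" by force
  qed
  then show ?thesis by (rule finite_subset) (simp add: finite_words)
qed

text \<open>The distance of A from the diagonal. It is squared so that the decrease caused by moving
  a unit one row is a strictly monotone affine function of its column; this singles out one leading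
  term.\<close>

definition spread :: "nat \<Rightarrow> mat \<Rightarrow> int"
  where "spread n A = (\<Sum>s\<in>{1..n}. \<Sum>t\<in>{1..n}. int (A s t) * (int s - int t)\<^sup>2)"

lemma spread_nonneg: "0 \<le> spread n A"
  unfolding spread_def by (intro sum_nonneg) simp

lemma sum_E:
  assumes "finite S" "finite J" "a \<in> S" "u \<in> J"
  shows "(\<Sum>s\<in>S. \<Sum>t\<in>J. int (E a u s t) * f s t) = (f a u :: int)"
proof -
  have "(\<Sum>s\<in>S. \<Sum>t\<in>J. int (E a u s t) * f s t) = (\<Sum>s\<in>S. \<Sum>t\<in>J. if t = u then (if s = a then f a u else 0) else 0)"
    by (intro sum.cong refl) (auto simp: E_def)
  also have "\<dots> = f a u" using assms by simp
  finally show ?thesis .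
qed

lemma int_move:
  assumes "B a u > 0"
  shows "int ((B - E a u + E b v) s t) = int (B s t) - int (E a u s t) + int (E b v s t)"
  using assms by (auto simp: E_def)

lemma spread_move:
  assumes "a \<in> {1..n}" "b \<in> {1..n}" "u \<in> {1..n}" "B a u > 0"
  shows "spread n (B - E a u + E b u) = spread n B - (int a - int u)\<^sup>2 + (int b - int u)\<^sup>2"
proof -
  have "spread n (B - E a u + E b u) =
      spread n B - (\<Sum>s\<in>{1..n}. \<Sum>t\<in>{1..n}. int (E a u s t) * (int s - int t)\<^sup>2)
        + (\<Sum>s\<in>{1..n}. \<Sum>t\<in>{1..n}. int (E b u s t) * (int s - int t)\<^sup>2)"
    unfolding spread_def int_move [where B = B and a = a and u = u, OF assms(4)]
    by (simp add: algebra_simps sum.distrib sum_subtractf)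
  then show ?thesis using assms by (simp add: sum_E del: One_nat_def)
qed

lemma Theta_move:
  assumes "B \<in> Theta n r" "a \<in> {1..n}" "b \<in> {1..n}" "u \<in> {1..n}" "v \<in> {1..n}" "B a u > 0"
  shows "B - E a u + E b v \<in> Theta n r"
proof -
  let ?B = "B - E a u + E b v"
  have "int (\<Sum>i=1..n. \<Sum>j=1..n. ?B i j) = int (\<Sum>i=1..n. \<Sum>j=1..n. B i j)
      - (\<Sum>s\<in>{1..n}. \<Sum>t\<in>{1..n}. int (E a u s t) * 1) + (\<Sum>s\<in>{1..n}. \<Sum>t\<in>{1..n}. int (E b v s t) * 1)"
    unfolding of_nat_sum int_move [of B a u, OF assms(6)] by (simp add: sum.distrib sum_subtractf)
  also have "\<dots> = int (\<Sum>i=1..n. \<Sum>j=1..n. B i j)"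
    using assms sum_E [of "{1..n}" "{1..n}" _ _ "\<lambda>_ _. 1"] by (simp del: One_nat_def of_nat_sum)
  finally have "(\<Sum>i=1..n. \<Sum>j=1..n. ?B i j) = (\<Sum>i=1..n. \<Sum>j=1..n. B i j)" by (simp only: of_nat_eq_iff)
  then show ?thesis using assms by (auto simp: Theta_def E_def)
qed

definition has_elementary :: "nat \<Rightarrow> nat \<Rightarrow> mat \<Rightarrow> bool"
  where "has_elementary n r A \<longleftrightarrow> (\<exists>X\<in>genalg n r. \<forall>B\<in>Theta n r. cf n r X B = (if B = A then 1 else 0))"

text \<open>Gaussian elimination: the other terms of Y are subtracted by means of known elementary
  operators, and the result is divided by the coefficient at A, which uses the field K.\<close>

lemma has_elementary_triangular:
  assumes Y: "Y \<in> genalg n r" and A: "A \<in> Theta n r" "cf n r Y A \<noteq> 0"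
    and lower: "\<And>B. B \<in> Theta n r \<Longrightarrow> B \<noteq> A \<Longrightarrow> cf n r Y B \<noteq> 0 \<Longrightarrow> has_elementary n r B"
  shows "has_elementary n r A"
proof -
  let ?S = "{B \<in> Theta n r. B \<noteq> A \<and> cf n r Y B \<noteq> 0}"
  have "\<forall>B\<in>?S. \<exists>X. X \<in> genalg n r \<and> (\<forall>C\<in>Theta n r. cf n r X C = (if C = B then 1 else 0))"
    using lower unfolding has_elementary_def by blast
  from bchoice [OF this] obtain X where X: "\<And>B. B \<in> ?S \<Longrightarrow> X B \<in> genalg n r"
    "\<And>B C. B \<in> ?S \<Longrightarrow> C \<in> Theta n r \<Longrightarrow> cf n r (X B) C = (if C = B then 1 else 0)" by blast
  let ?Z = "\<lambda>f i. (1 / cf n r Y A) * (Y f i + (\<Sum>B\<in>?S. - cf n r Y B * X B f i))"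
  have "op_scale (1 / cf n r Y A) (op_plus Y (\<lambda>f i. \<Sum>B\<in>?S. op_scale (- cf n r Y B) (X B) f i)) \<in> genalg n r"
    by (intro genalg.scale genalg.plus Y genalg_sum X(1))
  then have "?Z \<in> genalg n r" by (simp only: op_scale_def op_plus_def)
  moreover have "cf n r ?Z C = (if C = A then 1 else 0)" if C: "C \<in> Theta n r" for C
  proof -
    have "cf n r ?Z C = (1 / cf n r Y A) * (cf n r Y C + (\<Sum>B\<in>?S. - cf n r Y B * cf n r (X B) C))"
      by (simp only: cf_scale cf_plus cf_sum)
    also have "(\<Sum>B\<in>?S. - cf n r Y B * cf n r (X B) C) = (\<Sum>B\<in>?S. if B = C then - cf n r Y C else 0)"
      by (rule sum.cong) (auto simp: X(2) C)
    also have "\<dots> = (if C \<in> ?S then - cf n r Y C else 0)"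
      using finite_Theta [of n r] by (simp add: sum.delta')
    also have "(1 / cf n r Y A) * (cf n r Y C + \<dots>) = (if C = A then 1 else 0)"
      using A(2) C by auto
    finally show ?thesis .
  qed
  ultimately show ?thesis unfolding has_elementary_def by blast
qed

text \<open>For diagonal A the only word of type A against the sorted word is the sorted word
  itself, so the weight projection has coefficient 1 at A and 0 elsewhere.\<close>

lemma has_elementary_diagonal:
  assumes A: "A \<in> Theta n r" and diag: "\<And>s t. s \<noteq> t \<Longrightarrow> A s t = 0"
  shows "has_elementary n r A"
proof -
  let ?\<mu> = "co n A"
  have diagonal_word: "i = jw r ?\<mu>" if i: "i \<in> words n r" "mt r i (jw r ?\<mu>) = A" for i
  proof
    fix p
    show "i p = jw r ?\<mu> p"
    proof (cases "p \<in> {1..r}")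
      case True
      show ?thesis
      proof (rule ccontr)
        assume "i p \<noteq> jw r ?\<mu> p"
        then have "A (i p) (jw r ?\<mu> p) = 0" by (rule diag)
        moreover have "A (i p) (jw r ?\<mu> p) = card {x \<in> {1..r}. i x = i p \<and> jw r ?\<mu> x = jw r ?\<mu> p}"
          using i(2) by (simp add: mt_def fun_eq_iff)
        ultimately show False using True by auto
      qed
    qed (simp add: words_out [OF i(1)] words_out [OF jw_words [OF co_Lam [OF A]]])
  qed
  have self: "mt r (jw r ?\<mu>) (jw r ?\<mu>) = A"
    using column_word [OF A] diagonal_word by blast
  let ?X = "op_proj r ?\<mu>"
  have "cf n r ?X B = (if B = A then 1 else 0)" if B: "B \<in> Theta n r" for B
  proof -
    let ?j = "jw r (co n B)"
    obtain i where i: "i \<in> words n r" "mt r i ?j = B" using column_word [OF B] by blast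
    have jB: "ct r ?j = co n B" by (rule ct_jw [OF co_Lam [OF B]])
    have cfB: "cf n r ?X B = (if ct r i = ?\<mu> then single ?j 1 i else 0)"
      unfolding cf_eq [OF proj_commutant B i] by (simp add: op_proj_def)
    show ?thesis
    proof (cases "i = ?j \<and> co n B = ?\<mu>")
      case True
      then have "mt r (jw r ?\<mu>) (jw r ?\<mu>) = B" using i(2) by metis
      then have "B = A" using self by (simp only:)
      then show ?thesis using cfB True jB by (simp add: single_def)
    next
      case False
      have "B \<noteq> A"
      proof
        assume BA: "B = A"
        then have "i = jw r ?\<mu>" using diagonal_word i by simp
        then show False using False BA by simp
      qed
      then show ?thesis using cfB False jB by (auto simp: single_def)
    qed
  qed
  moreover have "?X \<in> genalg n r" by (rule genalg.proj)
  ultimately show ?thesis unfolding has_elementary_def by blast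
qed

text \<open>Moving the unit towards the diagonal gives A', available by induction. Applying
  \<open>Gop\<close> to its elementary operator yields the matrices B obtained from A' by moving a
  unit back from row b to row a. A itself is the one for column u, and \<open>others\<close> makes
  the remaining ones closer to the diagonal.\<close>

lemma has_elementary_step:
  assumes A: "A \<in> Theta n r" and root: "root_op R a b"
    and mem: "a \<in> {1..n}" "b \<in> {1..n}" "u \<in> {1..n}" "A a u > 0"
    and closer: "(int b - int u)\<^sup>2 < (int a - int u)\<^sup>2"
    and others: "\<And>v. v \<in> {1..n} \<Longrightarrow> v \<noteq> u \<Longrightarrow> A b v > 0 \<Longrightarrow>
      (int a - int v)\<^sup>2 - (int b - int v)\<^sup>2 < (int a - int u)\<^sup>2 - (int b - int u)\<^sup>2"
    and IH: "\<And>B. B \<in> Theta n r \<Longrightarrow> spread n B < spread n A \<Longrightarrow> has_elementary n r B"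
  shows "has_elementary n r A"
proof -
  let ?A' = "A - E a u + E b u"
  have ab: "a \<noteq> b" using root by (auto simp: root_op_def)
  have spread': "spread n ?A' = spread n A - (int a - int u)\<^sup>2 + (int b - int u)\<^sup>2"
    by (rule spread_move) (use mem in auto)
  have A': "?A' \<in> Theta n r" by (rule Theta_move [OF A]) (use mem in auto)
  have "has_elementary n r ?A'" by (rule IH [OF A']) (use spread' closer in simp)
  then obtain X where X: "X \<in> genalg n r" "\<And>B. B \<in> Theta n r \<Longrightarrow> cf n r X B = (if B = ?A' then 1 else 0)"
    unfolding has_elementary_def by blast
  let ?Y = "\<lambda>f. Gop r R a b (X f)"
  have Y: "?Y \<in> genalg n r"
    using genalg.comp [OF genalg.gen [OF root mem(1,2)] X(1)] by (simp add: comp_def)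
  let ?q = "\<lambda>B v. q ^ (\<Sum>w | w \<in> {1..n} \<and> R v w. B a w) * qsum (B a v)"
  have cfY: "cf n r ?Y B = (\<Sum>v | v \<in> {1..n} \<and> B a v > 0. ?q B v * (if B - E a v + E b v = ?A' then 1 else 0))"
    if B: "B \<in> Theta n r" for B
    unfolding cf_Gop_left [OF root mem(1,2) genalg_commutant [OF X(1)] B]
    by (intro sum.cong refl arg_cong2 [where f = "(*)"] X(2) Theta_move [OF B]) (use mem in auto)
  \<comment> \<open>The entry at (b, v) reveals which unit was moved, so a single summand survives
    at A.\<close>
  have inj: "v = u" if "A - E a v + E b v = ?A'" "A a v > 0" for v
  proof (rule ccontr)
    assume "v \<noteq> u"
    then have "(A - E a v + E b v) b v = Suc (A b v)" "?A' b v = A b v" using ab by (auto simp: E_def)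
    then show False using that(1) by simp
  qed
  have "cf n r ?Y A = (\<Sum>v | v \<in> {1..n} \<and> A a v > 0. if v = u then ?q A u else 0)"
    unfolding cfY [OF A] by (rule sum.cong) (use inj in auto)
  also have "\<dots> = ?q A u" using mem by simp
  also have "\<dots> \<noteq> 0" using qsum_nonzero [OF mem(4)] by simp
  finally have nz: "cf n r ?Y A \<noteq> 0" .
  show ?thesis
  proof (rule has_elementary_triangular [OF Y A nz])
    fix B assume B: "B \<in> Theta n r" "B \<noteq> A" "cf n r ?Y B \<noteq> 0"
    obtain v where v: "v \<in> {1..n}" "B a v > 0" "B - E a v + E b v = ?A'"
      using B(3) unfolding cfY [OF B(1)] by (elim sum.not_neutral_contains_not_neutral) (auto split: if_splits)
    have "v \<noteq> u"
    proof
      assume "v = u"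
      have "B s t = A s t" for s t
        using fun_cong [OF fun_cong [OF v(3), of s], of t] v(2) mem(4) \<open>v = u\<close>
        by (auto simp: E_def split: if_splits)
      then show False using B(2) by (auto simp: fun_eq_iff)
    qed
    have "A b v > 0"
      using fun_cong [OF fun_cong [OF v(3), of b], of v] \<open>v \<noteq> u\<close> ab by (auto simp: E_def)
    have "spread n ?A' = spread n B - (int a - int v)\<^sup>2 + (int b - int v)\<^sup>2"
      unfolding v(3) [symmetric] by (rule spread_move) (use mem v in auto)
    then have "spread n B < spread n A"
      using spread' others [OF v(1) \<open>v \<noteq> u\<close> \<open>A b v > 0\<close>] by linarith
    then show "has_elementary n r B" by (rule IH [OF B(1)])
  qed
qed

text \<open>Among the columns meeting the strict upper triangle take the last one, among those meeting the
  strict lower triangle the first one: moving a unit one step towards the diagonal then produces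
  \<open>A\<close> as the term furthest from the diagonal.\<close>

theorem all_elementary: "A \<in> Theta n r \<Longrightarrow> has_elementary n r A"
proof (induction "nat (spread n A)" arbitrary: A rule: less_induct)
  case less
  note A = less.prems
  have IH: "has_elementary n r B" if "B \<in> Theta n r" "spread n B < spread n A" for B
    using less.hyps [OF _ that(1)] that(2) spread_nonneg [of n B] by simp
  have range: "s \<in> {1..n} \<and> t \<in> {1..n}" if "A s t > 0" for s t
  proof (rule ccontr)
    assume "\<not> (s \<in> {1..n} \<and> t \<in> {1..n})"
    then have "A s t = 0" using A unfolding Theta_def by blast
    then show False using that by simp
  qed
  let ?U = "{u. \<exists>h<u. A h u > 0}" and ?L = "{u. \<exists>h>u. A h u > 0}"
  have fin: "finite ?U" "finite ?L"
    by (rule finite_subset [of _ "{1..n}"]; use range in auto)+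
  show ?case
  proof (cases "?U = {}")
    case False
    define u where "u = Max ?U"
    have u: "u \<in> ?U" "\<And>v. v \<in> ?U \<Longrightarrow> v \<le> u"
      unfolding u_def by (rule Max_in [OF fin(1) False], rule Max_ge [OF fin(1)])
    then obtain h where h: "h < u" "A h u > 0" by auto
    have hr: "h \<in> {1..n}" "Suc h \<in> {1..n}" "u \<in> {1..n}" using range [OF h(2)] h(1) by auto
    show ?thesis
    proof (rule has_elementary_step [OF A, of "(<)" h "Suc h" u])
      show "(int (Suc h) - int u)\<^sup>2 < (int h - int u)\<^sup>2"
        using h(1) by (simp add: power2_eq_square algebra_simps)
      fix v assume v: "v \<noteq> u" "A (Suc h) v > 0"
      have "v < u"
      proof (rule ccontr)
        assume "\<not> v < u"
        then have "v > u" using v by simp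
        moreover from this have "v \<in> ?U" using v h(1) by (auto intro!: exI [of _ "Suc h"])
        ultimately show False using u(2) by fastforce
      qed
      then show "(int h - int v)\<^sup>2 - (int (Suc h) - int v)\<^sup>2 < (int h - int u)\<^sup>2 - (int (Suc h) - int u)\<^sup>2"
        by (simp add: power2_eq_square algebra_simps)
    qed (use hr h IH in \<open>auto simp: root_op_def\<close>)
  next
    case noU: True
    show ?thesis
    proof (cases "?L = {}")
      case False
      define u where "u = Min ?L"
      have u: "u \<in> ?L" "\<And>v. v \<in> ?L \<Longrightarrow> u \<le> v"
        unfolding u_def by (rule Min_in [OF fin(2) False], rule Min_le [OF fin(2)])
      then obtain h' where h': "h' > u" "A h' u > 0" by auto
      then obtain h where h: "h' = Suc h" "u \<le> h" by (metis Suc_le_D Suc_le_mono less_eq_Suc_le)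
      have hr: "h \<in> {1..n}" "Suc h \<in> {1..n}" "u \<in> {1..n}" using range [OF h'(2)] h by auto
      show ?thesis
      proof (rule has_elementary_step [OF A, of "(>)" "Suc h" h u])
        show "(int h - int u)\<^sup>2 < (int (Suc h) - int u)\<^sup>2"
          using h by (simp add: power2_eq_square algebra_simps)
        fix v assume v: "v \<noteq> u" "A h v > 0"
        have "v > u"
        proof (rule ccontr)
          assume "\<not> v > u"
          then have "v < u" using v by simp
          moreover from this have "v \<in> ?L" using v h by (auto intro!: exI [of _ h])
          ultimately show False using u(2) by fastforce
        qed
        then show "(int (Suc h) - int v)\<^sup>2 - (int h - int v)\<^sup>2 < (int (Suc h) - int u)\<^sup>2 - (int h - int u)\<^sup>2"
          by (simp add: power2_eq_square algebra_simps)
      qed (use hr h h' IH in \<open>auto simp: root_op_def\<close>)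
    next
      case True
      have "A s t = 0" if "s \<noteq> t" for s t
      proof (cases "s < t")
        case True
        then show ?thesis using noU by auto
      next
        case False
        then have "t < s" using that by simp
        then show ?thesis using \<open>?L = {}\<close> by auto
      qed
      then show ?thesis by (rule has_elementary_diagonal [OF A])
    qed
  qed
qed

subsection \<open>Integral structure\<close>

definition elem :: "nat \<Rightarrow> nat \<Rightarrow> mat \<Rightarrow> tensor_op"
  where "elem n r A = (SOME X. X \<in> genalg n r \<and> (\<forall>B\<in>Theta n r. cf n r X B = (if B = A then 1 else 0)))"

lemma elem_props:
  assumes "A \<in> Theta n r"
  shows "elem n r A \<in> genalg n r" "B \<in> Theta n r \<Longrightarrow> cf n r (elem n r A) B = (if B = A then 1 else 0)"
proof -
  have "\<exists>X. X \<in> genalg n r \<and> (\<forall>B\<in>Theta n r. cf n r X B = (if B = A then 1 else 0))"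
    using all_elementary [OF assms] unfolding has_elementary_def by blast
  from someI_ex [OF this]
  have *: "elem n r A \<in> genalg n r \<and> (\<forall>B\<in>Theta n r. cf n r (elem n r A) B = (if B = A then 1 else 0))"
    unfolding elem_def .
  show "elem n r A \<in> genalg n r" using * ..
  show "B \<in> Theta n r \<Longrightarrow> cf n r (elem n r A) B = (if B = A then 1 else 0)" using * by blast
qed

lemma elem_commutant: "A \<in> Theta n r \<Longrightarrow> elem n r A \<in> commutant n r"
  by (rule genalg_commutant [OF elem_props(1)])

definition comb :: "nat \<Rightarrow> nat \<Rightarrow> (mat \<Rightarrow> K) \<Rightarrow> tensor_op"
  where "comb n r c = (\<lambda>f i. \<Sum>A\<in>Theta n r. c A * elem n r A f i)"

lemma comb_commutant: "comb n r c \<in> commutant n r"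
  unfolding comb_def by (intro commutant_sum commutant_scale elem_commutant)

lemma cf_comb: "B \<in> Theta n r \<Longrightarrow> cf n r (comb n r c) B = c B"
proof -
  assume B: "B \<in> Theta n r"
  have "cf n r (comb n r c) B = (\<Sum>A\<in>Theta n r. c A * cf n r (elem n r A) B)"
    unfolding comb_def by (simp only: cf_sum cf_scale)
  also have "\<dots> = (\<Sum>A\<in>Theta n r. if A = B then c B else 0)"
    by (rule sum.cong) (auto simp: elem_props(2) B)
  also have "\<dots> = c B" using B by (simp add: finite_Theta)
  finally show ?thesis .
qed

lemma comm_eq_comb:
  assumes "X \<in> commutant n r" "f \<in> TS n r"
  shows "X f = comb n r (cf n r X) f"
  by (rule comm_ext [OF assms(1) comb_commutant _ assms(2)]) (simp add: cf_comb)

definition LTS :: "nat \<Rightarrow> nat \<Rightarrow> ((nat \<Rightarrow> nat) \<Rightarrow> K) set"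
  where "LTS n r = {f \<in> TS n r. \<forall>i. f i \<in> laurent}"

lemma LTS_TS: "f \<in> LTS n r \<Longrightarrow> f \<in> TS n r"
  by (simp add: LTS_def)

lemma LTS_single: "i \<in> words n r \<Longrightarrow> single i 1 \<in> LTS n r"
  by (simp add: LTS_def TS_single, simp add: single_def)

lemma comm_laurent:
  assumes X: "X \<in> commutant n r" and c: "\<And>A. A \<in> Theta n r \<Longrightarrow> cf n r X A \<in> laurent" and f: "f \<in> LTS n r"
  shows "X f \<in> LTS n r"
proof -
  have single: "\<forall>k. X (single j 1) k \<in> laurent" if "j \<in> words n r" for j
    using that
  proof (induction rule: words_induct)
    case (sorted \<mu>)
    show ?case
    proof
      fix k
      show "X (single (jw r \<mu>) 1) k \<in> laurent"
      proof (cases "k \<in> words n r")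
        case True
        then show ?thesis by (simp add: comm_column [OF X sorted] c mt_Theta jw_words [OF sorted])
      next
        case False
        then show ?thesis using comm_TS [OF X TS_single [OF jw_words [OF sorted]]] by (simp add: TS_def)
      qed
    qed
  next
    case (step j p)
    show ?case
      using comm_Rop [OF X TS_single [OF step(2)] step(3), of 1] step(5)
        Rop_laurent [of "X (single (sw p j) 1)" p]
      by (simp add: Rop_single [of j p, OF step(4)])
  qed
  have "X f k \<in> laurent" for k
    unfolding comm_expand [OF X LTS_TS [OF f]]
    by (intro laurent.C_sum laurent.C_mult) (use f single in \<open>auto simp: LTS_def\<close>)
  then show ?thesis using comm_TS [OF X LTS_TS [OF f]] by (simp add: LTS_def)
qed

lemma hact_TS: "h \<in> carrier (hecke r) \<Longrightarrow> f \<in> TS n r \<Longrightarrow> hact r h f \<in> TS n r"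
  and hact_comm: "h \<in> carrier (hecke r) \<Longrightarrow> f \<in> TS n r \<Longrightarrow> X \<in> commutant n r \<Longrightarrow> X (hact r h f) = hact r h (X f)"
proof -
  have add: "hact r (hecke_class r (single u x) \<oplus>\<^bsub>hecke r\<^esub> h) f = (\<lambda>w. x * fold Rop u f w + hact r h f w)"
    if "u \<in> lists {1..<r}" "x \<in> laurent" "h \<in> carrier (hecke r)" for u x h f
    using that by (simp add: hact_add hact_word hecke_class_closed single_hecke_free)
  have fold_TS: "fold Rop u f \<in> TS n r" if "u \<in> lists {1..<r}" "f \<in> TS n r" for u f
    using that
  proof (induction u arbitrary: f)
    case (Cons p u)
    then have "Rop p f \<in> TS n r" by (intro TS_Rop) auto
    with Cons show ?case by simp
  qed simp
  have fold_comm: "X (fold Rop u f) = fold Rop u (X f)" if "u \<in> lists {1..<r}" "f \<in> TS n r" "X \<in> commutant n r" for u f X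
    using that(1,2)
  proof (induction u arbitrary: f)
    case (Cons p u)
    then show ?case using comm_Rop [OF that(3), of f p] TS_Rop [of f n r p] by simp
  qed simp
  show TS: "hact r h f \<in> TS n r" if "h \<in> carrier (hecke r)" "f \<in> TS n r" for h f
    using that(1)
    by (induction rule: hecke_induct)
      (simp_all add: hact_zero TS_zero add TS_plus TS_scale fold_TS that(2) del: in_lists_conv_set)
  show "X (hact r h f) = hact r h (X f)" if "h \<in> carrier (hecke r)" "f \<in> TS n r" "X \<in> commutant n r" for X h f
    using that(1)
    by (induction rule: hecke_induct)
      (simp_all add: hact_zero comm_zero [OF that(3)] add comm_plus [OF that(3)] comm_scale [OF that(3)]
        TS_scale fold_TS fold_comm TS that(2,3) del: in_lists_conv_set)
qed

lemma hact_one: "hact r \<one>\<^bsub>hecke r\<^esub> f = f"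
  using hact_scalar [OF laurent.C_one, of r f] by (simp add: scalar_one)

lemma word_generated:
  assumes "i \<in> words n r"
  shows "\<exists>h\<in>carrier (hecke r). hact r h (single (jw r (ct r i)) 1) = single i 1"
  using assms
proof (induction rule: words_induct)
  interpret H: ring "hecke r" by (rule hecke_ring)
  case (sorted \<mu>)
  then show ?case by (intro bexI [of _ "\<one>\<^bsub>hecke r\<^esub>"]) (simp_all add: hact_one ct_jw)
next
  interpret H: ring "hecke r" by (rule hecke_ring)
  case (step i p)
  note p = step(3)
  obtain h where h: "h \<in> carrier (hecke r)" "hact r h (single (jw r (ct r i)) 1) = single (sw p i) 1"
    using step(5) by (auto simp only: ct_sw [OF p])
  show ?case
  proof
    show "h \<otimes>\<^bsub>hecke r\<^esub> hecke_gen r p \<in> carrier (hecke r)" using h p by (intro H.m_closed hecke_gen_closed)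
    show "hact r (h \<otimes>\<^bsub>hecke r\<^esub> hecke_gen r p) (single (jw r (ct r i)) 1) = single i 1"
      unfolding hact_mult [OF h(1) hecke_gen_closed [OF p]] h(2) hact_gen [OF p]
      by (rule Rop_single [of i p, OF step(4)])
  qed
qed

text \<open>The delta functions of a given content are all reached from the sorted one; scaling and
  adding them gives every Laurent function of that content. This becomes the surjectivity of the
  identification with x_mu H.\<close>

lemma weight_space_cyclic:
  assumes g: "g \<in> LTS n r"
  shows "\<exists>h\<in>carrier (hecke r). hact r h (single (jw r \<mu>) 1) = (\<lambda>i. if ct r i = \<mu> then g i else 0)"
proof -
  interpret H: ring "hecke r" by (rule hecke_ring)
  have "\<exists>h\<in>carrier (hecke r). hact r h (single (jw r \<mu>) 1) = (\<lambda>i. if i \<in> J then g i else 0)"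
    if "finite J" "J \<subseteq> {i \<in> words n r. ct r i = \<mu>}" for J
    using that
  proof (induction J rule: finite_induct)
    case empty
    show ?case by (rule bexI [of _ "\<zero>\<^bsub>hecke r\<^esub>"]) (simp_all add: hact_zero)
  next
    case (insert j J)
    then obtain h where h: "h \<in> carrier (hecke r)" "hact r h (single (jw r \<mu>) 1) = (\<lambda>i. if i \<in> J then g i else 0)"
      by auto
    have gj: "g j \<in> laurent" using g by (simp add: LTS_def)
    obtain k where k: "k \<in> carrier (hecke r)" "hact r k (single (jw r \<mu>) 1) = single j 1"
      using word_generated [of j n r] insert.prems by auto
    note s = hecke_scalar_closed [OF gj, of r]
    show ?case
    proof (rule bexI)
      show "k \<otimes>\<^bsub>hecke r\<^esub> hecke_scalar r (g j) \<oplus>\<^bsub>hecke r\<^esub> h \<in> carrier (hecke r)" using h k s by simp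
      show "hact r (k \<otimes>\<^bsub>hecke r\<^esub> hecke_scalar r (g j) \<oplus>\<^bsub>hecke r\<^esub> h) (single (jw r \<mu>) 1) =
          (\<lambda>i. if i \<in> insert j J then g i else 0)"
        unfolding hact_add [OF H.m_closed [OF k(1) s] h(1)] hact_mult [OF k(1) s] k(2) hact_scalar [OF gj] h(2)
        using insert.hyps(2) by (auto simp: single_def)
    qed
  qed
  from this [of "{i \<in> words n r. ct r i = \<mu>}"] obtain h where
    h: "h \<in> carrier (hecke r)"
      "hact r h (single (jw r \<mu>) 1) = (\<lambda>i. if i \<in> {i \<in> words n r. ct r i = \<mu>} then g i else 0)"
    using finite_words [of n r] by auto
  have "(\<lambda>i. if i \<in> {i \<in> words n r. ct r i = \<mu>} then g i else 0) = (\<lambda>i. if ct r i = \<mu> then g i else 0)"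
    using g by (auto simp: LTS_def TS_def)
  then show ?thesis using h by auto
qed

text \<open>The weight projection fixes the delta function at the sorted word and commutes with the
  Hecke action.\<close>

lemma weight_support:
  assumes h: "h \<in> carrier (hecke r)" and \<mu>: "\<mu> \<in> Lam n r" and i: "ct r i \<noteq> \<mu>"
  shows "hact r h (single (jw r \<mu>) 1) i = 0"
proof -
  let ?d = "single (jw r \<mu>) 1"
  have "op_proj r \<mu> ?d = ?d"
    using ct_jw [OF \<mu>] by (auto simp: op_proj_def single_def)
  then have "op_proj r \<mu> (hact r h ?d) = hact r h ?d"
    using hact_comm [OF h TS_single [OF jw_words [OF \<mu>]] proj_commutant, of \<mu> 1] by simp
  then show ?thesis using i by (metis op_proj_def)
qed

section \<open>The module \<open>\<Oplus> x\<^sub>\<mu> \<H>\<close> as tensor space\<close>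

definition pull :: "nat \<Rightarrow> comp \<Rightarrow> ((nat \<Rightarrow> nat) \<Rightarrow> K) \<Rightarrow> (nat \<Rightarrow> nat) \<Rightarrow> K"
  where "pull r \<mu> g w = (if w permutes {1..r} then g (jw r \<mu> \<circ> w) else 0)"

text \<open>An ascent or descent of w may become a pair of equal letters. This is consistent because
  on equal letters both branches of \<open>Rop\<close> reduce to multiplication by q, the value that
  its first case prescribes.\<close>

lemma Rop_pull:
  assumes \<mu>: "\<mu> \<in> Lam n r" and p: "p \<in> {1..<r}"
  shows "Rop p (pull r \<mu> g) = pull r \<mu> (Rop p g)"
proof
  fix w
  show "Rop p (pull r \<mu> g) w = pull r \<mu> (Rop p g) w"
  proof (cases "w permutes {1..r}")
    case False
    then show ?thesis using sw_permutes_iff [OF p] by (simp add: Rop_def pull_def)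
  next
    case w: True
    have sw: "sw p w permutes {1..r}" by (rule sw_permutes [OF p w])
    have in_range: "w p \<in> {1..r}" "w (Suc p) \<in> {1..r}" using permutes_in_image [OF w] p by auto
    let ?i = "jw r \<mu> \<circ> w"
    have i: "?i p = jw r \<mu> (w p)" "?i (Suc p) = jw r \<mu> (w (Suc p))" by simp_all
    consider "w p < w (Suc p)" | "w (Suc p) < w p" using permutes_adjacent_neq [OF w, of p] by linarith
    then show ?thesis
    proof cases
      case 1
      then have "?i p \<le> ?i (Suc p)" using in_range by (auto intro!: jw_mono [OF \<mu>])
      then have "Rop p g ?i = q * g (sw p ?i)"
      proof (cases "?i p = ?i (Suc p)")
        case True
        then have "Rop p g ?i = q * g ?i" by (simp add: Rop_def)
        then show ?thesis unfolding sw_id [of ?i p, OF True] .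
      qed (simp add: Rop_def)
      then show ?thesis using 1 w sw by (simp add: Rop_def [of p "pull r \<mu> g"] pull_def sw_comp)
    next
      case 2
      then have "?i (Suc p) \<le> ?i p" using in_range by (auto intro!: jw_mono [OF \<mu>])
      then have "Rop p g ?i = g (sw p ?i) + (q - 1) * g ?i"
      proof (cases "?i p = ?i (Suc p)")
        case True
        then have "Rop p g ?i = q * g ?i" by (simp add: Rop_def)
        also have "\<dots> = g (sw p ?i) + (q - 1) * g ?i" unfolding sw_id [of ?i p, OF True] by (simp add: algebra_simps)
        finally show ?thesis .
      qed (simp add: Rop_def)
      then show ?thesis using 2 w sw by (simp add: Rop_def [of p "pull r \<mu> g"] pull_def sw_comp)
    qed
  qed
qed

lemma hact_pull:
  assumes h: "h \<in> carrier (hecke r)" and \<mu>: "\<mu> \<in> Lam n r"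
  shows "hact r h (pull r \<mu> g) = pull r \<mu> (hact r h g)"
proof -
  have fold: "fold Rop u (pull r \<mu> g) = pull r \<mu> (fold Rop u g)" if "u \<in> lists {1..<r}" for u g
    using that by (induction u arbitrary: g) (auto simp: Rop_pull [OF \<mu>])
  show ?thesis using h
  proof (induction rule: hecke_induct)
    case zero
    show ?case by (simp add: hact_zero pull_def fun_eq_iff)
  next
    case (add u x h)
    have c: "hecke_class r (single u x) \<in> carrier (hecke r)" by (intro hecke_class_closed single_hecke_free add)
    show ?case
      unfolding hact_add [OF c add(3)] hact_word [OF add(1,2)] add(4) fold [OF add(1)]
      by (simp add: pull_def fun_eq_iff)
  qed
qed

text \<open>The Young subgroup is the stabiliser of the sorted word, so its indicator function is
  the pullback of a delta function.\<close>

lemma x_elem_props: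
  assumes \<mu>: "\<mu> \<in> Lam n r"
  shows "x_elem n r \<mu> \<in> carrier (hecke r)" "ev r (x_elem n r \<mu>) = pull r \<mu> (single (jw r \<mu>) 1)"
proof -
  have fin: "finite (young n r \<mu>)"
    by (rule finite_subset [OF _ finite_permutations [of "{1..r}"]]) (auto simp: young_def)
  have perm: "w permutes {1..r}" if "w \<in> young n r \<mu>" for w using that by (simp add: young_def)
  have *: "T_sum r (young n r \<mu>) \<in> carrier (hecke r) \<and>
      ev r (T_sum r (young n r \<mu>)) = (\<lambda>w. if w \<in> young n r \<mu> then 1 else 0)"
    by (rule ev_T_sum [OF fin perm])
  then show "x_elem n r \<mu> \<in> carrier (hecke r)" by (simp add: x_elem_def)
  have "(\<lambda>w. if w \<in> young n r \<mu> then 1 else 0) = pull r \<mu> (single (jw r \<mu>) 1)"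
    by (intro ext) (simp add: pull_def single_def young_iff [OF \<mu>])
  then show "ev r (x_elem n r \<mu>) = pull r \<mu> (single (jw r \<mu>) 1)"
    using * by (simp only: x_elem_def)
qed

lemma x_mult_props:
  assumes \<mu>: "\<mu> \<in> Lam n r" and h: "h \<in> carrier (hecke r)"
  shows "x_elem n r \<mu> \<otimes>\<^bsub>hecke r\<^esub> h \<in> carrier (hecke r)"
    "ev r (x_elem n r \<mu> \<otimes>\<^bsub>hecke r\<^esub> h) = pull r \<mu> (hact r h (single (jw r \<mu>) 1))"
proof -
  interpret H: ring "hecke r" by (rule hecke_ring)
  show "x_elem n r \<mu> \<otimes>\<^bsub>hecke r\<^esub> h \<in> carrier (hecke r)" using x_elem_props(1) [OF \<mu>] h by simp
  show "ev r (x_elem n r \<mu> \<otimes>\<^bsub>hecke r\<^esub> h) = pull r \<mu> (hact r h (single (jw r \<mu>) 1))"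
    unfolding ev_mult [OF x_elem_props(1) [OF \<mu>] h] x_elem_props(2) [OF \<mu>] by (rule hact_pull [OF h \<mu>])
qed

text \<open>The component belonging to the content of i is read at some permutation that carries the
  sorted word to i.\<close>

definition vec :: "nat \<Rightarrow> nat \<Rightarrow> mod_elem \<Rightarrow> (nat \<Rightarrow> nat) \<Rightarrow> K"
  where "vec n r m i =
    (if i \<in> words n r then ev r (m (ct r i)) (SOME w. w permutes {1..r} \<and> i = jw r (ct r i) \<circ> w) else 0)"

lemma vec_TS: "vec n r m \<in> TS n r"
  by (simp add: TS_def vec_def)

lemma qmod_component:
  assumes "m \<in> qmod n r" "\<mu> \<in> Lam n r"
  obtains h where "h \<in> carrier (hecke r)" "m \<mu> = x_elem n r \<mu> \<otimes>\<^bsub>hecke r\<^esub> h"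
  using PiE_mem [OF assms(1) [unfolded qmod_def] assms(2)] by blast

lemma qmod_carrier: "m \<in> qmod n r \<Longrightarrow> \<mu> \<in> Lam n r \<Longrightarrow> m \<mu> \<in> carrier (hecke r)"
  by (metis qmod_component x_mult_props(1))

lemma vec_unique:
  assumes "\<And>\<mu>. \<mu> \<in> Lam n r \<Longrightarrow> ev r (m \<mu>) = pull r \<mu> (g \<mu>)"
  shows "vec n r m = (\<lambda>i. if i \<in> words n r then g (ct r i) i else 0)"
proof
  fix i
  show "vec n r m i = (if i \<in> words n r then g (ct r i) i else 0)"
  proof (cases "i \<in> words n r")
    case True
    let ?w = "SOME w. w permutes {1..r} \<and> i = jw r (ct r i) \<circ> w"
    have w: "?w permutes {1..r} \<and> i = jw r (ct r i) \<circ> ?w"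
      by (rule someI_ex [OF word_permutation [OF True]])
    have "ev r (m (ct r i)) ?w = g (ct r i) (jw r (ct r i) \<circ> ?w)"
      using assms [OF ct_Lam [OF True]] conjunct1 [OF w] by (simp add: pull_def)
    also have "jw r (ct r i) \<circ> ?w = i" using w by simp
    finally show ?thesis unfolding vec_def by (simp only: True if_True)
  qed (simp add: vec_def)
qed

lemma pull_words_cong:
  assumes "\<mu> \<in> Lam n r" "\<And>i. i \<in> words n r \<Longrightarrow> ct r i = \<mu> \<Longrightarrow> g i = g' i"
  shows "pull r \<mu> g = pull r \<mu> g'"
proof
  fix w
  show "pull r \<mu> g w = pull r \<mu> g' w"
  proof (cases "w permutes {1..r}")
    case True
    then have "g (jw r \<mu> \<circ> w) = g' (jw r \<mu> \<circ> w)"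
      using assms(2) comp_words [OF jw_words [OF assms(1)] True] ct_comp [OF True] ct_jw [OF assms(1)] by simp
    then show ?thesis by (simp add: pull_def)
  qed (simp add: pull_def)
qed

text \<open>Coordinates of elements of x_mu H are pullbacks and hence depend on a permutation w only
  through the word j_mu w. Thus the choice made in \<open>vec\<close> is immaterial.\<close>

lemma ev_qmod:
  assumes m: "m \<in> qmod n r" and \<mu>: "\<mu> \<in> Lam n r"
  shows "ev r (m \<mu>) = pull r \<mu> (vec n r m)"
proof -
  have "\<exists>g. ev r (m \<nu>) = pull r \<nu> g" if "\<nu> \<in> Lam n r" for \<nu>
    using x_mult_props(2) [OF that] by (metis qmod_component [OF m that])
  then obtain g where g: "\<And>\<nu>. \<nu> \<in> Lam n r \<Longrightarrow> ev r (m \<nu>) = pull r \<nu> (g \<nu>)" by metis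
  have "pull r \<mu> (g \<mu>) = pull r \<mu> (vec n r m)"
    by (rule pull_words_cong [OF \<mu>]) (simp add: vec_unique [OF g])
  then show ?thesis using g [OF \<mu>] by simp
qed

lemma qmod_extensional: "m \<in> qmod n r \<Longrightarrow> m \<in> extensional (Lam n r)"
  by (auto simp: qmod_def PiE_def)

text \<open>Coordinates decide equality in each component. This permits a comparison with a
  candidate whose membership in the module has not been established.\<close>

lemma qmod_eqI:
  assumes "m \<in> qmod n r" "m' \<in> extensional (Lam n r)"
    and "\<And>\<mu>. \<mu> \<in> Lam n r \<Longrightarrow> m' \<mu> \<in> carrier (hecke r) \<and> ev r (m' \<mu>) = pull r \<mu> (vec n r m)"
  shows "m' = m"
proof (rule extensionalityI [OF assms(2) qmod_extensional [OF assms(1)]])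
  fix \<mu> assume \<mu>: "\<mu> \<in> Lam n r"
  show "m' \<mu> = m \<mu>"
    by (rule ev_inj) (use assms(3) [OF \<mu>] qmod_carrier [OF assms(1) \<mu>] ev_qmod [OF assms(1) \<mu>] in auto)
qed

lemma vec_inj: "m \<in> qmod n r \<Longrightarrow> m' \<in> qmod n r \<Longrightarrow> vec n r m = vec n r m' \<Longrightarrow> m = m'"
  by (rule qmod_eqI) (auto simp: qmod_extensional qmod_carrier ev_qmod)

lemma vec_LTS: "m \<in> qmod n r \<Longrightarrow> vec n r m \<in> LTS n r"
proof -
  assume m: "m \<in> qmod n r"
  have "vec n r m i \<in> laurent" for i
    unfolding vec_def using ev_laurent [OF qmod_carrier [OF m ct_Lam]] by simp
  then show ?thesis by (simp add: LTS_def vec_TS)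
qed

lemma vec_surj:
  assumes g: "g \<in> LTS n r"
  shows "\<exists>m\<in>qmod n r. vec n r m = g"
proof -
  have "\<forall>\<mu>. \<exists>h. h \<in> carrier (hecke r) \<and> hact r h (single (jw r \<mu>) 1) = (\<lambda>i. if ct r i = \<mu> then g i else 0)"
    using weight_space_cyclic [OF g] by blast
  from choice [OF this] obtain h where h: "\<And>\<mu>. h \<mu> \<in> carrier (hecke r)"
    "\<And>\<mu>. hact r (h \<mu>) (single (jw r \<mu>) 1) = (\<lambda>i. if ct r i = \<mu> then g i else 0)" by blast
  let ?m = "\<lambda>\<mu>\<in>Lam n r. x_elem n r \<mu> \<otimes>\<^bsub>hecke r\<^esub> h \<mu>"
  have "?m \<in> qmod n r" unfolding qmod_def using h(1) by auto
  moreover have "vec n r ?m = g"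
  proof -
    have "vec n r ?m = (\<lambda>i. if i \<in> words n r then hact r (h (ct r i)) (single (jw r (ct r i)) 1) i else 0)"
      by (rule vec_unique [where g = "\<lambda>\<mu>. hact r (h \<mu>) (single (jw r \<mu>) 1)"]) (simp add: x_mult_props(2) h(1))
    also have "\<dots> = g" using g by (auto simp: h(2) LTS_def TS_def)
    finally show ?thesis .
  qed
  ultimately show ?thesis by blast
qed

lemma vec_words: "(\<lambda>i. if i \<in> words n r then g i else 0) = g" if "g \<in> TS n r"
  using that by (auto simp: TS_def)

lemma qmod_add_props:
  assumes m: "m \<in> qmod n r" "m' \<in> qmod n r"
  shows "qmod_add n r m m' \<in> qmod n r" "vec n r (qmod_add n r m m') = (\<lambda>i. vec n r m i + vec n r m' i)"
proof -
  interpret H: ring "hecke r" by (rule hecke_ring)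
  have "\<exists>h\<in>carrier (hecke r). m \<mu> \<oplus>\<^bsub>hecke r\<^esub> m' \<mu> = x_elem n r \<mu> \<otimes>\<^bsub>hecke r\<^esub> h" if \<mu>: "\<mu> \<in> Lam n r" for \<mu>
  proof -
    obtain h h' where h: "h \<in> carrier (hecke r)" "m \<mu> = x_elem n r \<mu> \<otimes>\<^bsub>hecke r\<^esub> h"
      "h' \<in> carrier (hecke r)" "m' \<mu> = x_elem n r \<mu> \<otimes>\<^bsub>hecke r\<^esub> h'"
      using qmod_component [OF m(1) \<mu>] qmod_component [OF m(2) \<mu>] by metis
    then have "m \<mu> \<oplus>\<^bsub>hecke r\<^esub> m' \<mu> = x_elem n r \<mu> \<otimes>\<^bsub>hecke r\<^esub> (h \<oplus>\<^bsub>hecke r\<^esub> h')"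
      using x_elem_props(1) [OF \<mu>] by (simp add: H.r_distr)
    then show ?thesis using h by blast
  qed
  then show "qmod_add n r m m' \<in> qmod n r" by (auto simp: qmod_def qmod_add_def)
  have "vec n r (qmod_add n r m m') = (\<lambda>i. if i \<in> words n r then vec n r m i + vec n r m' i else 0)"
  proof (rule vec_unique [where g = "\<lambda>_ i. vec n r m i + vec n r m' i"])
    fix \<mu> assume \<mu>: "\<mu> \<in> Lam n r"
    have "ev r (qmod_add n r m m' \<mu>) = (\<lambda>w. pull r \<mu> (vec n r m) w + pull r \<mu> (vec n r m') w)"
      using \<mu> m by (simp add: qmod_add_def ev_add qmod_carrier ev_qmod)
    then show "ev r (qmod_add n r m m' \<mu>) = pull r \<mu> (\<lambda>i. vec n r m i + vec n r m' i)"
      by (auto simp: pull_def)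
  qed
  then show "vec n r (qmod_add n r m m') = (\<lambda>i. vec n r m i + vec n r m' i)"
    using vec_words [OF TS_plus [OF vec_TS vec_TS]] by simp
qed

lemma qmod_act_props:
  assumes m: "m \<in> qmod n r" and h: "h \<in> carrier (hecke r)"
  shows "qmod_act n r m h \<in> qmod n r" "vec n r (qmod_act n r m h) = hact r h (vec n r m)"
proof -
  interpret H: ring "hecke r" by (rule hecke_ring)
  have "\<exists>k\<in>carrier (hecke r). m \<mu> \<otimes>\<^bsub>hecke r\<^esub> h = x_elem n r \<mu> \<otimes>\<^bsub>hecke r\<^esub> k" if \<mu>: "\<mu> \<in> Lam n r" for \<mu>
  proof -
    obtain k where k: "k \<in> carrier (hecke r)" "m \<mu> = x_elem n r \<mu> \<otimes>\<^bsub>hecke r\<^esub> k"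
      using qmod_component [OF m \<mu>] by metis
    then have "m \<mu> \<otimes>\<^bsub>hecke r\<^esub> h = x_elem n r \<mu> \<otimes>\<^bsub>hecke r\<^esub> (k \<otimes>\<^bsub>hecke r\<^esub> h)"
      using x_elem_props(1) [OF \<mu>] h by (simp add: H.m_assoc)
    then show ?thesis using h k by blast
  qed
  then show "qmod_act n r m h \<in> qmod n r" by (auto simp: qmod_def qmod_act_def)
  have "vec n r (qmod_act n r m h) = (\<lambda>i. if i \<in> words n r then hact r h (vec n r m) i else 0)"
  proof (rule vec_unique [where g = "\<lambda>_. hact r h (vec n r m)"])
    fix \<mu> assume \<mu>: "\<mu> \<in> Lam n r"
    have "ev r (qmod_act n r m h \<mu>) = hact r h (ev r (m \<mu>))"
      using \<mu> m h by (simp add: qmod_act_def ev_mult qmod_carrier)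
    then show "ev r (qmod_act n r m h \<mu>) = pull r \<mu> (hact r h (vec n r m))"
      by (simp only: ev_qmod [OF m \<mu>] hact_pull [OF h \<mu>])
  qed
  then show "vec n r (qmod_act n r m h) = hact r h (vec n r m)"
    using vec_words [OF hact_TS [OF h vec_TS]] by simp
qed

lemma qmod_incl_props:
  assumes \<mu>: "\<mu> \<in> Lam n r" and h: "h \<in> carrier (hecke r)"
  shows "qmod_incl n r \<mu> (x_elem n r \<mu> \<otimes>\<^bsub>hecke r\<^esub> h) \<in> qmod n r"
    "vec n r (qmod_incl n r \<mu> (x_elem n r \<mu> \<otimes>\<^bsub>hecke r\<^esub> h)) = hact r h (single (jw r \<mu>) 1)"
proof -
  interpret H: ring "hecke r" by (rule hecke_ring)
  have "\<exists>k\<in>carrier (hecke r). \<zero>\<^bsub>hecke r\<^esub> = x_elem n r \<nu> \<otimes>\<^bsub>hecke r\<^esub> k" if "\<nu> \<in> Lam n r" for \<nu>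
    using x_elem_props(1) [OF that] by (intro bexI [of _ "\<zero>\<^bsub>hecke r\<^esub>"]) simp_all
  then have "(if \<nu> = \<mu> then x_elem n r \<mu> \<otimes>\<^bsub>hecke r\<^esub> h else \<zero>\<^bsub>hecke r\<^esub>)
      \<in> {x_elem n r \<nu> \<otimes>\<^bsub>hecke r\<^esub> k | k. k \<in> carrier (hecke r)}" if "\<nu> \<in> Lam n r" for \<nu>
    using that h by (cases "\<nu> = \<mu>") (simp, blast, simp, blast)
  then show "qmod_incl n r \<mu> (x_elem n r \<mu> \<otimes>\<^bsub>hecke r\<^esub> h) \<in> qmod n r"
    unfolding qmod_def qmod_incl_def restrict_PiE_iff by (rule ballI)
  let ?g = "hact r h (single (jw r \<mu>) 1)"
  have "vec n r (qmod_incl n r \<mu> (x_elem n r \<mu> \<otimes>\<^bsub>hecke r\<^esub> h)) =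
      (\<lambda>i. if i \<in> words n r then (if ct r i = \<mu> then ?g i else 0) else 0)"
  proof (rule vec_unique [where g = "\<lambda>\<nu> i. if \<nu> = \<mu> then ?g i else 0"])
    fix \<nu> assume \<nu>: "\<nu> \<in> Lam n r"
    show "ev r (qmod_incl n r \<mu> (x_elem n r \<mu> \<otimes>\<^bsub>hecke r\<^esub> h) \<nu>) = pull r \<nu> (\<lambda>i. if \<nu> = \<mu> then ?g i else 0)"
      using \<nu> x_mult_props(2) [OF \<mu> h] by (auto simp: qmod_incl_def ev_zero pull_def)
  qed
  moreover have "?g \<in> TS n r" by (rule hact_TS [OF h TS_single [OF jw_words [OF \<mu>]]])
  ultimately show "vec n r (qmod_incl n r \<mu> (x_elem n r \<mu> \<otimes>\<^bsub>hecke r\<^esub> h)) = ?g"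
    using weight_support [OF h \<mu>] by (auto simp: TS_def fun_eq_iff)
qed

section \<open>The \<open>q\<close>-Schur algebra as a commutant\<close>

definition of_vec :: "nat \<Rightarrow> nat \<Rightarrow> ((nat \<Rightarrow> nat) \<Rightarrow> K) \<Rightarrow> mod_elem"
  where "of_vec n r g = (SOME m. m \<in> qmod n r \<and> vec n r m = g)"

lemma of_vec_props: "g \<in> LTS n r \<Longrightarrow> of_vec n r g \<in> qmod n r" "g \<in> LTS n r \<Longrightarrow> vec n r (of_vec n r g) = g"
proof -
  assume "g \<in> LTS n r"
  then have "\<exists>m. m \<in> qmod n r \<and> vec n r m = g" using vec_surj by blast
  from someI_ex [OF this] show "of_vec n r g \<in> qmod n r" "vec n r (of_vec n r g) = g"
    unfolding of_vec_def by blast+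
qed

lemma of_vec_vec: "m \<in> qmod n r \<Longrightarrow> of_vec n r (vec n r m) = m"
  by (rule vec_inj [where n = n and r = r]) (simp_all add: of_vec_props vec_LTS)

text \<open>The columns of \<phi>, transported to tensor space. Defining the operator by its columns
  extends \<phi> from the Laurent lattice K-linearly to all of \<open>TS n r\<close>.\<close>

definition Op :: "nat \<Rightarrow> nat \<Rightarrow> (mod_elem \<Rightarrow> mod_elem) \<Rightarrow> tensor_op"
  where "Op n r \<phi> = (\<lambda>f i. \<Sum>j\<in>words n r. f j * vec n r (\<phi> (of_vec n r (single j 1))) i)"

lemma qschur_int_carrier:
  "\<phi> \<in> carrier (qschur_int n r) \<longleftrightarrow> \<phi> \<in> qmod n r \<rightarrow>\<^sub>E qmod n r
    \<and> (\<forall>m\<in>qmod n r. \<forall>m'\<in>qmod n r. \<phi> (qmod_add n r m m') = qmod_add n r (\<phi> m) (\<phi> m'))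
    \<and> (\<forall>m\<in>qmod n r. \<forall>h\<in>carrier (hecke r). \<phi> (qmod_act n r m h) = qmod_act n r (\<phi> m) h)"
  by (simp add: qschur_int_def)

lemma S_closed: "\<phi> \<in> carrier (qschur_int n r) \<Longrightarrow> m \<in> qmod n r \<Longrightarrow> \<phi> m \<in> qmod n r"
  and S_add: "\<phi> \<in> carrier (qschur_int n r) \<Longrightarrow> m \<in> qmod n r \<Longrightarrow> m' \<in> qmod n r \<Longrightarrow>
    \<phi> (qmod_add n r m m') = qmod_add n r (\<phi> m) (\<phi> m')"
  and S_act: "\<phi> \<in> carrier (qschur_int n r) \<Longrightarrow> m \<in> qmod n r \<Longrightarrow> h \<in> carrier (hecke r) \<Longrightarrow>
    \<phi> (qmod_act n r m h) = qmod_act n r (\<phi> m) h"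
  and S_extensional: "\<phi> \<in> carrier (qschur_int n r) \<Longrightarrow> \<phi> \<in> extensional (qmod n r)"
  unfolding qschur_int_carrier by (auto simp: PiE_def)

lemma LTS_scale: "f \<in> LTS n r \<Longrightarrow> c \<in> laurent \<Longrightarrow> (\<lambda>i. c * f i) \<in> LTS n r"
  by (simp add: LTS_def TS_scale laurent.C_mult)

lemma LTS_zero: "(\<lambda>i. 0) \<in> LTS n r"
  by (simp add: LTS_def TS_zero)

lemma LTS_sum: "(\<And>x. x \<in> A \<Longrightarrow> f x \<in> LTS n r) \<Longrightarrow> (\<lambda>i. \<Sum>x\<in>A. f x i) \<in> LTS n r"
  by (simp add: LTS_def TS_sum laurent.C_sum)

lemma vec_scalar:
  "m \<in> qmod n r \<Longrightarrow> c \<in> laurent \<Longrightarrow> vec n r (qmod_act n r m (hecke_scalar r c)) = (\<lambda>i. c * vec n r m i)"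
  by (simp add: qmod_act_props hecke_scalar_closed hact_scalar)

text \<open>Laurent scalars act through the Hecke algebra, so \<phi> respects Laurent combinations;
  the vector of m is expanded in delta functions, with induction over the set of words used.\<close>

lemma vec_S:
  assumes \<phi>: "\<phi> \<in> carrier (qschur_int n r)" and m: "m \<in> qmod n r"
  shows "vec n r (\<phi> m) = Op n r \<phi> (vec n r m)"
proof -
  let ?e = "\<lambda>j. of_vec n r (single j 1)"
  have e: "?e j \<in> qmod n r" "vec n r (?e j) = single j 1" if "j \<in> words n r" for j
    using that by (simp_all add: of_vec_props LTS_single)
  have *: "vec n r (\<phi> (of_vec n r (\<lambda>i. \<Sum>j\<in>J. c j * single j 1 i))) = (\<lambda>i. \<Sum>j\<in>J. c j * vec n r (\<phi> (?e j)) i)"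
    if "finite J" "J \<subseteq> words n r" "\<And>j. j \<in> J \<Longrightarrow> c j \<in> laurent" for J c
    using that
  proof (induction J rule: finite_induct)
    case empty
    let ?z = "of_vec n r (\<lambda>i. 0)"
    have z: "?z \<in> qmod n r" "vec n r ?z = (\<lambda>i. 0)" by (simp_all add: of_vec_props LTS_zero)
    \<comment> \<open>That \<phi> maps zero to zero is extracted from its compatibility with the
      scalar 0.\<close>
    have "qmod_act n r ?z (hecke_scalar r 0) = ?z"
      by (rule vec_inj [where n = n and r = r])
        (simp_all add: z qmod_act_props hecke_scalar_closed hact_scalar)
    then have "\<phi> ?z = qmod_act n r (\<phi> ?z) (hecke_scalar r 0)"
      using S_act [OF \<phi> z(1), of "hecke_scalar r 0"] by (simp add: hecke_scalar_closed)
    then have "vec n r (\<phi> ?z) = (\<lambda>i. 0)"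
      using vec_scalar [OF S_closed [OF \<phi> z(1)], of 0] by simp
    then show ?case by simp
  next
    case (insert j J)
    let ?m = "of_vec n r (\<lambda>i. \<Sum>j\<in>J. c j * single j 1 i)" and ?s = "qmod_act n r (?e j) (hecke_scalar r (c j))"
    let ?n = "of_vec n r (\<lambda>i. \<Sum>j\<in>insert j J. c j * single j 1 i)"
    have cj: "c j \<in> laurent" and j: "j \<in> words n r" using insert by auto
    have "(\<lambda>i. \<Sum>j\<in>J. c j * single j 1 i) \<in> LTS n r" "(\<lambda>i. \<Sum>j\<in>insert j J. c j * single j 1 i) \<in> LTS n r"
      using insert.prems by (intro LTS_sum LTS_scale LTS_single; blast)+
    then have m: "?m \<in> qmod n r" "vec n r ?m = (\<lambda>i. \<Sum>j\<in>J. c j * single j 1 i)"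
      and n: "?n \<in> qmod n r" "vec n r ?n = (\<lambda>i. \<Sum>j\<in>insert j J. c j * single j 1 i)"
      by (simp_all add: of_vec_props)
    note h = hecke_scalar_closed [OF cj, of r]
    have s: "?s \<in> qmod n r" "vec n r ?s = (\<lambda>i. c j * single j 1 i)"
      using e [OF j] h by (simp_all add: qmod_act_props hact_scalar cj)
    have "?n = qmod_add n r ?s ?m"
      by (rule vec_inj [where n = n and r = r]) (use n m s insert.hyps in \<open>simp_all add: qmod_add_props\<close>)
    then have "\<phi> ?n = qmod_add n r (qmod_act n r (\<phi> (?e j)) (hecke_scalar r (c j))) (\<phi> ?m)"
      using S_add [OF \<phi> s(1) m(1)] S_act [OF \<phi> e(1) [OF j] h] by simp
    moreover have "vec n r (\<phi> ?m) = (\<lambda>i. \<Sum>j\<in>J. c j * vec n r (\<phi> (?e j)) i)"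
      using insert by simp
    ultimately have "vec n r (\<phi> ?n) = (\<lambda>i. c j * vec n r (\<phi> (?e j)) i + (\<Sum>j\<in>J. c j * vec n r (\<phi> (?e j)) i))"
      using S_closed [OF \<phi> e(1) [OF j]] S_closed [OF \<phi> m(1)] h
      by (simp add: qmod_add_props qmod_act_props hact_scalar cj)
    then show ?case using insert.hyps by simp
  qed
  have L: "vec n r m \<in> LTS n r" by (rule vec_LTS [OF m])
  have "m = of_vec n r (\<lambda>i. \<Sum>j\<in>words n r. vec n r m j * single j 1 i)"
    using of_vec_vec [OF m] TS_expand [OF vec_TS] by metis
  then have "vec n r (\<phi> m) = vec n r (\<phi> (of_vec n r (\<lambda>i. \<Sum>j\<in>words n r. vec n r m j * single j 1 i)))" by simp
  also have "\<dots> = (\<lambda>i. \<Sum>j\<in>words n r. vec n r m j * vec n r (\<phi> (?e j)) i)"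
    by (rule *) (use L in \<open>simp_all add: finite_words LTS_def\<close>)
  finally show ?thesis by (simp add: Op_def)
qed

lemma Op_linear: "Op n r \<phi> (\<lambda>i. \<Sum>x\<in>A. c x * g x i) = (\<lambda>i. \<Sum>x\<in>A. c x * Op n r \<phi> (g x) i)"
  unfolding Op_def sum_distrib_left sum_distrib_right
  by (subst sum.swap) (simp add: mult.assoc)

lemma Op_single: "j \<in> words n r \<Longrightarrow> Op n r \<phi> (single j 1) = vec n r (\<phi> (of_vec n r (single j 1)))"
proof
  fix i assume j: "j \<in> words n r"
  have "Op n r \<phi> (single j 1) i =
      (\<Sum>k\<in>words n r. if k = j then vec n r (\<phi> (of_vec n r (single j 1))) i else 0)"
    unfolding Op_def by (rule sum.cong) (auto simp: single_def)
  then show "Op n r \<phi> (single j 1) i = vec n r (\<phi> (of_vec n r (single j 1))) i"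
    using j by (simp add: finite_words)
qed

lemma Op_TS: "Op n r \<phi> f \<in> TS n r"
  unfolding Op_def by (intro TS_sum TS_scale vec_TS)

text \<open>On delta functions, which are integral, commutation is the H-linearity of \<phi> for the
  generators; it extends to \<open>TS n r\<close> by K-linearity.\<close>

lemma Op_commutant:
  assumes \<phi>: "\<phi> \<in> carrier (qschur_int n r)"
  shows "Op n r \<phi> \<in> commutant n r"
proof -
  have single: "Op n r \<phi> (Rop p (single j 1)) = Rop p (Op n r \<phi> (single j 1))"
    if j: "j \<in> words n r" and p: "p \<in> {1..<r}" for j p
  proof -
    let ?e = "of_vec n r (single j 1)"
    have e: "?e \<in> qmod n r" "vec n r ?e = single j 1" using j by (simp_all add: of_vec_props LTS_single)
    note g = hecke_gen_closed [OF p]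
    have "Rop p (single j 1) = vec n r (qmod_act n r ?e (hecke_gen r p))"
      by (simp only: qmod_act_props(2) [OF e(1) g] hact_gen [OF p] e(2))
    then have "Op n r \<phi> (Rop p (single j 1)) = vec n r (qmod_act n r (\<phi> ?e) (hecke_gen r p))"
      by (simp only: vec_S [OF \<phi> qmod_act_props(1) [OF e(1) g], symmetric] S_act [OF \<phi> e(1) g])
    also have "\<dots> = Rop p (vec n r (\<phi> ?e))"
      by (simp only: qmod_act_props(2) [OF S_closed [OF \<phi> e(1)] g] hact_gen [OF p])
    finally show ?thesis by (simp only: Op_single [OF j])
  qed
  have "Op n r \<phi> (Rop p f) = Rop p (Op n r \<phi> f)" if f: "f \<in> TS n r" and p: "p \<in> {1..<r}" for f p
  proof -
    have lin: "Rop p (\<lambda>i. \<Sum>j\<in>words n r. f j * g j i) = (\<lambda>i. \<Sum>j\<in>words n r. f j * Rop p (g j) i)" for g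
      by (simp only: Rop_sum Rop_scale)
    have "Op n r \<phi> (Rop p f) = Op n r \<phi> (Rop p (\<lambda>i. \<Sum>j\<in>words n r. f j * single j 1 i))"
      using TS_expand [OF f] by simp
    also have "\<dots> = (\<lambda>i. \<Sum>j\<in>words n r. f j * Op n r \<phi> (Rop p (single j 1)) i)"
      by (simp only: lin Op_linear)
    also have "\<dots> = (\<lambda>i. \<Sum>j\<in>words n r. f j * Rop p (Op n r \<phi> (single j 1)) i)"
      by (intro ext sum.cong refl) (simp only: single [OF _ p])
    also have "\<dots> = Rop p (Op n r \<phi> (\<lambda>i. \<Sum>j\<in>words n r. f j * single j 1 i))"
      by (simp only: lin Op_linear)
    finally show ?thesis using TS_expand [OF f] by simp
  qed
  then show ?thesis
    unfolding commutant_def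
    by (auto simp: Op_TS simp del: One_nat_def)
      (simp_all add: Op_def fun_eq_iff algebra_simps sum.distrib sum_distrib_left)
qed

lemma Op_comp:
  assumes "\<phi> \<in> carrier (qschur_int n r)" "\<psi> \<in> carrier (qschur_int n r)"
  shows "Op n r (\<phi> \<otimes>\<^bsub>qschur_int n r\<^esub> \<psi>) f = Op n r \<phi> (Op n r \<psi> f)"
proof -
  let ?e = "\<lambda>j. of_vec n r (single j 1)"
  have "Op n r \<phi> (Op n r \<psi> f) = (\<lambda>i. \<Sum>j\<in>words n r. f j * Op n r \<phi> (vec n r (\<psi> (?e j))) i)"
    unfolding Op_def [of n r \<psi>] by (rule Op_linear)
  also have "\<dots> = (\<lambda>i. \<Sum>j\<in>words n r. f j * vec n r (compose (qmod n r) \<phi> \<psi> (?e j)) i)"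
    by (intro ext sum.cong refl)
      (simp add: compose_eq of_vec_props LTS_single vec_S [OF assms(1)] S_closed [OF assms(2)])
  also have "\<dots> = Op n r (\<phi> \<otimes>\<^bsub>qschur_int n r\<^esub> \<psi>) f"
    by (simp add: Op_def qschur_int_def)
  finally show ?thesis by simp
qed

lemma Op_add:
  assumes "\<phi> \<in> carrier (qschur_int n r)" "\<psi> \<in> carrier (qschur_int n r)"
  shows "Op n r (\<phi> \<oplus>\<^bsub>qschur_int n r\<^esub> \<psi>) f = (\<lambda>i. Op n r \<phi> f i + Op n r \<psi> f i)"
  unfolding Op_def sum.distrib [symmetric]
  by (intro ext sum.cong refl)
    (simp add: qschur_int_def of_vec_props LTS_single qmod_add_props S_closed [OF assms(1)] S_closed [OF assms(2)] algebra_simps)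

lemma Op_smult:
  assumes "\<phi> \<in> carrier (qschur_int n r)" "a \<in> laurent"
  shows "Op n r (qschur_smult n r a \<phi>) f = (\<lambda>i. a * Op n r \<phi> f i)"
  unfolding Op_def sum_distrib_left
  by (intro ext sum.cong refl)
    (simp add: qschur_smult_def of_vec_props LTS_single vec_scalar S_closed [OF assms(1)] assms(2) algebra_simps)

lemma Op_inj:
  assumes \<phi>: "\<phi> \<in> carrier (qschur_int n r)" and \<psi>: "\<psi> \<in> carrier (qschur_int n r)"
    and eq: "\<And>f. f \<in> TS n r \<Longrightarrow> Op n r \<phi> f = Op n r \<psi> f"
  shows "\<phi> = \<psi>"
proof (rule extensionalityI [OF S_extensional [OF \<phi>] S_extensional [OF \<psi>]])
  fix m assume m: "m \<in> qmod n r"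
  show "\<phi> m = \<psi> m"
    by (rule vec_inj [where n = n and r = r]) (simp_all add: S_closed [OF \<phi> m] S_closed [OF \<psi> m] vec_S [OF \<phi> m] vec_S [OF \<psi> m] eq vec_TS)
qed

lemma cf_Op_laurent:
  assumes \<phi>: "\<phi> \<in> carrier (qschur_int n r)" and A: "A \<in> Theta n r"
  shows "cf n r (Op n r \<phi>) A \<in> laurent"
proof -
  let ?j = "jw r (co n A)"
  have j: "?j \<in> words n r" by (rule jw_words [OF co_Lam [OF A]])
  have "vec n r (\<phi> (of_vec n r (single ?j 1))) \<in> LTS n r"
    by (intro vec_LTS S_closed [OF \<phi>] of_vec_props LTS_single j)
  then show ?thesis unfolding cf_def Op_single [OF j] by (simp add: LTS_def)
qed

lemma commutant_id: "(\<lambda>f. f) \<in> commutant n r"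
  by (simp add: commutant_def)

text \<open>A map covered by an operator of the commutant is additive and H-linear because
  \<open>vec\<close> is injective. Sums, multiples, composites and the identity are all recognised
  as endomorphisms in this way.\<close>

lemma S_memI:
  assumes ext: "\<phi> \<in> extensional (qmod n r)" and X: "X \<in> commutant n r"
    and q: "\<And>m. m \<in> qmod n r \<Longrightarrow> \<phi> m \<in> qmod n r" "\<And>m. m \<in> qmod n r \<Longrightarrow> vec n r (\<phi> m) = X (vec n r m)"
  shows "\<phi> \<in> carrier (qschur_int n r)"
  unfolding qschur_int_carrier
proof (intro conjI ballI)
  show "\<phi> \<in> qmod n r \<rightarrow>\<^sub>E qmod n r" using ext q(1) by (auto simp: PiE_def)
  fix m m' assume m: "m \<in> qmod n r" "m' \<in> qmod n r"
  show "\<phi> (qmod_add n r m m') = qmod_add n r (\<phi> m) (\<phi> m')"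
    by (rule vec_inj [where n = n and r = r])
      (simp_all only: q [OF qmod_add_props(1) [OF m]] qmod_add_props [OF q(1) [OF m(1)] q(1) [OF m(2)]]
        q(2) [OF m(1)] q(2) [OF m(2)] qmod_add_props(2) [OF m] comm_plus [OF X vec_TS vec_TS])
next
  fix m h assume m: "m \<in> qmod n r" and h: "h \<in> carrier (hecke r)"
  show "\<phi> (qmod_act n r m h) = qmod_act n r (\<phi> m) h"
    by (rule vec_inj [where n = n and r = r])
      (simp_all only: q [OF qmod_act_props(1) [OF m h]] qmod_act_props [OF q(1) [OF m] h]
        q(2) [OF m] qmod_act_props(2) [OF m h] hact_comm [OF h vec_TS X])
qed

text \<open>Laurent coefficients make X preserve the Laurent lattice, and \<open>vec\<close>
  identifies that lattice with the module, so X can be transported back.\<close>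

lemma Op_surj:
  assumes X: "X \<in> commutant n r" and c: "\<And>A. A \<in> Theta n r \<Longrightarrow> cf n r X A \<in> laurent"
  shows "\<exists>\<phi>\<in>carrier (qschur_int n r). (\<forall>f\<in>TS n r. Op n r \<phi> f = X f)
    \<and> (\<forall>m\<in>qmod n r. vec n r (\<phi> m) = X (vec n r m))"
proof -
  let ?\<phi> = "\<lambda>m\<in>qmod n r. of_vec n r (X (vec n r m))"
  have L: "X (vec n r m) \<in> LTS n r" if "m \<in> qmod n r" for m
    by (rule comm_laurent [OF X c vec_LTS [OF that]])
  have q: "?\<phi> m \<in> qmod n r" "vec n r (?\<phi> m) = X (vec n r m)" if "m \<in> qmod n r" for m
    using that by (simp_all add: of_vec_props L)
  have \<phi>: "?\<phi> \<in> carrier (qschur_int n r)"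
    by (rule S_memI [OF _ X]) (simp_all only: q restrict_extensional)
  have "Op n r ?\<phi> f = X f" if f: "f \<in> TS n r" for f
  proof -
    have "Op n r ?\<phi> (single j 1) = X (single j 1)" if j: "j \<in> words n r" for j
      unfolding Op_single [OF j] q(2) [OF of_vec_props(1) [OF LTS_single [OF j]]] of_vec_props(2) [OF LTS_single [OF j]] ..
    then show ?thesis
      unfolding comm_expand [OF X f] comm_expand [OF Op_commutant [OF \<phi>] f] by simp
  qed
  then show ?thesis using \<phi> q(2) by blast
qed

subsection \<open>The double cosets and the basis \<open>e\<^sub>A\<close>\<close>

text \<open>Left multiplication by the Young subgroup of \<mu> leaves the word j_mu w unchanged, and
  right multiplication by that of \<nu> keeps its type. Conversely
  \<open>same_type_permutation\<close> yields the right factor b, after which the left factor is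
  forced.\<close>

lemma double_coset_eq:
  assumes \<lambda>: "\<mu> \<in> Lam n r" and \<mu>: "\<nu> \<in> Lam n r" and w: "w permutes {1..r}"
  shows "double_coset n r \<mu> w \<nu> =
    {v. v permutes {1..r} \<and> mt r (jw r \<mu> \<circ> v) (jw r \<nu>) = mt r (jw r \<mu> \<circ> w) (jw r \<nu>)}"
proof (intro equalityI subsetI)
  fix v assume "v \<in> double_coset n r \<mu> w \<nu>"
  then obtain a b where v: "v = a \<circ> w \<circ> b" and a: "a permutes {1..r}" "jw r \<mu> \<circ> a = jw r \<mu>"
    and b: "b permutes {1..r}" "jw r \<nu> \<circ> b = jw r \<nu>"
    by (auto simp: double_coset_def young_iff [OF \<lambda>] young_iff [OF \<mu>])
  have "mt r (jw r \<mu> \<circ> v) (jw r \<nu>) = mt r ((jw r \<mu> \<circ> w) \<circ> b) (jw r \<nu> \<circ> b)"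
    unfolding v b(2) by (simp only: comp_assoc [symmetric] a(2))
  also have "\<dots> = mt r (jw r \<mu> \<circ> w) (jw r \<nu>)" by (rule mt_comp [OF b(1)])
  finally show "v \<in> {v. v permutes {1..r} \<and> mt r (jw r \<mu> \<circ> v) (jw r \<nu>) = mt r (jw r \<mu> \<circ> w) (jw r \<nu>)}"
    unfolding v using permutes_compose [OF b(1) permutes_compose [OF w a(1)]] by (simp add: comp_assoc)
next
  fix v assume "v \<in> {v. v permutes {1..r} \<and> mt r (jw r \<mu> \<circ> v) (jw r \<nu>) = mt r (jw r \<mu> \<circ> w) (jw r \<nu>)}"
  then have v: "v permutes {1..r}" "mt r (jw r \<mu> \<circ> v) (jw r \<nu>) = mt r (jw r \<mu> \<circ> w) (jw r \<nu>)" by auto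
  obtain b where b: "b permutes {1..r}" "jw r \<mu> \<circ> v = jw r \<mu> \<circ> w \<circ> b" "jw r \<nu> = jw r \<nu> \<circ> b"
    using same_type_permutation [OF v(2) comp_words [OF jw_words [OF \<lambda>] v(1)] comp_words [OF jw_words [OF \<lambda>] w]
        jw_words [OF \<mu>]] by blast
  let ?u = "w \<circ> b" and ?a = "v \<circ> inv_into UNIV (w \<circ> b)"
  have u: "?u permutes {1..r}" by (rule permutes_compose [OF b(1) w])
  have a: "?a permutes {1..r}" by (rule permutes_compose [OF permutes_inv [OF u] v(1)])
  have "jw r \<mu> \<circ> ?a = (jw r \<mu> \<circ> ?u) \<circ> inv_into UNIV ?u"
    using b(2) by (simp add: comp_assoc [symmetric])
  also have "\<dots> = jw r \<mu> \<circ> (?u \<circ> inv_into UNIV ?u)" by (rule comp_assoc)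
  also have "\<dots> = jw r \<mu>" by (simp only: permutes_inv_o(1) [OF u] comp_id)
  finally have aY: "?a \<in> young n r \<mu>" using a by (simp add: young_iff [OF \<lambda>])
  have bY: "b \<in> young n r \<nu>" using b(1) b(3) [symmetric] by (simp add: young_iff [OF \<mu>])
  have "?a \<circ> w \<circ> b = v \<circ> (inv_into UNIV ?u \<circ> ?u)" by (simp only: comp_assoc)
  also have "\<dots> = v" by (simp only: permutes_inv_o(2) [OF u] comp_id)
  finally have "v = ?a \<circ> w \<circ> b" ..
  then show "v \<in> double_coset n r \<mu> w \<nu>"
    unfolding double_coset_def using aY bY by blast
qed

lemma card_block_meet:
  assumes \<lambda>: "\<mu> \<in> Lam n r" and \<mu>: "\<nu> \<in> Lam n r" and w: "w permutes {1..r}" and ab: "a \<in> {1..n}" "b \<in> {1..n}"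
  shows "card (block \<mu> a \<inter> w ` block \<nu> b) = mt r (jw r \<mu> \<circ> w) (jw r \<nu>) a b"
proof -
  have "block \<mu> a \<inter> w ` block \<nu> b = w ` {p \<in> {1..r}. (jw r \<mu> \<circ> w) p = a \<and> jw r \<nu> p = b}"
  proof (intro equalityI subsetI)
    fix x assume "x \<in> block \<mu> a \<inter> w ` block \<nu> b"
    then obtain p where p: "x = w p" "p \<in> block \<nu> b" "w p \<in> block \<mu> a" by blast
    have r: "p \<in> {1..r}" "w p \<in> {1..r}"
      using p block_subset [OF \<lambda> ab(1)] block_subset [OF \<mu> ab(2)] by blast+
    have "jw r \<mu> (w p) = a" "jw r \<nu> p = b"
      using jw_block [OF \<lambda> r(2), of a] jw_block [OF \<mu> r(1), of b] p ab by simp_all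
    then show "x \<in> w ` {p \<in> {1..r}. (jw r \<mu> \<circ> w) p = a \<and> jw r \<nu> p = b}"
      using p(1) r(1) by auto
  next
    fix x assume "x \<in> w ` {p \<in> {1..r}. (jw r \<mu> \<circ> w) p = a \<and> jw r \<nu> p = b}"
    then obtain p where p: "x = w p" "p \<in> {1..r}" "jw r \<mu> (w p) = a" "jw r \<nu> p = b" by auto
    have "w p \<in> {1..r}" using permutes_in_image [OF w] p(2) by blast
    then have "w p \<in> block \<mu> a" "p \<in> block \<nu> b"
      using jw_block [OF \<lambda>, of "w p" a] jw_block [OF \<mu> p(2), of b] p ab by simp_all
    then show "x \<in> block \<mu> a \<inter> w ` block \<nu> b" using p(1) by blast
  qed
  moreover have "inj_on w S" for S using permutes_inj [OF w] by (simp add: inj_on_def inj_def)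
  ultimately show ?thesis by (simp add: card_image mt_def)
qed

text \<open>A suitable w exists because a word of type A against the sorted word comes from a
  permutation; every suitable w gives the same set by \<open>double_coset_eq\<close>, so the
  description denotes it.\<close>

lemma coset_of_mat_eq:
  assumes A: "A \<in> Theta n r"
  shows "coset_of_mat n r A =
    {w. w permutes {1..r} \<and> mt r (jw r (ro n A) \<circ> w) (jw r (co n A)) = A}"
proof -
  note \<lambda> = ro_Lam [OF A] and \<mu> = co_Lam [OF A]
  let ?D = "{w. w permutes {1..r} \<and> mt r (jw r (ro n A) \<circ> w) (jw r (co n A)) = A}"
  let ?C = "\<lambda>w. \<forall>i\<in>{1..n}. \<forall>j\<in>{1..n}. A i j = card (block (ro n A) i \<inter> w ` block (co n A) j)"
  have C: "?C w \<longleftrightarrow> mt r (jw r (ro n A) \<circ> w) (jw r (co n A)) = A" if w: "w permutes {1..r}" for w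
  proof -
    let ?M = "mt r (jw r (ro n A) \<circ> w) (jw r (co n A))"
    have M: "?M \<in> Theta n r" by (rule mt_Theta [OF comp_words [OF jw_words [OF \<lambda>] w] jw_words [OF \<mu>]])
    have "?C w \<longleftrightarrow> (\<forall>i\<in>{1..n}. \<forall>j\<in>{1..n}. A i j = ?M i j)"
      using card_block_meet [OF \<lambda> \<mu> w] by simp
    also have "\<dots> \<longleftrightarrow> ?M = A"
    proof
      assume *: "\<forall>i\<in>{1..n}. \<forall>j\<in>{1..n}. A i j = ?M i j"
      show "?M = A"
      proof (intro ext)
        fix i j
        show "?M i j = A i j"
          using * A M unfolding Theta_def by (cases "i \<in> {1..n} \<and> j \<in> {1..n}") auto
      qed
    qed simp
    finally show ?thesis .
  qed
  have D: "double_coset n r (ro n A) w (co n A) = ?D" if "w permutes {1..r}" "?C w" for w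
    using double_coset_eq [OF \<lambda> \<mu> that(1)] C [OF that(1)] that(2) by simp
  obtain i where i: "i \<in> words n r" "mt r i (jw r (co n A)) = A" using column_word [OF A] by blast
  have "ct r i = ro n A" using ro_mt [OF jw_words [OF \<mu>], of i] i(2) by simp
  then obtain w where w: "w permutes {1..r}" "i = jw r (ro n A) \<circ> w"
    using word_permutation [OF i(1)] by auto
  have Cw: "?C w" using C [OF w(1)] i(2) w(2) by simp
  show ?thesis
    unfolding coset_of_mat_def
  proof (rule the_equality)
    show "\<exists>w. w permutes {1..r} \<and> ?D = double_coset n r (ro n A) w (co n A) \<and> ?C w"
      using w(1) Cw D [OF w(1) Cw] by blast
  qed (use D in blast)
qed

text \<open>Existence comes from lifting the elementary operator, whose coefficients 0 and 1 are
  Laurent. Uniqueness holds because the prescription fixes the images of all x_nu, that is, the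
  columns at all sorted words.\<close>

lemma e_basis_props:
  assumes A: "A \<in> Theta n r"
  shows "e_basis n r A \<in> carrier (qschur_int n r)"
    and "f \<in> TS n r \<Longrightarrow> Op n r (e_basis n r A) f = elem n r A f"
proof -
  note \<lambda> = ro_Lam [OF A] and \<mu> = co_Lam [OF A]
  interpret H: ring "hecke r" by (rule hecke_ring)
  let ?X = "elem n r A" and ?D = "coset_of_mat n r A"
  have X: "?X \<in> commutant n r" by (rule elem_commutant [OF A])
  have Xcol: "?X (single (jw r \<nu>) 1) i = (if i \<in> words n r \<and> mt r i (jw r \<nu>) = A then 1 else 0)"
    if \<nu>: "\<nu> \<in> Lam n r" for \<nu> i
  proof (cases "i \<in> words n r")
    case True
    then show ?thesis
      using comm_column [OF X \<nu> True] elem_props(2) [OF A mt_Theta [OF True jw_words [OF \<nu>]]] by simp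
  next
    case False
    then show ?thesis using comm_TS [OF X TS_single [OF jw_words [OF \<nu>]]] by (simp add: TS_def)
  qed
  obtain \<phi> where \<phi>: "\<phi> \<in> carrier (qschur_int n r)" "\<And>f. f \<in> TS n r \<Longrightarrow> Op n r \<phi> f = ?X f"
    "\<And>m. m \<in> qmod n r \<Longrightarrow> vec n r (\<phi> m) = ?X (vec n r m)"
    using Op_surj [OF X] elem_props(2) [OF A] by (metis laurent.C_one laurent.C_zero)
  have fin: "finite ?D"
    unfolding coset_of_mat_eq [OF A] by (rule finite_subset [OF _ finite_permutations [of "{1..r}"]]) auto
  have "T_sum r ?D \<in> carrier (hecke r) \<and> ev r (T_sum r ?D) = (\<lambda>w. if w \<in> ?D then 1 else 0)"
    by (rule ev_T_sum [OF fin]) (simp add: coset_of_mat_eq [OF A])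
  \<comment> \<open>The double coset consists of the w for which the sorted word of content ro(A),
    composed with w, has type A; so the coset sum and the pulled back column are the same indicator
    function.\<close>
  moreover have "(\<lambda>w. if w \<in> ?D then 1 else 0) = pull r (ro n A) (?X (single (jw r (co n A)) 1))"
    using comp_words [OF jw_words [OF \<lambda>]] by (auto simp: pull_def Xcol [OF \<mu>] coset_of_mat_eq [OF A])
  ultimately have TD: "T_sum r ?D \<in> carrier (hecke r)"
    "ev r (T_sum r ?D) = pull r (ro n A) (?X (single (jw r (co n A)) 1))" by auto
  let ?P = "\<lambda>\<phi>. \<phi> \<in> carrier (qschur_int n r)
      \<and> (\<forall>\<nu>\<in>Lam n r. \<forall>h\<in>carrier (hecke r).
            \<phi> (qmod_incl n r \<nu> (x_elem n r \<nu> \<otimes>\<^bsub>hecke r\<^esub> h)) =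
              (if \<nu> = co n A
               then qmod_incl n r (ro n A) (T_sum r ?D \<otimes>\<^bsub>hecke r\<^esub> h)
               else qmod_zero n r))"
  have P: "?P \<phi>"
  proof (intro conjI \<phi>(1) ballI)
    fix \<nu> h assume \<nu>: "\<nu> \<in> Lam n r" and h: "h \<in> carrier (hecke r)"
    let ?m = "qmod_incl n r \<nu> (x_elem n r \<nu> \<otimes>\<^bsub>hecke r\<^esub> h)"
    let ?t = "if \<nu> = co n A then qmod_incl n r (ro n A) (T_sum r ?D \<otimes>\<^bsub>hecke r\<^esub> h) else qmod_zero n r"
    have m: "?m \<in> qmod n r" by (rule qmod_incl_props(1) [OF \<nu> h])
    let ?g = "?X (single (jw r \<nu>) 1)"
    have g: "?g \<in> TS n r" by (rule comm_TS [OF X TS_single [OF jw_words [OF \<nu>]]])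
    have v: "vec n r (\<phi> ?m) = hact r h ?g"
      unfolding \<phi>(3) [OF m] qmod_incl_props(2) [OF \<nu> h] by (rule hact_comm [OF h TS_single [OF jw_words [OF \<nu>]] X])
    have shape: "\<nu> = co n A \<and> ct r i = ro n A" if "i \<in> words n r" "mt r i (jw r \<nu>) = A" for i
      using co_mt [OF that(1), of "jw r \<nu>"] ro_mt [OF jw_words [OF \<nu>], of i] that(2) ct_jw [OF \<nu>] by simp
    have supp: "hact r h ?g i = (if \<nu> = co n A \<and> ct r i = ro n A then hact r h ?g i else 0)" for i
    proof -
      have "op_proj r (ro n A) ?g = ?g"
        using shape by (auto simp: op_proj_def Xcol [OF \<nu>])
      then have "op_proj r (ro n A) (hact r h ?g) = hact r h ?g"
        using hact_comm [OF h g proj_commutant] by simp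
      then have 1: "hact r h ?g i = (if ct r i = ro n A then hact r h ?g i else 0)"
        by (metis op_proj_def)
      have "?g = (\<lambda>i. 0)" if "\<nu> \<noteq> co n A"
        using that shape by (intro ext) (auto simp: Xcol [OF \<nu>])
      moreover have "hact r h (\<lambda>i. 0) = (\<lambda>i. 0)"
        using hact_comm [OF h TS_zero [of n r] commutant_zero] by simp
      ultimately have "hact r h ?g i = 0" if "\<nu> \<noteq> co n A"
        using that by simp
      then show ?thesis using 1 by auto
    qed
    \<comment> \<open>That \<open>?t\<close> lies in the module is a consequence here and not an
      input.\<close>
    have "?t = \<phi> ?m"
    proof (rule qmod_eqI [OF S_closed [OF \<phi>(1) m]])
      show "?t \<in> extensional (Lam n r)" by (simp add: qmod_incl_def qmod_zero_def)
      fix \<kappa> assume \<kappa>: "\<kappa> \<in> Lam n r"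
      show "?t \<kappa> \<in> carrier (hecke r) \<and> ev r (?t \<kappa>) = pull r \<kappa> (vec n r (\<phi> ?m))"
      proof (cases "\<nu> = co n A \<and> \<kappa> = ro n A")
        case True
        then have t: "?t \<kappa> = T_sum r ?D \<otimes>\<^bsub>hecke r\<^esub> h" using \<kappa> by (simp add: qmod_incl_def)
        have "ev r (T_sum r ?D \<otimes>\<^bsub>hecke r\<^esub> h) = pull r (ro n A) (hact r h ?g)"
          unfolding ev_mult [OF TD(1) h] TD(2) hact_pull [OF h \<lambda>] using True by simp
        then show ?thesis unfolding t v using True TD(1) h by simp
      next
        case False
        then have t: "?t \<kappa> = \<zero>\<^bsub>hecke r\<^esub>" using \<kappa> by (auto simp: qmod_incl_def qmod_zero_def)
        have "pull r \<kappa> (hact r h ?g) = pull r \<kappa> (\<lambda>i. 0)"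
          by (rule pull_words_cong [OF \<kappa>]) (use False supp in metis)
        then show ?thesis unfolding t v by (simp add: ev_zero pull_def fun_eq_iff)
      qed
    qed
    then show "\<phi> ?m = ?t" by simp
  qed
  have uniq: "\<psi> = \<phi>" if \<psi>: "?P \<psi>" for \<psi>
  proof (rule Op_inj)
    show \<psi>S: "\<psi> \<in> carrier (qschur_int n r)" using \<psi> by blast
    \<comment> \<open>Testing at h = 1 suffices: these elements correspond to the delta functions at
      sorted words, whose columns determine an operator of the commutant.\<close>
    have same: "\<psi> (qmod_incl n r \<nu> (x_elem n r \<nu> \<otimes>\<^bsub>hecke r\<^esub> \<one>\<^bsub>hecke r\<^esub>)) =
        \<phi> (qmod_incl n r \<nu> (x_elem n r \<nu> \<otimes>\<^bsub>hecke r\<^esub> \<one>\<^bsub>hecke r\<^esub>))" if "\<nu> \<in> Lam n r" for \<nu>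
      using conjunct2 [OF \<psi>, rule_format, OF that H.one_closed] conjunct2 [OF P, rule_format, OF that H.one_closed]
      by simp
    have col: "Op n r \<psi> (single (jw r \<nu>) 1) = Op n r \<phi> (single (jw r \<nu>) 1)" if \<nu>: "\<nu> \<in> Lam n r" for \<nu>
    proof -
      let ?m = "qmod_incl n r \<nu> (x_elem n r \<nu> \<otimes>\<^bsub>hecke r\<^esub> \<one>\<^bsub>hecke r\<^esub>)"
      have m: "?m \<in> qmod n r" "vec n r ?m = single (jw r \<nu>) 1"
        using qmod_incl_props [OF \<nu> H.one_closed] by (simp_all add: hact_one)
      show ?thesis
        using vec_S [OF \<psi>S m(1)] vec_S [OF \<phi>(1) m(1)] same [OF \<nu>] m(2) by simp
    qed
    show "Op n r \<psi> f = Op n r \<phi> f" if "f \<in> TS n r" for f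
      by (rule comm_ext [OF Op_commutant [OF \<psi>S] Op_commutant [OF \<phi>(1)] _ that])
        (simp add: cf_def col co_Lam)
  qed (rule \<phi>(1))
  have e: "e_basis n r A = \<phi>"
    unfolding e_basis_def by (rule the_equality [where P = ?P, OF P uniq])
  show "e_basis n r A \<in> carrier (qschur_int n r)" unfolding e by (rule \<phi>(1))
  show "f \<in> TS n r \<Longrightarrow> Op n r (e_basis n r A) f = elem n r A f" unfolding e by (rule \<phi>(2))
qed

section \<open>Base change\<close>

lemma S_plus_closed:
  assumes \<phi>: "\<phi> \<in> carrier (qschur_int n r)" and \<psi>: "\<psi> \<in> carrier (qschur_int n r)"
  shows "\<phi> \<oplus>\<^bsub>qschur_int n r\<^esub> \<psi> \<in> carrier (qschur_int n r)"
  by (rule S_memI [OF _ commutant_plus [OF Op_commutant [OF \<phi>] Op_commutant [OF \<psi>]]])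
    (simp_all add: qschur_int_def qmod_add_props S_closed [OF \<phi>] S_closed [OF \<psi>] vec_S [OF \<phi>] vec_S [OF \<psi>])

lemma S_smult_closed:
  assumes \<phi>: "\<phi> \<in> carrier (qschur_int n r)" and a: "a \<in> laurent"
  shows "qschur_smult n r a \<phi> \<in> carrier (qschur_int n r)"
  by (rule S_memI [OF _ commutant_scale [OF Op_commutant [OF \<phi>], of a]])
    (simp_all add: qschur_smult_def qmod_act_props(1) vec_scalar hecke_scalar_closed a S_closed [OF \<phi>] vec_S [OF \<phi>])

lemma S_comp_closed:
  assumes \<phi>: "\<phi> \<in> carrier (qschur_int n r)" and \<psi>: "\<psi> \<in> carrier (qschur_int n r)"
  shows "\<phi> \<otimes>\<^bsub>qschur_int n r\<^esub> \<psi> \<in> carrier (qschur_int n r)"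
  by (rule S_memI [OF _ commutant_comp [OF Op_commutant [OF \<phi>] Op_commutant [OF \<psi>]]])
    (simp_all add: qschur_int_def compose_eq S_closed [OF \<phi>] S_closed [OF \<psi>] vec_S [OF \<phi>] vec_S [OF \<psi>])

lemma S_monoid: "Group.monoid (qschur_int n r)"
proof (rule monoidI)
  show "\<one>\<^bsub>qschur_int n r\<^esub> \<in> carrier (qschur_int n r)"
    by (rule S_memI [OF _ commutant_id]) (simp_all add: qschur_int_def)
next
  fix \<phi> \<psi> assume "\<phi> \<in> carrier (qschur_int n r)" "\<psi> \<in> carrier (qschur_int n r)"
  then show "\<phi> \<otimes>\<^bsub>qschur_int n r\<^esub> \<psi> \<in> carrier (qschur_int n r)" by (rule S_comp_closed)
next
  fix \<phi> \<psi> \<chi>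
  assume *: "\<phi> \<in> carrier (qschur_int n r)" "\<psi> \<in> carrier (qschur_int n r)" "\<chi> \<in> carrier (qschur_int n r)"
  show "\<phi> \<otimes>\<^bsub>qschur_int n r\<^esub> \<psi> \<otimes>\<^bsub>qschur_int n r\<^esub> \<chi> = \<phi> \<otimes>\<^bsub>qschur_int n r\<^esub> (\<psi> \<otimes>\<^bsub>qschur_int n r\<^esub> \<chi>)"
    using S_closed [OF *(3)] by (auto simp: qschur_int_def compose_def fun_eq_iff)
next
  fix \<phi> assume \<phi>: "\<phi> \<in> carrier (qschur_int n r)"
  show "\<one>\<^bsub>qschur_int n r\<^esub> \<otimes>\<^bsub>qschur_int n r\<^esub> \<phi> = \<phi>"
    by (rule extensionalityI [OF _ S_extensional [OF \<phi>]])
      (simp_all add: qschur_int_def compose_eq S_closed [OF \<phi>])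
  show "\<phi> \<otimes>\<^bsub>qschur_int n r\<^esub> \<one>\<^bsub>qschur_int n r\<^esub> = \<phi>"
    by (rule extensionalityI [OF _ S_extensional [OF \<phi>]])
      (simp_all add: qschur_int_def compose_eq)
qed

definition KS :: "nat \<Rightarrow> nat \<Rightarrow> (K \<times> (mod_elem \<Rightarrow> mod_elem)) monoid"
  where "KS n r = \<lparr>carrier = UNIV, monoid.mult = (*), one = 1\<rparr> \<times>\<times> qschur_int n r"

lemma KS_simps:
  "carrier (KS n r) = UNIV \<times> carrier (qschur_int n r)"
  "(k, s) \<otimes>\<^bsub>KS n r\<^esub> (l, t) = (k * l, s \<otimes>\<^bsub>qschur_int n r\<^esub> t)"
  by (simp_all add: KS_def DirProd_def)

interpretation ks: monoid_ring "UNIV :: int set" "KS n r" for n r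
proof -
  have "Group.monoid \<lparr>carrier = UNIV :: K set, monoid.mult = (*), one = 1\<rparr>"
    by (rule monoidI) auto
  then have "Group.monoid (KS n r)"
    unfolding KS_def by (rule DirProd_monoid [OF _ S_monoid])
  then show "monoid_ring (UNIV :: int set) (KS n r)"
    by (intro monoid_ring.intro coeff_subring_UNIV)
qed

abbreviation TF where "TF n r \<equiv> ks.MA n r"

lemma tensor_free_eq: "tensor_free (qschur_int n r) = TF n r"
  by (simp add: tensor_free_def KS_def)

definition TR :: "nat \<Rightarrow> nat \<Rightarrow> (K \<times> (mod_elem \<Rightarrow> mod_elem) \<Rightarrow> int) set"
  where "TR n r = tensor_relations laurent (qschur_smult n r) (qschur_int n r)"

definition TI :: "nat \<Rightarrow> nat \<Rightarrow> (K \<times> (mod_elem \<Rightarrow> mod_elem) \<Rightarrow> int) set"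
  where "TI n r = Idl\<^bsub>TF n r\<^esub> (TR n r)"

lemma tensor_single: "s \<in> carrier (qschur_int n r) \<Longrightarrow> single (k, s) c \<in> carrier (TF n r)"
  by (rule ks.single_carrier) (simp_all add: KS_simps)

lemma TR_cases:
  assumes "z \<in> TR n r"
  obtains
    (left) k l s where "s \<in> carrier (qschur_int n r)"
      "z = single (k + l, s) 1 \<ominus>\<^bsub>TF n r\<^esub> (single (k, s) 1 \<oplus>\<^bsub>TF n r\<^esub> single (l, s) 1)"
  | (right) k s t where "s \<in> carrier (qschur_int n r)" "t \<in> carrier (qschur_int n r)"
      "z = single (k, s \<oplus>\<^bsub>qschur_int n r\<^esub> t) 1 \<ominus>\<^bsub>TF n r\<^esub> (single (k, s) 1 \<oplus>\<^bsub>TF n r\<^esub> single (k, t) 1)"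
  | (scalar) k a s where "a \<in> laurent" "s \<in> carrier (qschur_int n r)"
      "z = single (k * a, s) 1 \<ominus>\<^bsub>TF n r\<^esub> single (k, qschur_smult n r a s) 1"
  using assms unfolding TR_def tensor_relations_def Let_def tensor_free_eq by blast

lemma TR_carrier: "TR n r \<subseteq> carrier (TF n r)"
proof
  interpret F: ring "TF n r" by (rule ks.monoid_algebra_ring)
  fix z assume "z \<in> TR n r"
  then show "z \<in> carrier (TF n r)"
    by (cases rule: TR_cases)
      (simp_all only: F.minus_closed F.add.m_closed tensor_single S_plus_closed S_smult_closed)
qed

lemma TI_ideal: "ideal (TI n r) (TF n r)"
  unfolding TI_def by (rule ring.genideal_ideal [OF ks.monoid_algebra_ring TR_carrier])

lemma qschur_eq: "qschur n r = TF n r Quot TI n r"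
  by (simp add: qschur_def base_change_def tensor_ideal_def tensor_free_eq TI_def TR_def)

lemma qschur_ring: "ring (qschur n r)"
  unfolding qschur_eq by (rule ideal.quotient_is_ring [OF TI_ideal])

definition tensor_class :: "nat \<Rightarrow> nat \<Rightarrow> (K \<times> (mod_elem \<Rightarrow> mod_elem) \<Rightarrow> int) \<Rightarrow> (K \<times> (mod_elem \<Rightarrow> mod_elem) \<Rightarrow> int) set"
  where "tensor_class n r F = TI n r +>\<^bsub>TF n r\<^esub> F"

lemma tensor_class_hom: "tensor_class n r \<in> ring_hom (TF n r) (qschur n r)"
  unfolding tensor_class_def [abs_def] qschur_eq by (rule ideal.rcos_ring_hom [OF TI_ideal])

lemma tensor_class_closed: "F \<in> carrier (TF n r) \<Longrightarrow> tensor_class n r F \<in> carrier (qschur n r)"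
  using tensor_class_hom by (rule ring_hom_closed)

lemma tensor_class_mult: "F \<in> carrier (TF n r) \<Longrightarrow> F' \<in> carrier (TF n r) \<Longrightarrow>
    tensor_class n r (F \<otimes>\<^bsub>TF n r\<^esub> F') = tensor_class n r F \<otimes>\<^bsub>qschur n r\<^esub> tensor_class n r F'"
  using tensor_class_hom by (rule ring_hom_mult)

lemma tensor_class_add: "F \<in> carrier (TF n r) \<Longrightarrow> F' \<in> carrier (TF n r) \<Longrightarrow>
    tensor_class n r (\<lambda>x. F x + F' x) = tensor_class n r F \<oplus>\<^bsub>qschur n r\<^esub> tensor_class n r F'"
  using ring_hom_add [OF tensor_class_hom, of F n r F'] by (simp add: ks.add_eq)

lemma tensor_class_zero: "tensor_class n r (\<lambda>x. 0) = \<zero>\<^bsub>qschur n r\<^esub>"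
  using ring_hom_zero [OF tensor_class_hom ks.monoid_algebra_ring qschur_ring, of n r] by (simp add: ks.zero_eq)

lemma qschur_carrier: "carrier (qschur n r) = tensor_class n r ` carrier (TF n r)"
  unfolding tensor_class_def [abs_def] qschur_eq by (auto simp: FactRing_def A_RCOSETS_def' a_r_coset_def)

lemma tensor_class_relation:
  assumes "F \<ominus>\<^bsub>TF n r\<^esub> F' \<in> TR n r" "F \<in> carrier (TF n r)" "F' \<in> carrier (TF n r)"
  shows "tensor_class n r F = tensor_class n r F'"
proof -
  interpret F: ring "TF n r" by (rule ks.monoid_algebra_ring)
  have "F \<ominus>\<^bsub>TF n r\<^esub> F' \<in> TI n r"
    using assms(1) F.genideal_self [OF TR_carrier] unfolding TI_def by blast
  then show ?thesis
    using F.quotient_eq_iff_same_a_r_cos [OF TI_ideal assms(2,3)] by (simp add: tensor_class_def)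
qed

definition pt :: "nat \<Rightarrow> nat \<Rightarrow> K \<Rightarrow> (mod_elem \<Rightarrow> mod_elem) \<Rightarrow> (K \<times> (mod_elem \<Rightarrow> mod_elem) \<Rightarrow> int) set"
  where "pt n r k s = tensor_class n r (single (k, s) 1)"

lemma pure_tensor_eq: "pure_tensor laurent (qschur_smult n r) (qschur_int n r) k s = pt n r k s"
  by (simp add: pure_tensor_def tensor_ideal_def tensor_free_eq pt_def tensor_class_def TI_def TR_def)

lemma pt_closed: "s \<in> carrier (qschur_int n r) \<Longrightarrow> pt n r k s \<in> carrier (qschur n r)"
  unfolding pt_def by (intro tensor_class_closed tensor_single)

lemma pt_add_left:
  assumes s: "s \<in> carrier (qschur_int n r)"
  shows "pt n r (k + l) s = pt n r k s \<oplus>\<^bsub>qschur n r\<^esub> pt n r l s"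
proof -
  interpret F: ring "TF n r" by (rule ks.monoid_algebra_ring)
  note c = tensor_single [OF s]
  have "pt n r (k + l) s = tensor_class n r (single (k, s) 1 \<oplus>\<^bsub>TF n r\<^esub> single (l, s) 1)"
    unfolding pt_def
  proof (rule tensor_class_relation [OF _ c F.add.m_closed [OF c c]])
    show "single (k + l, s) 1 \<ominus>\<^bsub>TF n r\<^esub> (single (k, s) 1 \<oplus>\<^bsub>TF n r\<^esub> single (l, s) 1) \<in> TR n r"
      unfolding TR_def tensor_relations_def Let_def tensor_free_eq
      by (rule UnI1, rule UnI1, rule CollectI, rule exI [of _ k], rule exI [of _ l], rule exI [of _ s])
        (simp add: s)
  qed
  then show ?thesis by (simp add: pt_def ks.add_eq tensor_class_add c)
qed

lemma pt_add_right:
  assumes s: "s \<in> carrier (qschur_int n r)" and t: "t \<in> carrier (qschur_int n r)"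
  shows "pt n r k (s \<oplus>\<^bsub>qschur_int n r\<^esub> t) = pt n r k s \<oplus>\<^bsub>qschur n r\<^esub> pt n r k t"
proof -
  interpret F: ring "TF n r" by (rule ks.monoid_algebra_ring)
  note c = tensor_single [OF s] tensor_single [OF t] tensor_single [OF S_plus_closed [OF s t]]
  have "pt n r k (s \<oplus>\<^bsub>qschur_int n r\<^esub> t) = tensor_class n r (single (k, s) 1 \<oplus>\<^bsub>TF n r\<^esub> single (k, t) 1)"
    unfolding pt_def
  proof (rule tensor_class_relation [OF _ c(3) F.add.m_closed [OF c(1) c(2)]])
    show "single (k, s \<oplus>\<^bsub>qschur_int n r\<^esub> t) 1 \<ominus>\<^bsub>TF n r\<^esub> (single (k, s) 1 \<oplus>\<^bsub>TF n r\<^esub> single (k, t) 1) \<in> TR n r"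
      unfolding TR_def tensor_relations_def Let_def tensor_free_eq
      by (rule UnI1, rule UnI2, rule CollectI, rule exI [of _ k], rule exI [of _ s], rule exI [of _ t])
        (simp add: s t)
  qed
  then show ?thesis by (simp add: pt_def ks.add_eq tensor_class_add c)
qed

lemma pt_scalar:
  assumes s: "s \<in> carrier (qschur_int n r)" and a: "a \<in> laurent"
  shows "pt n r k (qschur_smult n r a s) = pt n r (k * a) s"
proof -
  note c = tensor_single [OF s] tensor_single [OF S_smult_closed [OF s a]]
  have "pt n r (k * a) s = pt n r k (qschur_smult n r a s)"
    unfolding pt_def
  proof (rule tensor_class_relation [OF _ c])
    show "single (k * a, s) 1 \<ominus>\<^bsub>TF n r\<^esub> single (k, qschur_smult n r a s) 1 \<in> TR n r"
      unfolding TR_def tensor_relations_def Let_def tensor_free_eq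
      by (rule UnI2, rule CollectI, rule exI [of _ k], rule exI [of _ a], rule exI [of _ s])
        (simp add: s a)
  qed
  then show ?thesis ..
qed

lemma pt_zero: "s \<in> carrier (qschur_int n r) \<Longrightarrow> pt n r 0 s = \<zero>\<^bsub>qschur n r\<^esub>"
proof -
  interpret Q: ring "qschur n r" by (rule qschur_ring)
  assume s: "s \<in> carrier (qschur_int n r)"
  show ?thesis using pt_add_left [OF s, of 0 0] pt_closed [OF s, of 0] by simp
qed

section \<open>The operator of a tensor\<close>

definition Psi :: "nat \<Rightarrow> nat \<Rightarrow> (K \<times> (mod_elem \<Rightarrow> mod_elem) \<Rightarrow> int) \<Rightarrow> tensor_op"
  where "Psi n r F = (\<lambda>f i. lin of_int (\<lambda>x. fst x * Op n r (snd x) f i) F)"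

lemma Psi_plus:
  assumes "F \<in> carrier (TF n r)" "F' \<in> carrier (TF n r)"
  shows "Psi n r (\<lambda>x. F x + F' x) f = (\<lambda>i. Psi n r F f i + Psi n r F' f i)"
  using assms by (simp add: Psi_def int_K.lin_plus ks.carrier_finite)

lemma Psi_single: "Psi n r (single (k, s) c) f = (\<lambda>i. of_int c * (k * Op n r s f i))"
  by (simp add: Psi_def int_K.lin_single)

lemma Psi_uminus: "Psi n r (\<lambda>x. - F x) f = (\<lambda>i. - Psi n r F f i)"
  by (simp add: Psi_def lin_def sum_negf)

lemma Psi_mult:
  assumes F: "F \<in> carrier (TF n r)" and F': "F' \<in> carrier (TF n r)"
  shows "Psi n r (F \<otimes>\<^bsub>TF n r\<^esub> F') f = Psi n r F (Psi n r F' f)"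
proof
  fix i
  have carr: "snd x \<in> carrier (qschur_int n r)" if "F x \<noteq> 0 \<or> F' x \<noteq> 0" for x
    using ks.carrier_supp [OF F, of x] ks.carrier_supp [OF F', of x] that by (auto simp: KS_simps)
  have op: "Op n r s (Psi n r F' f) i = lin of_int (\<lambda>y. fst y * Op n r s (Op n r (snd y) f) i) F'" for s
    unfolding Psi_def lin_def mult.assoc [symmetric] by (simp add: Op_linear)
  have "Psi n r (F \<otimes>\<^bsub>TF n r\<^esub> F') f i =
      lin of_int (\<lambda>x. lin of_int (\<lambda>y. fst (x \<otimes>\<^bsub>KS n r\<^esub> y) * Op n r (snd (x \<otimes>\<^bsub>KS n r\<^esub> y)) f i) F') F"
    unfolding Psi_def by (rule int_K.lin_mult [OF F F'])
  also have "\<dots> = lin of_int (\<lambda>x. lin of_int (\<lambda>y. fst x * (fst y * Op n r (snd x) (Op n r (snd y) f) i)) F') F"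
  proof (intro lin_cong)
    fix x y assume "F x \<noteq> 0" "F' y \<noteq> 0"
    then have "snd x \<in> carrier (qschur_int n r)" "snd y \<in> carrier (qschur_int n r)" using carr by auto
    then show "fst (x \<otimes>\<^bsub>KS n r\<^esub> y) * Op n r (snd (x \<otimes>\<^bsub>KS n r\<^esub> y)) f i =
        fst x * (fst y * Op n r (snd x) (Op n r (snd y) f) i)"
      by (cases x; cases y) (simp add: KS_simps Op_comp mult.assoc)
  qed
  also have "\<dots> = lin of_int (\<lambda>x. fst x * Op n r (snd x) (Psi n r F' f) i) F"
    by (simp only: lin_scale_right op)
  finally show "Psi n r (F \<otimes>\<^bsub>TF n r\<^esub> F') f i = Psi n r F (Psi n r F' f) i"
    by (simp add: Psi_def)
qed

lemma Psi_zero: "Psi n r F (\<lambda>i. 0) = (\<lambda>i. 0)"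
  by (simp add: Psi_def Op_def lin_def)

lemma Psi_relation:
  assumes "z \<in> TR n r"
  shows "Psi n r z f = (\<lambda>i. 0)"
proof -
  interpret F: ring "TF n r" by (rule ks.monoid_algebra_ring)
  have minus: "Psi n r (F \<ominus>\<^bsub>TF n r\<^esub> F') f = (\<lambda>i. Psi n r F f i - Psi n r F' f i)"
    if "F \<in> carrier (TF n r)" "F' \<in> carrier (TF n r)" for F F'
    using Psi_plus [OF that(1) ks.uminus_carrier [OF that(2)], of f] by (simp add: ks.minus_eq [OF that] Psi_uminus)
  from assms show ?thesis
  proof (cases rule: TR_cases)
    case (left k l s)
    note c = tensor_single [OF left(1)]
    show ?thesis
      unfolding left(2) minus [OF c F.add.m_closed [OF c c]]
      unfolding ks.add_eq Psi_plus [OF c c] by (simp add: Psi_single algebra_simps)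
  next
    case (right k s t)
    note c = tensor_single [OF right(1)] tensor_single [OF right(2)] tensor_single [OF S_plus_closed [OF right(1,2)]]
    show ?thesis
      unfolding right(3) minus [OF c(3) F.add.m_closed [OF c(1,2)]]
      unfolding ks.add_eq Psi_plus [OF c(1,2)] by (simp add: Psi_single Op_add right(1,2) algebra_simps)
  next
    case (scalar k a s)
    note c = tensor_single [OF scalar(2)] tensor_single [OF S_smult_closed [OF scalar(2,1)]]
    show ?thesis
      unfolding scalar(3) minus [OF c] by (simp add: Psi_single Op_smult scalar(1,2))
  qed
qed

text \<open>The operator is read off an arbitrary representative; \<open>Phi_tensor_class\<close>
  shows independence, because the bilinearity relations act as zero.\<close>

definition Phi :: "nat \<Rightarrow> nat \<Rightarrow> (K \<times> (mod_elem \<Rightarrow> mod_elem) \<Rightarrow> int) set \<Rightarrow> tensor_op"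
  where "Phi n r z = Psi n r (SOME F. F \<in> carrier (TF n r) \<and> tensor_class n r F = z)"

lemma Phi_tensor_class:
  assumes F: "F \<in> carrier (TF n r)"
  shows "Phi n r (tensor_class n r F) = Psi n r F"
proof -
  interpret F: ring "TF n r" by (rule ks.monoid_algebra_ring)
  let ?G = "SOME G. G \<in> carrier (TF n r) \<and> tensor_class n r G = tensor_class n r F"
  have G: "?G \<in> carrier (TF n r)" "tensor_class n r ?G = tensor_class n r F"
    using someI [of "\<lambda>G. G \<in> carrier (TF n r) \<and> tensor_class n r G = tensor_class n r F" F] F by auto
  have "Psi n r ?G = Psi n r F"
  proof (rule F.quotient_lift [OF TR_carrier, of "Psi n r"])
    fix a b assume ab: "a \<in> carrier (TF n r)" "b \<in> carrier (TF n r)"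
    show "Psi n r (a \<oplus>\<^bsub>TF n r\<^esub> b) = Psi n r a + Psi n r b"
      by (intro ext) (simp add: ks.add_eq Psi_plus ab)
    assume "Psi n r a = 0"
    then have "Psi n r a f = (\<lambda>i. 0)" for f by (simp add: zero_fun_def)
    then show "Psi n r (a \<otimes>\<^bsub>TF n r\<^esub> b) = 0 \<and> Psi n r (b \<otimes>\<^bsub>TF n r\<^esub> a) = 0"
      by (intro conjI ext) (simp_all add: Psi_mult ab Psi_zero)
  next
    fix s assume "s \<in> TR n r"
    then show "Psi n r s = 0" by (intro ext) (simp add: Psi_relation)
  qed (use F G in \<open>simp_all only: tensor_class_def TI_def\<close>)
  then show ?thesis by (simp add: Phi_def)
qed

lemma Phi_mult:
  assumes "z \<in> carrier (qschur n r)" "z' \<in> carrier (qschur n r)"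
  shows "Phi n r (z \<otimes>\<^bsub>qschur n r\<^esub> z') f = Phi n r z (Phi n r z' f)"
proof -
  interpret F: ring "TF n r" by (rule ks.monoid_algebra_ring)
  from assms obtain F F' where F: "F \<in> carrier (TF n r)" "F' \<in> carrier (TF n r)" "z = tensor_class n r F" "z' = tensor_class n r F'"
    by (auto simp: qschur_carrier)
  then show ?thesis by (simp add: Phi_tensor_class Psi_mult F.m_closed flip: tensor_class_mult)
qed

lemma Phi_add:
  assumes "z \<in> carrier (qschur n r)" "z' \<in> carrier (qschur n r)"
  shows "Phi n r (z \<oplus>\<^bsub>qschur n r\<^esub> z') f = (\<lambda>i. Phi n r z f i + Phi n r z' f i)"
proof -
  from assms obtain F F' where F: "F \<in> carrier (TF n r)" "F' \<in> carrier (TF n r)" "z = tensor_class n r F" "z' = tensor_class n r F'"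
    by (auto simp: qschur_carrier)
  then show ?thesis by (simp add: Phi_tensor_class Psi_plus ks.plus_carrier flip: tensor_class_add)
qed

lemma Phi_zero: "Phi n r \<zero>\<^bsub>qschur n r\<^esub> f = (\<lambda>i. 0)"
proof -
  have "(\<lambda>x. 0) \<in> carrier (TF n r)" by (rule ks.carrierI) auto
  from Phi_tensor_class [OF this] show ?thesis by (simp add: tensor_class_zero Psi_def lin_def)
qed

lemma Phi_pt: "s \<in> carrier (qschur_int n r) \<Longrightarrow> Phi n r (pt n r k s) f = (\<lambda>i. k * Op n r s f i)"
  by (simp add: pt_def Phi_tensor_class tensor_single Psi_single)

section \<open>Reduction of tensors to combinations of the basis\<close>

definition qcomb :: "nat \<Rightarrow> nat \<Rightarrow> (mat \<Rightarrow> K) \<Rightarrow> (K \<times> (mod_elem \<Rightarrow> mod_elem) \<Rightarrow> int) set"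
  where "qcomb n r k = (\<Oplus>\<^bsub>qschur n r\<^esub> A \<in> Theta n r. pt n r (k A) (e_basis n r A))"

lemma pt_e_closed: "A \<in> Theta n r \<Longrightarrow> pt n r k (e_basis n r A) \<in> carrier (qschur n r)"
  by (intro pt_closed e_basis_props)

lemma qcomb_closed: "qcomb n r k \<in> carrier (qschur n r)"
proof -
  interpret Q: ring "qschur n r" by (rule qschur_ring)
  show ?thesis unfolding qcomb_def by (rule Q.finsum_closed) (auto intro: pt_e_closed)
qed

lemma qcomb_plus: "qcomb n r (\<lambda>A. k A + l A) = qcomb n r k \<oplus>\<^bsub>qschur n r\<^esub> qcomb n r l"
proof -
  interpret Q: ring "qschur n r" by (rule qschur_ring)
  have "qcomb n r (\<lambda>A. k A + l A) =
      (\<Oplus>\<^bsub>qschur n r\<^esub> A \<in> Theta n r. pt n r (k A) (e_basis n r A) \<oplus>\<^bsub>qschur n r\<^esub> pt n r (l A) (e_basis n r A))"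
    unfolding qcomb_def
    by (rule Q.finsum_cong') (auto intro: pt_e_closed simp: pt_add_left e_basis_props)
  also have "\<dots> = qcomb n r k \<oplus>\<^bsub>qschur n r\<^esub> qcomb n r l"
    unfolding qcomb_def by (rule Q.finsum_addf) (auto intro: pt_e_closed)
  finally show ?thesis .
qed

lemma qcomb_cong: "(\<And>A. A \<in> Theta n r \<Longrightarrow> k A = l A) \<Longrightarrow> qcomb n r k = qcomb n r l"
proof -
  interpret Q: ring "qschur n r" by (rule qschur_ring)
  assume "\<And>A. A \<in> Theta n r \<Longrightarrow> k A = l A"
  then show ?thesis unfolding qcomb_def by (intro Q.finsum_cong') (auto intro: pt_e_closed)
qed

lemma qcomb_zero: "qcomb n r (\<lambda>A. 0) = \<zero>\<^bsub>qschur n r\<^esub>"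
proof -
  interpret Q: ring "qschur n r" by (rule qschur_ring)
  have "qcomb n r (\<lambda>A. 0) = (\<Oplus>\<^bsub>qschur n r\<^esub> A \<in> Theta n r. \<zero>\<^bsub>qschur n r\<^esub>)"
    unfolding qcomb_def by (rule Q.finsum_cong') (auto simp: pt_zero e_basis_props)
  then show ?thesis by simp
qed

lemma qcomb_single:
  assumes A: "A \<in> Theta n r"
  shows "qcomb n r (\<lambda>B. if B = A then c else 0) = pt n r c (e_basis n r A)"
proof -
  interpret Q: ring "qschur n r" by (rule qschur_ring)
  have "qcomb n r (\<lambda>B. if B = A then c else 0) =
      (\<Oplus>\<^bsub>qschur n r\<^esub> B \<in> Theta n r. if A = B then pt n r c (e_basis n r B) else \<zero>\<^bsub>qschur n r\<^esub>)"
    unfolding qcomb_def by (rule Q.finsum_cong') (auto simp: pt_zero e_basis_props intro: pt_e_closed)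
  also have "\<dots> = pt n r c (e_basis n r A)"
    by (rule Q.finsum_singleton [OF A finite_Theta]) (auto intro: pt_e_closed)
  finally show ?thesis .
qed

lemma Phi_finsum:
  assumes "finite D" "\<And>x. x \<in> D \<Longrightarrow> z x \<in> carrier (qschur n r)"
  shows "Phi n r (\<Oplus>\<^bsub>qschur n r\<^esub> x \<in> D. z x) f = (\<lambda>i. \<Sum>x\<in>D. Phi n r (z x) f i)"
  using assms
proof (induction D rule: finite_induct)
  interpret Q: ring "qschur n r" by (rule qschur_ring)
  case empty
  show ?case by (simp add: Phi_zero)
next
  interpret Q: ring "qschur n r" by (rule qschur_ring)
  case (insert x D)
  have "(\<Oplus>\<^bsub>qschur n r\<^esub> y \<in> D. z y) \<in> carrier (qschur n r)"
    by (rule Q.finsum_closed) (use insert.prems in auto)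
  moreover have "(\<Oplus>\<^bsub>qschur n r\<^esub> y \<in> insert x D. z y) = z x \<oplus>\<^bsub>qschur n r\<^esub> (\<Oplus>\<^bsub>qschur n r\<^esub> y \<in> D. z y)"
    by (rule Q.finsum_insert) (use insert in auto)
  ultimately show ?case using insert by (simp add: Phi_add)
qed

lemma Phi_qcomb: "f \<in> TS n r \<Longrightarrow> Phi n r (qcomb n r k) f = comb n r k f"
  unfolding qcomb_def comb_def
  by (simp add: Phi_finsum finite_Theta pt_e_closed Phi_pt e_basis_props)

text \<open>Coefficients are peeled off one at a time, with \<open>D\<close> containing the matrices
  that may still occur. Each coefficient c is Laurent, so c e_A lies in the integral algebra and c
  can be moved through the tensor sign into K.\<close>

lemma pt_eq_qcomb:
  assumes "\<phi> \<in> carrier (qschur_int n r)"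
  shows "pt n r k \<phi> = qcomb n r (\<lambda>A. k * cf n r (Op n r \<phi>) A)"
proof -
  interpret Q: ring "qschur n r" by (rule qschur_ring)
  have "pt n r k \<phi> = qcomb n r (\<lambda>A. k * cf n r (Op n r \<phi>) A)"
    if "finite D" "D \<subseteq> Theta n r" "\<phi> \<in> carrier (qschur_int n r)"
      "\<And>A. A \<in> Theta n r \<Longrightarrow> A \<notin> D \<Longrightarrow> cf n r (Op n r \<phi>) A = 0" for D \<phi>
    using that
  proof (induction D arbitrary: \<phi> rule: finite_induct)
    case empty
    note \<phi> = empty(2)
    have z: "Op n r \<phi> f = (\<lambda>i. 0)" if "f \<in> TS n r" for f
      using comm_ext [OF Op_commutant [OF \<phi>] commutant_zero _ that] empty(3) by (simp add: cf_def)
    \<comment> \<open>With all coefficients zero, \<phi> equals its own double; the pure tensor t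
      then satisfies t = t + t and cancels.\<close>
    have "\<phi> \<oplus>\<^bsub>qschur_int n r\<^esub> \<phi> = \<phi>"
      by (rule Op_inj [OF S_plus_closed [OF \<phi> \<phi>] \<phi>]) (simp add: Op_add \<phi> z)
    then have "pt n r k \<phi> = \<zero>\<^bsub>qschur n r\<^esub>"
      using pt_add_right [OF \<phi> \<phi>, of k] pt_closed [OF \<phi>, of k] by simp
    moreover have "qcomb n r (\<lambda>A. k * cf n r (Op n r \<phi>) A) = qcomb n r (\<lambda>A. 0)"
      by (rule qcomb_cong) (simp add: empty(3))
    ultimately show ?case by (simp add: qcomb_zero)
  next
    case (insert A D)
    note \<phi> = insert.prems(2)
    have A: "A \<in> Theta n r" using insert.prems by simp
    define c where "c = cf n r (Op n r \<phi>) A"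
    have c: "c \<in> laurent" unfolding c_def by (rule cf_Op_laurent [OF \<phi> A])
    \<comment> \<open>Removing the term at A keeps all coefficients Laurent, so the difference is
      again the operator of an integral endomorphism.\<close>
    let ?X = "\<lambda>f i. Op n r \<phi> f i + (- c) * elem n r A f i"
    have X: "?X \<in> commutant n r"
      by (intro commutant_plus commutant_scale Op_commutant \<phi> elem_commutant A)
    have cfX: "cf n r ?X B = (if B = A then 0 else cf n r (Op n r \<phi>) B)" if "B \<in> Theta n r" for B
      unfolding cf_plus cf_scale elem_props(2) [OF A that] by (simp add: c_def)
    have "cf n r ?X B \<in> laurent" if "B \<in> Theta n r" for B
      unfolding cfX [OF that] using cf_Op_laurent [OF \<phi> that] by simp
    from Op_surj [OF X this] obtain \<psi> where
      \<psi>: "\<psi> \<in> carrier (qschur_int n r)" "\<And>f. f \<in> TS n r \<Longrightarrow> Op n r \<psi> f = ?X f" by blast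
    have cf\<psi>: "cf n r (Op n r \<psi>) B = (if B = A then 0 else cf n r (Op n r \<phi>) B)" if "B \<in> Theta n r" for B
      using cf_cong [OF that \<psi>(2)] cfX [OF that] by simp
    have IH: "pt n r k \<psi> = qcomb n r (\<lambda>B. k * cf n r (Op n r \<psi>) B)"
      by (rule insert.IH) (use insert.prems \<psi>(1) cf\<psi> in auto)
    note e = e_basis_props [OF A]
    let ?ce = "qschur_smult n r c (e_basis n r A)"
    have ce: "?ce \<in> carrier (qschur_int n r)" by (rule S_smult_closed [OF e(1) c])
    have "\<phi> = \<psi> \<oplus>\<^bsub>qschur_int n r\<^esub> ?ce"
      by (rule Op_inj [OF \<phi> S_plus_closed [OF \<psi>(1) ce]])
        (simp add: Op_add \<psi> ce Op_smult e c)
    then have "pt n r k \<phi> = pt n r k \<psi> \<oplus>\<^bsub>qschur n r\<^esub> pt n r (k * c) (e_basis n r A)"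
      using pt_add_right [OF \<psi>(1) ce, of k] pt_scalar [OF e(1) c, of k] by simp
    also have "\<dots> = qcomb n r (\<lambda>B. k * cf n r (Op n r \<psi>) B + (if B = A then k * c else 0))"
      unfolding IH qcomb_plus qcomb_single [OF A] ..
    also have "\<dots> = qcomb n r (\<lambda>B. k * cf n r (Op n r \<phi>) B)"
      by (rule qcomb_cong) (simp add: cf\<psi> c_def)
    finally show ?case .
  qed
  from this [OF finite_Theta order_refl assms] show ?thesis by simp
qed

text \<open>The free group has integer coefficients; repeated addition, and inversion for negative
  ones, turns them into scalars of the left tensor factor.\<close>

lemma tensor_class_single_int:
  assumes s: "s \<in> carrier (qschur_int n r)"
  shows "tensor_class n r (single (k, s) c) = pt n r (of_int c * k) s"
proof -
  interpret Q: ring "qschur n r" by (rule qschur_ring)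
  have nat: "tensor_class n r (single (k, s) (int m)) = pt n r (of_nat m * k) s" for m
  proof (induction m)
    case 0
    have "single (k, s) (0 :: int) = (\<lambda>x. 0)" by (auto simp: single_def)
    then show ?case by (simp add: tensor_class_zero pt_zero [OF s])
  next
    case (Suc m)
    have "single (k, s) (int (Suc m)) = (\<lambda>x. single (k, s) (int m) x + single (k, s) 1 x)"
      by (auto simp: single_def)
    then have "tensor_class n r (single (k, s) (int (Suc m))) = tensor_class n r (single (k, s) (int m)) \<oplus>\<^bsub>qschur n r\<^esub> pt n r k s"
      by (simp add: tensor_class_add tensor_single [OF s] pt_def)
    then show ?case using pt_add_left [OF s, of "of_nat m * k" k] Suc by (simp add: algebra_simps)
  qed
  have neg: "tensor_class n r (single (k, s) (- int m)) = pt n r (- of_nat m * k) s" for m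
  proof -
    have "(\<lambda>x. single (k, s) (- int m) x + single (k, s) (int m) x) = (\<lambda>x. 0)" by (auto simp: single_def)
    then have "tensor_class n r (single (k, s) (- int m)) \<oplus>\<^bsub>qschur n r\<^esub> pt n r (of_nat m * k) s = \<zero>\<^bsub>qschur n r\<^esub>"
      using tensor_class_add [OF tensor_single [OF s] tensor_single [OF s], of k "- int m" k "int m"] nat [of m]
      by (simp add: tensor_class_zero)
    moreover have "pt n r (- of_nat m * k) s \<oplus>\<^bsub>qschur n r\<^esub> pt n r (of_nat m * k) s = \<zero>\<^bsub>qschur n r\<^esub>"
      using pt_add_left [OF s, of "- of_nat m * k" "of_nat m * k"] pt_zero [OF s] by simp
    ultimately show ?thesis
      using pt_closed [OF s] tensor_class_closed [OF tensor_single [OF s]] by (metis Q.add.inv_equality)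
  qed
  show ?thesis using nat [of "nat c"] neg [of "nat (- c)"] by (cases "c \<ge> 0") auto
qed

lemma qschur_all_qcomb:
  assumes "z \<in> carrier (qschur n r)"
  shows "\<exists>k. z = qcomb n r k"
proof -
  obtain F where F: "F \<in> carrier (TF n r)" "z = tensor_class n r F" using assms by (auto simp: qschur_carrier)
  from F(1) have "\<exists>k. tensor_class n r F = qcomb n r k"
  proof (induction rule: ks.carrier_induct)
    case zero
    show ?case by (rule exI [of _ "\<lambda>A. 0"]) (simp add: tensor_class_zero qcomb_zero)
  next
    case (add a c F)
    obtain k s where a: "a = (k, s)" and s: "s \<in> carrier (qschur_int n r)"
      using add(1) by (cases a) (auto simp: KS_simps)
    obtain l where l: "tensor_class n r F = qcomb n r l" using add by blast
    have "tensor_class n r (\<lambda>g. single a c g + F g) = pt n r (of_int c * k) s \<oplus>\<^bsub>qschur n r\<^esub> qcomb n r l"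
      unfolding a using add(3) by (simp add: tensor_class_add tensor_single [OF s] tensor_class_single_int [OF s] l)
    then show ?case unfolding pt_eq_qcomb [OF s] qcomb_plus [symmetric] by blast
  qed
  then show ?thesis by (simp add: F(2))
qed

text \<open>Both elements are combinations of the e_A, whose coefficients are recovered from the
  operator by \<open>cf\<close>.\<close>

lemma Phi_inj:
  assumes "z \<in> carrier (qschur n r)" "z' \<in> carrier (qschur n r)"
    and eq: "\<And>f. f \<in> TS n r \<Longrightarrow> Phi n r z f = Phi n r z' f"
  shows "z = z'"
proof -
  obtain k l where kl: "z = qcomb n r k" "z' = qcomb n r l" using assms qschur_all_qcomb by metis
  have "comb n r k f = comb n r l f" if "f \<in> TS n r" for f
    using eq [OF that] by (simp add: kl Phi_qcomb [OF that])
  then have "k A = l A" if "A \<in> Theta n r" for A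
    using cf_cong [OF that, of "comb n r k" "comb n r l"] cf_comb [OF that] by metis
  then show ?thesis unfolding kl by (rule qcomb_cong)
qed

section \<open>The center\<close>

text \<open>The coefficient with respect to e_A instead of [A]: the normalising power of \<upsilon>
  is absorbed.\<close>

definition c_coeff :: "nat \<Rightarrow> nat \<Rightarrow> (mat \<Rightarrow> K) \<Rightarrow> mat \<Rightarrow> K"
  where "c_coeff n r x A = on_Omega n r x A * \<upsilon> powi (- int (d_stat n A))"

lemma c_elem_props:
  shows "c_elem n r x \<in> carrier (qschur n r)"
    and "f \<in> TS n r \<Longrightarrow> Phi n r (c_elem n r x) f = comb n r (c_coeff n r x) f"
proof -
  interpret Q: ring "qschur n r" by (rule qschur_ring)
  have sub: "Omega n r \<subseteq> Theta n r" by (auto simp: Omega_def)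
  have fin: "finite (Omega n r)" by (rule finite_subset [OF sub finite_Theta])
  have BLM: "pure_tensor laurent (qschur_smult n r) (qschur_int n r) (x A) (BLM n r A) =
      pt n r (x A * \<upsilon> powi (- int (d_stat n A))) (e_basis n r A)" if "A \<in> Omega n r" for A
    unfolding pure_tensor_eq BLM_def
    by (rule pt_scalar [OF e_basis_props(1) powi_laurent]) (use that sub in blast)
  have carr: "pt n r k (e_basis n r A) \<in> carrier (qschur n r)" if "A \<in> Omega n r" for A k
    using pt_e_closed that sub by blast
  have c: "c_elem n r x = (\<Oplus>\<^bsub>qschur n r\<^esub> A \<in> Omega n r. pt n r (x A * \<upsilon> powi (- int (d_stat n A))) (e_basis n r A))"
    unfolding c_elem_def by (rule Q.finsum_cong') (auto simp: BLM carr)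
  show "c_elem n r x \<in> carrier (qschur n r)"
    unfolding c by (rule Q.finsum_closed) (auto simp: carr)
  show "Phi n r (c_elem n r x) f = comb n r (c_coeff n r x) f" if f: "f \<in> TS n r"
  proof
    fix i
    have "Phi n r (c_elem n r x) f i =
        (\<Sum>A\<in>Omega n r. Phi n r (pt n r (x A * \<upsilon> powi (- int (d_stat n A))) (e_basis n r A)) f i)"
      unfolding c by (subst Phi_finsum [OF fin]) (simp_all add: carr)
    also have "\<dots> = (\<Sum>A\<in>Omega n r. c_coeff n r x A * elem n r A f i)"
    proof (rule sum.cong)
      fix A assume A: "A \<in> Omega n r"
      then have "A \<in> Theta n r" using sub by blast
      then show "Phi n r (pt n r (x A * \<upsilon> powi (- int (d_stat n A))) (e_basis n r A)) f i =
          c_coeff n r x A * elem n r A f i"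
        using A by (simp add: Phi_pt e_basis_props f c_coeff_def on_Omega_def)
    qed simp
    also have "\<dots> = comb n r (c_coeff n r x) f i"
      unfolding comb_def
      by (rule sum.mono_neutral_left) (auto simp: finite_Theta sub c_coeff_def on_Omega_def)
    finally show "Phi n r (c_elem n r x) f i = comb n r (c_coeff n r x) f i" .
  qed
qed

lemma c_coeff_balanced: "c_coeff n r x A \<noteq> 0 \<Longrightarrow> ro n A = co n A"
  by (auto simp: c_coeff_def on_Omega_def Omega_def split: if_splits)

text \<open>Equal row and column sums mean that c(x) preserves contents of words. This supplies the
  commutation with the weight projections, about which the center equations are silent.\<close>

lemma c_proj:
  assumes f: "f \<in> TS n r"
  shows "comb n r (c_coeff n r x) (op_proj r \<mu> f) = op_proj r \<mu> (comb n r (c_coeff n r x) f)"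
proof -
  let ?C = "comb n r (c_coeff n r x)"
  note C = comb_commutant [of n r "c_coeff n r x"]
  have L: "(\<lambda>f. ?C (op_proj r \<mu> f)) \<in> commutant n r" and R: "(\<lambda>f. op_proj r \<mu> (?C f)) \<in> commutant n r"
    by (rule commutant_comp [OF C proj_commutant], rule commutant_comp [OF proj_commutant C])
  show ?thesis
  proof (rule comm_ext [OF L R _ f])
    fix A assume A: "A \<in> Theta n r"
    let ?j = "jw r (co n A)"
    have j: "?j \<in> words n r" "ct r ?j = co n A"
      by (rule jw_words [OF co_Lam [OF A]], rule ct_jw [OF co_Lam [OF A]])
    obtain i where i: "i \<in> words n r" "mt r i ?j = A" using column_word [OF A] by blast
    have ct: "ct r i = ro n A" using ro_mt [OF j(1), of i] i(2) by simp
    have col: "?C (single ?j 1) i = c_coeff n r x A"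
      using comm_column [OF C co_Lam [OF A] i(1)] cf_comb [OF A] i(2) by simp
    have proj: "op_proj r \<mu> (single ?j 1) = (\<lambda>k. (if co n A = \<mu> then 1 else 0) * single ?j 1 k)"
      using j(2) by (auto simp: op_proj_def single_def)
    have "cf n r (\<lambda>f. ?C (op_proj r \<mu> f)) A = (if co n A = \<mu> then 1 else 0) * c_coeff n r x A"
      unfolding cf_eq [OF L A i] proj comm_scale [OF C TS_single [OF j(1)]] col ..
    moreover have "cf n r (\<lambda>f. op_proj r \<mu> (?C f)) A = (if ro n A = \<mu> then c_coeff n r x A else 0)"
      unfolding cf_eq [OF R A i] by (simp add: op_proj_def col ct)
    ultimately show "cf n r (\<lambda>f. ?C (op_proj r \<mu> f)) A = cf n r (\<lambda>f. op_proj r \<mu> (?C f)) A"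
      using c_coeff_balanced [of n r x A] by auto
  qed
qed

text \<open>A central c(x) commutes with all K-combinations of the e_A, and as operators the
  \<open>Gop\<close> are among them. Conversely, commuting with generators spreads through
  \<open>genalg\<close> to every elementary operator, and \<open>Phi_inj\<close> carries the result
  back to the algebra.\<close>

theorem center_iff_generators:
  "c_elem n r x \<in> ring_center (qschur n r) \<longleftrightarrow>
    (\<forall>R a b. root_op R a b \<and> a \<in> {1..n} \<and> b \<in> {1..n} \<longrightarrow>
      (\<forall>B\<in>Theta n r. cf n r (\<lambda>f. Gop r R a b (comb n r (c_coeff n r x) f)) B =
        cf n r (\<lambda>f. comb n r (c_coeff n r x) (Gop r R a b f)) B))"
    (is "?center \<longleftrightarrow> ?gens")
proof -
  let ?c = "c_elem n r x" and ?C = "comb n r (c_coeff n r x)"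
  note C = comb_commutant [of n r "c_coeff n r x"] and c = c_elem_props [where n = n and r = r and x = x]
  show ?thesis
  proof
    assume ?center
    then have comm: "?c \<otimes>\<^bsub>qschur n r\<^esub> y = y \<otimes>\<^bsub>qschur n r\<^esub> ?c" if "y \<in> carrier (qschur n r)" for y
      using that by (simp add: ring_center_def)
    have combs: "?C (comb n r k f) = comb n r k (?C f)" if f: "f \<in> TS n r" for k f
    proof -
      have "?C (comb n r k f) = Phi n r (?c \<otimes>\<^bsub>qschur n r\<^esub> qcomb n r k) f"
        using comm_TS [OF comb_commutant f] by (simp add: Phi_mult c qcomb_closed Phi_qcomb f)
      also have "\<dots> = comb n r k (?C f)"
        unfolding comm [OF qcomb_closed]
        using comm_TS [OF C f] by (simp add: Phi_mult c qcomb_closed Phi_qcomb f)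
      finally show ?thesis .
    qed
    show ?gens
    proof (intro allI impI ballI, elim conjE)
      fix R a b B assume root: "root_op R a b" and ab: "a \<in> {1..n}" "b \<in> {1..n}" and B: "B \<in> Theta n r"
      note G = Gop_commutant [OF root ab, of r]
      show "cf n r (\<lambda>f. Gop r R a b (?C f)) B = cf n r (\<lambda>f. ?C (Gop r R a b f)) B"
      proof (rule cf_cong [OF B])
        fix f assume f: "f \<in> TS n r"
        show "Gop r R a b (?C f) = ?C (Gop r R a b f)"
          unfolding comm_eq_comb [OF G f] comm_eq_comb [OF G comm_TS [OF C f]] combs [OF f] ..
      qed
    qed
  next
    assume gens: ?gens
    have gen: "?C (X f) = X (?C f)" if "X \<in> genalg n r" "f \<in> TS n r" for X f
      using that
    proof (induction arbitrary: f rule: genalg.induct)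
      case (gen R a b)
      note G = Gop_commutant [OF gen(1-3), of r]
      show ?case
        by (rule comm_ext [OF commutant_comp [OF C G] commutant_comp [OF G C] _ gen(4)])
          (use gens gen(1-3) in simp)
    next
      case (proj \<mu>)
      then show ?case by (rule c_proj)
    next
      case (plus X Y)
      then show ?case
        using comm_plus [OF C comm_TS [OF genalg_commutant [OF plus(1)] plus(5)]
            comm_TS [OF genalg_commutant [OF plus(2)] plus(5)]]
        by (simp add: op_plus_def)
    next
      case (scale X k)
      then show ?case
        using comm_scale [OF C comm_TS [OF genalg_commutant [OF scale(1)] scale(3)]]
        by (simp add: op_scale_def)
    next
      case (comp X Y)
      then show ?case using comm_TS [OF genalg_commutant [OF comp(2)] comp(5)] by simp
    qed
    have combs: "?C (comb n r k f) = comb n r k (?C f)" if f: "f \<in> TS n r" for k f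
    proof -
      have "?C (comb n r k f) = (\<lambda>i. \<Sum>A\<in>Theta n r. k A * ?C (elem n r A f) i)"
        unfolding comb_def [of n r k]
        by (subst comm_sum [OF C finite_Theta])
          (simp_all add: TS_scale comm_scale [OF C] comm_TS [OF elem_commutant f])
      also have "\<dots> = comb n r k (?C f)"
        unfolding comb_def [of n r k]
        by (intro ext sum.cong refl) (simp add: gen [OF elem_props(1) f])
      finally show ?thesis .
    qed
    have "?c \<otimes>\<^bsub>qschur n r\<^esub> y = y \<otimes>\<^bsub>qschur n r\<^esub> ?c" if y: "y \<in> carrier (qschur n r)" for y
    proof -
      interpret Q: ring "qschur n r" by (rule qschur_ring)
      obtain k where k: "y = qcomb n r k" using qschur_all_qcomb [OF y] by blast
      show ?thesis
      proof (rule Phi_inj)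
        fix f assume f: "f \<in> TS n r"
        show "Phi n r (?c \<otimes>\<^bsub>qschur n r\<^esub> y) f = Phi n r (y \<otimes>\<^bsub>qschur n r\<^esub> ?c) f"
          unfolding k using comm_TS [OF comb_commutant f] combs [OF f]
          by (simp add: Phi_mult c qcomb_closed Phi_qcomb f)
      qed (use y c(1) in simp_all)
    qed
    then show ?center using c(1) by (simp add: ring_center_def)
  qed
qed

subsection \<open>The normalisation\<close>

text \<open>The polarisation of the quadratic form d_A, over the integers so that differences of
  matrices may be inserted.\<close>

definition bil :: "nat \<Rightarrow> (nat \<Rightarrow> nat \<Rightarrow> int) \<Rightarrow> (nat \<Rightarrow> nat \<Rightarrow> int) \<Rightarrow> int"
  where "bil n X Y = (\<Sum>i\<in>{1..n}. \<Sum>j\<in>{1..n}. \<Sum>k\<in>{1..n}. \<Sum>l\<in>{1..n}. if k \<le> i \<and> j < l then X i j * Y k l else 0)"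

definition imat :: "mat \<Rightarrow> nat \<Rightarrow> nat \<Rightarrow> int"
  where "imat A = (\<lambda>i j. int (A i j))"

lemma d_stat_bil: "int (d_stat n A) = bil n (imat A) (imat A)"
proof -
  let ?P = "{1..n} \<times> {1..n} \<times> {1..n} \<times> {1..n}"
  have "{(i, j, k, l). i \<in> {1..n} \<and> j \<in> {1..n} \<and> k \<in> {1..n} \<and> l \<in> {1..n} \<and> i \<ge> k \<and> j < l} =
      {x \<in> ?P. case x of (i, j, k, l) \<Rightarrow> k \<le> i \<and> j < l}" by auto
  then have "d_stat n A = (\<Sum>x\<in>?P. if (case x of (i, j, k, l) \<Rightarrow> k \<le> i \<and> j < l)
      then (case x of (i, j, k, l) \<Rightarrow> A i j * A k l) else 0)"
    unfolding d_stat_def by (simp only: sum.inter_filter finite_cartesian_product finite_atLeastAtMost)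
  also have "\<dots> = (\<Sum>(i, j, k, l)\<in>?P. if k \<le> i \<and> j < l then A i j * A k l else 0)"
    by (rule sum.cong) (auto split: prod.splits)
  finally have d: "d_stat n A = (\<Sum>(i, j, k, l)\<in>?P. if k \<le> i \<and> j < l then A i j * A k l else 0)" .
  show ?thesis
    unfolding d bil_def sum.cartesian_product imat_def
    by (simp only: of_nat_sum) (rule sum.cong, auto)
qed

lemma bil_add: "bil n (\<lambda>i j. X i j + X' i j) Y = bil n X Y + bil n X' Y"
    "bil n Y (\<lambda>i j. X i j + X' i j) = bil n Y X + bil n Y X'"
  unfolding bil_def sum.distrib [symmetric]
  by (intro sum.cong refl, simp add: algebra_simps)+

lemma bil_diff: "bil n (\<lambda>i j. X i j - X' i j) Y = bil n X Y - bil n X' Y"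
    "bil n Y (\<lambda>i j. X i j - X' i j) = bil n Y X - bil n Y X'"
  unfolding bil_def sum_subtractf [symmetric]
  by (intro sum.cong refl, simp add: algebra_simps)+

lemma bil_E_right:
  assumes "a \<in> {1..n}" "u \<in> {1..n}"
  shows "bil n X (imat (E a u)) = (\<Sum>i\<in>{1..n}. \<Sum>j\<in>{1..n}. if a \<le> i \<and> j < u then X i j else 0)"
  unfolding bil_def
proof (intro sum.cong refl)
  fix i j
  have "(\<Sum>k\<in>{1..n}. \<Sum>l\<in>{1..n}. if k \<le> i \<and> j < l then X i j * imat (E a u) k l else 0) =
      (\<Sum>k\<in>{1..n}. \<Sum>l\<in>{1..n}. int (E a u k l) * (if k \<le> i \<and> j < l then X i j else 0))"
    by (intro sum.cong refl) (simp add: imat_def)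
  then show "(\<Sum>k\<in>{1..n}. \<Sum>l\<in>{1..n}. if k \<le> i \<and> j < l then X i j * imat (E a u) k l else 0) =
      (if a \<le> i \<and> j < u then X i j else 0)"
    using sum_E [of "{1..n}" "{1..n}" a u "\<lambda>k l. if k \<le> i \<and> j < l then X i j else 0"] assms by simp
qed

lemma bil_E_left:
  assumes "a \<in> {1..n}" "u \<in> {1..n}"
  shows "bil n (imat (E a u)) X = (\<Sum>k\<in>{1..n}. \<Sum>l\<in>{1..n}. if k \<le> a \<and> u < l then X k l else 0)"
proof -
  have "bil n (imat (E a u)) X = (\<Sum>i\<in>{1..n}. \<Sum>j\<in>{1..n}. int (E a u i j) *
      (\<Sum>k\<in>{1..n}. \<Sum>l\<in>{1..n}. if k \<le> i \<and> j < l then X k l else 0))"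
    unfolding bil_def sum_distrib_left by (intro sum.cong refl) (simp add: imat_def)
  then show ?thesis
    using sum_E [of "{1..n}" "{1..n}" a u "\<lambda>i j. \<Sum>k\<in>{1..n}. \<Sum>l\<in>{1..n}. if k \<le> i \<and> j < l then X k l else 0"] assms
    by simp
qed

lemma bil_E_E:
  assumes "a \<in> {1..n}" "u \<in> {1..n}" "b \<in> {1..n}" "v \<in> {1..n}"
  shows "bil n (imat (E a u)) (imat (E b v)) = (if b \<le> a \<and> u < v then 1 else 0)"
proof -
  have "bil n (imat (E a u)) (imat (E b v)) =
      (\<Sum>k\<in>{1..n}. \<Sum>l\<in>{1..n}. int (E b v k l) * (if k \<le> a \<and> u < l then 1 else 0))"
    unfolding bil_E_left [OF assms(1,2)] by (intro sum.cong refl) (simp add: imat_def)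
  then show ?thesis
    using sum_E [of "{1..n}" "{1..n}" b v "\<lambda>k l. if k \<le> a \<and> u < l then 1 else 0"] assms by simp
qed

text \<open>Expanding the quadratic form at Y plus a difference of two matrix units leaves mixed
  terms with Y, which telescope to parts of two neighbouring rows, and a contribution of the units
  alone.\<close>

lemma d_stat_row_move:
  assumes h: "h \<in> {1..n}" "Suc h \<in> {1..n}" "u \<in> {1..n}"
    and X: "\<And>i j. int (X i j) = int (Y i j) + int (E h u i j) - int (E (Suc h) u i j)"
  shows "int (d_stat n X) = int (d_stat n Y)
    + (\<Sum>j\<in>{1..<u}. int (Y h j)) - (\<Sum>j\<in>{u<..n}. int (Y (Suc h) j))"
proof -
  let ?e = "imat (E h u)" and ?f = "imat (E (Suc h) u)"
  have "imat X = (\<lambda>i j. imat Y i j + ?e i j - ?f i j)" by (simp add: imat_def fun_eq_iff X)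
  then have "int (d_stat n X) = int (d_stat n Y)
      + (bil n (imat Y) ?e - bil n (imat Y) ?f) + (bil n ?e (imat Y) - bil n ?f (imat Y))
      + (bil n ?e ?e - bil n ?e ?f - bil n ?f ?e + bil n ?f ?f)"
    by (simp only: d_stat_bil bil_add bil_diff)
  \<comment> \<open>Both units lie in one column, and the form counts only pairs in different
    columns.\<close>
  also have "bil n ?e ?e - bil n ?e ?f - bil n ?f ?e + bil n ?f ?f = 0"
    by (simp only: bil_E_E h) simp
  \<comment> \<open>The conditions h \<le> i and h + 1 \<le> i differ in row h only.\<close>
  also have "bil n (imat Y) ?e - bil n (imat Y) ?f = (\<Sum>j\<in>{1..<u}. int (Y h j))"
  proof -
    have "bil n (imat Y) ?e - bil n (imat Y) ?f =
        (\<Sum>i\<in>{1..n}. \<Sum>j\<in>{1..n}. if i = h then (if j < u then int (Y h j) else 0) else 0)"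
      unfolding bil_E_right [OF h(1,3)] bil_E_right [OF h(2,3)] sum_subtractf [symmetric]
      by (intro sum.cong refl) (auto simp: imat_def, metis le_antisym not_less_eq_eq)
    also have "\<dots> = (\<Sum>i\<in>{1..n}. if i = h then (\<Sum>j\<in>{1..n}. if j < u then int (Y h j) else 0) else 0)"
      by (rule sum.cong) auto
    also have "\<dots> = (\<Sum>j\<in>{1..n}. if j < u then int (Y h j) else 0)" using h by simp
    also have "\<dots> = (\<Sum>j\<in>{1..<u}. int (Y h j))"
      by (rule sum.mono_neutral_cong_right) (use h in auto)
    finally show ?thesis .
  qed
  also have "bil n ?e (imat Y) - bil n ?f (imat Y) = - (\<Sum>j\<in>{u<..n}. int (Y (Suc h) j))"
  proof -
    have "bil n ?f (imat Y) - bil n ?e (imat Y) =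
        (\<Sum>i\<in>{1..n}. \<Sum>j\<in>{1..n}. if i = Suc h then (if u < j then int (Y (Suc h) j) else 0) else 0)"
      unfolding bil_E_left [OF h(1,3)] bil_E_left [OF h(2,3)] sum_subtractf [symmetric]
      by (intro sum.cong refl) (auto simp: imat_def le_Suc_eq)
    also have "\<dots> = (\<Sum>i\<in>{1..n}. if i = Suc h then (\<Sum>j\<in>{1..n}. if u < j then int (Y (Suc h) j) else 0) else 0)"
      by (rule sum.cong) auto
    also have "\<dots> = (\<Sum>j\<in>{1..n}. if u < j then int (Y (Suc h) j) else 0)" using h by simp
    also have "\<dots> = (\<Sum>j\<in>{u<..n}. int (Y (Suc h) j))"
      by (rule sum.mono_neutral_cong_right) (use h in auto)
    finally show ?thesis by simp
  qed
  finally show ?thesis by simp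
qed

lemma d_stat_column_move:
  assumes h: "h \<in> {1..n}" "Suc h \<in> {1..n}" "u \<in> {1..n}"
    and X: "\<And>i j. int (X i j) = int (Y i j) + int (E u (Suc h) i j) - int (E u h i j)"
  shows "int (d_stat n X) = int (d_stat n Y)
    + (\<Sum>i\<in>{u..n}. int (Y i h)) - (\<Sum>i\<in>{1..u}. int (Y i (Suc h))) - 1"
proof -
  let ?e = "imat (E u (Suc h))" and ?f = "imat (E u h)"
  have "imat X = (\<lambda>i j. imat Y i j + ?e i j - ?f i j)" by (simp add: imat_def fun_eq_iff X)
  then have "int (d_stat n X) = int (d_stat n Y)
      + (bil n (imat Y) ?e - bil n (imat Y) ?f) + (bil n ?e (imat Y) - bil n ?f (imat Y))
      + (bil n ?e ?e - bil n ?e ?f - bil n ?f ?e + bil n ?f ?f)"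
    by (simp only: d_stat_bil bil_add bil_diff)
  \<comment> \<open>Here the two units share row u and lie in columns h < h + 1, so they form one
    counted pair, which enters with a minus sign.\<close>
  also have "bil n ?e ?e - bil n ?e ?f - bil n ?f ?e + bil n ?f ?f = - 1"
    by (simp only: bil_E_E h) simp
  also have "bil n (imat Y) ?e - bil n (imat Y) ?f = (\<Sum>i\<in>{u..n}. int (Y i h))"
  proof -
    have "bil n (imat Y) ?e - bil n (imat Y) ?f =
        (\<Sum>i\<in>{1..n}. \<Sum>j\<in>{1..n}. if j = h then (if u \<le> i then int (Y i h) else 0) else 0)"
      unfolding bil_E_right [OF h(3,1)] bil_E_right [OF h(3,2)] sum_subtractf [symmetric]
      by (intro sum.cong refl) (auto simp: imat_def less_Suc_eq)
    also have "\<dots> = (\<Sum>i\<in>{1..n}. if u \<le> i then int (Y i h) else 0)" using h by simp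
    also have "\<dots> = (\<Sum>i\<in>{u..n}. int (Y i h))"
      by (rule sum.mono_neutral_cong_right) (use h in auto)
    finally show ?thesis .
  qed
  also have "bil n ?e (imat Y) - bil n ?f (imat Y) = - (\<Sum>i\<in>{1..u}. int (Y i (Suc h)))"
  proof -
    have "bil n ?f (imat Y) - bil n ?e (imat Y) =
        (\<Sum>i\<in>{1..n}. \<Sum>j\<in>{1..n}. if j = Suc h then (if i \<le> u then int (Y i (Suc h)) else 0) else 0)"
      unfolding bil_E_left [OF h(3,1)] bil_E_left [OF h(3,2)] sum_subtractf [symmetric]
      by (intro sum.cong refl) (auto simp: imat_def, metis Suc_lessI)
    also have "\<dots> = (\<Sum>i\<in>{1..n}. if i \<le> u then int (Y i (Suc h)) else 0)" using h by simp
    also have "\<dots> = (\<Sum>i\<in>{1..u}. int (Y i (Suc h)))"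
      by (rule sum.mono_neutral_cong_right) (use h in auto)
    finally show ?thesis by simp
  qed
  finally show ?thesis by simp
qed

text \<open>A bookkeeping identity: q is the square of \<upsilon>, and by \<open>bar_qint\<close>
  the quantum integer is q^m times the barred one. What remains is a comparison of exponents of
  \<upsilon>.\<close>

lemma normalised_term:
  assumes "2 * int s + 2 * int m - dA = k + b"
  shows "q ^ s * qsum (Suc m) * \<upsilon> powi (- dA) = \<upsilon> powi k * (\<upsilon> powi b * bar (qint (int m + 1)))"
proof -
  have "q ^ s * qsum (Suc m) * \<upsilon> powi (- dA) =
      (\<upsilon> powi (2 * int s) * \<upsilon> powi (2 * int m) * \<upsilon> powi (- dA)) * bar (qint (int m + 1))"
    by (simp only: bar_qint [symmetric] upsilon_even [symmetric] mult_ac)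
  also have "\<upsilon> powi (2 * int s) * \<upsilon> powi (2 * int m) * \<upsilon> powi (- dA) = \<upsilon> powi (2 * int s + 2 * int m - dA)"
    by (simp add: power_int_add [symmetric])
  also have "\<dots> = \<upsilon> powi k * \<upsilon> powi b"
    unfolding assms by (simp add: power_int_add)
  finally show ?thesis by (simp only: mult_ac)
qed

lemma sum_split_at:
  fixes g :: "nat \<Rightarrow> int"
  assumes "u \<in> {1..n}"
  shows "(\<Sum>j\<in>{1..n}. g j) = (\<Sum>j\<in>{1..<u}. g j) + g u + (\<Sum>j\<in>{u<..n}. g j)"
    and "(\<Sum>j\<in>{u..n}. g j) = g u + (\<Sum>j\<in>{u<..n}. g j)"
    and "(\<Sum>j\<in>{1..u}. g j) = (\<Sum>j\<in>{1..<u}. g j) + g u"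
proof -
  have "{u..n} = insert u {u<..n}" using assms by auto
  then show 2: "(\<Sum>j\<in>{u..n}. g j) = g u + (\<Sum>j\<in>{u<..n}. g j)" by simp
  have "{1..u} = insert u {1..<u}" using assms by auto
  then show "(\<Sum>j\<in>{1..u}. g j) = (\<Sum>j\<in>{1..<u}. g j) + g u" by simp
  have "{1..n} = {1..<u} \<union> {u..n}" using assms by auto
  then have "(\<Sum>j\<in>{1..n}. g j) = (\<Sum>j\<in>{1..<u}. g j) + (\<Sum>j\<in>{u..n}. g j)"
    by (simp only:) (rule sum.union_disjoint, auto)
  then show "(\<Sum>j\<in>{1..n}. g j) = (\<Sum>j\<in>{1..<u}. g j) + g u + (\<Sum>j\<in>{u<..n}. g j)" using 2 by simp
qed

section \<open>Termwise comparison with the center equations\<close>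

lemma L_plus_term:
  assumes h: "h \<in> {1..n}" "Suc h \<in> {1..n}" and u: "u \<in> {1..n}" "B h u > 0"
    and A: "A = B - E h u + E (Suc h) u"
  shows "q ^ (\<Sum>v | v \<in> {1..n} \<and> u < v. B h v) * qsum (B h u) * \<upsilon> powi (- int (d_stat n A)) =
    \<upsilon> powi (int (ro n B h) - 1 - int (d_stat n B)) * L_plus n h u A"
proof -
  have ents: "B h u = Suc (A h u)" "\<And>v. v \<noteq> u \<Longrightarrow> B h v = A h v"
    using u(2) by (auto simp: A E_def)
  have "int (B i j) = int (A i j) + int (E h u i j) - int (E (Suc h) u i j)" for i j
    unfolding A int_move [of B h u, OF u(2)] by simp
  note d = d_stat_row_move [OF h u(1) this]
  have s: "int (\<Sum>v | v \<in> {1..n} \<and> u < v. B h v) = (\<Sum>j\<in>{u<..n}. int (A h j))"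
    unfolding of_nat_sum by (rule sum.cong) (use u(1) in \<open>auto simp: ents\<close>)
  have less: "(\<Sum>j\<in>{1..<u}. int (B h j)) = (\<Sum>j\<in>{1..<u}. int (A h j))"
    and greater: "(\<Sum>j\<in>{u<..n}. int (B h j)) = (\<Sum>j\<in>{u<..n}. int (A h j))"
    by (rule sum.cong; simp add: ents)+
  have ro: "int (ro n B h) = (\<Sum>j\<in>{1..<u}. int (A h j)) + int (B h u) + (\<Sum>j\<in>{u<..n}. int (A h j))"
    unfolding ro_def of_nat_sum sum_split_at(1) [OF u(1)] less greater ..
  show ?thesis
    unfolding L_plus_def ents(1)
  proof (rule normalised_term)
    have "\<beta> n u A h = int (A h u) + (\<Sum>j\<in>{u<..n}. int (A h j)) - (\<Sum>j\<in>{u<..n}. int (A (Suc h) j))"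
      unfolding \<beta>_def sum_split_at(2) [OF u(1)] by simp
    moreover have "int (B h u) = int (A h u) + 1" by (simp add: ents(1))
    ultimately show "2 * int (\<Sum>v | v \<in> {1..n} \<and> u < v. B h v) + 2 * int (A h u) - int (d_stat n A) =
        int (ro n B h) - 1 - int (d_stat n B) + \<beta> n u A h"
      using d s ro by linarith
  qed
qed

lemma L_minus_term:
  assumes h: "h \<in> {1..n}" "Suc h \<in> {1..n}" and u: "u \<in> {1..n}" "B (Suc h) u > 0"
    and A: "A = B - E (Suc h) u + E h u"
  shows "q ^ (\<Sum>v | v \<in> {1..n} \<and> v < u. B (Suc h) v) * qsum (B (Suc h) u) * \<upsilon> powi (- int (d_stat n A)) =
    \<upsilon> powi (int (ro n B (Suc h)) - 1 - int (d_stat n B)) * L_minus n h u A"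
proof -
  have ents: "B (Suc h) u = Suc (A (Suc h) u)" "\<And>v. v \<noteq> u \<Longrightarrow> B (Suc h) v = A (Suc h) v"
      "\<And>v. v \<noteq> u \<Longrightarrow> B h v = A h v"
    using u(2) by (auto simp: A E_def)
  \<comment> \<open>The unit now moves from row h + 1 to row h, so A and B exchange their roles in
    \<open>d_stat_row_move\<close> compared with the raising case.\<close>
  have "int (A i j) = int (B i j) + int (E h u i j) - int (E (Suc h) u i j)" for i j
    unfolding A int_move [of B "Suc h" u, OF u(2)] by simp
  note d = d_stat_row_move [OF h u(1) this]
  have s: "int (\<Sum>v | v \<in> {1..n} \<and> v < u. B (Suc h) v) = (\<Sum>j\<in>{1..<u}. int (A (Suc h) j))"
    unfolding of_nat_sum by (rule sum.cong) (use u(1) in \<open>auto simp: ents\<close>)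
  have less: "(\<Sum>j\<in>{1..<u}. int (B (Suc h) j)) = (\<Sum>j\<in>{1..<u}. int (A (Suc h) j))"
    and greater: "(\<Sum>j\<in>{u<..n}. int (B (Suc h) j)) = (\<Sum>j\<in>{u<..n}. int (A (Suc h) j))"
    and less': "(\<Sum>j\<in>{1..<u}. int (B h j)) = (\<Sum>j\<in>{1..<u}. int (A h j))"
    by (rule sum.cong; simp add: ents)+
  have ro: "int (ro n B (Suc h)) =
      (\<Sum>j\<in>{1..<u}. int (A (Suc h) j)) + int (B (Suc h) u) + (\<Sum>j\<in>{u<..n}. int (A (Suc h) j))"
    unfolding ro_def of_nat_sum sum_split_at(1) [OF u(1)] less greater ..
  have b: "\<beta>' u A h = (\<Sum>j\<in>{1..<u}. int (A (Suc h) j)) + int (A (Suc h) u) - (\<Sum>j\<in>{1..<u}. int (A h j))"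
    unfolding \<beta>'_def sum_split_at(3) [OF u(1)] by simp
  show ?thesis
    unfolding L_minus_def ents(1) Suc_eq_plus1 [symmetric] b
    by (rule normalised_term)
      (use d [unfolded less' greater] in \<open>simp only: s ro ents(1) of_nat_Suc; linarith\<close>)
qed

text \<open>The factor in front is independent of u. In contrast to the row case it contains no
  shift by 1: the -1 of \<open>d_stat_column_move\<close> is offset by A u h = B u h + 1.\<close>

lemma R_plus_term:
  assumes h: "h \<in> {1..n}" "Suc h \<in> {1..n}" and u: "u \<in> {1..n}" "B u (Suc h) > 0"
    and A: "A = B - E u (Suc h) + E u h"
  shows "q ^ (\<Sum>v | v \<in> {1..n} \<and> v < u. B v (Suc h)) * qsum (B u (Suc h)) * \<upsilon> powi (- int (d_stat n A)) =
    \<upsilon> powi (int (co n B h) - int (d_stat n B)) * R_plus n h u A"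
proof -
  have ents: "B u (Suc h) = Suc (A u (Suc h))" "\<And>v. v \<noteq> u \<Longrightarrow> B v (Suc h) = A v (Suc h)"
      "\<And>v. v \<noteq> u \<Longrightarrow> B v h = A v h" "A u h = Suc (B u h)"
    using u(2) by (auto simp: A E_def)
  have "int (B i j) = int (A i j) + int (E u (Suc h) i j) - int (E u h i j)" for i j
    unfolding A int_move [of B u "Suc h", OF u(2)] by simp
  note d = d_stat_column_move [OF h u(1) this]
  have s: "int (\<Sum>v | v \<in> {1..n} \<and> v < u. B v (Suc h)) = (\<Sum>j\<in>{1..<u}. int (A j (Suc h)))"
    unfolding of_nat_sum by (rule sum.cong) (use u(1) in \<open>auto simp: ents\<close>)
  have less: "(\<Sum>j\<in>{1..<u}. int (B j h)) = (\<Sum>j\<in>{1..<u}. int (A j h))"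
    and greater: "(\<Sum>j\<in>{u<..n}. int (B j h)) = (\<Sum>j\<in>{u<..n}. int (A j h))"
    by (rule sum.cong; simp add: ents)+
  have co: "int (co n B h) = (\<Sum>j\<in>{1..<u}. int (A j h)) + int (B u h) + (\<Sum>j\<in>{u<..n}. int (A j h))"
    unfolding co_def of_nat_sum sum_split_at(1) [OF u(1)] less greater ..
  have b: "\<beta>' u (mat_transpose A) h =
      (\<Sum>j\<in>{1..<u}. int (A j (Suc h))) + int (A u (Suc h)) - (\<Sum>j\<in>{1..<u}. int (A j h))"
    unfolding \<beta>'_def sum_split_at(3) [OF u(1)] by (simp add: mat_transpose_def)
  show ?thesis
    unfolding R_plus_def ents(1) Suc_eq_plus1 [symmetric] b
    by (rule normalised_term)
      (use d [unfolded ents(4) sum_split_at(2) [OF u(1)] sum_split_at(3) [OF u(1)]]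
        in \<open>simp only: s co of_nat_Suc; linarith\<close>)
qed

lemma R_minus_term:
  assumes h: "h \<in> {1..n}" "Suc h \<in> {1..n}" and u: "u \<in> {1..n}" "B u h > 0"
    and A: "A = B - E u h + E u (Suc h)"
  shows "q ^ (\<Sum>v | v \<in> {1..n} \<and> u < v. B v h) * qsum (B u h) * \<upsilon> powi (- int (d_stat n A)) =
    \<upsilon> powi (int (co n B (Suc h)) - int (d_stat n B)) * R_minus n h u A"
proof -
  have ents: "B u h = Suc (A u h)" "\<And>v. v \<noteq> u \<Longrightarrow> B v (Suc h) = A v (Suc h)"
      "\<And>v. v \<noteq> u \<Longrightarrow> B v h = A v h" "A u (Suc h) = Suc (B u (Suc h))"
    using u(2) by (auto simp: A E_def)
  have "int (A i j) = int (B i j) + int (E u (Suc h) i j) - int (E u h i j)" for i j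
    unfolding A int_move [of B u h, OF u(2)] by simp
  note d = d_stat_column_move [OF h u(1) this]
  have s: "int (\<Sum>v | v \<in> {1..n} \<and> u < v. B v h) = (\<Sum>j\<in>{u<..n}. int (A j h))"
    unfolding of_nat_sum by (rule sum.cong) (use u(1) in \<open>auto simp: ents\<close>)
  have less: "(\<Sum>j\<in>{1..<u}. int (B j (Suc h))) = (\<Sum>j\<in>{1..<u}. int (A j (Suc h)))"
    and greater: "(\<Sum>j\<in>{u<..n}. int (B j (Suc h))) = (\<Sum>j\<in>{u<..n}. int (A j (Suc h)))"
    and greater': "(\<Sum>j\<in>{u<..n}. int (B j h)) = (\<Sum>j\<in>{u<..n}. int (A j h))"
    by (rule sum.cong; simp add: ents)+
  have co: "int (co n B (Suc h)) =
      (\<Sum>j\<in>{1..<u}. int (A j (Suc h))) + int (B u (Suc h)) + (\<Sum>j\<in>{u<..n}. int (A j (Suc h)))"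
    unfolding co_def of_nat_sum sum_split_at(1) [OF u(1)] less greater ..
  have b: "\<beta> n u (mat_transpose A) h =
      int (A u h) + (\<Sum>j\<in>{u<..n}. int (A j h)) - (\<Sum>j\<in>{u<..n}. int (A j (Suc h)))"
    unfolding \<beta>_def sum_split_at(2) [OF u(1)] by (simp add: mat_transpose_def)
  show ?thesis
    unfolding R_minus_def ents(1) b
    by (rule normalised_term)
      (use d [unfolded ents(1) ents(4) less greater' sum_split_at(2) [OF u(1)] sum_split_at(3) [OF u(1)]]
        in \<open>simp only: s co of_nat_Suc; linarith\<close>)
qed

text \<open>In two of the four sums the theorem adds before it subtracts. Entries are natural
  numbers, and positivity of B a u makes both orders agree.\<close>

lemma move_commute: "B a u > 0 \<Longrightarrow> B - E a u + E b v = B + E b v - E a u"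
  by (auto simp: E_def fun_eq_iff)

lemma ro_move:
  assumes "u \<in> {1..n}" "v \<in> {1..n}" "B a u > 0"
  shows "int (ro n (B - E a u + E b v) i) = int (ro n B i) - (if i = a then 1 else 0) + (if i = b then 1 else 0)"
proof -
  have "(\<Sum>j\<in>{1..n}. int (E c w i j)) = (if i = c then 1 else 0)" if "w \<in> {1..n}" for c w
  proof -
    have "(\<Sum>j\<in>{1..n}. int (E c w i j)) = (\<Sum>j\<in>{1..n}. if j = w then (if i = c then 1 else 0) else 0)"
      by (rule sum.cong) (auto simp: E_def)
    then show ?thesis using that by simp
  qed
  then show ?thesis
    unfolding ro_def of_nat_sum int_move [of B a u, OF assms(3)] sum.distrib sum_subtractf
    using assms(1,2) by (simp only:)
qed

lemma co_move:
  assumes "a \<in> {1..n}" "b \<in> {1..n}" "B a u > 0"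
  shows "int (co n (B - E a u + E b v) j) = int (co n B j) - (if j = u then 1 else 0) + (if j = v then 1 else 0)"
proof -
  have "(\<Sum>i\<in>{1..n}. int (E c w i j)) = (if j = w then 1 else 0)" if "c \<in> {1..n}" for c w
  proof -
    have "(\<Sum>i\<in>{1..n}. int (E c w i j)) = (\<Sum>i\<in>{1..n}. if i = c then (if j = w then 1 else 0) else 0)"
      by (rule sum.cong) (auto simp: E_def)
    then show ?thesis using that by simp
  qed
  then show ?thesis
    unfolding co_def of_nat_sum int_move [of B a u, OF assms(3)] sum.distrib sum_subtractf
    using assms(1,2) by (simp only:)
qed

text \<open>The common form of the two families of matrices indexing the center equations, with (a,
  b) equal to (h, h + 1) or (h + 1, h).\<close>

definition shifted :: "nat \<Rightarrow> nat \<Rightarrow> nat \<Rightarrow> mat \<Rightarrow> bool"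
  where "shifted n a b B \<longleftrightarrow>
    (\<forall>i\<in>{1..n}. int (ro n B i) - int (co n B i) = (if i = a then 1 else 0) - (if i = b then 1 else 0))"

text \<open>Balance of the moved matrix dictates the difference between row and column sums of B.
  For all other B every summand on either side vanishes, so they impose no condition.\<close>

lemma c_coeff_shifted:
  assumes "a \<in> {1..n}" "b \<in> {1..n}" "u \<in> {1..n}"
  shows "B a u > 0 \<Longrightarrow> c_coeff n r x (B - E a u + E b u) \<noteq> 0 \<Longrightarrow> shifted n a b B"
    and "B u b > 0 \<Longrightarrow> c_coeff n r x (B - E u b + E u a) \<noteq> 0 \<Longrightarrow> shifted n a b B"
proof -
  assume B: "B a u > 0" and "c_coeff n r x (B - E a u + E b u) \<noteq> 0"
  then have "ro n (B - E a u + E b u) i = co n (B - E a u + E b u) i" for i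
    using c_coeff_balanced by metis
  then have "int (ro n (B - E a u + E b u) i) = int (co n (B - E a u + E b u) i)" for i by simp
  then have "int (ro n B i) - (if i = a then 1 else 0) + (if i = b then 1 else 0) = int (co n B i)" for i
    unfolding ro_move [of u n u B a b, OF assms(3,3) B] co_move [of a n b B u u, OF assms(1,2) B] by simp
  then show "shifted n a b B" unfolding shifted_def by (metis (no_types, opaque_lifting) add_diff_cancel_left' diff_add_eq diff_diff_eq2 diff_eq_eq)
next
  assume B: "B u b > 0" and "c_coeff n r x (B - E u b + E u a) \<noteq> 0"
  then have "ro n (B - E u b + E u a) i = co n (B - E u b + E u a) i" for i
    using c_coeff_balanced by metis
  then have "int (ro n (B - E u b + E u a) i) = int (co n (B - E u b + E u a) i)" for i by simp
  then have "int (ro n B i) = int (co n B i) - (if i = b then 1 else 0) + (if i = a then 1 else 0)" for i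
    unfolding ro_move [of b n a B u u, OF assms(2,1) B] co_move [of u n u B b a, OF assms(3,3) B] by simp
  then show "shifted n a b B" unfolding shifted_def by simp
qed

text \<open>Treats e_h and f_h at once. The assumptions write each summand as the corresponding one
  of the theorem times a factor independent of u; for shifted B the two factors coincide because
  ro(B)_a - 1 = co(B)_a, and a power of \<upsilon> can be cancelled.\<close>

lemma center_equation_iff:
  assumes root: "root_op R a b" and ab: "a \<in> {1..n}" "b \<in> {1..n}"
    and L: "\<And>B u. B \<in> Theta n r \<Longrightarrow> u \<in> {1..n} \<Longrightarrow> B a u > 0 \<Longrightarrow>
      q ^ (\<Sum>v | v \<in> {1..n} \<and> R u v. B a v) * qsum (B a u) * \<upsilon> powi (- int (d_stat n (B - E a u + E b u))) =
      \<upsilon> powi (int (ro n B a) - 1 - int (d_stat n B)) * Lc u (B - E a u + E b u)"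
    and Rc: "\<And>B u. B \<in> Theta n r \<Longrightarrow> u \<in> {1..n} \<Longrightarrow> B u b > 0 \<Longrightarrow>
      q ^ (\<Sum>v | v \<in> {1..n} \<and> R v u. B v b) * qsum (B u b) * \<upsilon> powi (- int (d_stat n (B - E u b + E u a))) =
      \<upsilon> powi (int (co n B a) - int (d_stat n B)) * Rc u (B - E u b + E u a)"
  shows "(\<forall>B\<in>Theta n r. cf n r (\<lambda>f. Gop r R a b (comb n r (c_coeff n r x) f)) B =
        cf n r (\<lambda>f. comb n r (c_coeff n r x) (Gop r R a b f)) B) \<longleftrightarrow>
    (\<forall>B\<in>{B \<in> Theta n r. shifted n a b B}.
      (\<Sum>u | u \<in> {1..n} \<and> B a u > 0. on_Omega n r x (B - E a u + E b u) * Lc u (B - E a u + E b u)) =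
      (\<Sum>u | u \<in> {1..n} \<and> B u b > 0. on_Omega n r x (B - E u b + E u a) * Rc u (B - E u b + E u a)))"
proof -
  let ?C = "comb n r (c_coeff n r x)"
  note C = comb_commutant [of n r "c_coeff n r x"]
  let ?l = "\<lambda>B. cf n r (\<lambda>f. Gop r R a b (?C f)) B" and ?r = "\<lambda>B. cf n r (\<lambda>f. ?C (Gop r R a b f)) B"
  let ?L = "\<lambda>B. \<Sum>u | u \<in> {1..n} \<and> B a u > 0. on_Omega n r x (B - E a u + E b u) * Lc u (B - E a u + E b u)"
  let ?R = "\<lambda>B. \<Sum>u | u \<in> {1..n} \<and> B u b > 0. on_Omega n r x (B - E u b + E u a) * Rc u (B - E u b + E u a)"
  have l: "?l B = (\<Sum>u | u \<in> {1..n} \<and> B a u > 0.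
      q ^ (\<Sum>v | v \<in> {1..n} \<and> R u v. B a v) * qsum (B a u) * c_coeff n r x (B - E a u + E b u))"
    and r: "?r B = (\<Sum>u | u \<in> {1..n} \<and> B u b > 0.
      q ^ (\<Sum>v | v \<in> {1..n} \<and> R v u. B v b) * qsum (B u b) * c_coeff n r x (B - E u b + E u a))"
    if B: "B \<in> Theta n r" for B
    unfolding cf_Gop_left [OF root ab C B] cf_Gop_right [OF root ab C B]
    by (rule sum.cong; use B ab in \<open>simp add: cf_comb Theta_move del: One_nat_def\<close>)+
  have lL: "?l B = \<upsilon> powi (int (ro n B a) - 1 - int (d_stat n B)) * ?L B" if B: "B \<in> Theta n r" for B
    unfolding l [OF B] sum_distrib_left
  proof (rule sum.cong)
    fix u assume u: "u \<in> {u. u \<in> {1..n} \<and> B a u > 0}"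
    let ?A = "B - E a u + E b u"
    have "q ^ (\<Sum>v | v \<in> {1..n} \<and> R u v. B a v) * qsum (B a u) * c_coeff n r x ?A =
        on_Omega n r x ?A * (q ^ (\<Sum>v | v \<in> {1..n} \<and> R u v. B a v) * qsum (B a u) * \<upsilon> powi (- int (d_stat n ?A)))"
      by (simp only: c_coeff_def mult_ac)
    also have "\<dots> = on_Omega n r x ?A * (\<upsilon> powi (int (ro n B a) - 1 - int (d_stat n B)) * Lc u ?A)"
      by (intro arg_cong [of _ _ "(*) _"] L [OF B]) (use u in auto)
    finally show "q ^ (\<Sum>v | v \<in> {1..n} \<and> R u v. B a v) * qsum (B a u) * c_coeff n r x ?A =
        \<upsilon> powi (int (ro n B a) - 1 - int (d_stat n B)) * (on_Omega n r x ?A * Lc u ?A)"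
      by (simp only: mult.left_commute)
  qed simp
  have rR: "?r B = \<upsilon> powi (int (co n B a) - int (d_stat n B)) * ?R B" if B: "B \<in> Theta n r" for B
    unfolding r [OF B] sum_distrib_left
  proof (rule sum.cong)
    fix u assume u: "u \<in> {u. u \<in> {1..n} \<and> B u b > 0}"
    let ?A = "B - E u b + E u a"
    have "q ^ (\<Sum>v | v \<in> {1..n} \<and> R v u. B v b) * qsum (B u b) * c_coeff n r x ?A =
        on_Omega n r x ?A * (q ^ (\<Sum>v | v \<in> {1..n} \<and> R v u. B v b) * qsum (B u b) * \<upsilon> powi (- int (d_stat n ?A)))"
      by (simp only: c_coeff_def mult_ac)
    also have "\<dots> = on_Omega n r x ?A * (\<upsilon> powi (int (co n B a) - int (d_stat n B)) * Rc u ?A)"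
      by (intro arg_cong [of _ _ "(*) _"] Rc [OF B]) (use u in auto)
    finally show "q ^ (\<Sum>v | v \<in> {1..n} \<and> R v u. B v b) * qsum (B u b) * c_coeff n r x ?A =
        \<upsilon> powi (int (co n B a) - int (d_stat n B)) * (on_Omega n r x ?A * Rc u ?A)"
      by (simp only: mult.left_commute)
  qed simp
  have "?l B = ?r B \<longleftrightarrow> (shifted n a b B \<longrightarrow> ?L B = ?R B)" if B: "B \<in> Theta n r" for B
  proof (cases "shifted n a b B")
    case True
    have "a \<noteq> b" using root by (auto simp: root_op_def)
    then have "int (ro n B a) - 1 - int (d_stat n B) = int (co n B a) - int (d_stat n B)"
      using bspec [OF True [unfolded shifted_def] ab(1)] by simp
    then show ?thesis using True unfolding lL [OF B] rR [OF B] by simp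
  next
    case False
    have "?l B = 0" unfolding l [OF B]
      by (rule sum.neutral) (use c_coeff_shifted(1) [OF ab, of _ B r x] False in auto)
    moreover have "?r B = 0" unfolding r [OF B]
      by (rule sum.neutral) (use c_coeff_shifted(2) [OF ab, of _ B r x] False in auto)
    ultimately show ?thesis using False by simp
  qed
  then show ?thesis by (simp add: Ball_def imp_conjL)
qed

lemma Theta_plus_shifted: "Theta_plus n r h = {B \<in> Theta n r. shifted n h (Suc h) B}"
  by (simp add: Theta_plus_def shifted_def \<alpha>_def \<epsilon>_def)

lemma Theta_minus_shifted: "Theta_minus n r h = {B \<in> Theta n r. shifted n (Suc h) h B}"
  by (simp add: Theta_minus_def shifted_def \<alpha>_def \<epsilon>_def)

theorem theorem2p6:
  fixes n r :: nat and x :: "mat \<Rightarrow> K"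
  shows "c_elem n r x \<in> ring_center (qschur n r) \<longleftrightarrow>
    (\<forall>h. 1 \<le> h \<and> h < n \<longrightarrow>
      (\<forall>B \<in> Theta_plus n r h.
        (\<Sum>u | u \<in> {1..n} \<and> B h u > 0.
            on_Omega n r x (B - E h u + E (h + 1) u) * L_plus n h u (B - E h u + E (h + 1) u))
        = (\<Sum>u | u \<in> {1..n} \<and> B u (h + 1) > 0.
            on_Omega n r x (B + E u h - E u (h + 1)) * R_plus n h u (B + E u h - E u (h + 1)))) \<and>
      (\<forall>B \<in> Theta_minus n r h.
        (\<Sum>u | u \<in> {1..n} \<and> B (h + 1) u > 0.
            on_Omega n r x (B + E h u - E (h + 1) u) * L_minus n h u (B + E h u - E (h + 1) u))
        = (\<Sum>u | u \<in> {1..n} \<and> B u h > 0.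
            on_Omega n r x (B - E u h + E u (h + 1)) * R_minus n h u (B - E u h + E u (h + 1)))))"
proof -
  let ?G = "\<lambda>R a b. \<forall>B\<in>Theta n r. cf n r (\<lambda>f. Gop r R a b (comb n r (c_coeff n r x) f)) B =
        cf n r (\<lambda>f. comb n r (c_coeff n r x) (Gop r R a b f)) B"
  \<comment> \<open>A root operator with both letters in range amounts to some h with 1 \<le> h < n
    together with one of the two directions.\<close>
  have gens: "c_elem n r x \<in> ring_center (qschur n r) \<longleftrightarrow>
      (\<forall>h. 1 \<le> h \<and> h < n \<longrightarrow> ?G (<) h (Suc h) \<and> ?G (>) (Suc h) h)"
    unfolding center_iff_generators
  proof (intro iffI allI impI)
    fix h assume G: "\<forall>R a b. root_op R a b \<and> a \<in> {1..n} \<and> b \<in> {1..n} \<longrightarrow> ?G R a b" and h: "1 \<le> h \<and> h < n"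
    have "root_op (<) h (Suc h)" "root_op (>) (Suc h) h" by (simp_all add: root_op_def)
    moreover have "h \<in> {1..n}" "Suc h \<in> {1..n}" using h by auto
    ultimately show "?G (<) h (Suc h) \<and> ?G (>) (Suc h) h" using G by blast
  next
    fix R a b assume G: "\<forall>h. 1 \<le> h \<and> h < n \<longrightarrow> ?G (<) h (Suc h) \<and> ?G (>) (Suc h) h"
      and r: "root_op R a b \<and> a \<in> {1..n} \<and> b \<in> {1..n}"
    then consider "R = (<)" "b = Suc a" "1 \<le> a \<and> a < n" | "R = (>)" "a = Suc b" "1 \<le> b \<and> b < n"
      unfolding root_op_def by auto
    then show "?G R a b" by cases (use G in blast)+
  qed
  have plus: "?G (<) h (Suc h) \<longleftrightarrow>
      (\<forall>B \<in> Theta_plus n r h.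
        (\<Sum>u | u \<in> {1..n} \<and> B h u > 0.
            on_Omega n r x (B - E h u + E (h + 1) u) * L_plus n h u (B - E h u + E (h + 1) u))
        = (\<Sum>u | u \<in> {1..n} \<and> B u (h + 1) > 0.
            on_Omega n r x (B + E u h - E u (h + 1)) * R_plus n h u (B + E u h - E u (h + 1))))"
    if "1 \<le> h \<and> h < n" for h
  proof -
    have h: "h \<in> {1..n}" "Suc h \<in> {1..n}" using that by auto
    have root: "root_op (<) h (Suc h)" by (simp add: root_op_def)
    have R: "(\<Sum>u | u \<in> {1..n} \<and> B u (Suc h) > 0.
        on_Omega n r x (B - E u (Suc h) + E u h) * R_plus n h u (B - E u (Suc h) + E u h)) =
      (\<Sum>u | u \<in> {1..n} \<and> B u (Suc h) > 0.
        on_Omega n r x (B + E u h - E u (Suc h)) * R_plus n h u (B + E u h - E u (Suc h)))" for B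
      by (rule sum.cong) (simp_all only: move_commute mem_Collect_eq)
    show ?thesis
      unfolding Suc_eq_plus1 [symmetric] Theta_plus_shifted R [symmetric]
      by (rule center_equation_iff [OF root h])
        (rule L_plus_term [OF h _ _ refl] R_plus_term [OF h _ _ refl]; assumption)+
  qed
  have minus: "?G (>) (Suc h) h \<longleftrightarrow>
      (\<forall>B \<in> Theta_minus n r h.
        (\<Sum>u | u \<in> {1..n} \<and> B (h + 1) u > 0.
            on_Omega n r x (B + E h u - E (h + 1) u) * L_minus n h u (B + E h u - E (h + 1) u))
        = (\<Sum>u | u \<in> {1..n} \<and> B u h > 0.
            on_Omega n r x (B - E u h + E u (h + 1)) * R_minus n h u (B - E u h + E u (h + 1))))"
    if "1 \<le> h \<and> h < n" for h
  proof -
    have h: "h \<in> {1..n}" "Suc h \<in> {1..n}" using that by auto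
    have root: "root_op (>) (Suc h) h" by (simp add: root_op_def)
    have L: "(\<Sum>u | u \<in> {1..n} \<and> B (Suc h) u > 0.
        on_Omega n r x (B - E (Suc h) u + E h u) * L_minus n h u (B - E (Suc h) u + E h u)) =
      (\<Sum>u | u \<in> {1..n} \<and> B (Suc h) u > 0.
        on_Omega n r x (B + E h u - E (Suc h) u) * L_minus n h u (B + E h u - E (Suc h) u))" for B
      by (rule sum.cong) (simp_all only: move_commute mem_Collect_eq)
    show ?thesis
      unfolding Suc_eq_plus1 [symmetric] Theta_minus_shifted L [symmetric]
      by (rule center_equation_iff [OF root h(2,1)])
        (rule L_minus_term [OF h _ _ refl] R_minus_term [OF h _ _ refl]; assumption)+
  qed
  show ?thesis
    unfolding gens using plus minus by blast
qed

end
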